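(* Let $E$ be one of the five elliptic curves over $\mathbb{Q}$ with complex multiplication, of conductor $N_E \in \{27, 32, 36, 64, 144\}$, listed in the context, with associated weight $2$ newform $g_{N_E}(z)=\sum a_{N_E}(n)q^n$ and associated form $G_{N_E}(z)=\sum C_{N_E}(n)q^n$ as given in the context. Let $p$ be a prime which is inert in the CM field of $E$. Then for all integers $m \geq 0$ we have \[ v_p\left(C_{N_E}(p^{2m+1})\right) = m \] and \[ v_p\left(\frac{G_{N_E}\,\big|\,U(p^{2m+1})}{C_{N_E}(p^{2m+1})} - g_{N_E}\right) \geq m+1 . \]
   Context: Let $q=e^{2\pi i z}$ with $z$ in the upper half plane, and let $\eta(z)=q^{1/24}\prod_{n\ge 1}(1-q^n)$ be the Dedekind eta function. All forms are identified with their $q$-expansions. The five curves $E$, their newforms $g_{N_E}\in S_2(\Gamma_0(N_E))$, and their CM fields are: - $N_E=27$: $y^2+y=x^3-7$, $g_{27}=\eta^2(3z)\eta^2(9z)$, CM field $\mathbb{Q}(\sqrt{-3})$; - $N_E=32$: $y^2=x^3+4x$, $g_{32}=\eta^2(4z)\eta^2(8z)$, CM field $\mathbb{Q}(i)$; - $N_E=36$: $y^2=x^3+1$, $g_{36}=\eta^4(6z)$, CM field $\mathbb{Q}(\sqrt{-3})$; - $N_E=64$: $y^2=x^3-4x$, $g_{64}=\dfrac{\eta^8(8z)}{\eta^2(4z)\eta^2(16z)}$, CM field $\mathbb{Q}(i)$; - $N_E=144$: $y^2=x^3-1$, $g_{144}=\dfrac{\eta^{12}(12z)}{\eta^4(6z)\eta^4(24z)}$,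 CM field $\mathbb{Q}(\sqrt{-3})$. The forms $G_{N_E}$ (the derivatives, normalized to have leading coefficient $1$, of the Weierstrass mock modular forms associated to the curves) are given explicitly by \[ G_{27}=\frac{\eta(3z)\eta^6(9z)}{\eta^3(27z)},\quad G_{32}=\frac{\eta^2(4z)\eta^6(16z)}{\eta^4(32z)},\quad G_{36}=\frac{\eta^3(6z)\eta(12z)\eta^3(18z)}{\eta^3(36z)}, \] \[ G_{64}=G_{32}\otimes\chi_8,\qquad G_{144}=G_{36}\otimes\chi_{12}, \] where $\chi_8$ and $\chi_{12}$ are the Kronecker symbols with discriminants $8$ and $12$, and $\left(\sum a(n)q^n\right)\otimes\chi=\sum \chi(n)a(n)q^n$ is the twist. For a positive integer $m$, the operator $U(m)$ acts on $q$-expansions by $\left(\sum a(n)q^n\right)\big|\,U(m)=\sum a(mn)q^n$. $v_p$ denotes the $p$-adic valuation, both on rational numbers and on power series in $q$ with rational coefficients: $v_p\left(\sum a(n)q^n\right)=\inf_n v_p(a(n))$.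
   Formalization: The prime p is also assumed not to divide N_E. This excludes only p = 2 for N_E = 36 and 144, where 2 is inert but C_{N_E}(2^{2m+1}) = 0 (exponents of G are ≡ -1 mod 6), so the claim fails and the quotient is undefined. *)

theory Defs
  imports
    "HOL-Analysis.Infinite_Products"
    "HOL-Library.Extended_Real"
    "HOL-Computational_Algebra.Computational_Algebra"
    "HOL-Algebra.Ideal"
    "HOL-Number_Theory.Residues"
begin

unbundle fps_syntax

section \<open>Operators on \<open>q\<close>-expansions\<close>

text \<open>
  A \<open>q\<close>-expansion is a formal Laurent series over the rationals, because the forms \<open>G\<close>
  below have a simple pole at infinity.
\<close>

definition U :: "nat \<Rightarrow> rat fls \<Rightarrow> rat fls" where
  "U m f = Abs_fls (\<lambda>n. f $$ (int m * n))"

text \<open>For \<open>m = 0\<close> the coefficient function need not vanish at large negative \<open>n\<close>.\<close>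

lemma U_nth:
  assumes "m > 0"
  shows "U m f $$ n = f $$ (int m * n)"
proof -
  have "f $$ (int m * k) = 0" if "k < - \<bar>fls_subdegree f\<bar>" for k
  proof -
    have "k < 0" using that by linarith
    with assms have "int m * k \<le> 1 * k"
      by (intro mult_right_mono_neg) auto
    then show ?thesis using that by (intro fls_eq0_below_subdegree) linarith
  qed
  then show ?thesis
    unfolding U_def by (intro nth_Abs_fls_lower_bound) blast
qed

definition twist :: "(int \<Rightarrow> int) \<Rightarrow> rat fls \<Rightarrow> rat fls" where
  "twist \<psi> f = Abs_fls (\<lambda>n. of_int (\<psi> n) * f $$ n)"

lemma twist_nth: "twist \<psi> f $$ n = of_int (\<psi> n) * f $$ n"
  unfolding twist_def
  by (rule nth_Abs_fls_lower_bound[where N = "fls_subdegree f"]) auto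

text \<open>
  The Kronecker symbol \<open>(a | n)\<close>. For \<open>n :: int\<close> the set \<open>prime_factors n\<close> consists of
  the positive primes dividing \<open>n\<close>, so the sign of \<open>n\<close> enters separately.
\<close>

definition kronecker_prime :: "int \<Rightarrow> int \<Rightarrow> int" where
  "kronecker_prime a p =
     (if p = 2 then (if even a then 0 else if a mod 8 \<in> {1, 7} then 1 else - 1)
      else Legendre a p)"

definition kronecker :: "int \<Rightarrow> int \<Rightarrow> int" where
  "kronecker a n =
     (if n = 0 then (if \<bar>a\<bar> = 1 then 1 else 0)
      else (if a < 0 \<and> n < 0 then - 1 else 1) *
           (\<Prod>p\<in>prime_factors n. kronecker_prime a p ^ multiplicity p n))"


section \<open>The \<open>p\<close>-adic valuation\<close>

definition vp :: "nat \<Rightarrow> rat \<Rightarrow> ereal" where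
  "vp p x =
     (if x = 0 then \<infinity>
      else ereal (real (multiplicity (int p) (fst (quotient_of x))) -
                  real (multiplicity (int p) (snd (quotient_of x)))))"

definition vp_fls :: "nat \<Rightarrow> rat fls \<Rightarrow> ereal" where
  "vp_fls p f = (INF n. vp p (f $$ n))"


section \<open>Eta quotients\<close>

text \<open>
  The product of \<open>1 - q ^ n\<close> over \<open>n \<ge> 1\<close>, convergent in the topology of formal power series.
\<close>

definition euler_product :: "rat fps" where
  "euler_product = (\<Prod>n. 1 - fps_X ^ Suc n)"

text \<open>
  To accommodate the factor \<open>q ^ (1/24)\<close>, eta is a series in \<open>t = q ^ (1/24)\<close>, that is,
  \<open>t\<close> times the product of all \<open>1 - t ^ (24 * n)\<close>. Replacing \<open>z\<close> by \<open>d * z\<close> replaces \<open>t\<close> by \<open>t ^ d\<close>.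
\<close>

definition eta :: "rat fls" where
  "eta = fls_X * fls_compose_power (fps_to_fls euler_product) 24"

definition eta_at :: "nat \<Rightarrow> rat fls" where
  "eta_at d = fls_compose_power eta d"

text \<open>
  All eta quotients below are series in \<open>t ^ 24 = q\<close>; their coefficient of \<open>q ^ n\<close> is the one of
  \<open>t ^ (24 * n)\<close>.
\<close>

definition q_expansion :: "rat fls \<Rightarrow> rat fls" where
  "q_expansion f = U 24 f"


section \<open>The five curves\<close>

text \<open>
  Each curve is named after its conductor:

  \<^item> \<open>E27\<close>: \<open>y^2 + y = x^3 - 7\<close>
  \<^item> \<open>E32\<close>: \<open>y^2 = x^3 + 4x\<close>
  \<^item> \<open>E36\<close>: \<open>y^2 = x^3 + 1\<close>
  \<^item> \<open>E64\<close>: \<open>y^2 = x^3 - 4x\<close>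
  \<^item> \<open>E144\<close>: \<open>y^2 = x^3 - 1\<close>
\<close>

datatype cm_curve = E27 | E32 | E36 | E64 | E144

primrec conductor :: "cm_curve \<Rightarrow> nat" where
  "conductor E27 = 27"
| "conductor E32 = 32"
| "conductor E36 = 36"
| "conductor E64 = 64"
| "conductor E144 = 144"

primrec newform :: "cm_curve \<Rightarrow> rat fls" where
  "newform E27 = q_expansion (eta_at 3 ^ 2 * eta_at 9 ^ 2)"
| "newform E32 = q_expansion (eta_at 4 ^ 2 * eta_at 8 ^ 2)"
| "newform E36 = q_expansion (eta_at 6 ^ 4)"
| "newform E64 = q_expansion (eta_at 8 ^ 8 / (eta_at 4 ^ 2 * eta_at 16 ^ 2))"
| "newform E144 = q_expansion (eta_at 12 ^ 12 / (eta_at 6 ^ 4 * eta_at 24 ^ 4))"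

definition G32 :: "rat fls" where
  "G32 = q_expansion (eta_at 4 ^ 2 * eta_at 16 ^ 6 / eta_at 32 ^ 4)"

definition G36 :: "rat fls" where
  "G36 = q_expansion (eta_at 6 ^ 3 * eta_at 12 * eta_at 18 ^ 3 / eta_at 36 ^ 3)"

primrec G :: "cm_curve \<Rightarrow> rat fls" where
  "G E27 = q_expansion (eta_at 3 * eta_at 9 ^ 6 / eta_at 27 ^ 3)"
| "G E32 = G32"
| "G E36 = G36"
| "G E64 = twist (kronecker 8) G32"
| "G E144 = twist (kronecker 12) G36"

definition C :: "cm_curve \<Rightarrow> nat \<Rightarrow> rat" where
  "C E n = G E $$ int n"


section \<open>Inert primes in the CM field\<close>

definition quadratic_field :: "int \<Rightarrow> complex set" where
  "quadratic_field d = {of_rat a + of_rat b * csqrt (of_int d) | a b. True}"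

primrec cm_field :: "cm_curve \<Rightarrow> complex set" where
  "cm_field E27 = quadratic_field (- 3)"
| "cm_field E32 = quadratic_field (- 1)"
| "cm_field E36 = quadratic_field (- 3)"
| "cm_field E64 = quadratic_field (- 1)"
| "cm_field E144 = quadratic_field (- 3)"

definition ring_of_integers :: "complex set \<Rightarrow> complex ring" where
  "ring_of_integers K =
     \<lparr>carrier = {x \<in> K. algebraic_int x}, monoid.mult = (*), one = 1, zero = 0, add = (+)\<rparr>"

definition inert :: "complex set \<Rightarrow> nat \<Rightarrow> bool" where
  "inert K p \<longleftrightarrow>
     primeideal (PIdl\<^bsub>ring_of_integers K\<^esub> (of_nat p)) (ring_of_integers K)"

end

theory Submission
  imports Defs "HOL-Number_Theory.Quadratic_Reciprocity"
begin

text \<open>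
  The curve is parametrized by a local parameter \<open>T\<close> at infinity, a power series in \<open>q\<close> with
  \<open>p\<close>-integral coefficients. In terms of \<open>T\<close>, the newform \<open>g\<close> and the form \<open>G\<close> become
  differentials of the first and the second kind, whose expansions are essentially binomial series
  with coefficients \<open>\<alpha> n\<close> and \<open>\<beta> n\<close>. For inert \<open>p\<close> Frobenius exchanges the two: products over
  residue systems modulo \<open>p ^ k\<close> show that \<open>\<beta> (p * n) / \<alpha> n\<close> is, modulo \<open>p * n\<close>, a unit \<open>\<gamma>\<close> that
  does not depend on \<open>n\<close>. As \<open>T(q) ^ p\<close> and \<open>T(q ^ p)\<close> are congruent modulo \<open>p\<close>, this carries
  over from the parameter \<open>T\<close> to \<open>q\<close>: the coefficient of \<open>G\<close> at \<open>p * n\<close> is congruent to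
  \<open>\<gamma> * a n\<close> modulo \<open>p * n\<close>, where the \<open>a n\<close> are the coefficients of \<open>g\<close>. The Hecke relation
  \<open>a (p ^ 2 * n) = - p * a n\<close> then gives the theorem. The Hecke relations hold because \<open>g\<close> is a
  theta series over the Gaussian or Eisenstein integers, and the differential equations for the
  parametrizations are identities between theta functions, proved by dissection.
\<close>

section \<open>Congruences modulo powers of the variable\<close>

text \<open>Inertness enters through the exponents. With e = 3, 4, 6 for the conductors 27, 32, 36,
  the coefficients \<open>\<alpha> n\<close> are supported on n = 1 mod e and the
  \<open>\<beta> n\<close> on n = - 1 mod e. The inert primes of good reduction satisfy p = - 1 mod
  e, so n -> p * n carries the first class to the second. The modulus has to be p * n, and not just
  p, because the passage from T to q compares integrals, whose coefficients are divided by n. The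
  true \<gamma> is a p-adic number; to stay within the rationals it is approximated, to a precision
  that depends on the range of coefficients considered. The pole of G is removed by adding the
  derivative of a p-integral Laurent series, which changes the n-th coefficient by a multiple of n.
  At p ^ (2 * m + 1) * n the modulus is p ^ (2 * m + 1) and C has valuation m, which leaves m + 1
  after division. Conductor 27 has good reduction at the inert prime 2, where square roots of series
  are not integral in general; hence the Fermat cubic and its cube roots. Conductors 64 and 144 are
  twists of 32 and 36: both sides of every congruence pick up the same sign.\<close>

definition eqm :: "nat \<Rightarrow> 'a::comm_ring_1 fps \<Rightarrow> 'a fps \<Rightarrow> bool" where
  "eqm K A B \<longleftrightarrow> (\<forall>n<K. fps_nth A n = fps_nth B n)"

lemma eqm_refl [simp, intro]: "eqm K A A"
  and eqm_sym: "eqm K A B \<Longrightarrow> eqm K B A"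
  and eqm_trans [trans]: "eqm K A B \<Longrightarrow> eqm K B D \<Longrightarrow> eqm K A D"
  by (auto simp: eqm_def)

lemma eqm_eq_trans [trans]: "eqm K A B \<Longrightarrow> B = D \<Longrightarrow> eqm K A D"
  and eq_eqm_trans [trans]: "A = B \<Longrightarrow> eqm K B D \<Longrightarrow> eqm K A D"
  by auto

lemma eqm_mult:
  assumes "eqm K A B" "eqm K F D"
  shows "eqm K (A * F) (B * D)"
  using assms unfolding eqm_def by (auto simp: fps_mult_nth intro!: sum.cong)

lemma eqm_sum: "(\<And>i. i \<in> S \<Longrightarrow> eqm K (f i) (g i)) \<Longrightarrow> eqm K (sum f S) (sum g S)"
  by (auto simp: eqm_def fps_sum_nth intro!: sum.cong)

lemma eqm_prod: "(\<And>i. i \<in> S \<Longrightarrow> eqm K (f i) (g i)) \<Longrightarrow> eqm K (prod f S) (prod g S)"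
  by (induction S rule: infinite_finite_induct) (auto intro: eqm_mult)

lemma eqm_power: "eqm K A B \<Longrightarrow> eqm K (A ^ n) (B ^ n)"
  by (induction n) (auto intro: eqm_mult)

lemma eqm_ext: "(\<And>K. eqm K A B) \<Longrightarrow> A = B"
  by (auto simp: eqm_def fps_eq_iff)

lemma eqm_X_power_mult: "K \<le> n \<Longrightarrow> eqm K (fps_X ^ n * A) 0"
  by (auto simp: eqm_def fps_X_power_mult_nth)

lemma eqm_cancel:
  fixes A B F :: "'a::field fps"
  assumes "eqm K (A * F) (B * F)" "fps_nth F 0 \<noteq> 0"
  shows "eqm K A B"
proof -
  have "eqm K (A * F * inverse F) (B * F * inverse F)"
    by (intro eqm_mult assms) auto
  moreover have "F * inverse F = 1"
    using assms(2) by (metis inverse_mult_eq_1 mult.commute)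
  ultimately show ?thesis by (simp add: mult.assoc)
qed


section \<open>Infinite products\<close>

text \<open>
  The infinite product over \<open>i \<ge> 0\<close>, provided that \<open>m > 0\<close>: then the factors with \<open>i > n\<close>
  do not affect the coefficient of \<open>X ^ n\<close>.
\<close>

definition qpoch :: "'a::comm_ring_1 \<Rightarrow> nat \<Rightarrow> nat \<Rightarrow> 'a fps" where
  "qpoch s j m = Abs_fps (\<lambda>n. fps_nth (\<Prod>i\<le>n. 1 - fps_const s * fps_X ^ (m * i + j)) n)"

lemma eqm_prod_extend:
  assumes "m > 0" "K \<le> N" "N \<le> N'"
  shows "eqm K (\<Prod>i<N'. 1 - fps_const s * fps_X ^ (m * i + j))
               (\<Prod>i<N. 1 - fps_const s * fps_X ^ (m * i + j))"
proof -
  have "eqm K (\<Prod>i\<in>{N..<N'}. 1 - fps_const s * fps_X ^ (m * i + j)) (\<Prod>i\<in>{N..<N'}. 1)"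
  proof (rule eqm_prod)
    fix i assume "i \<in> {N..<N'}"
    then have "K \<le> 1 * i" using assms by auto
    also have "\<dots> \<le> m * i + j" using assms(1) by (intro trans_le_add1 mult_right_mono) auto
    finally have "K \<le> m * i + j" .
    then have "eqm K (fps_X ^ (m * i + j) * fps_const s) 0" by (rule eqm_X_power_mult)
    then show "eqm K (1 - fps_const s * fps_X ^ (m * i + j)) 1"
      by (auto simp: eqm_def mult.commute)
  qed
  then have "eqm K ((\<Prod>i<N. 1 - fps_const s * fps_X ^ (m * i + j)) *
                    (\<Prod>i\<in>{N..<N'}. 1 - fps_const s * fps_X ^ (m * i + j)))
                   ((\<Prod>i<N. 1 - fps_const s * fps_X ^ (m * i + j)) * 1)"
    by (intro eqm_mult) auto
  moreover have "{..<N'} = {..<N} \<union> {N..<N'}" using assms by auto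
  moreover have "{..<N} \<inter> {N..<N'} = {}" by auto
  ultimately show ?thesis by (simp add: prod.union_disjoint)
qed

lemma eqm_qpoch:
  assumes "m > 0" "K \<le> N"
  shows "eqm K (qpoch s j m) (\<Prod>i<N. 1 - fps_const s * fps_X ^ (m * i + j))"
  unfolding eqm_def
proof (intro allI impI)
  fix n assume n: "n < K"
  have "eqm (Suc n) (\<Prod>i<N. 1 - fps_const s * fps_X ^ (m * i + j))
               (\<Prod>i<Suc n. 1 - fps_const s * fps_X ^ (m * i + j))"
    by (rule eqm_prod_extend) (use assms n in auto)
  then show "fps_nth (qpoch s j m) n = fps_nth (\<Prod>i<N. 1 - fps_const s * fps_X ^ (m * i + j)) n"
    unfolding eqm_def qpoch_def lessThan_Suc_atMost by auto
qed

text \<open>Arbitrarily long partial products suffice for a comparison; the freedom in N' lets a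
  proof use a multiple of the given number of factors.\<close>

lemma qpoch_eqI:
  assumes "m > 0" "\<And>K N. K \<le> N \<Longrightarrow> \<exists>N'\<ge>N. eqm K A (\<Prod>i<N'. 1 - fps_const s * fps_X ^ (m * i + j))"
  shows "A = qpoch s j m"
proof (rule eqm_ext)
  fix K
  obtain N where N: "N \<ge> K" "eqm K A (\<Prod>i<N. 1 - fps_const s * fps_X ^ (m * i + j))"
    using assms(2)[of K K] by auto
  show "eqm K A (qpoch s j m)"
    by (rule eqm_trans[OF N(2)]) (intro eqm_sym[OF eqm_qpoch] assms N)
qed

lemma qpoch_nth_0: "m > 0 \<Longrightarrow> j > 0 \<Longrightarrow> fps_nth (qpoch s j m) 0 = 1"
  by (simp add: qpoch_def)

lemma mult_add_less:
  fixes i k r N :: nat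
  assumes "r < k" "i < N"
  shows "r + i * k < N * k"
proof -
  have "r + i * k < Suc i * k" using assms by simp
  also have "\<dots> \<le> N * k" using assms by (intro mult_le_mono1) auto
  finally show ?thesis .
qed

text \<open>The factors are sorted by the residue r of their index n = k * i + r modulo k.\<close>

lemma qpoch_split:
  assumes "m > 0" "k > 0"
  shows "qpoch s j m = (\<Prod>r<k. qpoch s (j + m * r) (k * m))"
proof (rule sym, rule qpoch_eqI[OF assms(1)])
  fix K N :: nat assume KN: "K \<le> N"
  have "eqm K (\<Prod>r<k. qpoch s (j + m * r) (k * m))
              (\<Prod>r<k. \<Prod>i<N. 1 - fps_const s * fps_X ^ (k * m * i + (j + m * r)))"
    by (intro eqm_prod eqm_qpoch) (use assms KN in auto)
  also have "(\<Prod>r<k. \<Prod>i<N. 1 - fps_const s * fps_X ^ (k * m * i + (j + m * r))) =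
     (\<Prod>(r,i)\<in>{..<k}\<times>{..<N}. 1 - fps_const s * fps_X ^ (k * m * i + (j + m * r)))"
    by (rule prod.cartesian_product)
  also have "\<dots> = (\<Prod>n<k * N. 1 - fps_const s * fps_X ^ (m * n + j))"
    by (rule prod.reindex_bij_witness[where i = "\<lambda>n. (n mod k, n div k)" and j = "\<lambda>(r,i). k * i + r"])
       (use assms in \<open>auto simp: algebra_simps less_mult_imp_div_less intro!: mult_add_less\<close>)
  finally show "\<exists>N'\<ge>N. eqm K (\<Prod>r<k. qpoch s (j + m * r) (k * m))
     (\<Prod>i<N'. 1 - fps_const s * fps_X ^ (m * i + j))"
    using assms by (intro exI[of _ "k * N"]) auto
qed

lemma qpoch_mult_minus:
  assumes "m > 0"
  shows "qpoch s j m * qpoch (- s) j m = qpoch (s ^ 2) (2 * j) (2 * m)"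
proof (rule qpoch_eqI)
  show "2 * m > 0" using assms by simp
  fix K N :: nat assume KN: "K \<le> N"
  have "eqm K (qpoch s j m * qpoch (- s) j m)
     ((\<Prod>i<N. 1 - fps_const s * fps_X ^ (m * i + j)) * (\<Prod>i<N. 1 - fps_const (-s) * fps_X ^ (m * i + j)))"
    by (intro eqm_mult eqm_qpoch) (use assms KN in auto)
  also have "\<dots> = (\<Prod>i<N. 1 - fps_const (s^2) * fps_X ^ (2 * m * i + 2 * j))"
  proof (subst prod.distrib[symmetric], rule prod.cong[OF refl])
    fix i
    have diff: "(1 - c * x) * (1 - (- c) * x) = 1 - c ^ 2 * x ^ 2" for c x :: "'a fps"
      by (simp add: algebra_simps power2_eq_square)
    have "(fps_X :: 'a fps) ^ (2 * m * i + 2 * j) = (fps_X ^ (m * i + j)) ^ 2"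
      by (simp only: power_mult[symmetric]) (simp add: algebra_simps)
    moreover have "fps_const (s ^ 2) = fps_const s ^ 2" by (rule fps_const_power[symmetric])
    moreover have "fps_const (- s) = - fps_const s" by simp
    ultimately show "(1 - fps_const s * fps_X ^ (m * i + j)) * (1 - fps_const (- s) * fps_X ^ (m * i + j)) =
      1 - fps_const (s\<^sup>2) * fps_X ^ (2 * m * i + 2 * j)"
      by (simp only: diff)
  qed
  finally show "\<exists>N'\<ge>N. eqm K (qpoch s j m * qpoch (- s) j m)
            (\<Prod>i<N'. 1 - fps_const (s\<^sup>2) * fps_X ^ (2 * m * i + 2 * j))" by blast
qed

lemma compose_X_power_nth:
  "k > 0 \<Longrightarrow> fps_nth (fps_compose A (fps_X ^ k)) n = (if k dvd n then fps_nth A (n div k) else 0)"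
  by (auto simp: fps_nth_compose_X_power)

lemma eqm_compose_X_power:
  assumes "eqm K A B" "k > 0"
  shows "eqm K (fps_compose A (fps_X ^ k)) (fps_compose B (fps_X ^ k))"
  unfolding eqm_def
proof (intro allI impI)
  fix n assume "n < K"
  moreover have "n div k \<le> n" by simp
  ultimately have "n div k < K" by linarith
  then show "fps_nth (fps_compose A (fps_X ^ k)) n = fps_nth (fps_compose B (fps_X ^ k)) n"
    using assms by (auto simp: compose_X_power_nth eqm_def)
qed

lemma qpoch_compose:
  fixes s :: "'a::idom"
  assumes "m > 0" "k > 0"
  shows "fps_compose (qpoch s j m) (fps_X ^ k) = qpoch s (k * j) (k * m)"
proof (rule qpoch_eqI)
  show "k * m > 0" using assms by simp
  fix K N :: nat assume KN: "K \<le> N"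
  have "eqm K (fps_compose (qpoch s j m) (fps_X ^ k))
     (fps_compose (\<Prod>i<N. 1 - fps_const s * fps_X ^ (m * i + j)) (fps_X ^ k))"
    by (intro eqm_compose_X_power eqm_qpoch) (use assms KN in auto)
  also have "\<dots> = (\<Prod>i<N. 1 - fps_const s * fps_X ^ (k * m * i + k * j))"
  proof (subst fps_compose_prod_distrib, use assms in simp, rule prod.cong[OF refl])
    fix i
    have "fps_compose (fps_X ^ (m * i + j)) (fps_X ^ k :: 'a fps) = (fps_X ^ k) ^ (m * i + j)"
      using assms by (simp add: fps_compose_power[symmetric])
    also have "\<dots> = fps_X ^ (k * m * i + k * j)"
      by (simp add: power_mult[symmetric] algebra_simps)
    finally show "fps_compose (1 - fps_const s * fps_X ^ (m * i + j)) (fps_X ^ k) =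
        1 - fps_const s * fps_X ^ (k * m * i + k * j)"
      using assms by (simp add: fps_compose_sub_distrib fps_compose_mult_distrib)
  qed
  finally show "\<exists>N'\<ge>N. eqm K (fps_compose (qpoch s j m) (fps_X ^ k))
            (\<Prod>i<N'. 1 - fps_const s * fps_X ^ (k * m * i + k * j))" by blast
qed

section \<open>Theta series\<close>

text \<open>
  Below, \<open>lat w e\<close> stands for \<open>\<Sum>i. w i * X ^ e i\<close>. It is meaningful only if \<open>admis e\<close>:
  otherwise infinite sums of coefficients are \<open>0\<close> and negative exponents are dropped.
\<close>

definition admis :: "('i \<Rightarrow> int) \<Rightarrow> bool" where
  "admis e \<longleftrightarrow> (\<forall>i. e i \<ge> 0) \<and> (\<forall>n. finite {i. e i \<le> n})"

definition lat :: "('i \<Rightarrow> rat) \<Rightarrow> ('i \<Rightarrow> int) \<Rightarrow> rat fps" where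
  "lat w e = Abs_fps (\<lambda>n. \<Sum>i | e i = int n. w i)"

lemma lat_nth: "fps_nth (lat w e) n = (\<Sum>i | e i = int n. w i)"
  by (simp add: lat_def)

lemma admis_finite: "admis e \<Longrightarrow> finite {i. e i = n}"
  by (rule finite_subset[of _ "{i. e i \<le> n}"]) (auto simp: admis_def)

lemma lat_cong: "(\<And>i. w i = w' i) \<Longrightarrow> (\<And>i. e i = e' i) \<Longrightarrow> lat w e = lat w' e'"
  by (simp add: lat_def)

lemma lat_add: "lat w e + lat w' e = lat (\<lambda>i. w i + w' i) e"
  by (simp add: fps_eq_iff lat_nth sum.distrib)

lemma lat_cmult: "fps_const c * lat w e = lat (\<lambda>i. c * w i) e"
  by (simp add: fps_eq_iff lat_nth sum_distrib_left)

lemma lat_reindex: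
  assumes "inj f" "\<And>i. w i \<noteq> 0 \<Longrightarrow> i \<in> range f" "admis e"
  shows "lat w e = lat (\<lambda>j. w (f j)) (\<lambda>j. e (f j))"
proof -
  have "(\<Sum>i | e i = int n. w i) = (\<Sum>j | e (f j) = int n. w (f j))" for n
  proof -
    have "(\<Sum>j | e (f j) = int n. w (f j)) = (\<Sum>i\<in>f ` {j. e (f j) = int n}. w i)"
      by (subst sum.reindex) (use assms(1) in \<open>auto simp: inj_on_def\<close>)
    also have "\<dots> = (\<Sum>i | e i = int n. w i)"
      by (rule sum.mono_neutral_left) (use assms admis_finite[of e "int n"] in auto)
    finally show ?thesis by simp
  qed
  then show ?thesis by (simp add: fps_eq_iff lat_nth)
qed

lemma lat_mult:
  assumes "admis e" "admis e'"
  shows "lat w e * lat w' e' = lat (\<lambda>(i, j). w i * w' j) (\<lambda>(i, j). e i + e' j)"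
proof (rule fps_ext)
  fix n
  let ?S = "{(i, j). e i + e' j = int n}"
  have nn: "e i \<ge> 0" "e' j \<ge> 0" for i j using assms by (auto simp: admis_def)
  have "?S \<subseteq> {i. e i \<le> int n} \<times> {j. e' j \<le> int n}"
  proof safe
    fix i j assume "e i + e' j = int n"
    then show "e i \<le> int n" "e' j \<le> int n" using nn(1)[of i] nn(2)[of j] by linarith+
  qed
  then have fin: "finite ?S"
    by (rule finite_subset) (use assms in \<open>auto simp: admis_def\<close>)
  have "fps_nth (lat (\<lambda>(i, j). w i * w' j) (\<lambda>(i, j). e i + e' j)) n = (\<Sum>(i, j)\<in>?S. w i * w' j)"
    by (simp add: lat_nth case_prod_unfold)
  \<comment> \<open>Pairs are grouped by the exponent of the first factor. Both exponents being
    nonnegative, it lies between 0 and n.\<close>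
  also have "\<dots> = (\<Sum>k\<in>{0..n}. \<Sum>(i, j)\<in>{x \<in> ?S. nat (e (fst x)) = k}. w i * w' j)"
  proof (rule sum.group[symmetric])
    show "(\<lambda>x. nat (e (fst x))) ` ?S \<subseteq> {0..n}"
    proof safe
      fix i j assume "e i + e' j = int n"
      then have "e i \<le> int n" using nn(2)[of j] by linarith
      then show "nat (e (fst (i, j))) \<in> {0..n}" by simp
    qed
  qed (use fin in auto)
  also have "\<dots> = (\<Sum>k\<in>{0..n}. fps_nth (lat w e) k * fps_nth (lat w' e') (n - k))"
  proof (rule sum.cong[OF refl])
    fix k assume k: "k \<in> {0..n}"
    have "{x \<in> ?S. nat (e (fst x)) = k} = {i. e i = int k} \<times> {j. e' j = int (n - k)}"
      using k nn by (auto simp: of_nat_diff)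
    then show "(\<Sum>(i, j)\<in>{x \<in> ?S. nat (e (fst x)) = k}. w i * w' j) =
        fps_nth (lat w e) k * fps_nth (lat w' e') (n - k)"
      by (simp add: lat_nth sum_product sum.cartesian_product)
  qed
  finally show "fps_nth (lat w e * lat w' e') n =
      fps_nth (lat (\<lambda>(i, j). w i * w' j) (\<lambda>(i, j). e i + e' j)) n"
    by (simp add: fps_mult_nth)
qed

lemma admis_pair:
  assumes "admis e" "admis e'"
  shows "admis (\<lambda>(i, j). e i + e' j)"
proof -
  have nn: "e i \<ge> 0" "e' j \<ge> 0" for i j using assms by (auto simp: admis_def)
  have "finite {x. (case x of (i, j) \<Rightarrow> e i + e' j) \<le> n}" for n
  proof (rule finite_subset)
    show "{x. (case x of (i, j) \<Rightarrow> e i + e' j) \<le> n} \<subseteq> {i. e i \<le> n} \<times> {j. e' j \<le> n}"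
    proof safe
      fix i j assume "e i + e' j \<le> n"
      then show "e i \<le> n" "e' j \<le> n" using nn(1)[of i] nn(2)[of j] by linarith+
    qed
  qed (use assms in \<open>auto simp: admis_def\<close>)
  then show ?thesis using nn by (auto simp: admis_def)
qed

lemma lat_shift:
  assumes "admis e"
  shows "fps_X ^ k * lat w e = lat w (\<lambda>i. e i + int k)"
proof (rule fps_ext)
  fix n
  have nn: "e i \<ge> 0" for i using assms by (auto simp: admis_def)
  have "{i. e i + int k = int n} = (if n < k then {} else {i. e i = int (n - k)})"
  proof (cases "n < k")
    case True
    have "e i + int k \<noteq> int n" for i using nn[of i] True by linarith
    with True show ?thesis by simp
  qed (auto simp: of_nat_diff)
  then show "fps_nth (fps_X ^ k * lat w e) n = fps_nth (lat w (\<lambda>i. e i + int k)) n"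
    by (simp add: lat_nth fps_X_power_mult_nth)
qed

lemma admis_shift: 
  assumes "admis e" shows "admis (\<lambda>i. e i + int k)"
proof -
  have "{i. e i + int k \<le> n} = {i. e i \<le> n - int k}" for n by auto
  then show ?thesis using assms by (auto simp: admis_def)
qed

lemma lat_compose:
  assumes "k > 0"
  shows "fps_compose (lat w e) (fps_X ^ k) = lat w (\<lambda>i. int k * e i)"
proof (rule fps_ext)
  fix n
  have "{i. int k * e i = int n} = (if k dvd n then {i. e i = int (n div k)} else {})"
  proof (cases "k dvd n")
    case True
    then obtain r where "n = k * r" by auto
    then show ?thesis using assms by auto
  next
    case False
    then have "int k * e i \<noteq> int n" for i by (metis dvd_triv_left int_dvd_int_iff)
    with False show ?thesis by auto
  qed
  then show "fps_nth (fps_compose (lat w e) (fps_X ^ k)) n = fps_nth (lat w (\<lambda>i. int k * e i)) n"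
    using assms by (simp add: lat_nth compose_X_power_nth)
qed

lemma admis_scale:
  assumes "admis e" "k > 0" shows "admis (\<lambda>i. int k * e i)"
proof -
  have "{i. int k * e i \<le> n} \<subseteq> {i. e i \<le> n}" for n
  proof safe
    fix i assume a: "int k * e i \<le> n"
    have "1 * e i \<le> int k * e i" using assms by (intro mult_right_mono) (auto simp: admis_def)
    with a show "e i \<le> n" by linarith
  qed
  then have "finite {i. int k * e i \<le> n}" for n
    by (rule finite_subset) (use assms(1) in \<open>auto simp: admis_def\<close>)
  then show ?thesis using assms by (auto simp: admis_def)
qed

text \<open>The bound is |d| - 1 and not |d| because of the triangular exponents d (d - 1) / 2,
  which equal |d| - 1 at d = 1 and d = 2.\<close>

lemma admisI:
  fixes e :: "int \<Rightarrow> int"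
  assumes "\<And>d. e d \<ge> \<bar>d\<bar> - 1" "\<And>d. e d \<ge> 0"
  shows "admis e"
proof -
  have "finite {d. e d \<le> n}" for n
  proof (rule finite_subset[of _ "{-(n+1)..n+1}"])
    show "{d. e d \<le> n} \<subseteq> {-(n+1)..n+1}"
    proof safe
      fix d assume "e d \<le> n"
      with assms(1)[of d] have "\<bar>d\<bar> \<le> n + 1" by linarith
      then show "d \<in> {-(n+1)..n+1}" by auto
    qed
  qed auto
  then show ?thesis using assms by (auto simp: admis_def)
qed


section \<open>The finite triple product\<close>

text \<open>The Gaussian binomial coefficient, given by a q-Pascal rule rather than by a quotient,
  so that q may be any element of a commutative ring, such as a power of X or a constant
  polynomial.\<close>

fun qbinom :: "'a::comm_ring_1 \<Rightarrow> nat \<Rightarrow> nat \<Rightarrow> 'a" where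
  "qbinom q n 0 = 1"
| "qbinom q 0 (Suc k) = 0"
| "qbinom q (Suc n) (Suc k) = qbinom q n (Suc k) + q ^ (n - k) * qbinom q n k"

lemma qbinom_eq_0: "k > n \<Longrightarrow> qbinom q n k = 0"
  by (induction q n k rule: qbinom.induct) auto

lemma qbinom_self [simp]: "qbinom q n n = 1"
  by (induction n) (auto simp: qbinom_eq_0)

text \<open>The ratio of neighbouring coefficients with denominators cleared, as the ring has no
  division. It yields both the second Pascal rule \<open>qbinom_Suc'\<close> and the product formula
  \<open>qbinom_prod\<close>.\<close>

lemma qbinom_shift: "(1 - q ^ Suc k) * qbinom q n (Suc k) = (1 - q ^ (n - k)) * qbinom q n k"
proof (induction n arbitrary: k)
  case 0
  then show ?case by (cases k) auto
next
  case (Suc n)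
  consider "k = 0" | "k > n" | l where "k = Suc l" "l < n"
    by (metis Suc_less_eq not_less_eq old.nat.exhaust)
  then show ?case
  proof cases
    case 1
    have "(1 - q) * qbinom q n (Suc 0) = 1 - q ^ n"
      using Suc.IH[of 0] by simp
    then have "(1 - q) * (qbinom q n (Suc 0) + q ^ n) = 1 - q ^ n + (1 - q) * q ^ n"
      by (simp only: ring_distribs)
    also have "\<dots> = 1 - q ^ Suc n" by (simp add: algebra_simps)
    finally show ?thesis using 1 by simp
  next
    case 2
    then show ?thesis by (cases "k = Suc n") (auto simp: qbinom_eq_0)
  next
    case (3 l)
    define a b c where "a = qbinom q n (Suc (Suc l))" and "b = qbinom q n (Suc l)" and "c = qbinom q n l"
    define u v where "u = q ^ Suc l" and "v = q ^ (n - Suc l)"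
    have nl: "n - l = Suc (n - Suc l)" using 3 by simp
    have 1: "(1 - q * u) * a = (1 - v) * b"
      using Suc.IH[of "Suc l"] by (simp add: a_def b_def u_def v_def)
    have 2: "(1 - u) * b = (1 - q * v) * c"
      using Suc.IH[of l] by (simp add: b_def c_def u_def v_def nl)
    have "(1 - q * u) * (a + v * b) = (1 - q * v) * (b + q * v * c)"
    proof -
      have "(1 - q * u) * (a + v * b) = (1 - q * u) * a + (1 - q * u) * v * b"
        by (simp add: algebra_simps)
      also have "\<dots> = b - q * u * v * b" unfolding 1 by (simp add: algebra_simps)
      also have "\<dots> = (1 - q * v) * b + q * v * ((1 - u) * b)" by (simp add: algebra_simps)
      also have "\<dots> = (1 - q * v) * (b + q * v * c)" unfolding 2 by (simp add: algebra_simps)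
      finally show ?thesis .
    qed
    then show ?thesis using 3 by (simp add: a_def b_def c_def u_def v_def nl)
  qed
qed

lemma qbinom_Suc': "qbinom q (Suc n) (Suc k) = qbinom q n k + q ^ Suc k * qbinom q n (Suc k)"
  using qbinom_shift[of q k n] by (simp add: algebra_simps)

lemma qbinom_prod:
  assumes "k \<le> n"
  shows "qbinom q n k * ((\<Prod>i<k. 1 - q ^ Suc i) * (\<Prod>i<n - k. 1 - q ^ Suc i)) = (\<Prod>i<n. 1 - q ^ Suc i)"
  using assms
proof (induction k)
  case 0
  then show ?case by simp
next
  case (Suc k)
  have nk: "n - k = Suc (n - Suc k)" using Suc.prems by simp
  have "qbinom q n (Suc k) * ((\<Prod>i<Suc k. 1 - q ^ Suc i) * (\<Prod>i<n - Suc k. 1 - q ^ Suc i)) =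
     ((1 - q ^ Suc k) * qbinom q n (Suc k)) * ((\<Prod>i<k. 1 - q ^ Suc i) * (\<Prod>i<n - Suc k. 1 - q ^ Suc i))"
    by (simp add: algebra_simps)
  also have "\<dots> = qbinom q n k * ((\<Prod>i<k. 1 - q ^ Suc i) * ((1 - q ^ (n - k)) * (\<Prod>i<n - Suc k. 1 - q ^ Suc i)))"
    unfolding qbinom_shift by (simp add: algebra_simps)
  also have "(1 - q ^ (n - k)) * (\<Prod>i<n - Suc k. 1 - q ^ Suc i) = (\<Prod>i<n - k. 1 - q ^ Suc i)"
    unfolding nk by (simp add: mult.commute)
  also have "qbinom q n k * ((\<Prod>i<k. 1 - q ^ Suc i) * (\<Prod>i<n - k. 1 - q ^ Suc i)) = (\<Prod>i<n. 1 - q ^ Suc i)"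
    using Suc by simp
  finally show ?case .
qed

definition tri :: "nat \<Rightarrow> nat \<Rightarrow> nat" where
  "tri k N = nat ((int k - int N) * (int k - int N - 1) div 2)"

lemma int_tri: "int (tri k N) = (int k - int N) * (int k - int N - 1) div 2"
proof -
  have "(int k - int N) * (int k - int N - 1) \<ge> 0"
    by (cases "int k - int N \<ge> 1") (auto intro: mult_nonneg_nonneg mult_nonpos_nonpos)
  then show ?thesis by (simp add: tri_def)
qed

lemma tri_double: "2 * int (tri k N) = (int k - int N) * (int k - int N - 1)"
  unfolding int_tri by (rule dvd_mult_div_cancel) (cases "even (int k - int N)"; simp)

text \<open>A two-sided q-binomial theorem, whose limit is Jacobi's triple product. The factors are
  z - q ^ (i + 1) instead of 1 - q ^ (i + 1) / z, so that z need not be invertible; this moves the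
  usual exponent k - N of z to k. The induction on M uses the defining Pascal rule, the one on N
  uses the second rule.\<close>

lemma finite_triple_product:
  fixes z q :: "'a::comm_ring_1"
  shows "(\<Prod>i<M. 1 - z * q ^ i) * (\<Prod>i<N. z - q ^ Suc i) =
         (\<Sum>k\<le>M + N. (- 1) ^ (k + N) * q ^ tri k N * qbinom q (M + N) k * z ^ k)"
proof (induction N)
  case 0
  have t0: "tri (Suc k) 0 = tri k 0 + k" for k
    using tri_double[of k 0] tri_double[of "Suc k" 0] by (simp add: algebra_simps)
  show ?case
  proof (induction M)
    case 0
    then show ?case by (simp add: tri_def)
  next
    case (Suc M)
    let ?f = "\<lambda>k. (- 1) ^ k * q ^ tri k 0 * qbinom q M k * z ^ k"
    have "(\<Prod>i<Suc M. 1 - z * q ^ i) = (\<Sum>k\<le>M. ?f k) * (1 - z * q ^ M)"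
      using Suc by simp
    also have "\<dots> = (\<Sum>k\<le>Suc M. ?f k) - (\<Sum>k\<le>M. ?f k * z * q ^ M)"
      by (simp add: right_diff_distrib sum_distrib_right qbinom_eq_0 mult.assoc)
    also have "(\<Sum>k\<le>Suc M. ?f k) = ?f 0 + (\<Sum>k\<le>M. ?f (Suc k))" by (rule sum.atMost_Suc_shift)
    also have "?f 0 + (\<Sum>k\<le>M. ?f (Suc k)) - (\<Sum>k\<le>M. ?f k * z * q ^ M) =
       ?f 0 + (\<Sum>k\<le>M. ?f (Suc k) - ?f k * z * q ^ M)"
      by (simp add: sum_subtractf)
    also have "(\<Sum>k\<le>M. ?f (Suc k) - ?f k * z * q ^ M) =
       (\<Sum>k\<le>M. (- 1) ^ Suc k * q ^ tri (Suc k) 0 * qbinom q (Suc M) (Suc k) * z ^ Suc k)"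
    proof (rule sum.cong[OF refl])
      fix k assume "k \<in> {..M}"
      then have "q ^ M = q ^ k * q ^ (M - k)" by (simp flip: power_add)
      then show "?f (Suc k) - ?f k * z * q ^ M =
          (- 1) ^ Suc k * q ^ tri (Suc k) 0 * qbinom q (Suc M) (Suc k) * z ^ Suc k"
        by (simp add: t0 power_add algebra_simps)
    qed
    also have "?f 0 + (\<Sum>k\<le>M. (- 1) ^ Suc k * q ^ tri (Suc k) 0 * qbinom q (Suc M) (Suc k) * z ^ Suc k) = (\<Sum>k\<le>Suc M. (- 1) ^ k * q ^ tri k 0 * qbinom q (Suc M) k * z ^ k)"
      by (simp only: sum.atMost_Suc_shift) simp
    finally show ?case by simp
  qed
next
  case (Suc N)
  have t1: "tri (Suc k) (Suc N) = tri k N" for k by (simp add: tri_def)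
  have rearrange: "u - (x * y + v) = - x * y + (u - v)" for u v x y :: 'a
    by (simp add: algebra_simps)
  let ?L = "M + N"
  let ?f = "\<lambda>k. (- 1) ^ (k + N) * q ^ tri k N * qbinom q ?L k * z ^ k"
  have "(\<Prod>i<M. 1 - z * q ^ i) * (\<Prod>i<Suc N. z - q ^ Suc i) = (\<Sum>k\<le>?L. ?f k) * (z - q ^ Suc N)"
    using Suc by (simp add: mult.assoc[symmetric])
  also have "\<dots> = (\<Sum>k\<le>?L. ?f k * z) - (\<Sum>k\<le>?L. ?f k * q ^ Suc N)"
    by (simp only: right_diff_distrib sum_distrib_right)
  also have "(\<Sum>k\<le>?L. ?f k * q ^ Suc N) = (\<Sum>k\<le>Suc ?L. ?f k * q ^ Suc N)"
    by (simp add: qbinom_eq_0)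
  also have "(\<Sum>k\<le>Suc ?L. ?f k * q ^ Suc N) = ?f 0 * q ^ Suc N + (\<Sum>k\<le>?L. ?f (Suc k) * q ^ Suc N)" by (rule sum.atMost_Suc_shift)
  also have "(\<Sum>k\<le>?L. ?f k * z) - (?f 0 * q ^ Suc N + (\<Sum>k\<le>?L. ?f (Suc k) * q ^ Suc N)) =
      - ?f 0 * q ^ Suc N + (\<Sum>k\<le>?L. ?f k * z - ?f (Suc k) * q ^ Suc N)"
    unfolding sum_subtractf by (rule rearrange)
  also have "(\<Sum>k\<le>?L. ?f k * z - ?f (Suc k) * q ^ Suc N) =
     (\<Sum>k\<le>?L. (- 1) ^ (Suc k + Suc N) * q ^ tri (Suc k) (Suc N) * qbinom q (Suc ?L) (Suc k) * z ^ Suc k)"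
  proof (rule sum.cong[OF refl])
    fix k
    have "int (tri (Suc k) N + Suc N) = int (tri k N + Suc k)"
      using tri_double[of k N] tri_double[of "Suc k" N] by (simp add: algebra_simps)
    then have "q ^ tri (Suc k) N * q ^ Suc N = q ^ tri k N * q ^ Suc k"
      unfolding power_add[symmetric] by (metis of_nat_eq_iff)
    note exps = this
    have "?f (Suc k) * q ^ Suc N = - ((-1) ^ (k + N) * (q ^ tri (Suc k) N * q ^ Suc N) * qbinom q ?L (Suc k) * z ^ Suc k)"
      by (simp add: algebra_simps)
    also have "\<dots> = - ((-1) ^ (k + N) * (q ^ tri k N * q ^ Suc k) * qbinom q ?L (Suc k) * z ^ Suc k)"
      unfolding exps ..
    finally have shifted: "?f (Suc k) * q ^ Suc N = \<dots>" .
    show "?f k * z - ?f (Suc k) * q ^ Suc N =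
       (- 1) ^ (Suc k + Suc N) * q ^ tri (Suc k) (Suc N) * qbinom q (Suc ?L) (Suc k) * z ^ Suc k"
      unfolding shifted t1 qbinom_Suc' by (simp add: algebra_simps)
  qed
  also have "- ?f 0 * q ^ Suc N = (- 1) ^ Suc N * q ^ tri 0 (Suc N)"
  proof -
    have "int (tri 0 N + Suc N) = int (tri 0 (Suc N))"
      using tri_double[of 0 N] tri_double[of 0 "Suc N"] by (simp add: algebra_simps)
    then have "tri 0 (Suc N) = tri 0 N + Suc N" by simp
    then show ?thesis by (simp add: power_add algebra_simps)
  qed
  also have "(- 1) ^ Suc N * q ^ tri 0 (Suc N) +
     (\<Sum>k\<le>?L. (- 1) ^ (Suc k + Suc N) * q ^ tri (Suc k) (Suc N) * qbinom q (Suc ?L) (Suc k) * z ^ Suc k) =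
     (\<Sum>k\<le>Suc ?L. (- 1) ^ (k + Suc N) * q ^ tri k (Suc N) * qbinom q (Suc ?L) k * z ^ k)"
    by (simp only: sum.atMost_Suc_shift) simp
  finally show ?case by simp
qed

section \<open>The triple product and its derivative\<close>

text \<open>By \<open>qbinom_prod\<close> the coefficient is a quotient P n / (P k * P (n - k)) of
  finite products, and all three agree with the Euler product up to X ^ K when k and n - k are at
  least K.\<close>

lemma eqm_qbinom_euler:
  assumes "m > 0" "K \<le> k" "k + K \<le> n"
  shows "eqm K (qbinom (fps_X ^ m :: rat fps) n k * qpoch 1 m m) 1"
proof -
  define P where "P = (\<lambda>n. \<Prod>i<n. 1 - (fps_X ^ m :: rat fps) ^ Suc i)"
  have P: "eqm K (qpoch 1 m m) (P N)" if "K \<le> N" for N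
  proof -
    have "P N = (\<Prod>i<N. 1 - fps_const 1 * fps_X ^ (m * i + m))"
      unfolding P_def by (rule prod.cong[OF refl]) (simp add: power_mult[symmetric] power_add algebra_simps)
    then show ?thesis using eqm_qpoch[OF assms(1) that, of 1 m] by simp
  qed
  let ?E = "qpoch 1 m m :: rat fps"
  let ?b = "qbinom (fps_X ^ m :: rat fps) n k"
  have "eqm K (?b * ?E * ?E) (?b * (P k * P (n - k)))"
    unfolding mult.assoc by (intro eqm_mult P eqm_refl) (use assms in auto)
  also have "\<dots> = P n" unfolding P_def by (rule qbinom_prod) (use assms in auto)
  also have "eqm K (P n) (1 * ?E)"
    using eqm_sym[OF P[of n]] assms by simp
  finally show ?thesis
    by (rule eqm_cancel) (use assms in \<open>simp add: qpoch_nth_0\<close>)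
qed

lemma theta_limit:
  fixes A :: "rat fps" and B :: "nat \<Rightarrow> rat fps" and e :: "int \<Rightarrow> int"
  assumes m: "m > 0"
    and lim: "\<And>K. \<exists>M. \<forall>N\<ge>M. eqm K (B N) A"
    and fin: "\<And>N. B N = (\<Sum>k\<le>N + N. fps_const (w (int k - int N)) * fps_X ^ nat (e (int k - int N)) *
                            qbinom (fps_X ^ m) (N + N) k)"
    and e: "\<And>d. e d \<ge> \<bar>d\<bar> - 1" "\<And>d. e d \<ge> 0"
  shows "A * qpoch 1 m m = lat w e"
proof (rule eqm_ext)
  fix K
  obtain M where M: "eqm K (B N) A" if "N \<ge> M" for N using lim by blast
  \<comment> \<open>Large enough that an index k within K of either end of the range has |k - N| >
    K, so that its monomial has exponent at least K.\<close>
  define N where "N = M + 2 * K + 2"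
  let ?E = "qpoch 1 m m :: rat fps"
  let ?t = "\<lambda>d. fps_const (w d) * fps_X ^ nat (e d) :: rat fps"
  have "eqm K (A * ?E) (B N * ?E)"
    by (intro eqm_mult eqm_sym[OF M]) (auto simp: N_def)
  also have "B N * ?E = (\<Sum>k\<le>N + N. ?t (int k - int N) * (qbinom (fps_X ^ m) (N + N) k * ?E))"
    by (simp only: fin sum_distrib_right mult.assoc)
  also have "eqm K \<dots> (\<Sum>k\<le>N + N. ?t (int k - int N))"
  proof (rule eqm_sum)
    fix k assume k: "k \<in> {..N + N}"
    show "eqm K (?t (int k - int N) * (qbinom (fps_X ^ m) (N + N) k * ?E)) (?t (int k - int N))"
    proof (cases "K \<le> k \<and> k + K \<le> N + N")
      case True
      then have "eqm K (?t (int k - int N) * (qbinom (fps_X ^ m) (N + N) k * ?E)) (?t (int k - int N) * 1)"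
        by (intro eqm_mult eqm_refl eqm_qbinom_euler m) auto
      then show ?thesis by simp
    next
      case False
      then have "\<bar>int k - int N\<bar> \<ge> int K + 1" using k unfolding N_def by auto
      then have le: "K \<le> nat (e (int k - int N))" using e(1)[of "int k - int N"] by linarith
      have "eqm K (fps_X ^ nat (e (int k - int N)) * F) 0" for F :: "rat fps"
        by (rule eqm_X_power_mult[OF le])
      from this[of "fps_const (w (int k - int N)) * (qbinom (fps_X ^ m) (N + N) k * ?E)"]
        this[of "fps_const (w (int k - int N))"]
      show ?thesis by (auto simp: eqm_def mult_ac)
    qed
  qed
  also have "(\<Sum>k\<le>N + N. ?t (int k - int N)) = (\<Sum>d\<in>{- int N..int N}. ?t d)"
    by (rule sum.reindex_bij_witness[where i = "\<lambda>d. nat (d + int N)" and j = "\<lambda>k. int k - int N"]) auto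
  also have "eqm K \<dots> (lat w e)"
    unfolding eqm_def
  proof (intro allI impI)
    fix n assume n: "n < K"
    have "fps_nth (\<Sum>d\<in>{- int N..int N}. ?t d) n = (\<Sum>d\<in>{- int N..int N}. if e d = int n then w d else 0)"
      unfolding fps_sum_nth by (rule sum.cong[OF refl]) (use e(2) in \<open>auto simp: fps_X_power_nth nat_eq_iff\<close>)
    also have "\<dots> = (\<Sum>d\<in>{d\<in>{- int N..int N}. e d = int n}. w d)"
      by (simp add: sum.If_cases Int_def)
    also have "{d\<in>{- int N..int N}. e d = int n} = {d. e d = int n}"
    proof safe
      fix d assume "e d = int n"
      then have "\<bar>d\<bar> \<le> int n + 1" using e(1)[of d] by linarith
      then show "d \<in> {- int N..int N}" using n by (auto simp: N_def)
    qed
    finally show "fps_nth (\<Sum>d\<in>{- int N..int N}. ?t d) n = fps_nth (lat w e) n"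
      by (simp add: lat_nth)
  qed
  finally show "eqm K (A * ?E) (lat w e)" .
qed

lemma triple_exponent:
  fixes d m j :: int
  assumes "0 < j" "j < m"
  shows "m * (d * (d - 1) div 2) + j * d \<ge> \<bar>d\<bar> - 1" "m * (d * (d - 1) div 2) + j * d \<ge> 0"
proof -
  have ev: "2 * (d * (d - 1) div 2) = d * (d - 1)"
    by (rule dvd_mult_div_cancel) (cases "even d"; simp)
  define T where "T = d * (d - 1) div 2"
  have T: "2 * T = d * (d - 1)" using ev by (simp add: T_def)
  have "m * T + j * d \<ge> \<bar>d\<bar>"
  proof (cases "d \<ge> 0")
    case True
    have "d * (d - 1) \<ge> 0" using True by (cases "d = 0") (auto simp: zero_le_mult_iff)
    then have "T \<ge> 0" using T by simp
    then have "m * T \<ge> 0" using assms by simp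
    moreover have "j * d \<ge> 1 * d" using assms True by (intro mult_right_mono) auto
    ultimately show ?thesis using True by simp
  next
    case False
    have "d * (d - 1) \<ge> -2 * d" using False mult_right_mono_neg[of "d - 1" "-2" d] by (simp add: mult.commute)
    then have "T \<ge> - d" using T by simp
    then have "m * T \<ge> m * (- d)" using assms by (intro mult_left_mono) auto
    moreover have "(m - j) * (- d) \<ge> 1 * (- d)" using assms False by (intro mult_right_mono) auto
    ultimately show ?thesis using False by (simp add: algebra_simps)
  qed
  then show "m * (d * (d - 1) div 2) + j * d \<ge> \<bar>d\<bar> - 1" "m * (d * (d - 1) div 2) + j * d \<ge> 0"
    unfolding T_def by linarith+
qed

text \<open>This is \<open>finite_triple_product\<close> at z = s * X ^ j and q = X ^ m. As s is its
  own inverse, each z - q ^ (i + 1) is z times a factor of the second product, and the resulting z ^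
  N cancels.\<close>

theorem triple_product:
  fixes s :: rat
  assumes s: "s ^ 2 = 1" and j: "0 < j" "j < m"
  shows "qpoch s j m * qpoch s (m - j) m * qpoch 1 m m =
    lat (\<lambda>d. (- s) ^ nat \<bar>d\<bar>) (\<lambda>d. int m * (d * (d - 1) div 2) + int j * d)"
proof (rule theta_limit)
  show "m > 0" using j by simp
  show "\<bar>d\<bar> - 1 \<le> int m * (d * (d - 1) div 2) + int j * d" for d
    by (rule triple_exponent) (use j in auto)
  show nn: "0 \<le> int m * (d * (d - 1) div 2) + int j * d" for d
    by (rule triple_exponent) (use j in auto)
  define B where "B = (\<lambda>N. (\<Prod>i<N. 1 - fps_const s * fps_X ^ (m * i + j)) *
     (\<Prod>i<N. 1 - fps_const s * fps_X ^ (m * i + (m - j)) :: rat fps))"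
  show "\<exists>M. \<forall>N\<ge>M. eqm K (B N) (qpoch s j m * qpoch s (m - j) m)" for K
    unfolding B_def by (intro exI[of _ K] allI impI eqm_mult eqm_sym[OF eqm_qpoch]) (use j in auto)
  have ss: "s * s = 1" using s by (simp add: power2_eq_square)
  fix N
  define z :: "rat fps" where "z = fps_const s * fps_X ^ j"
  define q :: "rat fps" where "q = fps_X ^ m"
  have z0: "z \<noteq> 0" using ss by (auto simp: z_def)
  have p1: "(\<Prod>i<N. 1 - z * q ^ i) = (\<Prod>i<N. 1 - fps_const s * fps_X ^ (m * i + j))"
    by (rule prod.cong[OF refl]) (simp add: z_def q_def power_mult[symmetric] power_add mult_ac)
  have "(\<Prod>i<N. z - q ^ Suc i) = (\<Prod>i<N. z * (1 - fps_const s * fps_X ^ (m * i + (m - j))))"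
  proof (rule prod.cong[OF refl])
    fix i
    have "z * (fps_const s * fps_X ^ (m * i + (m - j))) = (fps_const s * fps_const s) * (fps_X ^ j * fps_X ^ (m * i + (m - j)))"
      by (simp only: z_def mult_ac)
    also have "\<dots> = fps_X ^ (j + (m * i + (m - j)))" using ss by (simp add: power_add)
    also have "j + (m * i + (m - j)) = m * Suc i" using j by simp
    finally show "z - q ^ Suc i = z * (1 - fps_const s * fps_X ^ (m * i + (m - j)))"
      by (simp only: right_diff_distrib mult_1_right q_def power_mult)
  qed
  also have "\<dots> = z ^ N * (\<Prod>i<N. 1 - fps_const s * fps_X ^ (m * i + (m - j)))"
    by (simp add: prod.distrib)
  finally have p2: "(\<Prod>i<N. z - q ^ Suc i) = \<dots>" .
  have "z ^ N * B N = (\<Sum>k\<le>N + N. (- 1) ^ (k + N) * q ^ tri k N * qbinom q (N + N) k * z ^ k)"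
    unfolding finite_triple_product[symmetric] p1 p2 B_def by (simp add: mult_ac)
  also have "\<dots> = (\<Sum>k\<le>N + N. z ^ N * (fps_const ((- s) ^ nat \<bar>int k - int N\<bar>) *
      fps_X ^ nat (int m * ((int k - int N) * (int k - int N - 1) div 2) + int j * (int k - int N)) *
      qbinom q (N + N) k))"
  proof (rule sum.cong[OF refl])
    fix k
    define d where "d = int k - int N"
    let ?e = "int m * (d * (d - 1) div 2) + int j * d"
    have "int (m * tri k N + j * k) = int (j * N + nat ?e)"
      using nn[of d] by (simp add: int_tri d_def algebra_simps)
    then have ex: "m * tri k N + j * k = j * N + nat ?e" by (simp only: of_nat_eq_iff)
    have sg: "(- 1) ^ (k + N) * s ^ k = s ^ N * (- s) ^ nat \<bar>d\<bar>"
    proof (cases "N \<le> k")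
      case True
      then obtain l where l: "k = N + l" using le_Suc_ex by blast
      have "nat \<bar>d\<bar> = l" by (simp add: d_def l)
      moreover have "(- s) ^ l = (- 1) ^ l * s ^ l" by (metis mult_minus1 power_mult_distrib)
      moreover have "(- 1 :: rat) ^ (N + l + N) = (- 1) ^ l"
        by (metis add.commute add.left_commute mult_2 power_add power_even_eq power_one_over power_mult minus_one_power_iff even_add)
      ultimately show ?thesis by (simp add: l power_add)
    next
      case False
      then obtain l where l: "N = k + l" using le_Suc_ex nat_le_linear by blast
      have "nat \<bar>d\<bar> = l" by (simp add: d_def l)
      moreover have "(- s) ^ l = (- 1) ^ l * s ^ l" by (metis mult_minus1 power_mult_distrib)
      moreover have "(- 1 :: rat) ^ (k + (k + l)) = (- 1) ^ l" by (simp add: power_add)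
      moreover have "s ^ l * s ^ l = 1" using ss by (simp add: power_mult_distrib[symmetric])
      ultimately show ?thesis by (simp add: l power_add)
    qed
    have "(- 1) ^ (k + N) * q ^ tri k N * qbinom q (N + N) k * z ^ k =
       fps_const ((- 1) ^ (k + N) * s ^ k) * fps_X ^ (m * tri k N + j * k) * qbinom q (N + N) k"
    proof -
      have 1: "(- 1 :: rat fps) ^ n = fps_const ((- 1) ^ n)" for n by (cases "even n") auto
      have 2: "z ^ k = fps_const (s ^ k) * fps_X ^ (j * k)"
        by (simp add: z_def power_mult_distrib power_mult fps_const_power)
      have 3: "q ^ tri k N = fps_X ^ (m * tri k N)" by (simp add: q_def power_mult)
      show ?thesis by (simp only: 1 2 3 power_add[of fps_X] fps_const_mult[symmetric] mult_ac)
    qed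
    also have "\<dots> = z ^ N * (fps_const ((- s) ^ nat \<bar>d\<bar>) * fps_X ^ nat ?e * qbinom q (N + N) k)"
    proof -
      have "z ^ N = fps_const (s ^ N) * fps_X ^ (j * N)"
        by (simp add: z_def power_mult_distrib power_mult fps_const_power)
      then show ?thesis unfolding sg ex by (simp only: power_add[of fps_X] fps_const_mult[symmetric] mult_ac)
    qed
    finally show "(- 1) ^ (k + N) * q ^ tri k N * qbinom q (N + N) k * z ^ k =
      z ^ N * (fps_const ((- s) ^ nat \<bar>int k - int N\<bar>) *
      fps_X ^ nat (int m * ((int k - int N) * (int k - int N - 1) div 2) + int j * (int k - int N)) *
      qbinom q (N + N) k)" by (simp only: d_def)
  qed
  finally show "B N = (\<Sum>k\<le>N + N. fps_const ((- s) ^ nat \<bar>int k - int N\<bar>) *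
      fps_X ^ nat (int m * ((int k - int N) * (int k - int N - 1) div 2) + int j * (int k - int N)) *
      qbinom (fps_X ^ m) (N + N) k)"
    using z0 by (simp add: sum_distrib_left[symmetric] q_def)
qed

text \<open>The finite triple product is differentiated with respect to z at z = 1. Its factor 1 - z
  vanishes there, so only minus the remaining product survives, which tends to the square of the
  Euler product; \<open>theta_limit\<close> supplies the third factor. For this z is a polynomial
  variable over the power series.\<close>

theorem jacobi_cube:
  "qpoch (1::rat) 1 1 ^ 3 = lat (\<lambda>d. - ((- 1) ^ nat \<bar>d\<bar> * of_int d)) (\<lambda>d. d * (d - 1) div 2)"
proof -
  let ?E = "qpoch 1 1 1 :: rat fps"
  define B where "B = (\<lambda>N. (\<Prod>i<N - 1. 1 - (fps_X :: rat fps) ^ Suc i) * (\<Prod>i<N. 1 - fps_X ^ Suc i))"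
  have ev: "2 * (d * (d - 1) div 2) = d * (d - 1)" for d :: int
    by (rule dvd_mult_div_cancel) (cases "even d"; simp)
  have "?E * ?E * ?E = lat (\<lambda>d. - ((- 1) ^ nat \<bar>d\<bar> * of_int d)) (\<lambda>d. d * (d - 1) div 2)"
  proof (rule theta_limit)
    \<comment> \<open>At N = 0 there is no factor 1 - z to split off and the sum is 0, hence the
      value 0 in place of \<open>B 0\<close>.\<close>
    show "\<exists>M. \<forall>N\<ge>M. eqm K (if N = 0 then 0 else B N) (?E * ?E)" for K
    proof (rule exI[of _ "Suc K"], intro allI impI)
      fix N assume N: "N \<ge> Suc K"
      have "eqm K (B N) (?E * ?E)"
        using eqm_mult[OF eqm_sym[OF eqm_qpoch[of 1 K "N - 1" "1::rat" 1]] eqm_sym[OF eqm_qpoch[of 1 K N "1::rat" 1]]] N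
        by (simp add: B_def)
      with N show "eqm K (if N = 0 then 0 else B N) (?E * ?E)" by simp
    qed
    fix d :: int
    have "d * (d - 1) \<ge> 2 * (\<bar>d\<bar> - 1)" 
    proof (cases "d \<ge> 1")
      case True
      have "(d - 1) * (d - 2) \<ge> 0" using True by (cases "d = 1") auto
      then show ?thesis using True by (simp add: algebra_simps)
    next
      case False
      have "d * (d + 1) \<ge> 0" using False by (cases "d = 0") (auto simp: zero_le_mult_iff)
      then show ?thesis using False by (simp add: algebra_simps)
    qed
    moreover obtain t where t: "d * (d - 1) div 2 = t" "2 * t = d * (d - 1)" using ev by blast
    ultimately have "2 * (\<bar>d\<bar> - 1) \<le> 2 * t" by simp
    then show "\<bar>d\<bar> - 1 \<le> d * (d - 1) div 2" unfolding t(1) by simp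
    have "d * (d - 1) \<ge> 0" by (cases "d \<ge> 1") (auto simp: zero_le_mult_iff)
    then show "0 \<le> d * (d - 1) div 2" using t by simp
  next
    fix N
    show "(if N = 0 then 0 else B N) = (\<Sum>k\<le>N + N. fps_const (- ((- 1) ^ nat \<bar>int k - int N\<bar> * of_int (int k - int N))) *
       fps_X ^ nat ((int k - int N) * (int k - int N - 1) div 2) * qbinom (fps_X ^ 1 :: rat fps) (N + N) k)"
    proof (cases "N = 0")
      case True
      then show ?thesis by simp
    next
      case False
      define c where "c = (\<lambda>k. (- 1) ^ (k + N) * fps_X ^ tri k N * qbinom (fps_X :: rat fps) (N + N) k)"
      define z :: "rat fps poly" where "z = [:0, 1:]"
      define P where "P = (\<Prod>i<N - 1. 1 - z * [:fps_X:] ^ Suc i) * (\<Prod>i<N. z - [:fps_X:] ^ Suc i)"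
      have pc: "[:a:] ^ n = [:a ^ n:]" for a :: "rat fps" and n
        by (induction n) (auto simp: mult.commute)
      have "(1 - z) * P = (\<Prod>i<N. 1 - z * [:fps_X:] ^ i) * (\<Prod>i<N. z - [:fps_X:] ^ Suc i)"
        using False unfolding P_def by (cases N) (auto simp: prod.lessThan_Suc_shift mult.assoc simp del: prod.lessThan_Suc)
      also have "\<dots> = (\<Sum>k\<le>N + N. (- 1) ^ (k + N) * [:fps_X:] ^ tri k N * qbinom [:fps_X:] (N + N) k * z ^ k)"
        by (rule finite_triple_product)
      also have "\<dots> = (\<Sum>k\<le>N + N. Polynomial.smult (c k) (z ^ k))"
      proof (rule sum.cong[OF refl])
        fix k
        have qb: "qbinom [:q:] n l = [:qbinom q n l:]" for q :: "rat fps" and n l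
          by (induction q n l rule: qbinom.induct) (auto simp: pc one_pCons)
        have "(- 1 :: rat fps poly) ^ (k + N) = [:(- 1) ^ (k + N):]"
          using pc[of "- 1" "k + N"] by (simp add: one_pCons)
        then show "(- 1) ^ (k + N) * [:fps_X:] ^ tri k N * qbinom [:fps_X:] (N + N) k * z ^ k = Polynomial.smult (c k) (z ^ k)"
          by (simp add: pc qb c_def mult_ac)
      qed
      finally have main: "(1 - z) * P = (\<Sum>k\<le>N + N. Polynomial.smult (c k) (z ^ k))" .
      have pz: "poly z 1 = 1" "poly (pderiv z) 1 = 1" by (simp_all add: z_def pderiv_pCons)
      have dz: "poly (pderiv (z ^ k)) 1 = of_nat k" for k
        by (induction k) (simp_all add: pderiv_mult pz)
      have sum0: "(\<Sum>k\<le>N + N. c k) = 0"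
        using arg_cong[OF main, of "\<lambda>p. poly p 1"] by (simp add: poly_sum pz)
      have "poly (pderiv ((1 - z) * P)) 1 = - poly P 1"
        by (simp add: pderiv_mult pderiv_diff pz pderiv_1)
      moreover have "poly (pderiv (\<Sum>k\<le>N + N. Polynomial.smult (c k) (z ^ k))) 1 = (\<Sum>k\<le>N + N. c k * of_nat k)"
        by (simp add: higher_pderiv_sum[of 1, simplified] poly_sum pderiv_smult dz)
      ultimately have "poly P 1 = - (\<Sum>k\<le>N + N. c k * of_nat k)" using main by simp
      \<comment> \<open>The coefficients sum to 0, so the weight k may be recentred to k -
        N.\<close>
      also have "\<dots> = - (\<Sum>k\<le>N + N. c k * of_nat k) + of_nat N * (\<Sum>k\<le>N + N. c k)"
        by (simp add: sum0)
      also have "\<dots> = (\<Sum>k\<le>N + N. - (c k * (of_nat k - of_nat N)))"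
        by (simp add: sum_negf[symmetric] sum_distrib_left sum.distrib[symmetric] algebra_simps)
      also have "poly P 1 = B N"
        by (simp add: P_def B_def poly_mult poly_prod pz pc mult.commute)
      also have "(\<Sum>k\<le>N + N. - (c k * (of_nat k - of_nat N))) =
        (\<Sum>k\<le>N + N. fps_const (- ((- 1) ^ nat \<bar>int k - int N\<bar> * of_int (int k - int N))) *
         fps_X ^ nat ((int k - int N) * (int k - int N - 1) div 2) * qbinom (fps_X ^ 1 :: rat fps) (N + N) k)"
      proof (rule sum.cong[OF refl])
        fix k
        have "even (k + N) \<longleftrightarrow> even (nat \<bar>int k - int N\<bar>)" by (simp add: even_nat_iff)
        then have "(- 1 :: rat fps) ^ (k + N) = fps_const ((- 1) ^ nat \<bar>int k - int N\<bar>)"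
          by (cases "even (k + N)") auto
        moreover have "(of_nat k - of_nat N :: rat fps) = fps_const (of_int (int k - int N))"
          by (simp add: fps_of_nat[symmetric])
        moreover have "tri k N = nat ((int k - int N) * (int k - int N - 1) div 2)" by (simp add: tri_def)
        ultimately show "- (c k * (of_nat k - of_nat N)) = fps_const (- ((- 1) ^ nat \<bar>int k - int N\<bar> * of_int (int k - int N))) *
         fps_X ^ nat ((int k - int N) * (int k - int N - 1) div 2) * qbinom (fps_X ^ 1 :: rat fps) (N + N) k"
          unfolding c_def by (simp only: fps_const_neg[symmetric] fps_const_mult[symmetric] power_one_right mult_ac mult_minus_left mult_minus_right)
      qed
      finally show ?thesis using False by simp
    qed
  qed auto
  then show ?thesis by (simp add: power3_eq_cube)
qed

section \<open>Theta functions as eta quotients\<close>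

text \<open>The eta function at k * z without its factor q ^ (k / 24); written E(q^k) in the
  comments below.\<close>

definition ep :: "nat \<Rightarrow> rat fps" where
  "ep k = qpoch 1 k k"

lemma ep_nth_0 [simp]: "k > 0 \<Longrightarrow> fps_nth (ep k) 0 = 1"
  by (simp add: ep_def qpoch_nth_0)

lemma ep_neq_0 [simp]: "k > 0 \<Longrightarrow> ep k \<noteq> 0"
  using ep_nth_0[of k] by (metis fps_zero_nth zero_neq_one)

lemma ep_compose [simp]: "j > 0 \<Longrightarrow> k > 0 \<Longrightarrow> fps_compose (ep k) (fps_X ^ j) = ep (j * k)"
  by (simp add: ep_def qpoch_compose)

definition sg :: "int \<Rightarrow> rat" where
  "sg d = (if even d then 1 else - 1)"

lemma sg_add: "sg (a + b) = sg a * sg b" and sg_minus [simp]: "sg (- a) = sg a"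
  and sg_diff: "sg (a - b) = sg a * sg b" and sg_sq [simp]: "sg a * sg a = 1"
  by (auto simp: sg_def)

lemma sg_numeral_simps [simp]: "sg 0 = 1" "sg 1 = - 1" "sg 2 = 1" "sg 3 = - 1"
  "sg (2 * a) = 1" "sg (3 * a) = sg a" "sg (a * 2) = 1" "sg (a * 3) = sg a"
  by (auto simp: sg_def)

lemma minus_one_power_nat_abs: "(- 1 :: rat) ^ nat \<bar>d\<bar> = sg d"
  by (simp add: sg_def minus_one_power_iff even_nat_iff)

text \<open>In Ramanujan's notation these six series are \<phi>(q), \<phi>(- q), \<psi>(q), f(q,
  q^2), f(q, q^5) and f(- q, - q^5). The exponents 2 n^2 + n give each triangular number once,
  whereas d (d - 1) / 2 over all integers d gives each of them twice
  (\<open>psi_double\<close>).\<close>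

definition phi :: "rat fps" where "phi = lat (\<lambda>n. 1) (\<lambda>n::int. n ^ 2)"
definition phim :: "rat fps" where "phim = lat sg (\<lambda>n. n ^ 2)"
definition psi :: "rat fps" where "psi = lat (\<lambda>n. 1) (\<lambda>n::int. 2 * n ^ 2 + n)"
definition f12 :: "rat fps" where "f12 = lat (\<lambda>n. 1) (\<lambda>n::int. n * (3 * n + 1) div 2)"
definition f15 :: "rat fps" where "f15 = lat (\<lambda>n. 1) (\<lambda>n::int. 3 * n ^ 2 + 2 * n)"
definition f15m :: "rat fps" where "f15m = lat sg (\<lambda>n::int. 3 * n ^ 2 + 2 * n)"

lemma pronic_half: "2 * (d * (d - 1) div 2) = d * (d - 1)" for d :: int
  by (rule dvd_mult_div_cancel) (cases "even d"; simp)

lemma div2_eqI: "2 * y = x \<Longrightarrow> x div 2 = y" for x y :: int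
  by auto

lemma tri_eqI:
  fixes m n j x :: int
  assumes "m * (n * (n - 1)) + 2 * j * n = 2 * x"
  shows "m * (n * (n - 1) div 2) + j * n = x"
proof -
  define t where "t = n * (n - 1) div 2"
  have t: "n * (n - 1) = 2 * t" unfolding t_def by (rule pronic_half[symmetric])
  show ?thesis using assms unfolding t_def[symmetric] t by simp
qed

lemma pent_half: "2 * (n * (3 * n + 1) div 2) = n * (3 * n + 1)"
  and pent_half': "2 * (n * (3 * n - 1) div 2) = n * (3 * n - 1)" for n :: int
  by (rule dvd_mult_div_cancel, cases "even n"; simp)+

lemma lessThan_2_3: "(\<Prod>r<2. f r) = f 0 * f (1::nat)" "(\<Prod>r<3. f r) = f 0 * f 1 * f (2::nat)"
    "(\<Sum>r<2. h r) = h 0 + h (1::nat)" "(\<Sum>r<3. h r) = h 0 + h 1 + h (2::nat)"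
  for f :: "nat \<Rightarrow> 'a::comm_monoid_mult" and h :: "nat \<Rightarrow> 'b::comm_monoid_add"
  by (simp_all add: eval_nat_numeral)

lemma admis_triple: "0 < j \<Longrightarrow> j < m \<Longrightarrow> admis (\<lambda>d. m * (d * (d - 1) div 2) + j * d)"
  by (rule admisI; rule triple_exponent)

lemma admis_square [simp]: "admis (\<lambda>n::int. n ^ 2)"
proof -
  have "(\<lambda>n::int. n ^ 2) = (\<lambda>d. 2 * (d * (d - 1) div 2) + 1 * d)"
    by (intro ext tri_eqI[symmetric]) (simp add: power2_eq_square algebra_simps)
  then show ?thesis using admis_triple[of 1 2] by simp
qed

lemma admis_psi [simp]: "admis (\<lambda>n::int. 2 * n ^ 2 + n)"
proof -
  have ex: "2 * n ^ 2 + n = 4 * (n * (n - 1) div 2) + 3 * n" for n :: int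
    by (rule tri_eqI[symmetric]) (simp add: power2_eq_square algebra_simps)
  show ?thesis unfolding ex by (rule admis_triple) auto
qed

lemma admis_f12 [simp]: "admis (\<lambda>n::int. n * (3 * n + 1) div 2)"
proof -
  have "n * (3 * n + 1) div 2 = 3 * (n * (n - 1) div 2) + 2 * n" for n :: int
    by (rule tri_eqI[symmetric]) (simp only: pent_half pent_half', simp add: algebra_simps)
  then show ?thesis using admis_triple[of 2 3] by simp
qed

lemma admis_euler [simp]: "admis (\<lambda>n::int. n * (3 * n - 1) div 2)"
proof -
  have "n * (3 * n - 1) div 2 = 3 * (n * (n - 1) div 2) + 1 * n" for n :: int
    by (rule tri_eqI[symmetric]) (simp only: pent_half pent_half', simp add: algebra_simps)
  then show ?thesis using admis_triple[of 1 3] by simp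
qed

lemma admis_f15 [simp]: "admis (\<lambda>n::int. 3 * n ^ 2 + 2 * n)"
proof -
  have ex: "3 * n ^ 2 + 2 * n = 6 * (n * (n - 1) div 2) + 5 * n" for n :: int
    by (rule tri_eqI[symmetric]) (simp add: power2_eq_square algebra_simps)
  show ?thesis unfolding ex by (rule admis_triple) auto
qed

lemma admis_tri [simp]: "admis (\<lambda>d::int. d * (d - 1) div 2)"
proof (rule admisI)
  fix d :: int
  have "d * (d - 1) \<ge> 2 * (\<bar>d\<bar> - 1)" 
  proof (cases "d \<ge> 1")
    case True
    have "(d - 1) * (d - 2) \<ge> 0" using True by (cases "d = 1") auto
    then show ?thesis using True by (simp add: algebra_simps)
  next
    case False
    have "d * (d + 1) \<ge> 0" using False by (cases "d = 0") (auto simp: zero_le_mult_iff)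
    then show ?thesis using False by (simp add: algebra_simps)
  qed
  then have "2 * (\<bar>d\<bar> - 1) \<le> 2 * (d * (d - 1) div 2)" unfolding pronic_half .
  then show "\<bar>d\<bar> - 1 \<le> d * (d - 1) div 2" by simp
  have "d * (d - 1) \<ge> 0" by (cases "d \<ge> 1") (auto simp: zero_le_mult_iff)
  then show "0 \<le> d * (d - 1) div 2" by simp
qed

lemma ep_odd: "ep 1 = qpoch 1 1 2 * ep 2"
  using qpoch_split[of 1 2 "1::rat" 1] by (simp add: ep_def lessThan_2_3 numeral_2_eq_2[symmetric])

lemma ep_third: "ep 1 = qpoch 1 1 3 * qpoch 1 2 3 * ep 3"
  using qpoch_split[of 1 3 "1::rat" 1] by (simp add: ep_def lessThan_2_3 numeral_2_eq_2[symmetric])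

lemma phim_ep: "phim * ep 2 = ep 1 ^ 2"
proof -
  have square: "2 * (n * (n - 1) div 2) + n = n ^ 2" for n :: int
    using tri_eqI[of 2 n 1 "n ^ 2"] by (simp add: power2_eq_square algebra_simps)
  have square': "n * (n - 1) + n = n ^ 2" for n :: int
    by (simp add: power2_eq_square algebra_simps)
  have "qpoch 1 1 2 * qpoch 1 1 2 * ep 2 = phim"
    using triple_product[of 1 1 2] by (simp add: ep_def phim_def minus_one_power_nat_abs square square')
  then show ?thesis by (simp only: ep_odd power2_eq_square mult_ac flip: \<open>_ = phim\<close>)
qed

text \<open>Since (1 - x) (1 + x) = 1 - x^2, the product of all 1 + q ^ (2 i + 1) is expressed
  through Euler products. The relations with eta quotients are all stated in this multiplied-out
  form.\<close>

lemma qpoch_minus_odd: "qpoch (- 1) 1 2 * ep 1 * ep 4 = ep 2 ^ 2"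
proof -
  have "qpoch 1 1 2 * qpoch (- 1) 1 2 = qpoch (1::rat) 2 4"
    using qpoch_mult_minus[of 2 "1::rat" 1] by simp
  moreover have "qpoch 1 2 4 * ep 4 = ep 2"
    using qpoch_split[of 2 2 "1::rat" 2] by (simp add: ep_def lessThan_2_3 numeral_2_eq_2[symmetric])
  moreover have "qpoch (- 1) 1 2 * ep 1 * ep 4 = (qpoch 1 1 2 * qpoch (- 1) 1 2) * ep 4 * ep 2"
    by (simp only: ep_odd mult_ac)
  ultimately show ?thesis by (simp add: power2_eq_square)
qed

lemma phi_ep: "phi * ep 1 ^ 2 * ep 4 ^ 2 = ep 2 ^ 5"
proof -
  have square: "2 * (n * (n - 1) div 2) + n = n ^ 2" for n :: int
    using tri_eqI[of 2 n 1 "n ^ 2"] by (simp add: power2_eq_square algebra_simps)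
  have square': "n * (n - 1) + n = n ^ 2" for n :: int
    by (simp add: power2_eq_square algebra_simps)
  have "qpoch (- 1) 1 2 * qpoch (- 1) 1 2 * ep 2 = phi"
    using triple_product[of "- 1" 1 2] by (simp add: ep_def phi_def square square')
  then have "phi * ep 1 ^ 2 * ep 4 ^ 2 = (qpoch (- 1) 1 2 * ep 1 * ep 4) ^ 2 * ep 2"
    by (simp only: power2_eq_square mult_ac flip: \<open>_ = phi\<close>)
  also have "\<dots> = (ep 2 ^ 2) ^ 2 * ep 2" unfolding qpoch_minus_odd ..
  also have "\<dots> = ep 2 ^ 5"
  proof -
    have "(x ^ 2) ^ 2 * x = x ^ 5" for x :: "rat fps" by (simp add: eval_nat_numeral mult_ac)
    then show ?thesis .
  qed
  finally show ?thesis .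
qed

lemma psi_ep: "psi * ep 1 = ep 2 ^ 2"
proof -
  have ex: "4 * (n * (n - 1) div 2) + 3 * n = 2 * n ^ 2 + n" for n :: int
    by (rule tri_eqI) (simp add: power2_eq_square algebra_simps)
  have "qpoch (- 1) 3 4 * qpoch (- 1) 1 4 * ep 4 = psi"
    using triple_product[of "- 1" 3 4] by (simp add: ep_def psi_def ex)
  moreover have "qpoch (- 1 :: rat) 1 2 = qpoch (- 1) 1 4 * qpoch (- 1) 3 4"
    using qpoch_split[of 2 2 "- 1 :: rat" 1] by (simp add: lessThan_2_3 numeral_2_eq_2[symmetric])
  ultimately have "psi * ep 1 = qpoch (- 1) 1 2 * ep 1 * ep 4"
    by (simp only: mult_ac flip: \<open>_ = psi\<close>)
  from trans[OF this qpoch_minus_odd] show ?thesis .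
qed

lemma f12_ep: "f12 * ep 1 * ep 6 = ep 2 * ep 3 ^ 2"
proof -
  have ex: "n * (3 * n + 1) div 2 = 3 * (n * (n - 1) div 2) + 2 * n" for n :: int
    by (rule tri_eqI[symmetric]) (simp only: pent_half pent_half', simp add: algebra_simps)
  have 1: "qpoch (- 1) 2 3 * qpoch (- 1) 1 3 * ep 3 = f12"
    using triple_product[of "- 1" 2 3] by (simp add: ep_def f12_def ex)
  have 2: "qpoch 1 1 3 * qpoch (- 1) 1 3 = qpoch (1::rat) 2 6" "qpoch 1 2 3 * qpoch (- 1) 2 3 = qpoch (1::rat) 4 6"
    using qpoch_mult_minus[of 3 "1::rat" 1] qpoch_mult_minus[of 3 "1::rat" 2] by simp_all
  have 3: "ep 2 = qpoch 1 2 6 * qpoch 1 4 6 * ep 6"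
    using qpoch_split[of 2 3 "1::rat" 2] by (simp add: ep_def lessThan_2_3 numeral_2_eq_2[symmetric])
  have "f12 * ep 1 * ep 6 = (qpoch 1 1 3 * qpoch (- 1) 1 3) * (qpoch 1 2 3 * qpoch (- 1) 2 3) * ep 6 * ep 3 ^ 2"
    by (simp only: 1[symmetric] ep_third power2_eq_square mult_ac)
  then show ?thesis unfolding 2 3 by (simp add: mult_ac)
qed

lemma f15m_ep: "f15m * ep 2 * ep 3 = ep 1 * ep 6 ^ 2"
proof -
  have ex: "3 * n ^ 2 + 2 * n = 6 * (n * (n - 1) div 2) + 5 * n" for n :: int
    by (rule tri_eqI[symmetric]) (simp add: power2_eq_square algebra_simps)
  have 1: "qpoch 1 5 6 * qpoch 1 1 6 * ep 6 = f15m"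
    using triple_product[of 1 5 6] by (simp add: ep_def f15m_def ex minus_one_power_nat_abs)
  have 2: "qpoch (1::rat) 1 2 = qpoch 1 1 6 * qpoch 1 3 6 * qpoch 1 5 6"
    using qpoch_split[of 2 3 "1::rat" 1] by (simp add: lessThan_2_3 numeral_2_eq_2[symmetric])
  have 3: "ep 3 = qpoch 1 3 6 * ep 6"
    using qpoch_split[of 3 2 "1::rat" 3] by (simp add: ep_def lessThan_2_3 numeral_2_eq_2[symmetric])
  show ?thesis unfolding 3 ep_odd by (simp only: 2 1[symmetric] power2_eq_square mult_ac)
qed

lemma euler_pentagonal: "ep 1 = lat sg (\<lambda>d. d * (3 * d - 1) div 2)"
proof -
  have ex: "n * (3 * n - 1) div 2 = 3 * (n * (n - 1) div 2) + 1 * n" for n :: int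
    by (rule tri_eqI[symmetric]) (simp only: pent_half pent_half', simp add: algebra_simps)
  show ?thesis unfolding ep_third
    using triple_product[of 1 1 3] by (simp add: ep_def ex minus_one_power_nat_abs)
qed

lemma jacobi_ep: "ep 1 ^ 3 = lat (\<lambda>d. - (sg d * of_int d)) (\<lambda>d. d * (d - 1) div 2)"
  using jacobi_cube by (simp add: ep_def minus_one_power_nat_abs)


section \<open>Dissections\<close>

lemma admis_inj:
  assumes "admis e" "inj f"
  shows "admis (\<lambda>k. e (f k))"
proof -
  have "finite {k. e (f k) \<le> n}" for n
    using finite_vimageI[of "{i. e i \<le> n}" f] assms by (simp add: admis_def vimage_def)
  then show ?thesis using assms(1) by (auto simp: admis_def)
qed

lemma lat_sum: "(\<Sum>i\<in>S. lat (w i) e) = lat (\<lambda>d. \<Sum>i\<in>S. w i d) e"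
  by (simp add: fps_eq_iff lat_nth fps_sum_nth sum.swap[of _ _ S])

lemma lat_split_mod:
  fixes e :: "int \<Rightarrow> int"
  assumes "m > 0" "admis e"
  shows "lat w e = (\<Sum>i<m. lat (\<lambda>k. w (int m * k + int i)) (\<lambda>k. e (int m * k + int i)))"
proof -
  define v where "v = (\<lambda>i d. if d mod int m = int i then w d else 0)"
  have "lat (v i) e = lat (\<lambda>k. w (int m * k + int i)) (\<lambda>k. e (int m * k + int i))" if "i < m" for i
  proof -
    have "lat (v i) e = lat (\<lambda>k. v i (int m * k + int i)) (\<lambda>k. e (int m * k + int i))"
    proof (rule lat_reindex)
      show "inj (\<lambda>k. int m * k + int i)" using assms by (auto simp: inj_on_def)
      fix d assume "v i d \<noteq> 0"
      then have "d mod int m = int i" by (auto simp: v_def split: if_splits)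
      then have "d = int m * (d div int m) + int i" by (metis mult_div_mod_eq)
      then show "d \<in> range (\<lambda>k. int m * k + int i)" by blast
    qed (rule assms)
    moreover have "(int m * k + int i) mod int m = int i" for k using that by simp
    ultimately show ?thesis by (simp add: v_def)
  qed
  then have "(\<Sum>i<m. lat (\<lambda>k. w (int m * k + int i)) (\<lambda>k. e (int m * k + int i))) = (\<Sum>i<m. lat (v i) e)"
    by (intro sum.cong) auto
  also have "\<dots> = lat (\<lambda>d. \<Sum>i<m. v i d) e" by (rule lat_sum)
  also have "(\<lambda>d. \<Sum>i<m. v i d) = w"
  proof
    fix d
    have "(\<Sum>i<m. v i d) = (\<Sum>i\<in>{nat (d mod int m)}. v i d)"
    proof (rule sum.mono_neutral_right)
      have "nat (d mod int m) < m" using assms by (simp add: nat_less_iff)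
      then show "{nat (d mod int m)} \<subseteq> {..<m}" by simp
    qed (auto simp: v_def)
    also have "\<dots> = w d" using assms by (simp add: v_def)
    finally show "(\<Sum>i<m. v i d) = w d" .
  qed
  finally show ?thesis by simp
qed

lemma lat_shift_index: "admis e \<Longrightarrow> lat w e = lat (\<lambda>k. w (k + c)) (\<lambda>k. e (k + c))" for c :: int
  by (rule lat_reindex) (auto simp: inj_on_def intro: range_eqI[of _ _ "_ - c"])

lemma lat_reflect_index: "admis e \<Longrightarrow> lat w e = lat (\<lambda>k. w (c - k)) (\<lambda>k. e (c - k))" for c :: int
  by (rule lat_reindex) (auto simp: inj_on_def intro: range_eqI[of _ _ "c - _"])

lemma psi_double: "fps_const 2 * psi = lat (\<lambda>d. 1) (\<lambda>d::int. d * (d - 1) div 2)"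
proof -
  have "lat (\<lambda>d. 1) (\<lambda>d::int. d * (d - 1) div 2) =
     lat (\<lambda>k. 1) (\<lambda>k. (2 * k) * (2 * k - 1) div 2) + lat (\<lambda>k. 1) (\<lambda>k. (2 * k + 1) * (2 * k + 1 - 1) div 2)"
    using lat_split_mod[of 2 "\<lambda>d. d * (d - 1) div 2" "\<lambda>_. 1"] by (simp add: lessThan_2_3 numeral_2_eq_2[symmetric])
  also have "(\<lambda>k::int. (2 * k + 1) * (2 * k + 1 - 1) div 2) = (\<lambda>n. 2 * n ^ 2 + n)"
    by (intro ext div2_eqI) (simp add: power2_eq_square algebra_simps)
  also have "(\<lambda>k::int. (2 * k) * (2 * k - 1) div 2) = (\<lambda>k. 2 * (0 - k) ^ 2 + (0 - k))"
    by (intro ext div2_eqI) (simp add: power2_eq_square algebra_simps)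
  also have "lat (\<lambda>k. 1) (\<lambda>k::int. 2 * (0 - k) ^ 2 + (0 - k)) = psi"
    unfolding psi_def by (rule lat_reflect_index[symmetric]) simp
  finally show ?thesis by (simp add: psi_def[symmetric] flip: mult_2)
qed

text \<open>In the series for 2 \<psi>(q) the classes d = 0 and d = 1 mod 3 both give f(q^3, q^6),
  the first after a reflection of the index, and the class d = 2 gives 2 q \<psi>(q^9).\<close>

lemma psi_dissect3: "psi = fps_compose f12 (fps_X ^ 3) + fps_X * fps_compose psi (fps_X ^ 9)"
proof -
  have "fps_const 2 * psi = 
      lat (\<lambda>k. 1) (\<lambda>k. (3 * k) * (3 * k - 1) div 2) +
      lat (\<lambda>k. 1) (\<lambda>k. (3 * k + 1) * (3 * k + 1 - 1) div 2) + 
      lat (\<lambda>k. 1) (\<lambda>k. (3 * k + 2) * (3 * k + 2 - 1) div 2)"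
    unfolding psi_double
    using lat_split_mod[of 3 "\<lambda>d. d * (d - 1) div 2" "\<lambda>_. 1"] by (simp add: lessThan_2_3 numeral_2_eq_2[symmetric])
  also have "(\<lambda>k::int. (3 * k) * (3 * k - 1) div 2) = (\<lambda>k. 3 * ((0 - k) * (3 * (0 - k) + 1) div 2))"
  proof (rule ext, rule div2_eqI)
    fix k :: int
    have "2 * (3 * y) = 3 * k * (3 * k - 1)" if "2 * y = (0 - k) * (3 * (0 - k) + 1)" for y
      using that by (simp add: algebra_simps)
    then show "2 * (3 * ((0 - k) * (3 * (0 - k) + 1) div 2)) = 3 * k * (3 * k - 1)"
      using pent_half .
  qed
  also have "lat (\<lambda>k. 1) (\<lambda>k. 3 * ((0 - k) * (3 * (0 - k) + 1) div 2)) = lat (\<lambda>k. 1) (\<lambda>k::int. 3 * (k * (3 * k + 1) div 2))"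
    using lat_reflect_index[of "\<lambda>k. int 3 * (k * (3 * k + 1) div 2)" "\<lambda>_. 1" 0, OF admis_scale] by simp
  also have "\<dots> = fps_compose f12 (fps_X ^ 3)" unfolding f12_def by (subst lat_compose) auto
  also have "(\<lambda>k::int. (3 * k + 1) * (3 * k + 1 - 1) div 2) = (\<lambda>k. 3 * (k * (3 * k + 1) div 2))"
  proof (rule ext, rule div2_eqI)
    fix k :: int
    have "2 * (3 * y) = (3 * k + 1) * (3 * k + 1 - 1)" if "2 * y = k * (3 * k + 1)" for y
      using that by (simp add: algebra_simps)
    then show "2 * (3 * (k * (3 * k + 1) div 2)) = (3 * k + 1) * (3 * k + 1 - 1)"
      using pent_half .
  qed
  also have "lat (\<lambda>k. 1) (\<lambda>k::int. 3 * (k * (3 * k + 1) div 2)) = fps_compose f12 (fps_X ^ 3)"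
    unfolding f12_def by (subst lat_compose) auto
  also have "(\<lambda>k::int. (3 * k + 2) * (3 * k + 2 - 1) div 2) = (\<lambda>k. int 9 * ((k + 1) * (k + 1 - 1) div 2) + int 1)"
  proof (rule ext, rule div2_eqI)
    fix k :: int
    have "2 * (int 9 * y + int 1) = (3 * k + 2) * (3 * k + 2 - 1)" if "2 * y = (k + 1) * (k + 1 - 1)" for y
      using that by (simp add: algebra_simps)
    then show "2 * (int 9 * ((k + 1) * (k + 1 - 1) div 2) + int 1) = (3 * k + 2) * (3 * k + 2 - 1)"
      using pronic_half .
  qed
  also have "lat (\<lambda>k. 1) (\<lambda>k. int 9 * ((k + 1) * (k + 1 - 1) div 2) + int 1) =
     lat (\<lambda>k. 1) (\<lambda>k. int 9 * (k * (k - 1) div 2) + int 1)"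
    by (rule lat_shift_index[symmetric]) (intro admis_shift admis_scale; simp)
  also have "\<dots> = fps_X ^ 1 * fps_compose (fps_const 2 * psi) (fps_X ^ 9)"
    unfolding psi_double by (subst lat_compose, simp, rule lat_shift[symmetric], rule admis_scale) auto
  finally have "fps_const 2 * psi = fps_const 2 * (fps_compose f12 (fps_X ^ 3) + fps_X * fps_compose psi (fps_X ^ 9))"
    by (simp add: fps_compose_mult_distrib algebra_simps numeral_fps_const[symmetric])
  then show ?thesis by (rule mult_left_cancel[THEN iffD1, rotated]) simp
qed

lemma phim_dissect3: "phim = fps_compose phim (fps_X ^ 9) - 2 * fps_X * fps_compose f15m (fps_X ^ 3)"
proof -
  have "phim = lat (\<lambda>k. sg (3 * k)) (\<lambda>k. (3 * k) ^ 2) +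
      lat (\<lambda>k. sg (3 * k + 1)) (\<lambda>k. (3 * k + 1) ^ 2) + 
      lat (\<lambda>k. sg (3 * k + 2)) (\<lambda>k. (3 * k + 2) ^ 2)"
    unfolding phim_def
    using lat_split_mod[of 3 "\<lambda>d. d ^ 2" sg] by (simp add: lessThan_2_3 numeral_2_eq_2[symmetric])
  also have "lat (\<lambda>k. sg (3 * k)) (\<lambda>k. (3 * k) ^ 2) = fps_compose phim (fps_X ^ 9)"
    unfolding phim_def by (subst lat_compose) (auto intro!: lat_cong simp: power2_eq_square)
  also have "lat (\<lambda>k. sg (3 * k + 2)) (\<lambda>k. (3 * k + 2) ^ 2) = lat (\<lambda>k. sg (3 * (-1 - k) + 2)) (\<lambda>k. (3 * (-1 - k) + 2) ^ 2)"
  proof (rule lat_reflect_index)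
    show "admis (\<lambda>k::int. (3 * k + 2) ^ 2)"
      by (rule admis_inj[of "\<lambda>n. n ^ 2" "\<lambda>k. 3 * k + 2"]) (auto simp: inj_on_def)
  qed
  also have "\<dots> = lat (\<lambda>k. sg (3 * k + 1)) (\<lambda>k. (3 * k + 1) ^ 2)"
    by (rule lat_cong) (auto simp: sg_def power2_eq_square algebra_simps)
  also have "lat (\<lambda>k. sg (3 * k + 1)) (\<lambda>k. (3 * k + 1) ^ 2) = fps_const (- 1) * lat sg (\<lambda>k. int 3 * (3 * k ^ 2 + 2 * k) + int 1)"
    unfolding lat_cmult by (rule lat_cong) (auto simp: sg_add power2_eq_square algebra_simps)
  also have "lat sg (\<lambda>k. int 3 * (3 * k ^ 2 + 2 * k) + int 1) = fps_X ^ 1 * fps_compose f15m (fps_X ^ 3)"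
    unfolding f15m_def by (subst lat_compose, simp, rule lat_shift[symmetric], rule admis_scale) auto
  finally have "phim = fps_compose phim (fps_X ^ 9) +
      fps_const (- 1) * (fps_X ^ 1 * fps_compose f15m (fps_X ^ 3)) +
      fps_const (- 1) * (fps_X ^ 1 * fps_compose f15m (fps_X ^ 3))" .
  moreover have "fps_const (- 1 :: rat) = - 1" by simp
  ultimately show ?thesis by (simp add: algebra_simps)
qed

lemma phi_dissect2: "phi = fps_compose phi (fps_X ^ 4) + 2 * fps_X * fps_compose psi (fps_X ^ 8)"
  and phim_dissect2: "phim = fps_compose phi (fps_X ^ 4) - 2 * fps_X * fps_compose psi (fps_X ^ 8)"
proof -
  have even: "lat (\<lambda>k. 1) (\<lambda>k::int. (2 * k) ^ 2) = fps_compose phi (fps_X ^ 4)"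
    unfolding phi_def by (subst lat_compose) (auto intro!: lat_cong simp: power2_eq_square)
  have "lat (\<lambda>k. 1) (\<lambda>k::int. (2 * k + 1) ^ 2) = lat (\<lambda>k. 1) (\<lambda>k::int. int 8 * ((k + 1) * (k + 1 - 1) div 2) + int 1)"
  proof (rule lat_cong[OF refl])
    fix k :: int
    have "(2 * k + 1) ^ 2 = int 8 * y + int 1" if "2 * y = (k + 1) * (k + 1 - 1)" for y
      using that by (simp add: power2_eq_square algebra_simps)
    then show "(2 * k + 1) ^ 2 = int 8 * ((k + 1) * (k + 1 - 1) div 2) + int 1"
      using pronic_half .
  qed
  also have "\<dots> = lat (\<lambda>k. 1) (\<lambda>k. int 8 * (k * (k - 1) div 2) + int 1)"
    by (rule lat_shift_index[symmetric]) (intro admis_shift admis_scale; simp)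
  also have "\<dots> = fps_X ^ 1 * fps_compose (fps_const 2 * psi) (fps_X ^ 8)"
    unfolding psi_double by (subst lat_compose, simp, rule lat_shift[symmetric], rule admis_scale) auto
  also have "\<dots> = 2 * fps_X * fps_compose psi (fps_X ^ 8)"
    by (simp add: fps_compose_mult_distrib numeral_fps_const[symmetric] mult_ac)
  finally have odd: "lat (\<lambda>k. 1) (\<lambda>k::int. (2 * k + 1) ^ 2) = \<dots>" .
  have "phi = lat (\<lambda>k. 1) (\<lambda>k. (2 * k) ^ 2) + lat (\<lambda>k. 1) (\<lambda>k. (2 * k + 1) ^ 2)"
    unfolding phi_def using lat_split_mod[of 2 "\<lambda>d. d ^ 2" "\<lambda>_. 1"] by (simp add: lessThan_2_3)
  then show "phi = fps_compose phi (fps_X ^ 4) + 2 * fps_X * fps_compose psi (fps_X ^ 8)"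
    unfolding even odd .
  have "phim = lat (\<lambda>k. 1) (\<lambda>k. (2 * k) ^ 2) + lat (\<lambda>k. - 1 * 1) (\<lambda>k. (2 * k + 1) ^ 2)"
    unfolding phim_def using lat_split_mod[of 2 "\<lambda>d. d ^ 2" sg] by (simp add: lessThan_2_3 sg_add)
  then have "phim = fps_compose phi (fps_X ^ 4) + fps_const (- 1) * (2 * fps_X * fps_compose psi (fps_X ^ 8))"
    unfolding even lat_cmult[symmetric] odd .
  moreover have "fps_const (- 1 :: rat) = - 1" by simp
  ultimately show "phim = fps_compose phi (fps_X ^ 4) - 2 * fps_X * fps_compose psi (fps_X ^ 8)"
    by simp
qed

lemma phi_dissect3: "phi = fps_compose phi (fps_X ^ 9) + 2 * fps_X * fps_compose f15 (fps_X ^ 3)"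
proof -
  have "phi = lat (\<lambda>k. 1) (\<lambda>k. (3 * k) ^ 2) +
      lat (\<lambda>k. 1) (\<lambda>k. (3 * k + 1) ^ 2) + lat (\<lambda>k. 1) (\<lambda>k. (3 * k + 2) ^ 2)"
    unfolding phi_def
    using lat_split_mod[of 3 "\<lambda>d. d ^ 2" "\<lambda>_. 1"] by (simp add: lessThan_2_3 numeral_2_eq_2[symmetric])
  also have "lat (\<lambda>k. 1) (\<lambda>k::int. (3 * k) ^ 2) = fps_compose phi (fps_X ^ 9)"
    unfolding phi_def by (subst lat_compose) (auto intro!: lat_cong simp: power2_eq_square)
  also have "lat (\<lambda>k. 1) (\<lambda>k::int. (3 * k + 2) ^ 2) = lat (\<lambda>k. 1) (\<lambda>k. (3 * (-1 - k) + 2) ^ 2)"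
    by (rule lat_reflect_index, rule admis_inj[of "\<lambda>n. n ^ 2" "\<lambda>k. 3 * k + 2"]) (auto simp: inj_on_def)
  also have "\<dots> = lat (\<lambda>k. 1) (\<lambda>k. (3 * k + 1) ^ 2)"
    by (rule lat_cong) (auto simp: power2_eq_square algebra_simps)
  also have "lat (\<lambda>k. 1) (\<lambda>k::int. (3 * k + 1) ^ 2) = lat (\<lambda>k. 1) (\<lambda>k. int 3 * (3 * k ^ 2 + 2 * k) + int 1)"
    by (rule lat_cong) (auto simp: power2_eq_square algebra_simps)
  also have "\<dots> = fps_X ^ 1 * fps_compose f15 (fps_X ^ 3)"
    unfolding f15_def by (subst lat_compose, simp, rule lat_shift[symmetric], rule admis_scale) auto
  finally show ?thesis by (simp add: algebra_simps)
qed

text \<open>The part of E(q)^3 with exponents divisible by 3, with q in place of q^3. Its quotient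
  by E(q) is Borwein's a(q).\<close>

definition jac :: "rat fps" where
  "jac = lat (\<lambda>k. - (sg k * of_int (3 * k))) (\<lambda>k. k * (3 * k - 1) div 2) +
         lat (\<lambda>k. sg k * of_int (3 * k + 1)) (\<lambda>k. k * (3 * k + 1) div 2)"

text \<open>The reflection d -> 1 - d preserves the exponent and flips the sign. This vanishing is
  what allows a weight linear in d to be changed by a quantity not depending on d.\<close>

lemma lat_sg_tri: "lat sg (\<lambda>d. d * (d - 1) div 2) = 0"
proof -
  have "lat sg (\<lambda>d. d * (d - 1) div 2) = lat (\<lambda>d. sg (1 - d)) (\<lambda>d. (1 - d) * (1 - d - 1) div 2)"
    by (rule lat_reflect_index) simp
  also have "\<dots> = lat (\<lambda>d. - 1 * sg d) (\<lambda>d. d * (d - 1) div 2)"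
    by (rule lat_cong) (auto simp: sg_diff algebra_simps)
  also have "\<dots> = - lat sg (\<lambda>d. d * (d - 1) div 2)"
    unfolding lat_cmult[symmetric] by (simp add: fps_eq_iff)
  finally show ?thesis by (simp add: equal_neg_zero)
qed

lemma jacobi_dissect3: "ep 1 ^ 3 = fps_compose jac (fps_X ^ 3) - 3 * fps_X * ep 9 ^ 3"
proof -
  let ?w = "\<lambda>d. - (sg d * of_int d)" and ?e = "\<lambda>d::int. d * (d - 1) div 2"
  have "ep 1 ^ 3 = lat (\<lambda>k. ?w (3 * k)) (\<lambda>k. ?e (3 * k)) + lat (\<lambda>k. ?w (3 * k + 1)) (\<lambda>k. ?e (3 * k + 1)) +
     lat (\<lambda>k. ?w (3 * k + 2)) (\<lambda>k. ?e (3 * k + 2))"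
    unfolding jacobi_ep
    using lat_split_mod[of 3 "?e" "?w"] by (simp add: lessThan_2_3 numeral_2_eq_2[symmetric])
  also have "lat (\<lambda>k. ?w (3 * k)) (\<lambda>k. ?e (3 * k)) =
     lat (\<lambda>k. - (sg k * of_int (3 * k))) (\<lambda>k. int 3 * (k * (3 * k - 1) div 2))"
  proof (rule lat_cong)
    fix k :: int
    have "2 * (int 3 * y) = 3 * k * (3 * k - 1)" if "2 * y = k * (3 * k - 1)" for y
      using that by (simp add: algebra_simps)
    from this[OF pent_half'] show "?e (3 * k) = int 3 * (k * (3 * k - 1) div 2)" by (rule div2_eqI)
  qed simp
  also have "lat (\<lambda>k. ?w (3 * k + 1)) (\<lambda>k. ?e (3 * k + 1)) =
     lat (\<lambda>k. sg k * of_int (3 * k + 1)) (\<lambda>k. int 3 * (k * (3 * k + 1) div 2))"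
  proof (rule lat_cong)
    fix k :: int
    have "2 * (int 3 * y) = (3 * k + 1) * (3 * k + 1 - 1)" if "2 * y = k * (3 * k + 1)" for y
      using that by (simp add: algebra_simps)
    from this[OF pent_half] show "?e (3 * k + 1) = int 3 * (k * (3 * k + 1) div 2)" by (rule div2_eqI)
  qed (simp add: sg_add)
  also have "lat (\<lambda>k. - (sg k * of_int (3 * k))) (\<lambda>k. int 3 * (k * (3 * k - 1) div 2)) +
     lat (\<lambda>k. sg k * of_int (3 * k + 1)) (\<lambda>k. int 3 * (k * (3 * k + 1) div 2)) = fps_compose jac (fps_X ^ 3)"
    unfolding jac_def by (simp add: fps_compose_add_distrib lat_compose)
  \<comment> \<open>With 3 k + 2 = 3 (k + 1) - 1, the contribution of - 1 will vanish by
    \<open>lat_sg_tri\<close>, and the rest is a multiple of Jacobi's series in q^9.\<close>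
  also have "lat (\<lambda>k. ?w (3 * k + 2)) (\<lambda>k. ?e (3 * k + 2)) =
     lat (\<lambda>k. 3 * (sg (k + 1) * of_int (k + 1)) + (- 1) * sg (k + 1)) (\<lambda>k. int 9 * ((k + 1) * (k + 1 - 1) div 2) + int 1)"
  proof (rule lat_cong)
    fix k :: int
    have "2 * (int 9 * y + int 1) = (3 * k + 2) * (3 * k + 2 - 1)" if "2 * y = (k + 1) * (k + 1 - 1)" for y
      using that by (simp add: algebra_simps)
    from this[OF pronic_half] show "?e (3 * k + 2) = int 9 * ((k + 1) * (k + 1 - 1) div 2) + int 1" by (rule div2_eqI)
  qed (simp add: sg_add algebra_simps)
  also have "\<dots> = lat (\<lambda>k. 3 * (sg k * of_int k) + (- 1) * sg k) (\<lambda>k. int 9 * (k * (k - 1) div 2) + int 1)"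
    by (rule lat_shift_index[symmetric]) (intro admis_shift admis_scale; simp)
  also have "\<dots> = fps_X ^ 1 * fps_compose (fps_const (- 3) * ep 1 ^ 3 + fps_const (- 1) * lat sg ?e) (fps_X ^ 9)"
    unfolding jacobi_ep lat_cmult lat_add
    by (subst lat_compose, simp, subst lat_shift, rule admis_scale) (auto intro!: lat_cong)
  also have "\<dots> = - 3 * fps_X * ep 9 ^ 3"
  proof -
    have "fps_const (- 3 :: rat) = - 3" "fps_const (- 1 :: rat) = - 1"
      by (metis fps_const_neg numeral_fps_const, simp)
    note eqs = this
    have "fps_compose (fps_const (- 3) * ep 1 ^ 3 + fps_const (- 1) * lat sg ?e) (fps_X ^ 9) =
        fps_const (- 3) * fps_compose (ep 1) (fps_X ^ 9) ^ 3"
      by (simp add: lat_sg_tri fps_compose_mult_distrib fps_compose_power del: ep_compose)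
    also have "\<dots> = - 3 * ep 9 ^ 3"
      unfolding eqs using ep_compose[of 9 1] by simp
    finally show ?thesis by simp
  qed
  finally show ?thesis by simp
qed


section \<open>Bilinear theta identities\<close>

text \<open>The square of Euler's pentagonal series is a sum over pairs (a, b), whose exponent
  separates in the coordinates half the sum and half the difference. Pairs with a + b even and with
  a + b odd give the two terms.\<close>

lemma ep_square: "ep 1 ^ 2 = fps_compose phi (fps_X ^ 3) * fps_compose f12 (fps_X ^ 2) -
   2 * fps_X * f15 * fps_compose psi (fps_X ^ 6)"
proof -
  let ?p = "\<lambda>d::int. d * (3 * d - 1) div 2"
  let ?w = "\<lambda>(a, b). sg a * sg b" and ?e = "\<lambda>(a, b). ?p a + ?p b"
  have adm: "admis ?e" by (intro admis_pair) simp_all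
  let ?we = "\<lambda>x. if even (fst x + snd x) then ?w x else 0"
  let ?wo = "\<lambda>x. if even (fst x + snd x) then 0 else ?w x"
  have "ep 1 ^ 2 = lat ?w ?e"
    unfolding euler_pentagonal power2_eq_square by (rule lat_mult) simp_all
  also have "\<dots> = lat ?we ?e + lat ?wo ?e"
    unfolding lat_add by (rule lat_cong) auto
  also have "lat ?we ?e = lat (\<lambda>x. ?we ((\<lambda>(m, n). (m + n, n - m)) x)) (\<lambda>x. ?e ((\<lambda>(m, n). (m + n, n - m)) x))"
  proof (rule lat_reindex)
    fix x assume "?we x \<noteq> 0"
    then have "even (fst x + snd x)" by (auto split: if_splits)
    then have "x = (\<lambda>(m, n). (m + n, n - m)) ((fst x - snd x) div 2, (fst x + snd x) div 2)"
      by (cases x) (simp, presburger)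
    then show "x \<in> range (\<lambda>(m, n). (m + n, n - m))" by blast
  qed (auto simp: inj_on_def adm)
  also have "\<dots> = lat (\<lambda>(m, n). 1 * 1) (\<lambda>(m, n). int 3 * m ^ 2 + int 2 * ((0 - n) * (3 * (0 - n) + 1) div 2))"
  proof (rule lat_cong)
    fix x :: "int \<times> int"
    obtain m n where x: "x = (m, n)" by (cases x)
    have "y + z = int 3 * m ^ 2 + int 2 * u" if "2 * y = (m + n) * (3 * (m + n) - 1)"
        "2 * z = (n - m) * (3 * (n - m) - 1)" "2 * u = (0 - n) * (3 * (0 - n) + 1)" for y z u
    proof -
      have "2 * (y + z) = 2 * (int 3 * m ^ 2 + int 2 * u)"
        using that by (simp add: power2_eq_square algebra_simps)
      then show ?thesis by simp
    qed
    from this[OF pent_half' pent_half' pent_half]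
    show "?e ((\<lambda>(m, n). (m + n, n - m)) x) = (\<lambda>(m, n). int 3 * m ^ 2 + int 2 * ((0 - n) * (3 * (0 - n) + 1) div 2)) x"
      by (simp add: x)
  qed (auto simp: sg_def)
  also have "\<dots> = lat (\<lambda>m. 1) (\<lambda>m::int. int 3 * m ^ 2) * lat (\<lambda>n. 1) (\<lambda>n::int. int 2 * ((0 - n) * (3 * (0 - n) + 1) div 2))"
  proof (rule lat_mult[symmetric])
    show "admis (\<lambda>n::int. int 2 * ((0 - n) * (3 * (0 - n) + 1) div 2))"
      by (rule admis_inj[of "\<lambda>n. int 2 * (n * (3 * n + 1) div 2)" "\<lambda>n. 0 - n"]) (intro admis_scale admis_f12, simp, simp add: inj_on_def)
  qed (intro admis_scale; simp)
  also have "lat (\<lambda>n. 1) (\<lambda>n::int. int 2 * ((0 - n) * (3 * (0 - n) + 1) div 2)) = fps_compose f12 (fps_X ^ 2)"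
    unfolding f12_def by (subst lat_compose, simp, rule lat_reflect_index[symmetric]) (intro admis_scale; simp)
  also have "lat (\<lambda>m. 1) (\<lambda>m::int. int 3 * m ^ 2) = fps_compose phi (fps_X ^ 3)"
    unfolding phi_def by (subst lat_compose) simp_all
  also have "lat ?wo ?e = lat (\<lambda>x. ?wo ((\<lambda>(m, n). (n + m + 1, n - m)) x)) (\<lambda>x. ?e ((\<lambda>(m, n). (n + m + 1, n - m)) x))"
  proof (rule lat_reindex)
    fix x assume "?wo x \<noteq> 0"
    then have "odd (fst x + snd x)" by (auto split: if_splits)
    then have "x = (\<lambda>(m, n). (n + m + 1, n - m)) ((fst x - snd x - 1) div 2, (fst x + snd x - 1) div 2)"
      by (cases x) (simp, presburger)
    then show "x \<in> range (\<lambda>(m, n). (n + m + 1, n - m))" by blast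
  qed (auto simp: inj_on_def adm)
  also have "\<dots> = lat (\<lambda>(m, n). - 1 * 1) (\<lambda>(m, n). (int 6 * ((m + 1) * (m + 1 - 1) div 2) + int 1) + (3 * n ^ 2 + 2 * n))"
  proof (rule lat_cong)
    fix x :: "int \<times> int"
    obtain m n where x: "x = (m, n)" by (cases x)
    have "y + z = int 6 * u + int 1 + (3 * n ^ 2 + 2 * n)" if "2 * y = (n + m + 1) * (3 * (n + m + 1) - 1)"
        "2 * z = (n - m) * (3 * (n - m) - 1)" "2 * u = (m + 1) * (m + 1 - 1)" for y z u
    proof -
      have "2 * (y + z) = 2 * (int 6 * u + int 1 + (3 * n ^ 2 + 2 * n))"
        using that by (simp add: power2_eq_square algebra_simps)
      then show ?thesis by simp
    qed
    from this[OF pent_half' pent_half' pronic_half]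
    show "?e ((\<lambda>(m, n). (n + m + 1, n - m)) x) = (\<lambda>(m, n). (int 6 * ((m + 1) * (m + 1 - 1) div 2) + int 1) + (3 * n ^ 2 + 2 * n)) x"
      by (simp add: x)
  qed (auto simp: sg_def)
  also have "\<dots> = lat (\<lambda>m. - 1) (\<lambda>m. int 6 * ((m + 1) * (m + 1 - 1) div 2) + int 1) * lat (\<lambda>n. 1) (\<lambda>n::int. 3 * n ^ 2 + 2 * n)"
  proof (rule lat_mult[symmetric])
    show "admis (\<lambda>m::int. int 6 * ((m + 1) * (m + 1 - 1) div 2) + int 1)"
      by (rule admis_inj[of "\<lambda>m. int 6 * (m * (m - 1) div 2) + int 1" "\<lambda>m. m + 1"])
        (intro admis_shift admis_scale admis_tri, simp, simp add: inj_on_def)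
  qed simp
  also have "lat (\<lambda>m. - 1) (\<lambda>m::int. int 6 * ((m + 1) * (m + 1 - 1) div 2) + int 1) =
     lat (\<lambda>m. - 1 * 1) (\<lambda>m::int. int 6 * (m * (m - 1) div 2) + int 1)"
    unfolding mult_1_right
    by (rule lat_shift_index[of "\<lambda>m. int 6 * (m * (m - 1) div 2) + int 1" "\<lambda>_. - 1" 1, symmetric])
       (intro admis_shift admis_scale admis_tri, simp)
  also have "\<dots> = fps_const (- 1) * (fps_X ^ 1 * fps_compose (fps_const 2 * psi) (fps_X ^ 6))"
    unfolding psi_double lat_cmult[symmetric]
    by (subst lat_compose, simp, subst lat_shift, rule admis_scale) auto
  also have "\<dots> = - 2 * fps_X * fps_compose psi (fps_X ^ 6)"
  proof -
    have eq: "fps_const (- 1 :: rat) = - 1" by simp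
    show ?thesis unfolding eq by (simp add: fps_compose_mult_distrib numeral_fps_const[symmetric] mult_ac)
  qed
  also have "lat (\<lambda>n. 1) (\<lambda>n::int. 3 * n ^ 2 + 2 * n) = f15" by (simp add: f15_def)
  finally show ?thesis by (simp add: mult_ac)
qed


text \<open>This and \<open>thetaB\<close> are theta series of weight 3/2. They enter the newform of
  conductor 27 through \<open>ep_square_27\<close>; \<open>thetaA_phim\<close> and
  \<open>thetaB_phim\<close> identify them as eta quotients.\<close>

definition thetaA :: "rat fps" where
  "thetaA = lat (\<lambda>n. of_int (3 * n + 1)) (\<lambda>n::int. 3 * n ^ 2 + 2 * n)"

definition thetaB :: "rat fps" where
  "thetaB = lat (\<lambda>n. of_int (6 * n + 1)) (\<lambda>n::int. n * (3 * n + 1) div 2)"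

lemma lat_sg_pair_0:
  fixes v :: "int \<Rightarrow> rat"
  assumes "admis f" "c > 0"
  shows "lat (\<lambda>(d, m). sg d * v m) (\<lambda>(d, m). int c * (d * (d - 1) div 2) + f m) = 0"
proof -
  have "lat (\<lambda>(d, m). sg d * v m) (\<lambda>(d, m). int c * (d * (d - 1) div 2) + f m) =
     lat sg (\<lambda>d. int c * (d * (d - 1) div 2)) * lat v f"
    by (rule lat_mult[symmetric]) (intro admis_scale admis_tri assms)+
  also have "lat sg (\<lambda>d. int c * (d * (d - 1) div 2)) = fps_compose (lat sg (\<lambda>d. d * (d - 1) div 2)) (fps_X ^ c)"
    using assms by (subst lat_compose) auto
  finally show ?thesis by (simp add: lat_sg_tri)
qed

text \<open>
  In the next two lemmas the product is a sum over pairs; it is regrouped along the lines on which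
  a linear form \<open>k\<close> is constant. The coefficient may be changed by multiples of \<open>sg d\<close> without
  changing the sum, so that it becomes a function of \<open>k\<close>, and the residue of \<open>k\<close> modulo 3
  determines the sum over the line.
\<close>

lemma lat_antisym_0:
  assumes "admis e" "bij f" "\<And>x. e (f x) = e x" "\<And>x. w (f x) = - w x"
  shows "lat w e = 0"
proof -
  have "lat w e = lat (\<lambda>x. w (f x)) (\<lambda>x. e (f x))"
    by (rule lat_reindex) (use assms in \<open>auto simp: bij_def\<close>)
  also have "\<dots> = lat (\<lambda>x. - 1 * w x) e" using assms by (intro lat_cong) auto
  also have "\<dots> = fps_const (- 1) * lat w e" by (rule lat_cmult[symmetric])
  also have "\<dots> = - lat w e" by (simp add: fps_eq_iff)
  finally show ?thesis by (simp add: equal_neg_zero)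
qed

lemma lat_split_mod_pair:
  fixes e :: "int \<times> int \<Rightarrow> int"
  assumes "admis e" and bij: "\<And>i. i \<in> {0, 1, 2} \<Longrightarrow> inj (f i)"
    and range: "\<And>i x. i \<in> {0, 1, 2} \<Longrightarrow> h x mod 3 = i \<Longrightarrow> x \<in> range (f i)"
    and mod: "\<And>i x. i \<in> {0, 1, 2} \<Longrightarrow> h (f i x) mod 3 = i"
  shows "lat w e = lat (\<lambda>x. w (f 0 x)) (\<lambda>x. e (f 0 x)) + lat (\<lambda>x. w (f 1 x)) (\<lambda>x. e (f 1 x)) +
     lat (\<lambda>x. w (f (2::int) x)) (\<lambda>x. e (f 2 x))"
proof -
  define v where "v = (\<lambda>i x. if h x mod (3::int) = i then w x else 0)"
  have "lat (v i) e = lat (\<lambda>x. w (f i x)) (\<lambda>x. e (f i x))" if "i \<in> {0, 1, 2}" for i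
  proof -
    have "lat (v i) e = lat (\<lambda>x. v i (f i x)) (\<lambda>x. e (f i x))"
      by (rule lat_reindex) (use bij that range assms(1) in \<open>auto simp: v_def split: if_splits\<close>)
    then show ?thesis by (simp add: v_def mod[OF that])
  qed
  moreover have "w x = v 0 x + v 1 x + v 2 x" for x
  proof -
    have "h x mod 3 \<in> {0, 1, 2}" by auto
    then show ?thesis by (auto simp: v_def)
  qed
  then have "w = (\<lambda>x. v 0 x + v 1 x + v 2 x)" by (rule ext)
  then have "lat w e = lat (\<lambda>x. v 0 x + v 1 x + v 2 x) e" by simp
  then have "lat w e = lat (v 0) e + lat (v 1) e + lat (v 2) e" by (simp add: lat_add)
  ultimately show ?thesis by simp
qed

lemma thetaA_phim: "ep 4 ^ 3 * phim = ep 4 * thetaA"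
proof -
  let ?t = "\<lambda>d::int. d * (d - 1) div 2" and ?p = "\<lambda>a::int. a * (3 * a - 1) div 2"
  let ?e = "\<lambda>(d, m). int 4 * ?t d + m ^ 2"
  let ?g = "\<lambda>(a, b). int 4 * ?p a + (3 * b ^ 2 + 2 * b)"
  let ?w = "\<lambda>(d, m). - (sg d * of_int (2 * d + m) * sg m) / 2"
  have adm: "admis ?e" by (intro admis_pair admis_scale) simp_all
  have admg: "admis ?g" by (intro admis_pair admis_scale) simp_all
  have "ep 4 ^ 3 = fps_compose (ep 1 ^ 3) (fps_X ^ 4)"
    using ep_compose[of 4 1] by (simp add: fps_compose_power[symmetric] del: ep_compose)
  then have "ep 4 ^ 3 * phim = lat (\<lambda>d. - (sg d * of_int d)) (\<lambda>d. int 4 * ?t d) * lat sg (\<lambda>m. m ^ 2)"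
    by (simp add: jacobi_ep lat_compose phim_def del: One_nat_def)
  also have "\<dots> = lat (\<lambda>(d, m). - (sg d * of_int d) * sg m) ?e"
    by (intro lat_mult admis_scale admis_tri admis_square) simp_all
  also have "\<dots> = lat (\<lambda>(d, m). - (sg d * of_int d) * sg m) ?e + lat (\<lambda>(d, m). sg d * (- of_int m * sg m / 2)) ?e"
    using lat_sg_pair_0[of "\<lambda>m. m ^ 2" 4 "\<lambda>m. - of_int m * sg m / 2", OF admis_square] by simp
  also have "\<dots> = lat ?w ?e"
    unfolding lat_add by (rule lat_cong) (auto simp: field_simps)
  \<comment> \<open>\<open>f i\<close> parametrizes the pairs with m + 2 d = i mod 3. For i = 0 and
    i = 2 the coordinates make the exponent separate into 4 times a pentagonal number and 3 r^2 + 2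
    r; for i = 1 it is symmetric under d' -> 1 - d', while the weight is antisymmetric.\<close>
  also define f where "f = (\<lambda>i (d', r). if i = (0::int) then (d' - r, - r - 2 * d')
      else if i = 1 then (d' + r, r + 1 - 2 * d') else (r + 1 - d', r + 2 * d' :: int))"
  have "lat ?w ?e = lat (\<lambda>x. ?w (f 0 x)) (\<lambda>x. ?e (f 0 x)) + lat (\<lambda>x. ?w (f 1 x)) (\<lambda>x. ?e (f 1 x)) +
     lat (\<lambda>x. ?w (f 2 x)) (\<lambda>x. ?e (f 2 x))"
  proof (rule lat_split_mod_pair[OF adm, where h = "\<lambda>(d, m). m + 2 * d"])
    fix i :: int and x :: "int \<times> int" assume i: "i \<in> {0, 1, 2}"
    then show "inj (f i)" by (auto simp: f_def inj_on_def)
    have "(case f i x of (d, m) \<Rightarrow> m + 2 * d) = 3 * (if i = 0 then - snd x else snd x) + i"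
      using i by (cases x) (auto simp: f_def)
    then show "(case f i x of (d, m) \<Rightarrow> m + 2 * d) mod 3 = i" using i by auto
    assume h: "(case x of (d, m) \<Rightarrow> m + 2 * d) mod 3 = i"
    obtain d m where x: "x = (d, m)" by (cases x)
    define r where "r = (m + 2 * d) div 3"
    have k: "m + 2 * d = 3 * r + i" using h by (simp add: x r_def) presburger
    have "x = f i (if i = 0 then (d - r, - r) else if i = 1 then (d - r, r) else (r + 1 - d, r))"
      using i k by (auto simp: f_def x)
    then show "x \<in> range (f i)" by blast
  qed
  also have "lat (\<lambda>x. ?w (f 1 x)) (\<lambda>x. ?e (f 1 x)) = 0"
  proof (rule lat_antisym_0[where f = "\<lambda>(d, r). (1 - d, r)"])
    show "admis (\<lambda>x. ?e (f 1 x))" by (rule admis_inj[OF adm]) (auto simp: f_def inj_on_def)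
    show "bij (\<lambda>(d, r). (1 - d, r :: int) :: int \<times> int)"
      by (rule o_bij[of "\<lambda>(d, r). (1 - d, r)"]) auto
    fix x :: "int \<times> int"
    obtain d r where x: "x = (d, r)" by (cases x)
    have "int 4 * y + (r + 1 - 2 * (1 - d)) ^ 2 = int 4 * z + (r + 1 - 2 * d) ^ 2"
      if "2 * y = (1 - d + r) * (1 - d + r - 1)" "2 * z = (d + r) * (d + r - 1)" for y z
      using that by (simp add: power2_eq_square algebra_simps)
    from this[OF pronic_half pronic_half] show "?e (f 1 ((\<lambda>(d, r). (1 - d, r)) x)) = ?e (f 1 x)"
      by (simp add: f_def x)
    show "?w (f 1 ((\<lambda>(d, r). (1 - d, r)) x)) = - ?w (f 1 x)"
      by (simp add: f_def x sg_def)
  qed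
  also have "lat (\<lambda>x. ?w (f 0 x)) (\<lambda>x. ?e (f 0 x)) = lat (\<lambda>(a, b). sg a * of_int (3 * b) / 2) ?g"
  proof (rule lat_cong)
    fix x :: "int \<times> int"
    obtain d r where x: "x = (d, r)" by (cases x)
    have "int 4 * y + (- r - 2 * d) ^ 2 = int 4 * z + (3 * r ^ 2 + 2 * r)"
      if "2 * y = (d - r) * (d - r - 1)" "2 * z = d * (3 * d - 1)" for y z
      using that by (simp add: power2_eq_square algebra_simps)
    from this[OF pronic_half pent_half'] show "?e (f 0 x) = ?g x" by (simp add: f_def x)
    show "?w (f 0 x) = (\<lambda>(a, b). sg a * of_int (3 * b) / 2) x"
      by (simp add: f_def x sg_def)
  qed
  also have "lat (\<lambda>x. ?w (f 2 x)) (\<lambda>x. ?e (f 2 x)) = lat (\<lambda>(a, b). sg a * of_int (3 * b + 2) / 2) ?g"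
  proof (rule lat_cong)
    fix x :: "int \<times> int"
    obtain d r where x: "x = (d, r)" by (cases x)
    have "int 4 * y + (r + 2 * d) ^ 2 = int 4 * z + (3 * r ^ 2 + 2 * r)"
      if "2 * y = (r + 1 - d) * (r + 1 - d - 1)" "2 * z = d * (3 * d - 1)" for y z
      using that by (simp add: power2_eq_square algebra_simps)
    from this[OF pronic_half pent_half'] show "?e (f 2 x) = ?g x" by (simp add: f_def x)
    show "?w (f 2 x) = (\<lambda>(a, b). sg a * of_int (3 * b + 2) / 2) x"
      by (simp add: f_def x sg_def)
  qed
  also have "lat (\<lambda>(a, b). sg a * of_int (3 * b) / 2) ?g + 0 + lat (\<lambda>(a, b). sg a * of_int (3 * b + 2) / 2) ?g =
     lat (\<lambda>(a, b). sg a * of_int (3 * b + 1)) ?g"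
    unfolding add_0_right lat_add by (rule lat_cong) (auto simp: field_simps)
  also have "\<dots> = lat sg (\<lambda>a. int 4 * ?p a) * lat (\<lambda>n. of_int (3 * n + 1)) (\<lambda>n::int. 3 * n ^ 2 + 2 * n)"
    by (rule lat_mult[symmetric]; (rule admis_scale)?; simp)
  also have "lat sg (\<lambda>a. int 4 * ?p a) = fps_compose (ep 1) (fps_X ^ 4)"
    unfolding euler_pentagonal by (rule lat_compose[symmetric]) simp
  also have "fps_compose (ep 1) (fps_X ^ 4) = ep 4"
    using ep_compose[of 4 1] by simp
  finally show ?thesis by (simp add: thetaA_def)
qed

lemma thetaB_phim: "ep 1 ^ 3 * phim = ep 2 * thetaB"
proof -
  let ?t = "\<lambda>d::int. d * (d - 1) div 2" and ?p = "\<lambda>a::int. a * (3 * a - 1) div 2"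
  let ?e = "\<lambda>(d, n). int 1 * ?t d + n ^ 2"
  let ?g = "\<lambda>(a, b). int 2 * ?p a + b * (3 * b + 1) div 2"
  let ?w = "\<lambda>(d, n). - (sg d * of_int (d + 2 * n) * sg n)"
  have adm: "admis ?e" by (intro admis_pair admis_scale) simp_all
  have "ep 1 ^ 3 * phim = lat (\<lambda>d. - (sg d * of_int d)) (\<lambda>d. int 1 * ?t d) * lat sg (\<lambda>m. m ^ 2)"
    by (simp add: jacobi_ep phim_def del: One_nat_def)
  also have "\<dots> = lat (\<lambda>(d, m). - (sg d * of_int d) * sg m) ?e"
    by (intro lat_mult admis_scale admis_tri admis_square) simp_all
  also have "\<dots> = lat (\<lambda>(d, m). - (sg d * of_int d) * sg m) ?e + lat (\<lambda>(d, n). sg d * (- 2 * of_int n * sg n)) ?e"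
    using lat_sg_pair_0[of "\<lambda>m. m ^ 2" 1 "\<lambda>n. - 2 * of_int n * sg n", OF admis_square] by simp
  also have "\<dots> = lat ?w ?e"
    unfolding lat_add by (rule lat_cong) (auto simp: algebra_simps)
  \<comment> \<open>As in \<open>thetaA_phim\<close>, with the linear form d + 2 n; now the class 2
    is the antisymmetric one.\<close>
  also define f where "f = (\<lambda>i (n, r). if i = (0::int) then (- r + 2 * n, - n - r)
      else if i = 1 then (r + 1 - 2 * n, n + r) else (r + 2 - 2 * n, n + r :: int))"
  have "lat ?w ?e = lat (\<lambda>x. ?w (f 0 x)) (\<lambda>x. ?e (f 0 x)) + lat (\<lambda>x. ?w (f 1 x)) (\<lambda>x. ?e (f 1 x)) +
     lat (\<lambda>x. ?w (f 2 x)) (\<lambda>x. ?e (f 2 x))"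
  proof (rule lat_split_mod_pair[OF adm, where h = "\<lambda>(d, n). d + 2 * n"])
    fix i :: int and x :: "int \<times> int" assume i: "i \<in> {0, 1, 2}"
    then show "inj (f i)" by (auto simp: f_def inj_on_def)
    have "(case f i x of (d, n) \<Rightarrow> d + 2 * n) = 3 * (if i = 0 then - snd x else snd x) + i"
      using i by (cases x) (auto simp: f_def)
    then show "(case f i x of (d, n) \<Rightarrow> d + 2 * n) mod 3 = i" using i by auto
    assume h: "(case x of (d, n) \<Rightarrow> d + 2 * n) mod 3 = i"
    obtain d n where x: "x = (d, n)" by (cases x)
    define r where "r = (d + 2 * n) div 3"
    have k: "d + 2 * n = 3 * r + i" using h by (simp add: x r_def) presburger
    have "x = f i (if i = 0 then (r - n, - r) else (n - r, r))"
      using i k by (auto simp: f_def x)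
    then show "x \<in> range (f i)" by blast
  qed
  also have "lat (\<lambda>x. ?w (f 2 x)) (\<lambda>x. ?e (f 2 x)) = 0"
  proof (rule lat_antisym_0[where f = "\<lambda>(d, r). (1 - d, r)"])
    show "admis (\<lambda>x. ?e (f 2 x))" by (rule admis_inj[OF adm]) (auto simp: f_def inj_on_def)
    show "bij (\<lambda>(d, r). (1 - d, r :: int) :: int \<times> int)"
      by (rule o_bij[of "\<lambda>(d, r). (1 - d, r)"]) auto
    fix x :: "int \<times> int"
    obtain n r where x: "x = (n, r)" by (cases x)
    have "int 1 * y + (1 - n + r) ^ 2 = int 1 * z + (n + r) ^ 2"
      if "2 * y = (r + 2 - 2 * (1 - n)) * (r + 2 - 2 * (1 - n) - 1)" "2 * z = (r + 2 - 2 * n) * (r + 2 - 2 * n - 1)" for y z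
    proof -
      have "2 * (int 1 * y + (1 - n + r) ^ 2) = 2 * (int 1 * z + (n + r) ^ 2)"
        using that by (simp add: power2_eq_square algebra_simps)
      then show ?thesis by simp
    qed
    from this[OF pronic_half pronic_half] show "?e (f 2 ((\<lambda>(d, r). (1 - d, r)) x)) = ?e (f 2 x)"
      by (simp add: f_def x)
    show "?w (f 2 ((\<lambda>(d, r). (1 - d, r)) x)) = - ?w (f 2 x)"
      by (simp add: f_def x sg_def)
  qed
  also have "lat (\<lambda>x. ?w (f 0 x)) (\<lambda>x. ?e (f 0 x)) = lat (\<lambda>(a, b). sg a * of_int (3 * b)) ?g"
  proof (rule lat_cong)
    fix x :: "int \<times> int"
    obtain n r where x: "x = (n, r)" by (cases x)
    have "int 1 * y + (- n - r) ^ 2 = int 2 * z + u"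
      if "2 * y = (- r + 2 * n) * (- r + 2 * n - 1)" "2 * z = n * (3 * n - 1)" "2 * u = r * (3 * r + 1)" for y z u
    proof -
      have "2 * (int 1 * y + (- n - r) ^ 2) = 2 * (int 2 * z + u)"
        using that by (simp add: power2_eq_square algebra_simps)
      then show ?thesis by simp
    qed
    from this[OF pronic_half pent_half' pent_half] show "?e (f 0 x) = ?g x" by (simp add: f_def x)
    show "?w (f 0 x) = (\<lambda>(a, b). sg a * of_int (3 * b)) x"
      by (simp add: f_def x sg_def)
  qed
  also have "lat (\<lambda>x. ?w (f 1 x)) (\<lambda>x. ?e (f 1 x)) = lat (\<lambda>(a, b). sg a * of_int (3 * b + 1)) ?g"
  proof (rule lat_cong)
    fix x :: "int \<times> int"
    obtain n r where x: "x = (n, r)" by (cases x)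
    have "int 1 * y + (n + r) ^ 2 = int 2 * z + u"
      if "2 * y = (r + 1 - 2 * n) * (r + 1 - 2 * n - 1)" "2 * z = n * (3 * n - 1)" "2 * u = r * (3 * r + 1)" for y z u
    proof -
      have "2 * (int 1 * y + (n + r) ^ 2) = 2 * (int 2 * z + u)"
        using that by (simp add: power2_eq_square algebra_simps)
      then show ?thesis by simp
    qed
    from this[OF pronic_half pent_half' pent_half] show "?e (f 1 x) = ?g x" by (simp add: f_def x)
    show "?w (f 1 x) = (\<lambda>(a, b). sg a * of_int (3 * b + 1)) x"
      by (simp add: f_def x sg_def)
  qed
  also have "lat (\<lambda>(a, b). sg a * of_int (3 * b)) ?g + lat (\<lambda>(a, b). sg a * of_int (3 * b + 1)) ?g + 0 =
     lat (\<lambda>(a, b). sg a * of_int (6 * b + 1)) ?g"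
    unfolding add_0_right lat_add by (rule lat_cong) (auto simp: algebra_simps)
  also have "\<dots> = lat sg (\<lambda>a. int 2 * ?p a) * lat (\<lambda>n. of_int (6 * n + 1)) (\<lambda>n::int. n * (3 * n + 1) div 2)"
    by (rule lat_mult[symmetric]; (rule admis_scale)?; simp)
  also have "lat sg (\<lambda>a. int 2 * ?p a) = fps_compose (ep 1) (fps_X ^ 2)"
    unfolding euler_pentagonal by (rule lat_compose[symmetric]) simp
  also have "fps_compose (ep 1) (fps_X ^ 2) = ep 2"
    using ep_compose[of 2 1] by simp
  finally show ?thesis by (simp add: thetaB_def)
qed

section \<open>Substitutions and derivations\<close>

definition sub :: "nat \<Rightarrow> rat fps \<Rightarrow> rat fps" where
  "sub k F = fps_compose F (fps_X ^ k)"

lemma sub_nth: "k > 0 \<Longrightarrow> fps_nth (sub k F) n = (if k dvd n then fps_nth F (n div k) else 0)"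
  by (simp add: sub_def compose_X_power_nth)

lemma sub_nth_mult [simp]: "k > 0 \<Longrightarrow> fps_nth (sub k F) (k * n) = fps_nth F n"
  by (simp add: sub_nth)

lemma sub_nth_0 [simp]: "fps_nth (sub k F) 0 = fps_nth F 0"
  by (simp add: sub_def)

context
  fixes k :: nat assumes k: "k > 0"
begin

lemma sub_add: "sub k (A + B) = sub k A + sub k B"
  and sub_diff: "sub k (A - B) = sub k A - sub k B"
  by (simp_all add: sub_def fps_compose_add_distrib fps_compose_sub_distrib)

lemma sub_mult: "sub k (A * B) = sub k A * sub k B"
  using k by (simp add: sub_def fps_compose_mult_distrib)

lemma sub_power: "sub k (A ^ n) = sub k A ^ n"
  using k by (simp add: sub_def fps_compose_power)

lemma sub_X: "sub k fps_X = fps_X ^ k"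
  using k by (simp add: sub_def)

lemma sub_1: "sub k 1 = 1" by (simp add: sub_def)

lemma sub_const: "sub k (fps_const c) = fps_const c" by (simp add: sub_def)

lemma sub_numeral: "sub k (numeral n) = numeral n"
  by (simp add: sub_def numeral_fps_const)

lemma sub_ep: "j > 0 \<Longrightarrow> sub k (ep j) = ep (k * j)"
  using k by (simp add: sub_def)

lemma sub_sub: "j > 0 \<Longrightarrow> sub k (sub j A) = sub (k * j) A"
  using k by (auto simp: fps_eq_iff sub_nth mult.commute[of k j] elim!: dvdE)

lemma sub_inj: "sub k A = sub k B \<longleftrightarrow> A = B"
  using k by (metis fps_ext sub_nth_mult)

lemma XD_sub: "fps_XD (sub k A) = of_nat k * sub k (fps_XD A)"
  using k by (auto simp: fps_eq_iff sub_nth fps_of_nat[symmetric])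

end

lemmas sub_simps = sub_add sub_diff sub_mult sub_power sub_X sub_1 sub_const sub_numeral sub_ep sub_sub

lemma sub_Suc_0 [simp]: "sub (Suc 0) A = A" by (simp add: sub_def)

lemma XD_mult: "fps_XD (A * B) = fps_XD A * B + A * fps_XD B" for A B :: "rat fps"
  by (simp add: fps_XD_def algebra_simps)

lemma XD_diff: "fps_XD (A - B) = fps_XD A - fps_XD B" for A B :: "rat fps"
  by (simp add: fps_XD_def algebra_simps)

lemma XD_X: "fps_XD (fps_X :: rat fps) = fps_X"
  by (simp add: fps_XD_def)

lemma XD_numeral: "fps_XD (numeral n :: rat fps) = 0"
  by (simp add: fps_XD_def numeral_fps_const)

lemma XD_1: "fps_XD (1 :: rat fps) = 0"
  by (simp add: fps_XD_def)

lemma XD_power2: "fps_XD (A ^ 2) = 2 * A * fps_XD A"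
  and XD_power3: "fps_XD (A ^ 3) = 3 * A ^ 2 * fps_XD A"
  and XD_power4: "fps_XD (A ^ 4) = 4 * A ^ 3 * fps_XD A" for A :: "rat fps"
  by (simp_all add: eval_nat_numeral XD_mult algebra_simps)

lemmas XD_simps = fps_XD_add XD_diff XD_mult XD_X XD_numeral XD_1 XD_power2 XD_power3 XD_power4

text \<open>The coefficient of q ^ n is 0 or that of q ^ (n / k), and the descent ends at n = 0 or
  with a coefficient 0.\<close>

lemma sub_fixed_const:
  assumes "k \<ge> 2" "sub k F = F"
  shows "F = fps_const (fps_nth F 0)"
proof (rule fps_ext)
  fix n
  show "fps_nth F n = fps_nth (fps_const (fps_nth F 0)) n"
  proof (induction n rule: less_induct)
    case (less n)
    have F: "fps_nth F n = (if k dvd n then fps_nth F (n div k) else 0)"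
      using assms sub_nth[of k F n] by simp
    show ?case
    proof (cases "n > 0 \<and> k dvd n")
      case True
      then have "n div k < n" "n div k \<noteq> 0" using assms by (auto elim!: dvdE)
      then show ?thesis using less[of "n div k"] F True by simp
    next
      case False
      then show ?thesis using F by auto
    qed
  qed
qed

text \<open>
  The quotient \<open>N / M\<close> is invariant under a substitution \<open>q \<mapsto> q ^ k\<close>, hence constant. This
  replaces the finite-dimensionality of spaces of modular forms.
\<close>

lemma sub_quotient_const:
  assumes "k \<ge> 2" "fps_nth N 0 = 1" "fps_nth M 0 = 1" "N * sub k M = sub k N * M"
  shows "N = M"
proof -
  have u: "A * inverse A = 1" if "fps_nth A 0 = 1" for A :: "rat fps"
    using that by (metis inverse_mult_eq_1 mult.commute zero_neq_one)
  define R where "R = N * inverse M"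
  have NM: "N = R * M" using u[of M] assms by (simp add: R_def mult.assoc) (metis inverse_mult_eq_1 mult.right_neutral zero_neq_one)
  have "R * M * sub k M = sub k R * M * sub k M"
    using assms(1,4) unfolding NM by (simp add: sub_mult mult_ac)
  moreover have "M * sub k M \<noteq> 0" using assms by (auto simp: fps_eq_iff intro: exI[of _ 0])
  ultimately have "sub k R = R" by (simp add: mult.assoc)
  then have "R = fps_const (fps_nth R 0)" by (rule sub_fixed_const[OF assms(1)])
  moreover have "fps_nth R 0 = 1" using assms by (simp add: R_def)
  ultimately show ?thesis using NM by simp
qed

lemma fps_square_unique:
  fixes A B :: "rat fps"
  assumes "A ^ 2 = B ^ 2" "fps_nth A 0 = 1" "fps_nth B 0 = 1"
  shows "A = B"
proof -
  have "(A - B) * (A + B) = 0" using assms(1) by (simp add: algebra_simps power2_eq_square)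
  moreover have "A + B \<noteq> 0" using assms by (metis add_eq_0_iff_both_eq_0 fps_add_nth fps_zero_nth one_add_one zero_neq_numeral)
  ultimately show ?thesis by simp
qed

lemma fps_cube_unique:
  fixes A B :: "rat fps"
  assumes "A ^ 3 = B ^ 3" "fps_nth A 0 = 1" "fps_nth B 0 = 1"
  shows "A = B"
proof -
  have "(A - B) * (A ^ 2 + A * B + B ^ 2) = 0"
    using assms(1) by (simp add: algebra_simps power2_eq_square power3_eq_cube)
  moreover have "fps_nth (A ^ 2 + A * B + B ^ 2) 0 = 3" using assms by (simp add: power2_eq_square)
  then have "A ^ 2 + A * B + B ^ 2 \<noteq> 0" by (metis fps_zero_nth zero_neq_numeral)
  ultimately show ?thesis by simp
qed


section \<open>Norms from cube roots of unity\<close>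

text \<open>The substitution of w * q for q. The target is complex because w will be a cube root of
  unity.\<close>

definition rot :: "complex \<Rightarrow> rat fps \<Rightarrow> complex fps" where
  "rot w F = Abs_fps (\<lambda>n. of_rat (fps_nth F n) * w ^ n)"

lemma rot_nth: "fps_nth (rot w F) n = of_rat (fps_nth F n) * w ^ n"
  by (simp add: rot_def)

lemma rot_add: "rot w (A + B) = rot w A + rot w B"
  and rot_diff: "rot w (A - B) = rot w A - rot w B"
  by (simp_all add: fps_eq_iff rot_nth of_rat_add of_rat_diff algebra_simps)

lemma rot_mult: "rot w (A * B) = rot w A * rot w B"
proof (rule fps_ext)
  fix n
  have "fps_nth (rot w (A * B)) n = (\<Sum>i=0..n. of_rat (fps_nth A i * fps_nth B (n - i)) * w ^ n)"
    by (simp add: rot_nth fps_mult_nth of_rat_sum sum_distrib_right)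
  also have "\<dots> = (\<Sum>i=0..n. fps_nth (rot w A) i * fps_nth (rot w B) (n - i))"
  proof (rule sum.cong[OF refl])
    fix i assume "i \<in> {0..n}"
    then have "w ^ n = w ^ i * w ^ (n - i)" by (simp flip: power_add)
    then show "of_rat (fps_nth A i * fps_nth B (n - i)) * w ^ n = fps_nth (rot w A) i * fps_nth (rot w B) (n - i)"
      by (simp add: rot_nth of_rat_mult)
  qed
  finally show "fps_nth (rot w (A * B)) n = fps_nth (rot w A * rot w B) n" by (simp add: fps_mult_nth)
qed

lemma rot_1: "rot w 1 = 1"
  by (auto simp: fps_eq_iff rot_nth)

lemma rot_power: "rot w (A ^ n) = rot w A ^ n"
  by (induction n) (simp_all add: rot_1 rot_mult)

lemma rot_X: "rot w fps_X = fps_const w * fps_X"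
  by (auto simp: fps_eq_iff rot_nth fps_X_def)

lemma rot_prod: "rot w (prod f S) = (\<Prod>i\<in>S. rot w (f i))"
  by (induction S rule: infinite_finite_induct) (simp_all add: rot_1 rot_mult)

lemma rot_sub3: "w ^ 3 = 1 \<Longrightarrow> rot w (sub 3 A) = rot 1 (sub 3 A)"
  by (auto simp: fps_eq_iff rot_nth sub_nth power_mult elim!: dvdE)

lemma rot_1_inj: "rot 1 A = rot 1 B \<Longrightarrow> A = B"
  by (simp add: fps_eq_iff rot_nth)

lemma eqm_rot: "eqm K A B \<Longrightarrow> eqm K (rot w A) (rot w B)"
  by (simp add: eqm_def rot_nth)

definition om :: complex where "om = cis (2 * pi / 3)"

lemma om_cube: "om ^ 3 = 1"
  by (simp add: om_def power3_eq_cube cis_mult)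

lemma om_sum: "1 + om + om ^ 2 = 0"
proof -
  have "om \<noteq> 1"
  proof
    assume "om = 1"
    then have "sin (2 * pi / 3) = 0" by (simp add: om_def complex_eq_iff)
    moreover have "sin (2 * pi / 3) > 0" by (rule sin_gt_zero) (simp_all add: pi_gt_zero)
    ultimately show False by simp
  qed
  moreover have "(om - 1) * (1 + om + om ^ 2) = om ^ 3 - 1"
    by (simp add: algebra_simps power2_eq_square power3_eq_cube)
  ultimately show ?thesis using om_cube by simp
qed

text \<open>The norm from series in q to series in q^3. It can be computed from a 3-dissection as
  well as from an infinite product, and comparing the two produces cubic theta identities.\<close>

definition norm3 :: "rat fps \<Rightarrow> complex fps" where
  "norm3 A = rot 1 A * rot om A * rot (om ^ 2) A"

lemma norm3_mult: "norm3 (A * B) = norm3 A * norm3 B"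
  by (simp add: norm3_def rot_mult mult_ac)

lemma norm3_power: "norm3 (A ^ n) = norm3 A ^ n"
  by (simp add: norm3_def rot_power power_mult_distrib)

lemma norm3_sub3: "norm3 (sub 3 A) = rot 1 (sub 3 A) ^ 3"
proof -
  have "(om ^ 2) ^ 3 = 1" using om_cube by (metis power_mult mult.commute power_one)
  then show ?thesis
    unfolding norm3_def rot_sub3[OF om_cube] rot_sub3[OF \<open>(om ^ 2) ^ 3 = 1\<close>]
    by (simp add: power3_eq_cube)
qed

lemma eqm_norm3: "eqm K A B \<Longrightarrow> eqm K (norm3 A) (norm3 B)"
  unfolding norm3_def by (intro eqm_mult eqm_rot)

lemma norm3_linear: "norm3 (sub 3 A + fps_X * sub 3 B) = rot 1 (sub 3 A ^ 3 + fps_X ^ 3 * sub 3 B ^ 3)"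
proof -
  define a b x where "a = rot 1 (sub 3 A)" and "b = rot 1 (sub 3 B)" and "x = (fps_X :: complex fps)"
  have w2: "(om ^ 2) ^ 3 = 1" using om_cube by (metis power_mult mult.commute power_one)
  have "norm3 (sub 3 A + fps_X * sub 3 B) =
      (a + x * b) * (a + fps_const om * x * b) * (a + fps_const (om ^ 2) * x * b)"
    by (simp add: norm3_def rot_add rot_mult rot_X rot_sub3[OF om_cube] rot_sub3[OF w2] a_def b_def x_def)
  also have "\<dots> = a ^ 3 + x ^ 3 * b ^ 3"
  proof -
    define u v where "u = fps_const om" and "v = fps_const (om ^ 2)"
    have "fps_const (1 + om + om ^ 2) = (0 :: complex fps)" unfolding om_sum by simp
    then have s: "1 + u + v = 0" unfolding u_def v_def by (simp flip: fps_const_add fps_const_1_eq_1)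
    have m: "u * v = 1" unfolding u_def v_def
      using om_cube by (simp add: power2_eq_square power3_eq_cube mult.assoc)
    have "(a + x * b) * (a + u * x * b) * (a + v * x * b) =
       a ^ 3 + a ^ 2 * x * b * (1 + u + v) + a * x ^ 2 * b ^ 2 * (u + v + u * v) + u * v * x ^ 3 * b ^ 3"
      by (simp add: algebra_simps power2_eq_square power3_eq_cube)
    moreover have "u + v + u * v = 0" using s m by (simp add: add.commute add.left_commute)
    ultimately show ?thesis using s m unfolding u_def v_def by simp
  qed
  also have "\<dots> = rot 1 (sub 3 A ^ 3 + fps_X ^ 3 * sub 3 B ^ 3)"
    by (simp add: rot_add rot_mult rot_power rot_X a_def b_def x_def)
  finally show ?thesis .
qed

text \<open>If 3 does not divide n, the conjugates of 1 - q^n multiply to 1 - q^(3n); otherwise all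
  three coincide. Both sides carry a factor that is 1 when 3 does not divide n, so that the product
  over all n can be taken uniformly and without division.\<close>

lemma norm3_factor:
  "norm3 (1 - fps_X ^ n) * (if 3 dvd n then rot 1 (1 - fps_X ^ (3 * n)) else rot 1 1) =
   (if 3 dvd n then rot 1 (1 - fps_X ^ n) ^ 3 else rot 1 1) * rot 1 (1 - fps_X ^ (3 * n))"
proof (cases "3 dvd n")
  case True
  then obtain m where n: "n = 3 * m" by auto
  have "1 - fps_X ^ n = sub 3 (1 - fps_X ^ m)" by (simp add: n sub_simps power_mult)
  then have "norm3 (1 - fps_X ^ n) = rot 1 (1 - fps_X ^ n) ^ 3"
    by (simp only: norm3_sub3)
  with True show ?thesis by simp
next
  case False
  define u where "u = (om ^ n)"
  have u3: "u ^ 3 = 1" unfolding u_def by (metis om_cube power_commutes power_mult power_one mult.commute)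
  have "1 + u + u ^ 2 = 0"
  proof -
    have "u \<noteq> 1"
    proof
      assume u1: "u = 1"
      have "n mod 3 = 1 \<or> n mod 3 = 2" using False by presburger
      moreover have "u = om ^ (n mod 3)"
        unfolding u_def by (subst (1) mult_div_mod_eq[of 3 n, symmetric]) (simp only: power_add power_mult om_cube, simp)
      ultimately have "om = 1 \<or> om ^ 2 = 1" using u1 by auto
      then have "om = 1" using om_cube by (auto simp: power2_eq_square power3_eq_cube)
      then show False using om_sum by simp
    qed
    moreover have "(u - 1) * (1 + u + u ^ 2) = u ^ 3 - 1"
      by (simp add: algebra_simps power2_eq_square power3_eq_cube)
    ultimately show ?thesis using u3 by simp
  qed
  then have s: "1 + fps_const u + fps_const (u ^ 2) = 0"
    by (metis fps_const_0_eq_0 fps_const_1_eq_1 fps_const_add)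
  have m: "fps_const u * fps_const (u ^ 2) = 1"
    using u3 by (simp add: power2_eq_square power3_eq_cube mult.assoc)
  have rw: "rot w (1 - fps_X ^ n) = 1 - fps_const (w ^ n) * fps_X ^ n" for w
    by (simp add: rot_diff rot_1 rot_power rot_X power_mult_distrib fps_const_power)
  define x where "x = (fps_X ^ n :: complex fps)"
  define v w where "v = fps_const u" and "w = fps_const (u ^ 2)"
  have "norm3 (1 - fps_X ^ n) = (1 - x) * (1 - v * x) * (1 - w * x)"
    by (simp add: norm3_def rw u_def v_def w_def x_def power_mult[symmetric] mult.commute)
  also have "\<dots> = 1 - x * (1 + v + w) + x ^ 2 * (v + w + v * w) - v * w * x ^ 3"
    by (simp add: algebra_simps power2_eq_square power3_eq_cube)
  also have "v + w + v * w = 1 + v + w" using m by (simp add: v_def w_def)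
  also have "1 + v + w = 0" using s by (simp add: v_def w_def)
  also have "v * w = 1" using m by (simp add: v_def w_def)
  also have "1 - x * 0 + x ^ 2 * 0 - 1 * x ^ 3 = 1 - x ^ 3" by simp
  also have "\<dots> = rot 1 (1 - fps_X ^ (3 * n))"
    by (simp add: rot_diff rot_1 rot_power rot_X x_def power_mult[symmetric] mult.commute)
  finally show ?thesis using False by (simp add: rot_1)
qed

text \<open>\<open>norm3_factor\<close> is multiplied over n \<le> 3 K. The multiples of 3 among
  these n contribute the factors of E(q^9) on the left and those of E(q^3)^3 on the right; the
  remaining E(q^3) comes from all n.\<close>

lemma norm3_ep: "norm3 (ep 1) * rot 1 (ep 9) = rot 1 (ep 3) ^ 4"
proof (rule eqm_ext)
  fix K
  define f where "f = (\<lambda>n. 1 - fps_X ^ n :: rat fps)"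
  have ep: "eqm K (ep k) (\<Prod>n\<in>{1..N}. f (k * n))" if "k > 0" "K \<le> N" for k N
  proof -
    have "eqm K (ep k) (\<Prod>i<N. 1 - fps_const 1 * fps_X ^ (k * i + k))"
      unfolding ep_def by (rule eqm_qpoch) (use that in auto)
    also have "(\<Prod>i<N. 1 - fps_const 1 * fps_X ^ (k * i + k)) = (\<Prod>n\<in>{1..N}. f (k * n))"
      by (rule prod.reindex_bij_witness[where i = "\<lambda>n. n - 1" and j = Suc]) (auto simp: f_def add.commute)
    finally show ?thesis .
  qed
  let ?D = "\<lambda>N. {n \<in> {1..N}. 3 dvd n}"
  have D: "(\<Prod>n\<in>?D (3 * N). g n) = (\<Prod>n\<in>{1..N}. g (3 * n))" for g :: "nat \<Rightarrow> complex fps" and N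
    by (rule prod.reindex_bij_witness[where i = "\<lambda>n. 3 * n" and j = "\<lambda>n. n div 3"]) auto
  define P where "P = (\<lambda>k N. \<Prod>n\<in>{1..N}. rot 1 (f (k * n)))"
  have P: "eqm K (rot 1 (ep k)) (P k N)" if "k > 0" "K \<le> N" for k N
    using eqm_rot[OF ep[OF that], of 1] by (simp add: P_def rot_prod)
  have D': "(\<Prod>n\<in>{1..3 * K}. if 3 dvd n then g n else rot 1 1) = (\<Prod>n\<in>{1..K}. g (3 * n))" for g :: "nat \<Rightarrow> complex fps"
    unfolding D[symmetric] by (simp add: rot_1 prod.If_cases Int_def)
  have "eqm K (norm3 (ep 1) * rot 1 (ep 9)) (norm3 (\<Prod>n\<in>{1..3 * K}. f (1 * n)) * P 9 K)"
    by (intro eqm_mult eqm_norm3 ep P) auto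
  also have "norm3 (\<Prod>n\<in>{1..3 * K}. f (1 * n)) * P 9 K =
     (\<Prod>n\<in>{1..3 * K}. norm3 (f n) * (if 3 dvd n then rot 1 (f (3 * n)) else rot 1 1))"
    using D'[of "\<lambda>n. rot 1 (f (3 * n))"] by (simp add: prod.distrib P_def norm3_def rot_prod mult_ac)
  also have "\<dots> = (\<Prod>n\<in>{1..3 * K}. (if 3 dvd n then rot 1 (f n) ^ 3 else rot 1 1) * rot 1 (f (3 * n)))"
    unfolding f_def norm3_factor ..
  also have "\<dots> = P 3 K ^ 3 * P 3 (3 * K)"
    using D'[of "\<lambda>n. rot 1 (f n) ^ 3"] by (simp add: prod.distrib P_def prod_power_distrib)
  also have "eqm K \<dots> (rot 1 (ep 3) ^ 3 * rot 1 (ep 3))"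
    by (intro eqm_mult eqm_power eqm_sym[OF P]) auto
  finally show "eqm K (norm3 (ep 1) * rot 1 (ep 9)) (rot 1 (ep 3) ^ 4)"
    by (simp add: eval_nat_numeral mult_ac)
qed

lemma rot_sub2: "rot w (sub 2 A) = fps_compose (rot (w ^ 2) A) (fps_X ^ 2)"
  by (auto simp: fps_eq_iff rot_nth sub_nth fps_nth_compose_X_power power_mult elim!: dvdE)

text \<open>This is \<open>norm3_ep\<close> with q^2 for q. Squaring permutes the cube roots of
  unity, as \<omega>^4 = \<omega>, so the norm commutes with the substitution.\<close>

lemma norm3_ep2: "norm3 (ep 2) * rot 1 (ep 18) = rot 1 (ep 6) ^ 4"
proof -
  have om4: "om ^ 4 = om"
    using om_cube by (simp add: eval_nat_numeral)
  have s: "fps_compose (rot 1 A) (fps_X ^ 2) = rot 1 (sub 2 A)" for A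
    using rot_sub2[of 1 A] by simp
  have "norm3 (sub 2 (ep 1)) = fps_compose (norm3 (ep 1)) (fps_X ^ 2)"
    by (simp add: norm3_def rot_sub2 om4 fps_compose_mult_distrib mult_ac)
  moreover have "fps_compose (norm3 (ep 1)) (fps_X ^ 2) * rot 1 (sub 2 (ep 9)) = rot 1 (sub 2 (ep 3)) ^ 4"
    using arg_cong[OF norm3_ep, of "\<lambda>F. fps_compose F (fps_X ^ 2)"]
    by (simp add: fps_compose_mult_distrib fps_compose_power[symmetric] s)
  ultimately show ?thesis by (simp add: sub_ep)
qed

section \<open>The differential equations of the modular parametrizations\<close>

lemma pow_expand:
  fixes x :: "'a::comm_ring_1"
  shows "x ^ 2 = x * x" "x ^ 3 = x * x * x" "x ^ 4 = x * x * x * x" "x ^ 5 = x * x * x * x * x"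
    "x ^ 6 = x * x * x * x * x * x" "x ^ 7 = x * x * x * x * x * x * x" "x ^ 8 = x * x * x * x * x * x * x * x"
    "x ^ 9 = x * x * x * x * x * x * x * x * x"
  by (simp_all add: eval_nat_numeral mult_ac)

lemma sub_eq: "A = B \<Longrightarrow> sub k A = sub k B" by simp

lemma psi_ep_sub: "k > 0 \<Longrightarrow> sub k psi * ep k = ep (k * 2) ^ 2"
  using sub_eq[OF psi_ep, of k] by (simp add: sub_simps)

lemma phim_ep_sub: "k > 0 \<Longrightarrow> sub k phim * ep (k * 2) = ep k ^ 2"
  using sub_eq[OF phim_ep, of k] by (simp add: sub_simps)

lemma phi_ep_sub: "k > 0 \<Longrightarrow> sub k phi * ep k ^ 2 * ep (k * 4) ^ 2 = ep (k * 2) ^ 5"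
  using sub_eq[OF phi_ep, of k] by (simp add: sub_simps)

lemma ep_cancel:
  assumes "A * B = A' * B" "B \<noteq> (0 :: rat fps)"
  shows "A = A'"
  using assms by simp

section \<open>Quartic theta identities, for conductor 32\<close>

lemma psi_sq: "psi ^ 2 = phi * sub 2 psi"
proof (rule ep_cancel)
  have s: "sub 2 psi * ep 2 = ep 4 ^ 2" using psi_ep_sub[of 2] by simp
  have "psi ^ 2 * (ep 1 ^ 2 * ep 4 ^ 2 * ep 2) = (psi * ep 1) ^ 2 * ep 4 ^ 2 * ep 2" by (simp add: pow_expand algebra_simps)
  also have "\<dots> = (phi * ep 1 ^ 2 * ep 4 ^ 2) * (sub 2 psi * ep 2)" unfolding psi_ep phi_ep s by (simp add: pow_expand algebra_simps)
  also have "\<dots> = phi * sub 2 psi * (ep 1 ^ 2 * ep 4 ^ 2 * ep 2)" by (simp add: pow_expand algebra_simps)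
  finally show "psi ^ 2 * (ep 1 ^ 2 * ep 4 ^ 2 * ep 2) = phi * sub 2 psi * (ep 1 ^ 2 * ep 4 ^ 2 * ep 2)" .
qed simp

lemma phi_phim: "phi * phim = sub 2 phim ^ 2"
proof (rule ep_cancel)
  have s: "sub 2 phim * ep 4 = ep 2 ^ 2" using phim_ep_sub[of 2] by simp
  have "phi * phim * (ep 1 ^ 2 * ep 4 ^ 2 * ep 2) = (phi * ep 1 ^ 2 * ep 4 ^ 2) * (phim * ep 2)" by (simp add: pow_expand algebra_simps)
  also have "\<dots> = (sub 2 phim * ep 4) ^ 2 * ep 1 ^ 2 * ep 2" unfolding phi_ep phim_ep s by (simp add: pow_expand algebra_simps)
  also have "\<dots> = sub 2 phim ^ 2 * (ep 1 ^ 2 * ep 4 ^ 2 * ep 2)" by (simp add: pow_expand algebra_simps)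
  finally show "phi * phim * (ep 1 ^ 2 * ep 4 ^ 2 * ep 2) = sub 2 phim ^ 2 * (ep 1 ^ 2 * ep 4 ^ 2 * ep 2)" .
qed simp

text \<open>By the 2-dissections, the difference \<delta> of the two sides of the first identity
  satisfies \<delta>(q^2) = - \<delta>(q). Hence it is invariant under q -> q^4, so it is a
  constant, and this constant is its own negative.\<close>

lemma phi_sq: "phi ^ 2 = sub 2 phi ^ 2 + 4 * fps_X * sub 4 psi ^ 2"
  and phim_sq: "phim ^ 2 = sub 2 phi ^ 2 - 4 * fps_X * sub 4 psi ^ 2"
proof -
  define \<delta> where "\<delta> = phi ^ 2 - (sub 2 phi ^ 2 + 4 * fps_X * sub 4 psi ^ 2)"
  have d1: "phi = sub 4 phi + 2 * fps_X * sub 8 psi" and d2: "phim = sub 4 phi - 2 * fps_X * sub 8 psi"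
    using phi_dissect2 phim_dissect2 by (simp_all add: sub_def)
  have s: "sub 4 psi ^ 2 = sub 4 phi * sub 8 psi"
    using sub_eq[OF psi_sq, of 4] by (simp add: sub_simps)
  have e: "\<delta> = sub 4 phi ^ 2 + 4 * fps_X ^ 2 * sub 8 psi ^ 2 - sub 2 phi ^ 2"
    unfolding \<delta>_def s by (subst d1) (simp add: algebra_simps power2_eq_square)
  have "sub 2 \<delta> = sub 2 phi ^ 2 - (sub 4 phi ^ 2 + 4 * fps_X ^ 2 * sub 8 psi ^ 2)"
    unfolding \<delta>_def by (simp add: sub_simps)
  then have neg: "sub 2 \<delta> = - \<delta>" unfolding e by simp
  have "sub 2 (- \<delta>) = - sub 2 \<delta>" by (simp add: sub_def fps_compose_uminus)
  then have "sub 2 (sub 2 \<delta>) = \<delta>" by (simp add: neg)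
  then have "sub 4 \<delta> = \<delta>" using sub_sub[of 2 2 \<delta>] by simp
  then have "\<delta> = fps_const (fps_nth \<delta> 0)" by (intro sub_fixed_const[of 4]) simp_all
  moreover have "fps_nth \<delta> 0 = 0" using arg_cong[OF neg, of "\<lambda>f. fps_nth f 0"] by simp
  ultimately have \<delta>: "\<delta> = 0" by simp
  then show "phi ^ 2 = sub 2 phi ^ 2 + 4 * fps_X * sub 4 psi ^ 2" by (simp add: \<delta>_def)
  have "phim ^ 2 = (sub 4 phi ^ 2 + 4 * fps_X ^ 2 * sub 8 psi ^ 2) - 4 * fps_X * (sub 4 phi * sub 8 psi)"
    by (subst d2) (simp add: algebra_simps power2_eq_square)
  also have "sub 4 phi ^ 2 + 4 * fps_X ^ 2 * sub 8 psi ^ 2 = sub 2 phi ^ 2" using e \<delta> by simp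
  finally show "phim ^ 2 = sub 2 phi ^ 2 - 4 * fps_X * sub 4 psi ^ 2" by (simp add: s)
qed

lemma phi_nth_0 [simp]: "fps_nth phi 0 = 1" and phim_nth_0 [simp]: "fps_nth phim 0 = 1"
  and psi_nth_0 [simp]: "fps_nth psi 0 = 1" and f12_nth_0 [simp]: "fps_nth f12 0 = 1"
  using arg_cong[OF phi_ep, of "\<lambda>f. fps_nth f 0"] arg_cong[OF phim_ep, of "\<lambda>f. fps_nth f 0"]
    arg_cong[OF psi_ep, of "\<lambda>f. fps_nth f 0"] arg_cong[OF f12_ep, of "\<lambda>f. fps_nth f 0"]
  by (simp_all add: fps_power_zeroth)

lemma nth_0_neq_0: "fps_nth F 0 = 1 \<Longrightarrow> F \<noteq> (0 :: rat fps)" by auto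

text \<open>Equivalent to the classical q d/dq log(\<theta>2 / \<theta>3) = \<theta>4^4 / 4, where
  \<theta>2 / \<theta>3 = 2 q^(1/4) \<psi>(q^2) / \<phi>(q). The squares of \<phi>(q) and
  \<psi>(q^2) are polynomials in q, \<phi>(q^2) and \<psi>(q^4), and the Wronskian of the latter two
  is the left side at q^2; so the quotient of the two sides is invariant under q -> q^2.\<close>

lemma theta_wronskian:
  "4 * (phi * fps_XD (sub 2 psi) - sub 2 psi * fps_XD phi) + phi * sub 2 psi = phi * sub 2 psi * phim ^ 4"
proof (rule sub_quotient_const[of 2])
  define a b p s where "a = sub 2 phi" and "b = sub 4 psi" and "p = sub 2 psi" and "s = sub 2 phim"
  define Da Db where "Da = fps_XD a" and "Db = fps_XD b"
  have h1: "phi ^ 2 = a ^ 2 + 4 * fps_X * b ^ 2" using phi_sq by (simp add: a_def b_def)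
  have h2: "p ^ 2 = a * b" using sub_eq[OF psi_sq, of 2] by (simp add: sub_simps a_def b_def p_def)
  have h3: "phi * phim = s ^ 2" using phi_phim by (simp add: s_def)
  have h4: "phim ^ 2 = a ^ 2 - 4 * fps_X * b ^ 2" using phim_sq by (simp add: a_def b_def)
  have d1: "2 * phi * fps_XD phi = 2 * a * Da + 4 * fps_X * b ^ 2 + 8 * fps_X * b * Db"
    using arg_cong[OF h1, of fps_XD] by (simp add: XD_simps Da_def Db_def algebra_simps)
  have d2: "2 * p * fps_XD p = a * Db + b * Da"
    using arg_cong[OF h2, of fps_XD] by (simp add: XD_simps Da_def Db_def algebra_simps)
  have e1: "2 * sub 2 (fps_XD p) = Db" using XD_sub[of 2 p] by (simp add: p_def b_def Db_def sub_sub)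
  have e2: "2 * sub 2 (fps_XD phi) = Da" using XD_sub[of 2 phi] by (simp add: a_def Da_def)
  let ?N = "4 * (phi * fps_XD p - p * fps_XD phi) + phi * p" and ?M = "phi * p * phim ^ 4"
  define N2 where "N2 = 2 * (a * Db - b * Da) + a * b"
  have sN: "sub 2 ?N = N2"
  proof -
    have "sub 2 ?N = 2 * (a * (2 * sub 2 (fps_XD p)) - b * (2 * sub 2 (fps_XD phi))) + a * b"
      by (simp add: sub_simps a_def b_def p_def algebra_simps)
    then show ?thesis by (simp add: e1 e2 N2_def)
  qed
  have sM: "sub 2 ?M = a * b * s ^ 4"
    by (simp add: sub_simps a_def b_def p_def s_def)
  have "2 * (phi * p * ?N) = 4 * (phi ^ 2 * (2 * p * fps_XD p) - p ^ 2 * (2 * phi * fps_XD phi)) + 2 * phi ^ 2 * p ^ 2"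
    by (simp add: pow_expand algebra_simps)
  also have "\<dots> = 2 * (phim ^ 2 * N2)"
    unfolding N2_def d1 d2 h4 h1 h2 by (simp add: pow_expand algebra_simps)
  finally have 1: "phi * p * ?N = phim ^ 2 * N2" by simp
  have "phi * p * ?M = p ^ 2 * (phi * phim) ^ 2 * phim ^ 2" by (simp add: pow_expand algebra_simps)
  also have "\<dots> = a * b * s ^ 4 * phim ^ 2" unfolding h2 h3 by (simp add: pow_expand algebra_simps)
  finally have 2: "phi * p * ?M = a * b * s ^ 4 * phim ^ 2" .
  have "(phi * p) * (?N * (a * b * s ^ 4)) = (phi * p * ?N) * (a * b * s ^ 4)" by (simp add: pow_expand algebra_simps)
  also have "\<dots> = N2 * (a * b * s ^ 4 * phim ^ 2)" unfolding 1 by (simp add: pow_expand algebra_simps)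
  also have "\<dots> = (phi * p) * (N2 * ?M)" unfolding 2[symmetric] by (simp add: pow_expand algebra_simps)
  finally have "(phi * p) * (?N * (a * b * s ^ 4)) = (phi * p) * (N2 * ?M)" .
  moreover have "phi * p \<noteq> 0" using nth_0_neq_0[of phi] nth_0_neq_0[of p] by (simp add: p_def)
  ultimately have "?N * sub 2 ?M = sub 2 ?N * ?M" unfolding sN sM by simp
  then show "(4 * (phi * fps_XD (sub 2 psi) - sub 2 psi * fps_XD phi) + phi * sub 2 psi) * sub 2 (phi * sub 2 psi * phim ^ 4) =
    sub 2 (4 * (phi * fps_XD (sub 2 psi) - sub 2 psi * fps_XD phi) + phi * sub 2 psi) * (phi * sub 2 psi * phim ^ 4)"
    by (simp only: p_def)
qed (simp_all add: fps_power_zeroth)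

text \<open>With q^4 for q, the functions x = u / q^2 and Y = y / q^3 satisfy Y^2 = x^3 + 4 x, the
  curve of conductor 32. The second equation then says that q dx/dq is - 2 Y times the
  newform.\<close>

lemma parametrization_4:
  assumes u: "u * sub 4 psi = sub 2 phi" and y: "y * sub 4 psi ^ 2 = sub 2 psi * phi"
  shows "y ^ 2 = u ^ 3 + 4 * fps_X * u" "u - 2 * fps_XD u = y * (ep 1 ^ 2 * ep 2 ^ 2)"
proof -
  define a b p s where "a = sub 2 phi" and "b = sub 4 psi" and "p = sub 2 psi" and "s = sub 2 phim"
  have b0: "b \<noteq> 0" using nth_0_neq_0[of b] by (simp add: b_def)
  have h1: "phi ^ 2 = a ^ 2 + 4 * fps_X * b ^ 2" using phi_sq by (simp add: a_def b_def)
  have h2: "p ^ 2 = a * b" using sub_eq[OF psi_sq, of 2] by (simp add: sub_simps a_def b_def p_def)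
  have u': "u * b = a" and y': "y * b ^ 2 = p * phi" using u y by (simp_all add: a_def b_def p_def)
  have "y ^ 2 * b ^ 4 = (y * b ^ 2) ^ 2" by (simp add: pow_expand algebra_simps)
  also have "\<dots> = p ^ 2 * phi ^ 2" unfolding y' by (simp add: pow_expand algebra_simps)
  also have "\<dots> = a ^ 3 * b + 4 * fps_X * a * b ^ 3" unfolding h1 h2 by (simp add: pow_expand algebra_simps)
  also have "\<dots> = (u ^ 3 + 4 * fps_X * u) * b ^ 4" unfolding u'[symmetric] by (simp add: pow_expand algebra_simps)
  finally have "y ^ 2 * b ^ 4 = (u ^ 3 + 4 * fps_X * u) * b ^ 4" .
  then show "y ^ 2 = u ^ 3 + 4 * fps_X * u" using b0 by simp
  have h3: "phi * phim = s ^ 2" using phi_phim by (simp add: s_def)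
  have w: "2 * (a * fps_XD b - b * fps_XD a) + a * b = a * b * s ^ 4"
  proof -
    define v w where "v = sub 2 (fps_XD p)" and "w = sub 2 (fps_XD phi)"
    have "sub 2 (4 * (phi * fps_XD p - p * fps_XD phi) + phi * p) = sub 2 (phi * p * phim ^ 4)"
      unfolding p_def using theta_wronskian by simp
    moreover have sp: "sub 2 p = b" by (simp add: p_def b_def sub_sub)
    ultimately have "4 * (a * v - b * w) + a * b = a * b * s ^ 4"
      by (simp add: sub_simps a_def s_def v_def w_def)
    moreover have "fps_XD b = 2 * v" using XD_sub[of 2 p] by (simp add: sp v_def)
    moreover have "fps_XD a = 2 * w" using XD_sub[of 2 phi] by (simp add: a_def w_def)
    moreover have "2 * (a * (2 * v) - b * (2 * w)) + a * b = 4 * (a * v - b * w) + a * b" by (simp add: pow_expand algebra_simps)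
    ultimately show ?thesis by simp
  qed
  define Da Db where "Da = fps_XD a" and "Db = fps_XD b"
  have d: "fps_XD u * b + u * Db = Da"
    using arg_cong[OF u', of fps_XD] by (simp add: XD_mult Da_def Db_def)
  have e: "p * phi * phim ^ 2 = ep 1 ^ 2 * ep 2 ^ 2"
  proof (rule ep_cancel)
    have s: "p * ep 2 = ep 4 ^ 2" using psi_ep_sub[of 2] by (simp add: p_def)
    have "p * phi * phim ^ 2 * (ep 2 ^ 3 * ep 1 ^ 2 * ep 4 ^ 2) = (p * ep 2) * (phi * ep 1 ^ 2 * ep 4 ^ 2) * (phim * ep 2) ^ 2"
      by (simp add: pow_expand algebra_simps)
    also have "\<dots> = ep 1 ^ 2 * ep 2 ^ 2 * (ep 2 ^ 3 * ep 1 ^ 2 * ep 4 ^ 2)"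
      unfolding s phi_ep phim_ep by (simp add: pow_expand algebra_simps)
    finally show "p * phi * phim ^ 2 * (ep 2 ^ 3 * ep 1 ^ 2 * ep 4 ^ 2) = ep 1 ^ 2 * ep 2 ^ 2 * (ep 2 ^ 3 * ep 1 ^ 2 * ep 4 ^ 2)" .
  qed simp
  have "(u - 2 * fps_XD u) * b ^ 2 = 2 * (a * Db - b * Da) + a * b"
    unfolding d[symmetric] u'[symmetric] by (simp add: pow_expand algebra_simps)
  also have "\<dots> = a * b * s ^ 4" using w by (simp add: Da_def Db_def)
  also have "\<dots> = p ^ 2 * (s ^ 2) ^ 2" unfolding h2 by (simp add: pow_expand algebra_simps)
  also have "\<dots> = p * phi * (p * phi * phim ^ 2)" unfolding h3[symmetric] by (simp add: pow_expand algebra_simps)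
  also have "\<dots> = (y * b ^ 2) * (ep 1 ^ 2 * ep 2 ^ 2)" unfolding e y' ..
  also have "\<dots> = y * (ep 1 ^ 2 * ep 2 ^ 2) * b ^ 2" by (simp add: pow_expand algebra_simps)
  finally show "u - 2 * fps_XD u = y * (ep 1 ^ 2 * ep 2 ^ 2)" using b0 by simp
qed

section \<open>Cubic theta identities, for conductor 36\<close>

lemma f12_cube: "f12 ^ 3 * sub 3 psi + fps_X * sub 3 psi ^ 4 = psi ^ 4"
proof -
  define F P where "F = sub 3 f12" and "P = sub 9 psi"
  have P9: "P = sub 3 (sub 3 psi)" by (simp add: P_def sub_sub)
  have psi: "psi = F + fps_X * P"
    using psi_dissect3 by (simp add: F_def P_def sub_def)
  \<comment> \<open>The norm of \<psi>(q) is computed here from its 3-dissection and below from its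
    eta quotient. Equating the two gives the claim with q^3 for q.\<close>
  have "norm3 (F + fps_X * P) = rot 1 (F ^ 3 + fps_X ^ 3 * P ^ 3)"
    unfolding P9 F_def by (rule norm3_linear)
  then have "norm3 psi = rot 1 (F ^ 3 + fps_X ^ 3 * P ^ 3)" unfolding psi[symmetric] .
  moreover have "rot 1 (sub 3 psi ^ 4) = norm3 psi * rot 1 P"
  proof -
    define r where "r = (\<lambda>A. rot 1 A)"
    have e: "norm3 (ep 1) * r (ep 9) = r (ep 3) ^ 4" "norm3 (ep 2) * r (ep 18) = r (ep 6) ^ 4"
      using norm3_ep norm3_ep2 by (simp_all add: r_def)
    have n: "norm3 psi * norm3 (ep 1) = norm3 (ep 2) ^ 2"
      using psi_ep by (metis norm3_mult norm3_power)
    have m: "r (sub 3 psi) * r (ep 3) = r (ep 6) ^ 2" "r P * r (ep 9) = r (ep 18) ^ 2"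
      using psi_ep_sub[of 3] psi_ep_sub[of 9] by (simp_all add: r_def P_def flip: rot_mult rot_power)
    have nz: "r (ep k) \<noteq> 0" if "k > 0" for k
    proof
      assume "r (ep k) = 0"
      then have "fps_nth (r (ep k)) 0 = 0" by simp
      then show False using that by (simp add: r_def rot_nth)
    qed
    let ?K = "norm3 (ep 1) * r (ep 18) ^ 2 * r (ep 9) * r (ep 3) ^ 4"
    have "norm3 psi * r P * ?K = (norm3 psi * norm3 (ep 1)) * (r P * r (ep 9)) * r (ep 18) ^ 2 * r (ep 3) ^ 4"
      by (simp add: pow_expand algebra_simps)
    also have "\<dots> = (norm3 (ep 2) * r (ep 18)) ^ 2 * r (ep 18) ^ 2 * r (ep 3) ^ 4"
      unfolding n m by (simp add: pow_expand algebra_simps)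
    also have "\<dots> = (r (ep 6) ^ 2) ^ 4 * (r (ep 3) ^ 4) * r (ep 18) ^ 2" unfolding e by (simp add: pow_expand algebra_simps)
    also have "\<dots> = (r (sub 3 psi) * r (ep 3)) ^ 4 * (norm3 (ep 1) * r (ep 9)) * r (ep 18) ^ 2"
      unfolding m e ..
    also have "\<dots> = r (sub 3 psi) ^ 4 * ?K" by (simp add: pow_expand algebra_simps)
    finally have "norm3 psi * r P * ?K = r (sub 3 psi) ^ 4 * ?K" .
    moreover have "norm3 (ep 1) \<noteq> 0" using e(1) nz[of 3] by auto
    ultimately show ?thesis using nz by (simp add: r_def rot_power)
  qed
  ultimately have "rot 1 (sub 3 psi ^ 4) = rot 1 ((F ^ 3 + fps_X ^ 3 * P ^ 3) * P)"
    by (simp add: rot_mult)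
  then have "sub 3 psi ^ 4 = (F ^ 3 + fps_X ^ 3 * P ^ 3) * P" by (rule rot_1_inj)
  then have "sub 3 (psi ^ 4) = (F ^ 3 + fps_X ^ 3 * P ^ 3) * P" by (simp add: sub_simps)
  also have "\<dots> = sub 3 (f12 ^ 3 * sub 3 psi + fps_X * sub 3 psi ^ 4)"
    by (simp add: F_def P_def sub_simps pow_expand algebra_simps)
  finally have "sub 3 (psi ^ 4) = sub 3 (f12 ^ 3 * sub 3 psi + fps_X * sub 3 psi ^ 4)" .
  then show ?thesis by (simp add: sub_inj)
qed


text \<open>The left side is 3 f(q, q^2) \<psi>(q^3) times the logarithmic derivative of q^(1/3)
  \<psi>(q^3) / f(q, q^2). As in \<open>theta_wronskian\<close>, the quotient of the two sides is
  invariant, here under q -> q^3: the relations \<open>h1\<close> to \<open>h3\<close> express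
  everything through the components A and B of the 3-dissection of \<psi>, whose Wronskian is the
  left side at q^3.\<close>

lemma cubic_wronskian:
  "f12 * sub 3 psi - 3 * (sub 3 psi * fps_XD f12 - f12 * fps_XD (sub 3 psi)) = psi ^ 2 * ep 1 ^ 4"
proof (rule sub_quotient_const[of 3])
  define A B P Q where "A = sub 3 f12" and "B = sub 9 psi" and "P = psi" and "Q = sub 3 psi"
  define DA DB where "DA = fps_XD A" and "DB = fps_XD B"
  define DF DQ where "DF = fps_XD f12" and "DQ = fps_XD Q"
  have h1: "P = A + fps_X * B"
    using psi_dissect3 by (simp add: A_def B_def P_def sub_def)
  have h2: "f12 ^ 3 * Q = P ^ 4 - fps_X * Q ^ 4"
    using f12_cube by (simp add: P_def Q_def algebra_simps)
  have h3: "Q ^ 4 = B * (A ^ 3 + fps_X ^ 3 * B ^ 3)"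
    using sub_eq[OF f12_cube, of 3] by (simp add: A_def B_def Q_def sub_simps algebra_simps eval_nat_numeral)
  \<comment> \<open>The square of this expression is the cofactor that appears when the Wronskian is
    rewritten in A and B. Being an eta quotient, it can be compared with the right side.\<close>
  have h4: "A - 2 * fps_X * B = phim * (ep 6 * inverse (ep 3))"
  proof -
    have i: "ep 3 * inverse (ep 3) = 1" by (metis ep_nth_0 inverse_mult_eq_1 mult.commute zero_less_numeral zero_neq_one)
    have eq1: "phim = sub 9 phim - 2 * fps_X * sub 3 f15m" using phim_dissect3 by (simp add: sub_def)
    have eq2: "sub 9 phim * ep 6 = A * ep 3"
    proof (rule ep_cancel)
      have 1: "A * ep 3 * ep 18 = ep 6 * ep 9 ^ 2" using sub_eq[OF f12_ep, of 3] by (simp add: A_def sub_simps)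
      have 2: "sub 9 phim * ep 18 = ep 9 ^ 2" using phim_ep_sub[of 9] by simp
      have "sub 9 phim * ep 6 * ep 18 = ep 6 * (sub 9 phim * ep 18)" by (simp add: pow_expand algebra_simps)
      then show "sub 9 phim * ep 6 * ep 18 = A * ep 3 * ep 18" unfolding 1 2 .
    qed simp
    have eq3: "sub 3 f15m * ep 6 = B * ep 3"
    proof (rule ep_cancel)
      have "sub 3 f15m * ep 6 * ep 9 = ep 3 * ep 18 ^ 2" using sub_eq[OF f15m_ep, of 3] by (simp add: sub_simps)
      moreover have "ep 18 ^ 2 = B * ep 9" using psi_ep_sub[of 9] by (simp add: B_def)
      ultimately show "sub 3 f15m * ep 6 * ep 9 = B * ep 3 * ep 9" by (simp add: mult_ac)
    qed simp
    note eqs = eq1 eq2 eq3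
    have "phim * ep 6 = sub 9 phim * ep 6 - 2 * fps_X * (sub 3 f15m * ep 6)"
      by (subst eqs(1)) (simp add: pow_expand algebra_simps)
    also have "\<dots> = (A - 2 * fps_X * B) * ep 3" unfolding eqs(2,3) by (simp add: pow_expand algebra_simps)
    finally have "phim * ep 6 * inverse (ep 3) = (A - 2 * fps_X * B) * (ep 3 * inverse (ep 3))"
      by (simp add: mult.assoc)
    then show ?thesis unfolding i by (simp add: mult.assoc)
  qed
  have d1: "fps_XD P = DA + fps_X * B + fps_X * DB"
    using arg_cong[OF h1, of fps_XD] by (simp add: XD_simps DA_def DB_def algebra_simps)
  have d2: "3 * f12 ^ 2 * DF * Q + f12 ^ 3 * DQ = 4 * P ^ 3 * fps_XD P - fps_X * Q ^ 4 - 4 * fps_X * Q ^ 3 * DQ"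
    using arg_cong[OF h2, of fps_XD] by (simp add: XD_simps DF_def DQ_def algebra_simps)
  have d3: "4 * Q ^ 3 * DQ = DB * A ^ 3 + 3 * A ^ 2 * B * DA + 3 * fps_X ^ 3 * B ^ 4 + 4 * fps_X ^ 3 * B ^ 3 * DB"
    using arg_cong[OF h3, of fps_XD] by (simp add: XD_simps DA_def DB_def DQ_def algebra_simps eval_nat_numeral)
  define N M where "N = f12 * Q - 3 * (Q * DF - f12 * DQ)" and "M = P ^ 2 * ep 1 ^ 4"
  define N2 where "N2 = A * B - (B * DA - A * DB)"
  have sN: "sub 3 N = N2"
  proof -
    have "3 * sub 3 (fps_XD f12) = DA" "3 * sub 3 (fps_XD Q) = DB"
      using XD_sub[of 3 f12] XD_sub[of 3 Q] by (simp_all add: A_def B_def Q_def DA_def DB_def sub_sub)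
    moreover have "sub 3 N = A * B - (B * (3 * sub 3 DF) - A * (3 * sub 3 DQ))"
      by (simp add: N_def sub_simps A_def B_def Q_def algebra_simps)
    ultimately show ?thesis by (simp add: N2_def DF_def DQ_def)
  qed
  have sM: "sub 3 M = Q ^ 2 * ep 3 ^ 4"
    by (simp add: M_def P_def Q_def sub_simps)
  have 1: "Q * f12 ^ 2 * N = P ^ 3 * (P * Q - 4 * Q * fps_XD P + 4 * P * DQ)"
  proof -
    have "Q * f12 ^ 2 * N = Q * (f12 ^ 3 * Q) - Q * (3 * f12 ^ 2 * DF * Q + f12 ^ 3 * DQ) + 4 * (f12 ^ 3 * Q) * DQ"
      unfolding N_def by (simp add: pow_expand algebra_simps)
    also have "\<dots> = P ^ 3 * (P * Q - 4 * Q * fps_XD P + 4 * P * DQ)" unfolding h2 d2 by (simp add: pow_expand algebra_simps)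
    finally show ?thesis .
  qed
  have 2: "P * Q ^ 4 - 4 * Q ^ 4 * fps_XD P + P * (4 * Q ^ 3 * DQ) = P * (A - 2 * fps_X * B) ^ 2 * N2"
    unfolding N2_def h3 d3 d1 unfolding h1 by (simp add: pow_expand algebra_simps)
  have 3: "Q ^ 4 * f12 ^ 2 * N = P ^ 4 * (A - 2 * fps_X * B) ^ 2 * N2"
  proof -
    have "Q ^ 4 * f12 ^ 2 * N = Q ^ 3 * (Q * f12 ^ 2 * N)" by (simp add: pow_expand algebra_simps)
    also have "\<dots> = P ^ 3 * (P * Q ^ 4 - 4 * Q ^ 4 * fps_XD P + P * (4 * Q ^ 3 * DQ))" unfolding 1 by (simp add: pow_expand algebra_simps)
    also have "\<dots> = P ^ 4 * (A - 2 * fps_X * B) ^ 2 * N2" unfolding 2 by (simp add: pow_expand algebra_simps)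
    finally show ?thesis .
  qed
  have i: "ep 3 * inverse (ep 3) = 1" by (metis ep_nth_0 inverse_mult_eq_1 mult.commute zero_less_numeral zero_neq_one)
  have 4: "Q ^ 4 * f12 ^ 2 * M = P ^ 4 * (A - 2 * fps_X * B) ^ 2 * (Q ^ 2 * ep 3 ^ 4)"
  proof -
    have "Q * f12 * ep 1 ^ 2 = P * phim * ep 6 * ep 3"
    proof (rule ep_cancel)
      have q: "Q * ep 3 = ep 6 ^ 2" "P * ep 1 = ep 2 ^ 2" using psi_ep_sub[of 3] psi_ep by (simp_all add: Q_def P_def)
      have "Q * f12 * ep 1 ^ 2 * (ep 1 * ep 6 * ep 3 * ep 2) = (Q * ep 3) * (f12 * ep 1 * ep 6) * ep 1 ^ 2 * ep 2"
        by (simp add: pow_expand algebra_simps)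
      also have "\<dots> = (P * ep 1) * (phim * ep 2) * ep 6 ^ 2 * ep 3 ^ 2"
        unfolding q f12_ep phim_ep by (simp add: pow_expand algebra_simps)
      also have "\<dots> = P * phim * ep 6 * ep 3 * (ep 1 * ep 6 * ep 3 * ep 2)" by (simp add: pow_expand algebra_simps)
      finally show "Q * f12 * ep 1 ^ 2 * (ep 1 * ep 6 * ep 3 * ep 2) = P * phim * ep 6 * ep 3 * (ep 1 * ep 6 * ep 3 * ep 2)" .
    qed simp
    note w = this
    have "Q ^ 4 * f12 ^ 2 * M = Q ^ 2 * P ^ 2 * (Q * f12 * ep 1 ^ 2) ^ 2" unfolding M_def by (simp add: pow_expand algebra_simps)
    also have "\<dots> = P ^ 4 * phim ^ 2 * ep 6 ^ 2 * ep 3 ^ 2 * Q ^ 2 * 1 ^ 2" unfolding w by (simp add: pow_expand algebra_simps)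
    also have "\<dots> = P ^ 4 * (A - 2 * fps_X * B) ^ 2 * (Q ^ 2 * ep 3 ^ 4)"
      unfolding i[symmetric] h4 by (simp add: pow_expand algebra_simps)
    finally show ?thesis .
  qed
  have "(Q ^ 4 * f12 ^ 2) * (N * sub 3 M) = (Q ^ 4 * f12 ^ 2) * (sub 3 N * M)"
  proof -
    have "(Q ^ 4 * f12 ^ 2) * (N * (Q ^ 2 * ep 3 ^ 4)) = (Q ^ 4 * f12 ^ 2 * N) * (Q ^ 2 * ep 3 ^ 4)" by (simp add: pow_expand algebra_simps)
    also have "\<dots> = N2 * (P ^ 4 * (A - 2 * fps_X * B) ^ 2 * (Q ^ 2 * ep 3 ^ 4))" unfolding 3 by (simp add: pow_expand algebra_simps)
    also have "\<dots> = (Q ^ 4 * f12 ^ 2) * (N2 * M)" unfolding 4[symmetric] by (simp add: pow_expand algebra_simps)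
    finally show ?thesis unfolding sN sM .
  qed
  moreover have "Q ^ 4 * f12 ^ 2 \<noteq> 0" using nth_0_neq_0[of Q] nth_0_neq_0[of f12] by (simp add: Q_def)
  ultimately show "(f12 * sub 3 psi - 3 * (sub 3 psi * fps_XD f12 - f12 * fps_XD (sub 3 psi))) * sub 3 (psi ^ 2 * ep 1 ^ 4) =
    sub 3 (f12 * sub 3 psi - 3 * (sub 3 psi * fps_XD f12 - f12 * fps_XD (sub 3 psi))) * (psi ^ 2 * ep 1 ^ 4)"
    by (simp add: N_def M_def P_def Q_def DF_def DQ_def)
qed (simp_all add: fps_power_zeroth)

text \<open>With q^6 for q, the functions x = u / q^2 and Y = y / q^3 satisfy Y^2 = x^3 + 1, the
  curve of conductor 36, and again q dx/dq is - 2 Y times the newform.\<close>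

lemma parametrization_6:
  assumes u: "u * sub 3 psi = f12" and y: "y * sub 3 psi ^ 2 = psi ^ 2"
  shows "y ^ 2 = u ^ 3 + fps_X" "u - 3 * fps_XD u = y * ep 1 ^ 4"
proof -
  define Q where "Q = sub 3 psi"
  have Q0: "Q \<noteq> 0" using nth_0_neq_0[of Q] by (simp add: Q_def)
  note u' = u[folded Q_def] and y' = y[folded Q_def]
  have c: "f12 ^ 3 * Q + fps_X * Q ^ 4 = psi ^ 4" using f12_cube by (simp add: Q_def)
  have "y ^ 2 * Q ^ 4 = (y * Q ^ 2) ^ 2" by (simp add: pow_expand algebra_simps)
  also have "\<dots> = psi ^ 4" unfolding y' by (simp add: pow_expand algebra_simps)
  also have "\<dots> = (u * Q) ^ 3 * Q + fps_X * Q ^ 4" unfolding c[symmetric] u' ..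
  also have "\<dots> = (u ^ 3 + fps_X) * Q ^ 4" by (simp add: pow_expand algebra_simps)
  finally have "y ^ 2 * Q ^ 4 = (u ^ 3 + fps_X) * Q ^ 4" .
  then show "y ^ 2 = u ^ 3 + fps_X" using Q0 by simp
  have d: "fps_XD u * Q + u * fps_XD Q = fps_XD f12"
    using arg_cong[OF u', of fps_XD] by (simp add: XD_mult)
  have w: "f12 * Q - 3 * (Q * fps_XD f12 - f12 * fps_XD Q) = psi ^ 2 * ep 1 ^ 4"
    using cubic_wronskian by (simp add: Q_def)
  have "(u - 3 * fps_XD u) * Q ^ 2 = (u * Q) * Q - 3 * (Q * (fps_XD u * Q + u * fps_XD Q) - (u * Q) * fps_XD Q)"
    by (simp add: pow_expand algebra_simps)
  also have "\<dots> = psi ^ 2 * ep 1 ^ 4" unfolding d u' by (rule w)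
  also have "\<dots> = y * ep 1 ^ 4 * Q ^ 2" unfolding y'[symmetric] by (simp add: pow_expand algebra_simps)
  finally have "(u - 3 * fps_XD u) * Q ^ 2 = y * ep 1 ^ 4 * Q ^ 2" .
  then show "u - 3 * fps_XD u = y * ep 1 ^ 4" using Q0 by simp
qed

section \<open>Borwein's cubic theta functions, for conductor 27\<close>

definition ca :: "rat fps" where "ca = jac * inverse (ep 1)"
definition cb :: "rat fps" where "cb = ep 1 ^ 3 * inverse (ep 3)"
text \<open>\<open>ca\<close>, \<open>cb\<close> and \<open>cc\<close> are a(q), b(q) and c(q) / (3
  q^(1/3)); the division makes the exponents integral and the constant term 1. Taking a(q) from the
  3-dissection of E(q)^3, rather than as a lattice sum, gives \<open>cb_dissect\<close> at
  once.\<close>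

definition cc :: "rat fps" where "cc = ep 3 ^ 3 * inverse (ep 1)"

lemma ep_inverse: "k > 0 \<Longrightarrow> inverse (ep k) * ep k = 1"
  by (rule inverse_mult_eq_1) simp

lemma ca_ep: "ca * ep 1 = jac" and cb_ep: "cb * ep 3 = ep 1 ^ 3" and cc_ep: "cc * ep 1 = ep 3 ^ 3"
  by (simp_all add: ca_def cb_def cc_def mult.assoc ep_inverse del: One_nat_def)

lemma cc_ep_sub: "k > 0 \<Longrightarrow> sub k cc * ep k = ep (k * 3) ^ 3"
  using sub_eq[OF cc_ep, of k] by (simp add: sub_simps)

lemma cb_dissect: "cb = sub 3 ca - 3 * fps_X * sub 3 cc"
proof (rule ep_cancel)
  have 1: "sub 3 ca * ep 3 = sub 3 jac" using sub_eq[OF ca_ep, of 3] by (simp add: sub_simps)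
  have 2: "sub 3 cc * ep 3 = ep 9 ^ 3" using cc_ep_sub[of 3] by simp
  have "cb * ep 3 = sub 3 jac - 3 * fps_X * ep 9 ^ 3"
    unfolding cb_ep using jacobi_dissect3 by (simp add: sub_def)
  also have "\<dots> = (sub 3 ca - 3 * fps_X * sub 3 cc) * ep 3"
    unfolding 1[symmetric] 2[symmetric] by (simp add: pow_expand algebra_simps)
  finally show "cb * ep 3 = (sub 3 ca - 3 * fps_X * sub 3 cc) * ep 3" .
qed simp

text \<open>Borwein's identity a^3 = b^3 + c^3. The norm of b is b(q^3)^3 by its eta quotient and
  a(q^3)^3 - 27 q^3 cc(q^3)^3 by its 3-dissection.\<close>

lemma cubic_sum: "ca ^ 3 = cb ^ 3 + 27 * fps_X * cc ^ 3"
proof -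
  have n: "sub 3 (- 3 * cc) = - 3 * sub 3 cc"
  proof -
    have eq: "(- 3 :: rat fps) = fps_const (- 3)" by (simp add: numeral_fps_const)
    show ?thesis unfolding eq by (simp only: sub_mult sub_const zero_less_numeral)
  qed
  have "norm3 (sub 3 ca + fps_X * sub 3 (- 3 * cc)) = rot 1 (sub 3 ca ^ 3 + fps_X ^ 3 * sub 3 (- 3 * cc) ^ 3)"
    by (rule norm3_linear)
  then have "norm3 cb = rot 1 (sub 3 ca ^ 3 + fps_X ^ 3 * sub 3 (- 3 * cc) ^ 3)"
    unfolding n by (simp add: cb_dissect mult_ac)
  moreover have "norm3 cb = rot 1 (sub 3 cb ^ 3)"
  proof -
    define r where "r = (\<lambda>A. rot 1 A)"
    have e: "norm3 (ep 1) * r (ep 9) = r (ep 3) ^ 4" using norm3_ep by (simp add: r_def)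
    have "norm3 cb * norm3 (sub 3 (ep 1)) = norm3 (ep 1) ^ 3"
      using cb_ep by (simp add: sub_simps flip: norm3_mult norm3_power)
    then have n: "norm3 cb * r (ep 3) ^ 3 = norm3 (ep 1) ^ 3"
      unfolding norm3_sub3 by (simp add: sub_simps r_def)
    have "sub 3 cb * ep 9 = ep 3 ^ 3" using sub_eq[OF cb_ep, of 3] by (simp add: sub_simps)
    then have m: "r (sub 3 cb) * r (ep 9) = r (ep 3) ^ 3" by (simp add: r_def flip: rot_mult rot_power)
    have nz: "r (ep k) \<noteq> 0" if "k > 0" for k
    proof
      assume "r (ep k) = 0"
      then have "fps_nth (r (ep k)) 0 = 0" by simp
      then show False using that by (simp add: r_def rot_nth)
    qed
    have "norm3 cb * (r (ep 3) ^ 3 * r (ep 9) ^ 3) = (norm3 cb * r (ep 3) ^ 3) * r (ep 9) ^ 3" by (simp add: pow_expand algebra_simps)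
    also have "\<dots> = (norm3 (ep 1) * r (ep 9)) ^ 3" unfolding n by (simp add: pow_expand algebra_simps)
    also have "\<dots> = (r (sub 3 cb) * r (ep 9)) ^ 3 * r (ep 3) ^ 3" unfolding e m by (simp add: pow_expand algebra_simps)
    also have "\<dots> = r (sub 3 cb) ^ 3 * (r (ep 3) ^ 3 * r (ep 9) ^ 3)" by (simp add: pow_expand algebra_simps)
    finally have "norm3 cb * (r (ep 3) ^ 3 * r (ep 9) ^ 3) = r (sub 3 cb) ^ 3 * (r (ep 3) ^ 3 * r (ep 9) ^ 3)" .
    then show ?thesis using nz by (simp add: r_def rot_power)
  qed
  ultimately have "sub 3 cb ^ 3 = sub 3 ca ^ 3 + fps_X ^ 3 * sub 3 (- 3 * cc) ^ 3"
    by (metis rot_1_inj)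
  then have "sub 3 (cb ^ 3) = sub 3 (ca ^ 3 - 27 * fps_X * cc ^ 3)"
    unfolding n by (simp add: sub_simps pow_expand)
  then show ?thesis by (simp add: sub_inj)
qed

lemma ca_nth_0 [simp]: "fps_nth ca 0 = 1"
proof -
  have "fps_nth cb 0 = 1" by (simp add: cb_def fps_power_zeroth)
  then show ?thesis using arg_cong[OF cb_dissect, of "\<lambda>f. fps_nth f 0"] by (simp add: fps_mult_nth_0)
qed

lemma cb_nth_0 [simp]: "fps_nth cb 0 = 1" and cc_nth_0 [simp]: "fps_nth cc 0 = 1"
  by (simp_all add: cb_def cc_def fps_power_zeroth)

text \<open>The quadratic form is the cofactor of b(q) = A - 3 q K in A^3 - 27 q^3 K^3, where A and
  K are \<open>ca\<close> and \<open>cc\<close> at q^3. By \<open>cubic_sum\<close> this difference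
  is b(q^3)^3, and what remains is a relation between eta quotients.\<close>

lemma cc_cube: "cc ^ 3 = sub 3 cc * (sub 3 ca ^ 2 + 3 * fps_X * sub 3 ca * sub 3 cc + 9 * fps_X ^ 2 * sub 3 cc ^ 2)"
proof -
  define A K B where "A = sub 3 ca" and "K = sub 3 cc" and "B = sub 3 cb"
  have b: "cb = A - 3 * fps_X * K" using cb_dissect by (simp add: A_def K_def)
  have B: "A ^ 3 = B ^ 3 + 27 * fps_X ^ 3 * K ^ 3"
    using sub_eq[OF cubic_sum, of 3] by (simp add: A_def B_def K_def sub_simps)
  have e1: "cc * ep 1 = ep 3 ^ 3" "cb * ep 3 = ep 1 ^ 3" by (rule cc_ep cb_ep)+
  have e2: "K * ep 3 = ep 9 ^ 3" using cc_ep_sub[of 3] by (simp add: K_def)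
  have e3: "B * ep 9 = ep 3 ^ 3" using sub_eq[OF cb_ep, of 3] by (simp add: B_def sub_simps)
  have 1: "cb * (A ^ 2 + 3 * fps_X * A * K + 9 * fps_X ^ 2 * K ^ 2) = B ^ 3"
  proof -
    have "cb * (A ^ 2 + 3 * fps_X * A * K + 9 * fps_X ^ 2 * K ^ 2) = A ^ 3 - 27 * fps_X ^ 3 * K ^ 3"
      unfolding b by (simp add: pow_expand algebra_simps)
    then show ?thesis unfolding B by simp
  qed
  have "cc ^ 3 * (cb * ep 3 * ep 9 ^ 3) = K * B ^ 3 * (ep 3 * ep 9 ^ 3)"
  proof -
    have "cc ^ 3 * (cb * ep 3 * ep 9 ^ 3) = (cc * ep 1) ^ 3 * ep 9 ^ 3"
      unfolding e1(2) by (simp add: pow_expand algebra_simps)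
    also have "\<dots> = (K * ep 3) * (B * ep 9) ^ 3" unfolding e1(1) e2 e3 by (simp add: pow_expand algebra_simps)
    also have "\<dots> = K * B ^ 3 * (ep 3 * ep 9 ^ 3)" by (simp add: pow_expand algebra_simps)
    finally show ?thesis .
  qed
  then have "cc ^ 3 * (cb * ep 3 * ep 9 ^ 3) = (K * (A ^ 2 + 3 * fps_X * A * K + 9 * fps_X ^ 2 * K ^ 2)) * (cb * ep 3 * ep 9 ^ 3)"
    unfolding 1[symmetric] by (simp add: mult_ac)
  then show ?thesis unfolding A_def[symmetric] K_def[symmetric]
    by (rule ep_cancel) (simp add: nth_0_neq_0)
qed

text \<open>The two sides have the same cube, by \<open>cubic_sum\<close> and
  \<open>cc_cube\<close>, and the same constant term 1.\<close>

lemma ca_dissect: "ca = sub 3 ca + 6 * fps_X * sub 3 cc"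
proof (rule fps_cube_unique)
  have "ca ^ 3 = cb ^ 3 + 27 * fps_X * cc ^ 3" by (rule cubic_sum)
  also have "\<dots> = (sub 3 ca + 6 * fps_X * sub 3 cc) ^ 3"
    unfolding cc_cube cb_dissect by (simp add: pow_expand algebra_simps)
  finally show "ca ^ 3 = (sub 3 ca + 6 * fps_X * sub 3 cc) ^ 3" .
qed (simp_all add: fps_mult_nth_0)

text \<open>This is q d/dq log(c / a) = b^3 / (3 a) with denominators cleared, proved like
  \<open>theta_wronskian\<close> by invariance under q -> q^3.\<close>

lemma borwein_wronskian: "3 * (ca * fps_XD cc - cc * fps_XD ca) + ca * cc = cb ^ 3 * cc"
proof (rule sub_quotient_const[of 3])
  define A K B where "A = sub 3 ca" and "K = sub 3 cc" and "B = sub 3 cb"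
  define DA DK Da Dc where "DA = fps_XD A" and "DK = fps_XD K" and "Da = fps_XD ca" and "Dc = fps_XD cc"
  have b: "cb = A - 3 * fps_X * K" using cb_dissect by (simp add: A_def K_def)
  have a: "ca = A + 6 * fps_X * K" using ca_dissect by (simp add: A_def K_def)
  have B: "A ^ 3 = B ^ 3 + 27 * fps_X ^ 3 * K ^ 3"
    using sub_eq[OF cubic_sum, of 3] by (simp add: A_def B_def K_def sub_simps)
  have c: "cc ^ 3 = K * (A ^ 2 + 3 * fps_X * A * K + 9 * fps_X ^ 2 * K ^ 2)"
    using cc_cube by (simp add: A_def K_def)
  have da: "Da = DA + 6 * fps_X * K + 6 * fps_X * DK"
    using arg_cong[OF a, of fps_XD] by (simp add: XD_simps DA_def DK_def Da_def algebra_simps)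
  have dc: "3 * cc ^ 2 * Dc = DK * (A ^ 2 + 3 * fps_X * A * K + 9 * fps_X ^ 2 * K ^ 2) +
     K * (2 * A * DA + 3 * fps_X * A * K + 3 * fps_X * DA * K + 3 * fps_X * A * DK + 18 * fps_X ^ 2 * K ^ 2 + 18 * fps_X ^ 2 * K * DK)"
    using arg_cong[OF c, of fps_XD]
    by (simp add: XD_simps DA_def DK_def Dc_def algebra_simps eval_nat_numeral)
  define N where "N = 3 * (ca * Dc - cc * Da) + ca * cc"
  define N2 where "N2 = A * DK - K * DA + A * K"
  have sN: "sub 3 N = N2"
  proof -
    have "3 * sub 3 (fps_XD ca) = DA" "3 * sub 3 (fps_XD cc) = DK"
      using XD_sub[of 3 ca] XD_sub[of 3 cc] by (simp_all add: A_def K_def DA_def DK_def)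
    moreover have "sub 3 N = A * (3 * sub 3 Dc) - K * (3 * sub 3 Da) + A * K"
      by (simp add: N_def sub_simps A_def K_def algebra_simps)
    ultimately show ?thesis by (simp add: N2_def Da_def Dc_def)
  qed
  have sM: "sub 3 (cb ^ 3 * cc) = B ^ 3 * K" by (simp add: B_def K_def sub_simps)
  have "cc ^ 2 * N = ca * (3 * cc ^ 2 * Dc) - 3 * cc ^ 3 * Da + ca * cc ^ 3"
    unfolding N_def by (simp add: pow_expand algebra_simps)
  also have "\<dots> = cb ^ 2 * N2"
    unfolding N2_def dc c da a b by (simp add: pow_expand algebra_simps)
  finally have 1: "cc ^ 2 * N = cb ^ 2 * N2" .
  have 2: "cc ^ 2 * (cb ^ 3 * cc) = cb ^ 2 * (B ^ 3 * K)"
  proof -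
    have "cb * (A ^ 2 + 3 * fps_X * A * K + 9 * fps_X ^ 2 * K ^ 2) = A ^ 3 - 27 * fps_X ^ 3 * K ^ 3"
      unfolding b by (simp add: pow_expand algebra_simps)
    then have d: "cb * (A ^ 2 + 3 * fps_X * A * K + 9 * fps_X ^ 2 * K ^ 2) = B ^ 3" unfolding B by simp
    have "cc ^ 2 * (cb ^ 3 * cc) = cb ^ 3 * cc ^ 3" by (simp add: pow_expand algebra_simps)
    also have "\<dots> = cb ^ 2 * ((cb * (A ^ 2 + 3 * fps_X * A * K + 9 * fps_X ^ 2 * K ^ 2)) * K)"
      unfolding c by (simp add: pow_expand algebra_simps)
    finally show ?thesis unfolding d .
  qed
  have "cc ^ 2 * cb ^ 2 * (N * (B ^ 3 * K)) = cc ^ 2 * cb ^ 2 * (N2 * (cb ^ 3 * cc))"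
  proof -
    have "cc ^ 2 * cb ^ 2 * (N * (B ^ 3 * K)) = (cc ^ 2 * N) * (cb ^ 2 * (B ^ 3 * K))" by (simp add: pow_expand algebra_simps)
    also have "\<dots> = cc ^ 2 * cb ^ 2 * (N2 * (cb ^ 3 * cc))" unfolding 1 2[symmetric] by (simp add: pow_expand algebra_simps)
    finally show ?thesis .
  qed
  moreover have "cc ^ 2 * cb ^ 2 \<noteq> 0" by (simp add: nth_0_neq_0)
  ultimately show "(3 * (ca * fps_XD cc - cc * fps_XD ca) + ca * cc) * sub 3 (cb ^ 3 * cc) =
     sub 3 (3 * (ca * fps_XD cc - cc * fps_XD ca) + ca * cc) * (cb ^ 3 * cc)"
    unfolding sM using sN by (simp add: N_def Da_def Dc_def)
qed (simp_all add: fps_power_zeroth)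

section \<open>Primes inert in the Eisenstein and Gaussian integers\<close>

lemma fermat_int:
  fixes a :: int
  assumes "prime p" "\<not> int p dvd a"
  shows "[a ^ (p - 1) = 1] (mod int p)"
proof -
  have p0: "int p > 0" using assms(1) prime_gt_0_nat by simp
  define b where "b = nat (a mod int p)"
  have b: "int b = a mod int p" using p0 by (simp add: b_def)
  have "\<not> p dvd b"
    using assms(2) b by (metis dvd_mod_iff dvd_refl int_dvd_int_iff)
  then have "[b ^ (p - 1) = 1] (mod p)" using fermat_theorem assms(1) by blast
  then have "[int b ^ (p - 1) = 1] (mod int p)" by (metis cong_int_iff of_nat_1 of_nat_power)
  moreover have "[a ^ (p - 1) = int b ^ (p - 1)] (mod int p)"
    unfolding b by (intro cong_pow) (simp add: cong_def)
  ultimately show ?thesis by (rule cong_trans[rotated])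
qed

text \<open>If p did not divide t, then s^3 = t^3 would hold modulo p between units. As p - 1 is 1
  modulo 3, cubing is injective on units, so s = t modulo p and p would divide 3 t^2.\<close>

lemma prime_dvd_eisenstein_norm:
  fixes s t :: int
  assumes p: "prime p" "p mod 3 = 2" and dvd: "int p dvd s ^ 2 + s * t + t ^ 2"
  shows "int p dvd s \<and> int p dvd t"
proof -
  have pi: "prime (int p)" using p by simp
  have "int p dvd t"
  proof (rule ccontr)
    assume t: "\<not> int p dvd t"
    have s: "\<not> int p dvd s"
    proof
      assume "int p dvd s"
      then have "int p dvd s ^ 2 + s * t" by (simp add: power2_eq_square)
      with dvd have "int p dvd t ^ 2" by (metis dvd_add_right_iff)
      with pi t show False using prime_dvd_power by blast
    qed
    define k where "k = p div 3"
    have pk: "p - 1 = 3 * k + 1" using p(2) unfolding k_def by presburger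
    have "s ^ 3 - t ^ 3 = (s - t) * (s ^ 2 + s * t + t ^ 2)"
      by (simp add: algebra_simps power2_eq_square power3_eq_cube)
    then have "[s ^ 3 = t ^ 3] (mod int p)" using dvd by (simp add: cong_iff_dvd_diff)
    then have "[(s ^ 3) ^ k = (t ^ 3) ^ k] (mod int p)" by (rule cong_pow)
    then have c: "[s ^ (3 * k) = t ^ (3 * k)] (mod int p)" by (simp add: power_mult)
    have s1: "[s ^ (3 * k) * s = 1] (mod int p)" and t1: "[t ^ (3 * k) * t = 1] (mod int p)"
      using fermat_int[OF p(1) s] fermat_int[OF p(1) t] unfolding pk by (simp_all add: mult.commute)
    have "[s ^ (3 * k) * s = t ^ (3 * k) * t] (mod int p)" by (rule cong_trans[OF s1 cong_sym[OF t1]])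
    also have "[t ^ (3 * k) * t = s ^ (3 * k) * t] (mod int p)"
      by (rule cong_scalar_right[OF cong_sym[OF c]])
    finally have "[s ^ (3 * k) * s = s ^ (3 * k) * t] (mod int p)" .
    moreover have "coprime (s ^ (3 * k)) (int p)"
      using prime_imp_coprime[OF pi s] by (simp add: coprime_commute)
    ultimately have st: "[s = t] (mod int p)" by (simp add: cong_mult_lcancel)
    then have "int p dvd s - t" by (simp add: cong_iff_dvd_diff)
    then have "int p dvd (s - t) * (s + 2 * t)" by simp
    moreover have "s ^ 2 + s * t + t ^ 2 = (s - t) * (s + 2 * t) + 3 * t ^ 2"
      by (simp add: algebra_simps power2_eq_square)
    ultimately have "int p dvd 3 * t ^ 2" using dvd by (metis dvd_add_right_iff)
    then have "int p dvd 3" using pi t by (metis prime_dvd_mult_iff prime_dvd_power)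
    then have "p dvd 3" by (metis int_dvd_int_iff of_nat_numeral)
    then have "p = 1 \<or> p = 3" using prime_nat_iff[of 3] by auto
    then show False using p by auto
  qed
  moreover from this have "int p dvd s * t + t ^ 2" by (simp add: power2_eq_square)
  then have "int p dvd s ^ 2" using dvd by (metis dvd_add_left_iff add.assoc)
  then have "int p dvd s" using pi prime_dvd_power by blast
  ultimately show ?thesis by blast
qed

lemma prime_dvd_square_add_3_square:
  fixes x y :: int
  assumes "prime p" "p mod 3 = 2" "odd p" "int p dvd x ^ 2 + 3 * y ^ 2"
  shows "int p dvd x \<and> int p dvd y"
proof -
  have "(x - y) ^ 2 + (x - y) * (2 * y) + (2 * y) ^ 2 = x ^ 2 + 3 * y ^ 2"
    by (simp add: algebra_simps power2_eq_square)
  then have "int p dvd (x - y) ^ 2 + (x - y) * (2 * y) + (2 * y) ^ 2" using assms(4) by metis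
  then have d: "int p dvd x - y" "int p dvd 2 * y"
    using prime_dvd_eisenstein_norm[OF assms(1,2)] by blast+
  have "coprime (int p) 2" using assms(3) by simp
  then have "int p dvd y" using d(2) by (simp add: coprime_dvd_mult_right_iff)
  then show ?thesis using d(1) by (metis diff_add_cancel dvd_add)
qed

text \<open>Otherwise x^2 = - y^2 modulo p with x and y units; raising this to the odd power (p - 1)
  / 2 gives 1 = - 1 by Fermat's theorem.\<close>

lemma prime_dvd_sum_squares:
  fixes x y :: int
  assumes p: "prime p" "p mod 4 = 3" and dvd: "int p dvd x ^ 2 + y ^ 2"
  shows "int p dvd x \<and> int p dvd y"
proof -
  have pi: "prime (int p)" using p by simp
  have "int p dvd y"
  proof (rule ccontr)
    assume y: "\<not> int p dvd y"
    have x: "\<not> int p dvd x"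
    proof
      assume "int p dvd x"
      then have "int p dvd x ^ 2" by (simp add: power2_eq_square)
      with dvd have "int p dvd y ^ 2" by (metis dvd_add_right_iff)
      with pi y show False using prime_dvd_power by blast
    qed
    define k where "k = p div 4"
    have pk: "p - 1 = 2 * (2 * k + 1)" using p(2) unfolding k_def by presburger
    have "[x ^ 2 = - (y ^ 2)] (mod int p)" using dvd by (simp add: cong_iff_dvd_diff)
    then have "[(x ^ 2) ^ (2 * k + 1) = (- (y ^ 2)) ^ (2 * k + 1)] (mod int p)" by (rule cong_pow)
    moreover have "x ^ (p - 1) = (x ^ 2) ^ (2 * k + 1)" unfolding pk by (rule power_mult)
    moreover have "(- (y ^ 2)) ^ (2 * k + 1) = - (y ^ (p - 1))"
      unfolding pk power_mult by (rule power_minus_odd) simp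
    ultimately have "[x ^ (p - 1) = - (y ^ (p - 1))] (mod int p)" by metis
    moreover have "[- (y ^ (p - 1)) = - 1] (mod int p)"
      using fermat_int[OF p(1) y] by (simp add: cong_minus_minus_iff)
    ultimately have "[x ^ (p - 1) = - 1] (mod int p)" by (rule cong_trans)
    then have "[1 = - 1] (mod int p)" by (rule cong_trans[OF cong_sym[OF fermat_int[OF p(1) x]]])
    then have "int p dvd 2" by (simp add: cong_iff_dvd_diff)
    then have "p dvd 2" by (metis int_dvd_int_iff of_nat_numeral)
    then have "p \<le> 2" by (rule dvd_imp_le) simp
    then show False using p by (cases p) auto
  qed
  moreover from this have "int p dvd y ^ 2" by (simp add: power2_eq_square)
  then have "int p dvd x ^ 2" using dvd by (metis dvd_add_left_iff)
  then have "int p dvd x" using pi prime_dvd_power by blast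
  ultimately show ?thesis by blast
qed


section \<open>Hecke relations for the newforms\<close>

text \<open>In the applications \<sigma> is multiplication of lattice coordinates by p up to signs.
  As p is inert, a norm divisible by p forces the lattice point itself to be divisible by p, which
  is the last hypothesis; hence the terms at p ^ 2 * k are exactly the images of those at k.\<close>

lemma lat_hecke:
  fixes w :: "'i \<Rightarrow> rat" and e :: "'i \<Rightarrow> int"
  assumes "admis e" "inj \<sigma>" "p > 0"
    and e: "\<And>i. w i \<noteq> 0 \<Longrightarrow> e (\<sigma> i) = int p ^ 2 * e i"
    and w: "\<And>i. w i \<noteq> 0 \<Longrightarrow> w (\<sigma> i) = - of_nat p * w i"
    and range: "\<And>i. w i \<noteq> 0 \<Longrightarrow> int p dvd e i \<Longrightarrow> \<exists>j. w j \<noteq> 0 \<and> i = \<sigma> j"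
  shows "fps_nth (lat w e) (p ^ 2 * k) = - of_nat p * fps_nth (lat w e) k"
proof -
  have fin: "finite {i. e i = n}" for n by (rule admis_finite[OF assms(1)])
  have supp: "fps_nth (lat w e) n = (\<Sum>i | e i = int n \<and> w i \<noteq> 0. w i)" for n
    unfolding lat_nth by (rule sum.mono_neutral_right) (use fin in auto)
  have eq: "{i. e i = int (p ^ 2 * k) \<and> w i \<noteq> 0} = \<sigma> ` {j. e j = int k \<and> w j \<noteq> 0}"
  proof safe
    fix i assume i: "e i = int (p ^ 2 * k)" "w i \<noteq> 0"
    then have "int p dvd e i" by (simp add: power2_eq_square)
    then obtain j where j: "w j \<noteq> 0" "i = \<sigma> j" using range i by blast
    then have "e j = int k" using e[of j] i assms(3) by simp
    then show "i \<in> \<sigma> ` {j. e j = int k \<and> w j \<noteq> 0}" using j by blast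
  next
    fix j assume j: "e j = int k" "w j \<noteq> 0"
    then show "e (\<sigma> j) = int (p ^ 2 * k)" using e by simp
    assume "w (\<sigma> j) = 0"
    then show False using w[OF j(2)] j(2) assms(3) by simp
  qed
  show "fps_nth (lat w e) (p ^ 2 * k) = - of_nat p * fps_nth (lat w e) k"
    unfolding supp eq sum_distrib_left
    by (subst sum.reindex) (use assms(2) w in \<open>auto simp: inj_on_def intro!: sum.cong\<close>)
qed

definition hecke_inert :: "nat \<Rightarrow> rat fps \<Rightarrow> bool" where
  "hecke_inert p g \<longleftrightarrow> (\<forall>k. fps_nth g (p ^ 2 * k) = - of_nat p * fps_nth g k)"

lemma sub_lat: "k > 0 \<Longrightarrow> sub k (lat w e) = lat w (\<lambda>i. int k * e i)"
  unfolding sub_def by (rule lat_compose)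

lemma sub_1_id [simp]: "sub 1 A = A" by simp

text \<open>E^4 = E^3 * E is a double series whose weight becomes proportional to 2 d - 1 by means
  of \<open>lat_sg_pair_0\<close>. Four times the exponent in the newform is then (6 a - 1)^2 + 3 (2
  d - 1)^2, a norm form of the Eisenstein integers.\<close>

lemma hecke_36:
  assumes p: "prime p" "p mod 6 = 5"
  shows "hecke_inert p (fps_X * sub 6 (ep 1 ^ 4))"
proof -
  let ?t = "\<lambda>d::int. d * (d - 1) div 2" and ?p = "\<lambda>a::int. a * (3 * a - 1) div 2"
  let ?e = "\<lambda>(d, a). int 6 * (int 1 * ?t d + ?p a) + int 1"
  let ?w = "\<lambda>(d, a). - (sg d * sg a * of_int (2 * d - 1)) / 2"
  have adm0: "admis (\<lambda>(d, a). int 1 * ?t d + ?p a)" by (intro admis_pair admis_scale admis_tri admis_euler) simp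
  have adm: "admis ?e"
    using admis_shift[OF admis_scale[OF adm0, of 6], of 1] by (simp add: case_prod_unfold)
  have "ep 1 ^ 4 = lat (\<lambda>d. - (sg d * of_int d)) (\<lambda>d. int 1 * ?t d) * lat sg ?p"
  proof -
    have "ep 1 ^ 4 = ep 1 ^ 3 * ep 1" by (simp only: pow_expand mult_ac)
    then show ?thesis by (simp only: jacobi_ep euler_pentagonal[symmetric] of_nat_1 mult_1_left)
  qed
  also have "\<dots> = lat (\<lambda>(d, a). - (sg d * of_int d) * sg a) (\<lambda>(d, a). int 1 * ?t d + ?p a)"
    by (intro lat_mult admis_scale admis_tri admis_euler) simp
  also have "\<dots> = lat (\<lambda>(d, a). - (sg d * of_int d) * sg a) (\<lambda>(d, a). int 1 * ?t d + ?p a) +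
     lat (\<lambda>(d, a). sg d * (sg a / 2)) (\<lambda>(d, a). int 1 * ?t d + ?p a)"
    using lat_sg_pair_0[of ?p 1 "\<lambda>a. sg a / 2", OF admis_euler] by simp
  also have "\<dots> = lat ?w (\<lambda>(d, a). int 1 * ?t d + ?p a)"
    unfolding lat_add by (rule lat_cong) (auto simp: field_simps)
  finally have "fps_X * sub 6 (ep 1 ^ 4) = fps_X ^ 1 * lat ?w (\<lambda>i. int 6 * (case i of (d, a) \<Rightarrow> int 1 * ?t d + ?p a))"
    by (simp add: sub_lat)
  also have "\<dots> = lat ?w ?e"
    by (subst lat_shift) (use admis_scale[OF adm0, of 6] in \<open>auto intro!: lat_cong\<close>)
  finally have g: "fps_X * sub 6 (ep 1 ^ 4) = lat ?w ?e" .
  have four: "4 * ?e (d, a) = (6 * a - 1) ^ 2 + 3 * (2 * d - 1) ^ 2" for d a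
  proof -
    have "4 * (int 6 * (int 1 * y + z) + int 1) = (6 * a - 1) ^ 2 + 3 * (2 * d - 1) ^ 2"
      if "2 * y = d * (d - 1)" "2 * z = a * (3 * a - 1)" for y z
      using that by (simp add: power2_eq_square algebra_simps)
    from this[OF pronic_half pent_half'] show ?thesis by simp
  qed
  define k where "k = int (p div 6)"
  have pk: "int p = 6 * k + 5" using p(2) unfolding k_def by presburger
  \<comment> \<open>This sends 6 a - 1 to - p (6 a - 1) and 2 d - 1 to p (2 d - 1); the first sign
    keeps the residue - 1 modulo 6. The shifts are 3 k + 2 = (p - 1) / 2 and k + 1 = (p + 1) / 6.
    Their sum is odd, which produces the sign of - p in the Hecke relation.\<close>
  define \<sigma> where "\<sigma> = (\<lambda>(d, a). (int p * d - (3 * k + 2), - int p * a + (k + 1)))"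
  have p0: "p > 0" using p(1) prime_gt_0_nat by simp
  have co: "6 * (- int p * a + (k + 1)) - 1 = - int p * (6 * a - 1)"
    "2 * (int p * d - (3 * k + 2)) - 1 = int p * (2 * d - 1)" for a d
    by (simp_all add: pk algebra_simps)
  have "p mod 3 = 2" "odd p" using p(2) by presburger+
  note nt = prime_dvd_square_add_3_square[OF p(1) this]
  note H = lat_hecke[where w = ?w and e = ?e and \<sigma> = \<sigma> and p = p, OF adm]
  have inj: "inj \<sigma>" using p0 by (auto simp: inj_on_def \<sigma>_def)
  have se: "?e (\<sigma> i) = int p ^ 2 * ?e i" for i
  proof -
    obtain d a where i: "i = (d, a)" by (cases i)
    have "4 * ?e (\<sigma> i) = 4 * (int p ^ 2 * ?e i)"
      unfolding i \<sigma>_def prod.case four[unfolded prod.case] co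
      by (simp only: mult.left_commute[of 4] four[unfolded prod.case]) (simp add: power2_eq_square algebra_simps)
    then show ?thesis by simp
  qed
  have sw: "?w (\<sigma> i) = - of_nat p * ?w i" for i
  proof -
    obtain d a where i: "i = (d, a)" by (cases i)
    have op: "odd (int p)" using \<open>odd p\<close> by simp
    have "sg (int p * d - (3 * k + 2)) * sg (- int p * a + (k + 1)) = - (sg d * sg a)"
      using op by (auto simp: sg_def)
    moreover have "(of_int (2 * (int p * d - (3 * k + 2)) - 1) :: rat) = of_nat p * of_int (2 * d - 1)"
      unfolding co by simp
    ultimately show ?thesis unfolding i \<sigma>_def prod.case by simp
  qed
  have rg: "\<exists>j. ?w j \<noteq> 0 \<and> i = \<sigma> j" if "?w i \<noteq> 0" "int p dvd ?e i" for i
  proof -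
    obtain d a where i: "i = (d, a)" by (cases i)
    have "int p dvd 4 * ?e i" using that(2) by (rule dvd_mult)
    then have "int p dvd (6 * a - 1) ^ 2 + 3 * (2 * d - 1) ^ 2" unfolding i four .
    then obtain u v where u: "6 * a - 1 = int p * u" and v: "2 * d - 1 = int p * v"
      using nt by (meson dvdE)
    have "6 * a - 1 = 6 * (k * u) + 5 * u" using u by (simp add: pk algebra_simps)
    then have "\<exists>a'. u = 1 - 6 * a'" by presburger
    then obtain a' where a': "u = 1 - 6 * a'" by blast
    have "odd (int p * v)" unfolding v[symmetric] by simp
    then have "odd v" by simp
    then have "\<exists>d'. v = 2 * d' - 1" by presburger
    then obtain d' where d': "v = 2 * d' - 1" by blast
    have "6 * a - 1 = 6 * (- int p * a' + (k + 1)) - 1" unfolding co u a' by (simp add: algebra_simps)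
    moreover have "2 * d - 1 = 2 * (int p * d' - (3 * k + 2)) - 1" unfolding co v d' by simp
    ultimately have "i = \<sigma> (d', a')" by (simp add: i \<sigma>_def)
    moreover have "?w (d', a') \<noteq> 0" using that(1) sw[of "(d', a')"] \<open>i = \<sigma> (d', a')\<close> by auto
    ultimately show ?thesis by blast
  qed
  show ?thesis
    unfolding hecke_inert_def g using H[OF inj p0 se sw rg] by blast
qed


text \<open>Here E(q)^2 E(q^2)^2 = E(q^2)^3 \<phi>(- q), and after the substitution q -> q^4 and the
  shift by q the exponent is the sum of squares (2 d - 1)^2 + (2 m)^2.\<close>

lemma hecke_32:
  assumes p: "prime p" "p mod 4 = 3"
  shows "hecke_inert p (fps_X * sub 4 (ep 1 ^ 2 * ep 2 ^ 2))"
proof -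
  let ?t = "\<lambda>d::int. d * (d - 1) div 2"
  let ?e = "\<lambda>(d, m). int 4 * (int 2 * ?t d + m ^ 2) + int 1"
  let ?w = "\<lambda>(d, m). - (sg d * sg m * of_int (2 * d - 1)) / 2"
  have adm0: "admis (\<lambda>(d, m). int 2 * ?t d + m ^ 2)" by (intro admis_pair admis_scale admis_tri admis_square) simp
  have adm: "admis ?e"
    using admis_shift[OF admis_scale[OF adm0, of 4], of 1] by (simp add: case_prod_unfold)
  have "ep 1 ^ 2 * ep 2 ^ 2 = ep 2 ^ 3 * phim"
    unfolding phim_ep[symmetric] by (simp add: pow_expand algebra_simps)
  also have "ep 2 ^ 3 = lat (\<lambda>d. - (sg d * of_int d)) (\<lambda>d. int 2 * ?t d)"
  proof -
    have "ep 2 ^ 3 = sub 2 (ep 1 ^ 3)" by (simp add: sub_simps)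
    then show ?thesis unfolding jacobi_ep by (simp add: sub_lat)
  qed
  also have "\<dots> * phim = lat (\<lambda>(d, m). - (sg d * of_int d) * sg m) (\<lambda>(d, m). int 2 * ?t d + m ^ 2)"
    unfolding phim_def by (intro lat_mult admis_scale admis_tri admis_square) simp
  also have "\<dots> = lat (\<lambda>(d, m). - (sg d * of_int d) * sg m) (\<lambda>(d, m). int 2 * ?t d + m ^ 2) +
     lat (\<lambda>(d, m). sg d * (sg m / 2)) (\<lambda>(d, m). int 2 * ?t d + m ^ 2)"
    using lat_sg_pair_0[of "\<lambda>m. m ^ 2" 2 "\<lambda>m. sg m / 2", OF admis_square] by simp
  also have "\<dots> = lat ?w (\<lambda>(d, m). int 2 * ?t d + m ^ 2)"
    unfolding lat_add by (rule lat_cong) (auto simp: field_simps)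
  finally have "fps_X * sub 4 (ep 1 ^ 2 * ep 2 ^ 2) = fps_X ^ 1 * lat ?w (\<lambda>i. int 4 * (case i of (d, m) \<Rightarrow> int 2 * ?t d + m ^ 2))"
    by (simp add: sub_lat)
  also have "\<dots> = lat ?w ?e"
    by (subst lat_shift) (use admis_scale[OF adm0, of 4] in \<open>auto intro!: lat_cong\<close>)
  finally have g: "fps_X * sub 4 (ep 1 ^ 2 * ep 2 ^ 2) = lat ?w ?e" .
  have four: "?e (d, m) = (2 * d - 1) ^ 2 + (2 * m) ^ 2" for d m
  proof -
    have "int 4 * (int 2 * y + m ^ 2) + int 1 = (2 * d - 1) ^ 2 + (2 * m) ^ 2"
      if "2 * y = d * (d - 1)" for y
      using that by (simp add: power2_eq_square algebra_simps)
    from this[OF pronic_half] show ?thesis by simp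
  qed
  define k where "k = int (p div 4)"
  have pk: "int p = 4 * k + 3" using p(2) unfolding k_def by presburger
  \<comment> \<open>Multiplication of 2 d - 1 and 2 m by p. The shift 2 k + 1 = (p - 1) / 2 is odd,
    which produces the sign of - p.\<close>
  define \<sigma> where "\<sigma> = (\<lambda>(d, m). (int p * d - (2 * k + 1), int p * m))"
  have p0: "p > 0" using p(1) prime_gt_0_nat by simp
  have co: "2 * (int p * d - (2 * k + 1)) - 1 = int p * (2 * d - 1)" for d
    by (simp add: pk algebra_simps)
  have "odd p" using p(2) by presburger
  then have op: "odd (int p)" by simp
  note nt = prime_dvd_sum_squares[OF p]
  note H = lat_hecke[where w = ?w and e = ?e and \<sigma> = \<sigma> and p = p, OF adm]
  have inj: "inj \<sigma>" using p0 by (auto simp: inj_on_def \<sigma>_def)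
  have se: "?e (\<sigma> i) = int p ^ 2 * ?e i" for i
  proof -
    obtain d m where i: "i = (d, m)" by (cases i)
    have "?e (\<sigma> i) = (int p * (2 * d - 1)) ^ 2 + (2 * (int p * m)) ^ 2"
      unfolding co[symmetric] i \<sigma>_def prod.case four[unfolded prod.case] ..
    also have "\<dots> = int p ^ 2 * ((2 * d - 1) ^ 2 + (2 * m) ^ 2)"
      by (simp add: power2_eq_square algebra_simps)
    also have "\<dots> = int p ^ 2 * ?e i" unfolding i four ..
    finally show ?thesis .
  qed
  have sw: "?w (\<sigma> i) = - of_nat p * ?w i" for i
  proof -
    obtain d m where i: "i = (d, m)" by (cases i)
    have "sg (int p * d - (2 * k + 1)) * sg (int p * m) = - (sg d * sg m)"
      using op by (auto simp: sg_def)
    moreover have "(of_int (2 * (int p * d - (2 * k + 1)) - 1) :: rat) = of_nat p * of_int (2 * d - 1)"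
      unfolding co by simp
    ultimately show ?thesis unfolding i \<sigma>_def prod.case by simp
  qed
  have rg: "\<exists>j. ?w j \<noteq> 0 \<and> i = \<sigma> j" if "?w i \<noteq> 0" "int p dvd ?e i" for i
  proof -
    obtain d m where i: "i = (d, m)" by (cases i)
    have "int p dvd (2 * d - 1) ^ 2 + (2 * m) ^ 2" using that(2) unfolding i four .
    then obtain u v where u: "2 * m = int p * u" and v: "2 * d - 1 = int p * v"
      using nt by (meson dvdE)
    have "even (int p * u)" unfolding u[symmetric] by simp
    then have "even u" using op by simp
    then obtain m' where m': "u = 2 * m'" by blast
    have "odd (int p * v)" unfolding v[symmetric] by simp
    then have "odd v" by simp
    then have "\<exists>d'. v = 2 * d' - 1" by presburger
    then obtain d' where d': "v = 2 * d' - 1" by blast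
    have "2 * d - 1 = 2 * (int p * d' - (2 * k + 1)) - 1" unfolding co v d' by simp
    moreover have "m = int p * m'" using u m' by simp
    ultimately have "i = \<sigma> (d', m')" by (simp add: i \<sigma>_def)
    moreover have "?w (d', m') \<noteq> 0" using that(1) sw[of "(d', m')"] \<open>i = \<sigma> (d', m')\<close> by auto
    ultimately show ?thesis by blast
  qed
  show ?thesis
    unfolding hecke_inert_def g using H[OF inj p0 se sw rg] by blast
qed

text \<open>In \<open>ep_square\<close> at q^3, the 3-dissections of \<psi>(q^2) and \<phi>(q)
  eliminate f(q^6, q^12) and f(q^3, q^15). After multiplication by E(q)^2 the factors \<psi>(q^2)
  and \<phi>(q) become theta series of weight 3/2.\<close>

lemma ep_square_27: "ep 1 ^ 2 * ep 3 ^ 2 = thetaA * sub 9 phi - fps_X ^ 2 * sub 2 thetaB * sub 18 psi"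
proof -
  have "ep 1 ^ 2 = sub 3 phi * sub 2 f12 - 2 * fps_X * f15 * sub 6 psi"
    using ep_square by (simp add: sub_def)
  from sub_eq[OF this, of 3]
  have e: "ep 3 ^ 2 = sub 9 phi * sub 6 f12 - 2 * fps_X ^ 3 * sub 3 f15 * sub 18 psi"
    by (simp add: sub_simps)
  have "psi = sub 3 f12 + fps_X * sub 9 psi" using psi_dissect3 by (simp add: sub_def)
  from sub_eq[OF this, of 2] have f: "sub 6 f12 = sub 2 psi - fps_X ^ 2 * sub 18 psi" by (simp add: sub_simps)
  have f15: "2 * fps_X * sub 3 f15 = phi - sub 9 phi" using phi_dissect3 unfolding sub_def by (metis add_diff_cancel_left')
  have "ep 3 ^ 2 = sub 9 phi * sub 6 f12 - fps_X ^ 2 * (2 * fps_X * sub 3 f15) * sub 18 psi"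
    unfolding e by (simp add: pow_expand algebra_simps)
  then have e3: "ep 3 ^ 2 = sub 9 phi * sub 2 psi - fps_X ^ 2 * phi * sub 18 psi"
    unfolding f f15 by (simp add: pow_expand algebra_simps)
  have s2: "sub 2 psi * ep 2 = ep 4 ^ 2" using psi_ep_sub[of 2] by simp
  have "(thetaA * ep 2) * ep 4 = (ep 1 ^ 2 * sub 2 psi * ep 2) * ep 4"
  proof -
    have "(thetaA * ep 2) * ep 4 = (ep 4 * thetaA) * ep 2" by (simp add: mult_ac)
    also have "\<dots> = ep 4 ^ 3 * (phim * ep 2)" unfolding thetaA_phim[symmetric] by (simp add: mult_ac)
    also have "\<dots> = (ep 1 ^ 2 * (sub 2 psi * ep 2)) * ep 4"
      unfolding phim_ep s2 by (simp add: pow_expand mult_ac)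
    finally show ?thesis by (simp add: mult_ac)
  qed
  then have "thetaA * ep 2 = ep 1 ^ 2 * sub 2 psi * ep 2" by (rule ep_cancel) simp
  then have tA: "thetaA = ep 1 ^ 2 * sub 2 psi" by (rule ep_cancel) simp
  have p2: "sub 2 phim * ep 4 = ep 2 ^ 2" using phim_ep_sub[of 2] by simp
  have t2: "ep 4 * sub 2 thetaB = ep 2 ^ 3 * sub 2 phim"
    using sub_eq[OF thetaB_phim, of 2] by (simp add: sub_simps)
  have "sub 2 thetaB * ep 4 ^ 2 = (ep 1 ^ 2 * phi) * ep 4 ^ 2"
  proof -
    have "sub 2 thetaB * ep 4 ^ 2 = (ep 4 * sub 2 thetaB) * ep 4" by (simp add: pow_expand mult_ac)
    also have "\<dots> = ep 2 ^ 3 * (sub 2 phim * ep 4)" unfolding t2 by (simp add: mult_ac)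
    also have "\<dots> = phi * ep 1 ^ 2 * ep 4 ^ 2" unfolding p2 phi_ep by (simp add: pow_expand mult_ac)
    finally show ?thesis by (simp add: mult_ac)
  qed
  then have tB: "sub 2 thetaB = ep 1 ^ 2 * phi" by (rule ep_cancel) simp
  show ?thesis unfolding tA tB e3 by (simp add: algebra_simps)
qed

lemma abs_le_square_int: "\<bar>x\<bar> \<le> x ^ 2" for x :: int
proof (cases "x = 0")
  case False
  then have "1 * \<bar>x\<bar> \<le> \<bar>x\<bar> * \<bar>x\<bar>" by (intro mult_right_mono) auto
  then show ?thesis by (simp add: power2_eq_square)
qed simp

text \<open>The sum runs over the numbers (u + 3 v sqrt(- 3)) / 2 with u = 2 mod 3 and u, v of equal
  parity, whose norm is (u^2 + 27 v^2) / 4. Even and odd u give the two terms of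
  \<open>ep_square_27\<close>.\<close>

lemma hecke_27:
  assumes p: "prime p" "p mod 3 = 2"
  shows "hecke_inert p (fps_X * sub 3 (ep 1 ^ 2 * ep 3 ^ 2))"
proof -
  let ?t = "\<lambda>d::int. d * (d - 1) div 2"
  let ?e = "\<lambda>(u::int, v::int). (u ^ 2 + 27 * v ^ 2) div 4"
  let ?w = "\<lambda>(u::int, v::int). if u mod 3 = 2 \<and> even (u + v) then of_int u / 2 else 0 :: rat"
  have nonneg: "?e i \<ge> 0" for i by (cases i) (simp add: pos_imp_zdiv_nonneg_iff)
  have adm: "admis ?e"
  proof -
    have "finite {i. ?e i \<le> n}" for n
    proof (rule finite_subset)
      show "{i. ?e i \<le> n} \<subseteq> {-(4 * n + 4)..4 * n + 4} \<times> {-(4 * n + 4)..4 * n + 4}"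
      proof safe
        fix u v :: int assume "(u ^ 2 + 27 * v ^ 2) div 4 \<le> n"
        then have "u ^ 2 + 27 * v ^ 2 \<le> 4 * n + 4" by linarith
        moreover have "u ^ 2 \<ge> \<bar>u\<bar>" "v ^ 2 \<ge> \<bar>v\<bar>" by (rule abs_le_square_int)+
        moreover have "v ^ 2 \<ge> 0" "u ^ 2 \<ge> 0" by simp_all
        ultimately have "\<bar>u\<bar> \<le> 4 * n + 4" "\<bar>v\<bar> \<le> 4 * n + 4" by linarith+
        then show "u \<in> {-(4 * n + 4)..4 * n + 4}" "v \<in> {-(4 * n + 4)..4 * n + 4}" by auto
      qed
    qed simp
    with nonneg show ?thesis unfolding admis_def by blast
  qed
  have four: "4 * ?e (u, v) = u ^ 2 + 27 * v ^ 2" if ev: "even (u + v)" for u v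
  proof -
    have "u ^ 2 + 27 * v ^ 2 = (u + v) * (u + v) - 2 * ((u + v) * v) + 28 * v ^ 2"
      by (simp add: power2_eq_square algebra_simps)
    moreover obtain c where c: "u + v = 2 * c" using ev by blast
    ultimately have "u ^ 2 + 27 * v ^ 2 = 4 * (c * c - c * v + 7 * v ^ 2)" unfolding c by (simp add: algebra_simps)
    then show ?thesis by simp
  qed
  let ?we = "\<lambda>x. if even (fst x) then ?w x else 0" and ?wo = "\<lambda>x. if even (fst x) then 0 else ?w x"
  have e1: "?e (6 * x + 2, 2 * y) = int 3 * ((3 * x ^ 2 + 2 * x) + int 9 * y ^ 2) + int 1" for x y
  proof -
    have "4 * ?e (6 * x + 2, 2 * y) = 4 * (int 3 * ((3 * x ^ 2 + 2 * x) + int 9 * y ^ 2) + int 1)"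
      by (subst four) (simp_all add: power2_eq_square algebra_simps)
    then show ?thesis by simp
  qed
  have e2: "?e (- (6 * x + 1), 2 * y - 1) = int 3 * (int 2 * (x * (3 * x + 1) div 2) + int 18 * ?t y + int 2) + int 1" for x y
  proof -
    have "(6 * x + 1) ^ 2 + 27 * (2 * y - 1) ^ 2 = 4 * (int 3 * (int 2 * a + int 18 * b + int 2) + int 1)"
      if "2 * a = x * (3 * x + 1)" "2 * b = y * (y - 1)" for a b
      using that by (simp add: power2_eq_square algebra_simps)
    from this[OF pent_half pronic_half]
    have "4 * ?e (- (6 * x + 1), 2 * y - 1) = 4 * (int 3 * (int 2 * (x * (3 * x + 1) div 2) + int 18 * ?t y + int 2) + int 1)"
      by (subst four) (simp_all only: power2_minus, simp)
    then show ?thesis by simp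
  qed
  have "lat ?w ?e = lat ?we ?e + lat ?wo ?e"
    unfolding lat_add by (rule lat_cong) auto
  also have "lat ?we ?e = lat (\<lambda>x. ?we ((\<lambda>(x, y). (6 * x + 2, 2 * y)) x)) (\<lambda>x. ?e ((\<lambda>(x, y). (6 * x + 2, 2 * y)) x))"
  proof (rule lat_reindex[OF _ _ adm])
    fix i assume a: "?we i \<noteq> 0"
    obtain u v where i: "i = (u, v)" by (cases i)
    have "u mod 3 = 2" "even u" "even v" using a by (auto simp: i split: if_splits)
    then have "i = (\<lambda>(x, y). (6 * x + 2, 2 * y)) (u div 6, v div 2)" unfolding i by (simp, presburger)
    then show "i \<in> range (\<lambda>(x, y). (6 * x + 2, 2 * y))" by blast
  qed (auto simp: inj_on_def)
  also have "\<dots> = lat (\<lambda>(x, y). of_int (3 * x + 1) * 1) (\<lambda>i. int 3 * (case i of (x, y) \<Rightarrow> (3 * x ^ 2 + 2 * x) + int 9 * y ^ 2) + int 1)"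
  proof (rule lat_cong)
    fix i :: "int \<times> int"
    obtain x y where i: "i = (x, y)" by (cases i)
    show "?e ((\<lambda>(x, y). (6 * x + 2, 2 * y)) i) = int 3 * (case i of (x, y) \<Rightarrow> (3 * x ^ 2 + 2 * x) + int 9 * y ^ 2) + int 1"
      unfolding i using e1[of x y] by simp
    have "(6 * x + 2) mod 3 = 2" by presburger
    then show "?we ((\<lambda>(x, y). (6 * x + 2, 2 * y)) i) = (\<lambda>(x, y). of_int (3 * x + 1) * 1) i"
      unfolding i by simp
  qed
  also have "\<dots> = fps_X * sub 3 (thetaA * sub 9 phi)"
  proof -
    have a: "admis (\<lambda>(x::int, y::int). (3 * x ^ 2 + 2 * x) + int 9 * y ^ 2)"
      by (intro admis_pair admis_scale admis_f15 admis_square) simp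
    have "thetaA * sub 9 phi = lat (\<lambda>(x, y). of_int (3 * x + 1) * 1) (\<lambda>(x, y). (3 * x ^ 2 + 2 * x) + int 9 * y ^ 2)"
      unfolding thetaA_def phi_def sub_lat[of 9, simplified]
      using lat_mult[OF admis_f15 admis_scale[OF admis_square, of 9]] by simp
    then have "fps_X ^ 1 * sub 3 (thetaA * sub 9 phi) =
       fps_X ^ 1 * lat (\<lambda>(x, y). of_int (3 * x + 1) * 1) (\<lambda>i. int 3 * (case i of (x, y) \<Rightarrow> (3 * x ^ 2 + 2 * x) + int 9 * y ^ 2))"
      by (simp add: sub_lat)
    also have "\<dots> = lat (\<lambda>(x, y). of_int (3 * x + 1) * 1) (\<lambda>i. int 3 * (case i of (x, y) \<Rightarrow> (3 * x ^ 2 + 2 * x) + int 9 * y ^ 2) + int 1)"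
      by (rule lat_shift) (intro admis_scale a, simp)
    finally show ?thesis by simp
  qed
  also have "lat ?wo ?e = lat (\<lambda>x. ?wo ((\<lambda>(x, y). (- (6 * x + 1), 2 * y - 1)) x)) (\<lambda>x. ?e ((\<lambda>(x, y). (- (6 * x + 1), 2 * y - 1)) x))"
  proof (rule lat_reindex[OF _ _ adm])
    fix i assume a: "?wo i \<noteq> 0"
    obtain u v where i: "i = (u, v)" by (cases i)
    have "u mod 3 = 2" "odd u" "odd v" using a by (auto simp: i split: if_splits)
    then have "i = (\<lambda>(x, y). (- (6 * x + 1), 2 * y - 1)) (- (u div 6) - 1, v div 2 + 1)" unfolding i by (simp, presburger)
    then show "i \<in> range (\<lambda>(x, y). (- (6 * x + 1), 2 * y - 1))" by blast
  qed (auto simp: inj_on_def)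
  also have "\<dots> = lat (\<lambda>i. (- 1 / 2) * (case i of (x, y) \<Rightarrow> of_int (6 * x + 1) * 1))
     (\<lambda>i. int 3 * (case i of (x, y) \<Rightarrow> int 2 * (x * (3 * x + 1) div 2) + int 18 * ?t y + int 2) + int 1)"
  proof (rule lat_cong)
    fix i :: "int \<times> int"
    obtain x y where i: "i = (x, y)" by (cases i)
    show "?e ((\<lambda>(x, y). (- (6 * x + 1), 2 * y - 1)) i) = int 3 * (case i of (x, y) \<Rightarrow> int 2 * (x * (3 * x + 1) div 2) + int 18 * ?t y + int 2) + int 1"
      unfolding i prod.case by (rule e2[unfolded prod.case])
    have "(- (6 * x + 1)) mod 3 = 2" by presburger
    moreover have "(of_int (- (6 * x + 1)) :: rat) / 2 = (- 1 / 2) * (of_int (6 * x + 1) * 1)" by (simp add: field_simps)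
    ultimately show "?wo ((\<lambda>(x, y). (- (6 * x + 1), 2 * y - 1)) i) = (- 1 / 2) * (case i of (x, y) \<Rightarrow> of_int (6 * x + 1) * 1)"
      unfolding i prod.case fst_conv by simp
  qed
  also have "\<dots> = fps_const (- 1 / 2) * (fps_X * sub 3 (fps_X ^ 2 * (sub 2 thetaB * (fps_const 2 * sub 18 psi))))"
  proof -
    have a: "admis (\<lambda>(x::int, y::int). int 2 * (x * (3 * x + 1) div 2) + int 18 * ?t y)"
      by (intro admis_pair admis_scale admis_f12 admis_tri) simp_all
    have "fps_const 2 * sub 18 psi = sub 18 (fps_const 2 * psi)" by (simp only: sub_mult sub_const zero_less_numeral)
    also have "\<dots> = lat (\<lambda>d. 1) (\<lambda>y. int 18 * ?t y)" unfolding psi_double by (rule sub_lat) simp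
    finally have ps: "fps_const 2 * sub 18 psi = lat (\<lambda>d. 1) (\<lambda>y. int 18 * ?t y)" .
    have tb: "sub 2 thetaB = lat (\<lambda>n. of_int (6 * n + 1)) (\<lambda>x. int 2 * (x * (3 * x + 1) div 2))"
      unfolding thetaB_def by (rule sub_lat) simp
    have "sub 2 thetaB * (fps_const 2 * sub 18 psi) = lat (\<lambda>(x, y). of_int (6 * x + 1) * 1) (\<lambda>(x, y). int 2 * (x * (3 * x + 1) div 2) + int 18 * ?t y)"
      unfolding ps tb by (intro lat_mult admis_scale admis_f12 admis_tri) simp_all
    then have "fps_X ^ 2 * (sub 2 thetaB * (fps_const 2 * sub 18 psi)) =
       lat (\<lambda>(x, y). of_int (6 * x + 1) * 1) (\<lambda>i. (case i of (x, y) \<Rightarrow> int 2 * (x * (3 * x + 1) div 2) + int 18 * ?t y) + int 2)"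
      by (simp only: lat_shift[OF a])
    then have "sub 3 (fps_X ^ 2 * (sub 2 thetaB * (fps_const 2 * sub 18 psi))) =
       lat (\<lambda>(x, y). of_int (6 * x + 1) * 1) (\<lambda>i. int 3 * ((case i of (x, y) \<Rightarrow> int 2 * (x * (3 * x + 1) div 2) + int 18 * ?t y) + int 2))"
      by (simp only: sub_lat zero_less_numeral)
    then have "fps_X ^ 1 * sub 3 (fps_X ^ 2 * (sub 2 thetaB * (fps_const 2 * sub 18 psi))) =
       lat (\<lambda>(x, y). of_int (6 * x + 1) * 1) (\<lambda>i. int 3 * ((case i of (x, y) \<Rightarrow> int 2 * (x * (3 * x + 1) div 2) + int 18 * ?t y) + int 2) + int 1)"
      by (simp only:) (rule lat_shift, rule admis_scale[OF admis_shift[OF a]], simp)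
    then show ?thesis
      unfolding lat_cmult[symmetric] power_one_right by (simp only:) (rule arg_cong2[where f = "(*)"], simp, rule lat_cong, auto)
  qed
  also have "fps_X * sub 3 (thetaA * sub 9 phi) + \<dots> = fps_X * sub 3 (ep 1 ^ 2 * ep 3 ^ 2)"
  proof -
    have h: "fps_const (- 1 / 2 :: rat) * fps_const 2 = - 1" by simp
    have "fps_const (- 1 / 2) * (fps_X * (fps_X ^ 6 * (a * (fps_const 2 * b)))) =
       (fps_const (- 1 / 2) * fps_const 2) * (fps_X * (fps_X ^ 6 * (a * b)))" for a b :: "rat fps"
      by (simp only: mult_ac)
    then have "fps_const (- 1 / 2) * (fps_X * (fps_X ^ 6 * (a * (fps_const 2 * b)))) = - (fps_X * (fps_X ^ 6 * (a * b)))" for a b :: "rat fps"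
      unfolding h by simp
    note h' = this
    have x6: "(fps_X ^ 3) ^ 2 = (fps_X ^ 6 :: rat fps)" by (simp flip: power_mult)
    have s: "sub 3 (fps_X ^ 2 * (sub 2 thetaB * (fps_const 2 * sub 18 psi))) = fps_X ^ 6 * (sub 6 thetaB * (fps_const 2 * sub 54 psi))"
      using x6 by (simp only: sub_simps zero_less_numeral) simp
    have t: "sub 3 (ep 1 ^ 2 * ep 3 ^ 2) = sub 3 (thetaA * sub 9 phi) - fps_X ^ 6 * (sub 6 thetaB * sub 54 psi)"
      unfolding ep_square_27 using x6 by (simp add: sub_simps mult.assoc)
    show ?thesis unfolding s h' t by (simp add: algebra_simps)
  qed
  finally have g: "fps_X * sub 3 (ep 1 ^ 2 * ep 3 ^ 2) = lat ?w ?e" by simp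
  have p0: "p > 0" using p(1) prime_gt_0_nat by simp
  \<comment> \<open>As - p is 1 modulo 3, the condition u = 2 mod 3 is preserved; the weight u / 2
    itself supplies the factor - p.\<close>
  define \<sigma> where "\<sigma> = (\<lambda>(u, v). (- int p * u, int p * v))"
  have inj: "inj \<sigma>" using p0 by (auto simp: inj_on_def \<sigma>_def)
  define k where "k = int (p div 3)"
  have pk: "int p = 3 * k + 2" using p(2) unfolding k_def by presburger
  have par: "even (- int p * u + int p * v)" if "even (u + v)" for u v
  proof -
    have "- int p * u + int p * v = int p * ((u + v) - 2 * u)" by (simp add: algebra_simps)
    then show ?thesis using that by simp
  qed
  have md: "(- int p * u) mod 3 = u mod 3" for u
  proof -
    have "- int p * u = u + 3 * (- (k + 1) * u)" unfolding pk by (simp add: algebra_simps)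
    then show ?thesis by (metis mod_mult_self2)
  qed
  have se: "?e (\<sigma> i) = int p ^ 2 * ?e i" if "?w i \<noteq> 0" for i
  proof -
    obtain u v where i: "i = (u, v)" by (cases i)
    have ev: "even (u + v)" using that by (auto simp: i split: if_splits)
    have "4 * ?e (\<sigma> i) = (- int p * u) ^ 2 + 27 * (int p * v) ^ 2"
      unfolding i \<sigma>_def prod.case using four[OF par[OF ev]] by simp
    also have "\<dots> = int p ^ 2 * (u ^ 2 + 27 * v ^ 2)" by (simp add: power2_eq_square algebra_simps)
    also have "\<dots> = 4 * (int p ^ 2 * ?e i)" unfolding i four[OF ev, symmetric] by simp
    finally show ?thesis by simp
  qed
  have sw: "?w (\<sigma> i) = - of_nat p * ?w i" if "?w i \<noteq> 0" for i
  proof -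
    obtain u v where i: "i = (u, v)" by (cases i)
    have "even (u + v)" "u mod 3 = 2" using that by (auto simp: i split: if_splits)
    then show ?thesis using par[of u v] md[of u] unfolding i \<sigma>_def by simp
  qed
  have rg: "\<exists>j. ?w j \<noteq> 0 \<and> i = \<sigma> j" if w0: "?w i \<noteq> 0" and dv: "int p dvd ?e i" for i
  proof -
    obtain u v where i: "i = (u, v)" by (cases i)
    have ev: "even (u + v)" and u3: "u mod 3 = 2" and u0: "u \<noteq> 0" using w0 by (auto simp: i split: if_splits)
    obtain u' v' where uv: "u = - int p * u'" "v = int p * v'" "even (u' + v')"
    proof (cases "p = 2")
      case True
      \<comment> \<open>Here u^2 + 27 v^2 is divisible by 8, whereas it is 4 modulo 8 for odd u and
        v. Hence both are even, and divisibility by 8 also makes their halves of equal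
        parity.\<close>
      obtain c where c: "?e i = 2 * c" using dv True by auto
      have e8: "u ^ 2 + 27 * v ^ 2 = 8 * c" using four[OF ev] c unfolding i by simp
      have "even u"
      proof (rule ccontr)
        assume ou: "odd u"
        then obtain x where x: "u = 2 * x + 1" by (rule oddE)
        have "odd v" using ou ev by simp
        then obtain y where y: "v = 2 * y + 1" by (rule oddE)
        have "4 * (x * (x + 1)) + 1 + 27 * (4 * (y * (y + 1)) + 1) = 8 * c"
          using e8 unfolding x y by (simp add: power2_eq_square algebra_simps)
        moreover have "even (x * (x + 1))" "even (y * (y + 1))" by simp_all
        then obtain a b where "x * (x + 1) = 2 * a" "y * (y + 1) = 2 * b" by (metis evenE)
        ultimately have "8 * a + 1 + 27 * (8 * b + 1) = 8 * c" by simp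
        then show False by presburger
      qed
      then obtain x where x: "u = 2 * x" by blast
      have "even v" using \<open>even u\<close> ev by simp
      then obtain y where y: "v = 2 * y" by blast
      have "4 * (x ^ 2 + 27 * y ^ 2) = 8 * c" using e8 unfolding x y by (simp add: power2_eq_square)
      then have "x ^ 2 + 27 * y ^ 2 = 2 * c" by simp
      then have "even (x ^ 2 + 27 * y ^ 2)" by simp
      then have "even (- x + y)" by simp
      then show thesis using that[of "- x" y] x y True by simp
    next
      case False
      have op: "odd p" using False p(1) prime_odd_nat prime_ge_2_nat[OF p(1)] by force
      have "int p dvd 4 * ?e i" using dv by (rule dvd_mult)
      then have "int p dvd u ^ 2 + 3 * (3 * v) ^ 2" unfolding i four[OF ev] by (simp add: power_mult_distrib)
      then have d: "int p dvd u" "int p dvd 3 * v"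
        using prime_dvd_square_add_3_square[OF p op] by blast+
      have "\<not> int p dvd 3"
      proof
        assume "int p dvd 3"
        then have "p dvd 3" by (metis int_dvd_int_iff of_nat_numeral)
        then have "p = 1 \<or> p = 3" using prime_nat_iff[of 3] by auto
        then show False using p by auto
      qed
      then have "int p dvd v" using d(2) p(1) by (metis prime_dvd_mult_iff prime_int_nat_transfer of_nat_0_le_iff prime_nat_int_transfer)
      then obtain y where y: "v = int p * y" by blast
      obtain x where x: "u = int p * x" using d(1) by blast
      have "even (int p * (x + y))" using ev unfolding x y by (simp add: distrib_left)
      then have "even (x + y)" using op by simp
      then show thesis using that[of "- x" y] x y by simp
    qed
    have "u' mod 3 = 2" using md[of u'] u3 uv(1) by simp
    moreover have "u' \<noteq> 0" using u0 uv(1) by auto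
    ultimately have "?w (u', v') \<noteq> 0" using uv(3) by simp
    moreover have "i = \<sigma> (u', v')" by (simp add: i \<sigma>_def uv)
    ultimately show ?thesis by blast
  qed
  show ?thesis
    unfolding hecke_inert_def g using lat_hecke[where w = ?w and e = ?e and \<sigma> = \<sigma> and p = p, OF adm inj p0 se sw rg] by blast
qed

section \<open>The local ring at a prime\<close>

text \<open>The localization of the integers at p inside the rationals. All coefficients are
  rational, so it takes the place of the p-adic integers.\<close>

definition zp :: "nat \<Rightarrow> rat set" where
  "zp p = {of_int a / of_int b | a b. \<not> int p dvd b}"

text \<open>The bound v_p(x) \<ge> k, in a form that adds and multiplies without a separate case for
  0.\<close>

definition pd :: "nat \<Rightarrow> nat \<Rightarrow> rat \<Rightarrow> bool" where
  "pd p k x \<longleftrightarrow> (\<exists>y\<in>zp p. x = of_nat p ^ k * y)"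

definition zp_unit :: "nat \<Rightarrow> rat \<Rightarrow> bool" where
  "zp_unit p x \<longleftrightarrow> (\<exists>a b. \<not> int p dvd a \<and> \<not> int p dvd b \<and> x = of_int a / of_int b)"

locale prime_local =
  fixes p :: nat
  assumes prime_p: "prime p"
begin

lemma prime_int_p: "prime (int p)" using prime_p by simp

lemma p_pos: "p > 0" using prime_p prime_gt_0_nat by simp

lemma not_dvd_mult: "\<not> int p dvd a \<Longrightarrow> \<not> int p dvd b \<Longrightarrow> \<not> int p dvd a * b"
  using prime_int_p by (simp add: prime_dvd_mult_iff)

lemma not_dvd_neq_0: "\<not> int p dvd a \<Longrightarrow> of_int a \<noteq> (0 :: rat)"
  by auto

lemma zp_of_int [simp, intro]: "of_int a \<in> zp p"
proof -
  have "\<not> int p dvd 1" using prime_int_p by (metis not_prime_unit)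
  then show ?thesis unfolding zp_def by (intro CollectI exI[of _ a] exI[of _ 1]) simp
qed

lemma zp_of_nat [simp, intro]: "of_nat a \<in> zp p"
  using zp_of_int[of "int a"] by simp

lemma zp_0 [simp, intro]: "0 \<in> zp p" and zp_1 [simp, intro]: "1 \<in> zp p"
  using zp_of_int[of 0] zp_of_int[of 1] by simp_all

lemma zp_add [intro]: "x \<in> zp p \<Longrightarrow> y \<in> zp p \<Longrightarrow> x + y \<in> zp p"
proof -
  assume "x \<in> zp p" "y \<in> zp p"
  then obtain a b c d where "\<not> int p dvd b" "\<not> int p dvd d" "x = of_int a / of_int b" "y = of_int c / of_int d"
    by (auto simp: zp_def)
  then show ?thesis unfolding zp_def
    by (intro CollectI exI[of _ "a * d + c * b"] exI[of _ "b * d"])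
       (use not_dvd_mult not_dvd_neq_0 in \<open>auto simp: add_frac_eq\<close>)
qed

lemma zp_mult [intro]: "x \<in> zp p \<Longrightarrow> y \<in> zp p \<Longrightarrow> x * y \<in> zp p"
proof -
  assume "x \<in> zp p" "y \<in> zp p"
  then obtain a b c d where "\<not> int p dvd b" "\<not> int p dvd d" "x = of_int a / of_int b" "y = of_int c / of_int d"
    by (auto simp: zp_def)
  then show ?thesis unfolding zp_def
    by (intro CollectI exI[of _ "a * c"] exI[of _ "b * d"]) (use not_dvd_mult in auto)
qed

lemma zp_uminus [intro]: "x \<in> zp p \<Longrightarrow> - x \<in> zp p"
  using zp_mult[OF zp_of_int[of "- 1"], of x] by simp

lemma zp_diff [intro]: "x \<in> zp p \<Longrightarrow> y \<in> zp p \<Longrightarrow> x - y \<in> zp p"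
  using zp_add[of x "- y"] by auto

lemma zp_power [intro]: "x \<in> zp p \<Longrightarrow> x ^ n \<in> zp p"
  by (induction n) auto

lemma zp_sum [intro]: "(\<And>i. i \<in> S \<Longrightarrow> f i \<in> zp p) \<Longrightarrow> sum f S \<in> zp p"
  by (induction S rule: infinite_finite_induct) auto

lemma zp_inverse_of_int [intro]: "\<not> int p dvd a \<Longrightarrow> inverse (of_int a) \<in> zp p"
  unfolding zp_def by (intro CollectI exI[of _ 1] exI[of _ a]) (simp add: divide_inverse)

lemma zp_unit_iff: "zp_unit p x \<longleftrightarrow> x \<noteq> 0 \<and> x \<in> zp p \<and> inverse x \<in> zp p"
proof
  assume "zp_unit p x"
  then show "x \<noteq> 0 \<and> x \<in> zp p \<and> inverse x \<in> zp p"
    unfolding zp_unit_def zp_def by (force simp: not_dvd_neq_0)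
next
  assume x: "x \<noteq> 0 \<and> x \<in> zp p \<and> inverse x \<in> zp p"
  obtain a b where ab: "\<not> int p dvd b" "x = of_int a / of_int b" using x unfolding zp_def by blast
  obtain c d where cd: "\<not> int p dvd d" "inverse x = of_int c / of_int d" using x unfolding zp_def by blast
  note * = ab(1) cd(1) ab(2) cd(2)
  have "of_int (a * c) = (of_int (b * d) :: rat)"
    using * x not_dvd_neq_0[of b] not_dvd_neq_0[of d] by (simp add: field_simps)
  then have "a * c = b * d" using of_int_eq_iff by blast
  then have "\<not> int p dvd a" using not_dvd_mult[OF *(1,2)] by (metis dvd_mult2)
  then show "zp_unit p x" unfolding zp_unit_def using * by blast
qed

lemma zp_unit_mult: "zp_unit p x \<Longrightarrow> zp_unit p y \<Longrightarrow> zp_unit p (x * y)"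
  unfolding zp_unit_iff by (auto simp: inverse_mult_distrib)

lemma zp_unit_of_int: "\<not> int p dvd a \<Longrightarrow> zp_unit p (of_int a)"
  unfolding zp_unit_iff using not_dvd_neq_0 by auto

lemma zp_unit_power: "zp_unit p x \<Longrightarrow> zp_unit p (x ^ n)"
  unfolding zp_unit_iff by (auto simp: power_inverse[symmetric])

lemma pd_0 [simp, intro]: "pd p k 0" unfolding pd_def by (intro bexI[of _ 0]) auto

lemma pd_zp: "pd p 0 x \<longleftrightarrow> x \<in> zp p" by (auto simp: pd_def)

lemma pd_add [intro]: "pd p k x \<Longrightarrow> pd p k y \<Longrightarrow> pd p k (x + y)"
  unfolding pd_def by (metis distrib_left zp_add)

lemma pd_mult: "pd p k x \<Longrightarrow> pd p l y \<Longrightarrow> pd p (k + l) (x * y)"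
proof -
  assume "pd p k x" "pd p l y"
  then obtain x' y' where "x' \<in> zp p" "y' \<in> zp p" "x = of_nat p ^ k * x'" "y = of_nat p ^ l * y'"
    by (auto simp: pd_def)
  then show ?thesis unfolding pd_def by (intro bexI[of _ "x' * y'"]) (auto simp: power_add)
qed

lemma pd_mult_zp: "pd p k x \<Longrightarrow> y \<in> zp p \<Longrightarrow> pd p k (x * y)"
  and pd_zp_mult: "pd p k x \<Longrightarrow> y \<in> zp p \<Longrightarrow> pd p k (y * x)"
  using pd_mult[of k x 0 y] by (auto simp: pd_zp mult.commute)

lemma pd_uminus: "pd p k x \<Longrightarrow> pd p k (- x)"
  using pd_zp_mult[of k x "of_int (- 1)"] by auto

lemma pd_diff: "pd p k x \<Longrightarrow> pd p k y \<Longrightarrow> pd p k (x - y)"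
  using pd_add[of k x "- y"] pd_uminus[of k y] by simp

lemma pd_sum: "(\<And>i. i \<in> S \<Longrightarrow> pd p k (f i)) \<Longrightarrow> pd p k (sum f S)"
  by (induction S rule: infinite_finite_induct) auto

lemma pd_p_power: "pd p k (of_nat p ^ k)"
  unfolding pd_def by (intro bexI[of _ 1]) auto

lemma pd_mono: "pd p k x \<Longrightarrow> l \<le> k \<Longrightarrow> pd p l x"
proof -
  assume "pd p k x" "l \<le> k"
  then obtain y where y: "y \<in> zp p" "x = of_nat p ^ k * y" by (auto simp: pd_def)
  have "x = of_nat p ^ l * (of_nat p ^ (k - l) * y)"
    using y \<open>l \<le> k\<close> by (simp flip: power_add mult.assoc)
  then show ?thesis unfolding pd_def using y by blast
qed

lemma pd_of_int: "int p ^ k dvd a \<Longrightarrow> pd p k (of_int a)"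
proof -
  assume "int p ^ k dvd a"
  then obtain c where "a = int p ^ k * c" by blast
  then show ?thesis unfolding pd_def by (intro bexI[of _ "of_int c"]) auto
qed

lemma pd_of_nat: "p ^ k dvd a \<Longrightarrow> pd p k (of_nat a)"
  using pd_of_int[of k "int a"] by (metis of_int_of_nat_eq int_dvd_int_iff of_nat_power)

lemma pd_divide_unit: "pd p k x \<Longrightarrow> zp_unit p u \<Longrightarrow> pd p k (x / u)"
  unfolding divide_inverse zp_unit_iff by (intro pd_mult_zp) auto

text \<open>The part of n prime to p is a unit, so division by n costs exactly the multiplicity of p
  in n. This is the loss suffered by integration.\<close>

lemma pd_divide_nat:
  assumes "pd p (multiplicity p n + k) x" "n > 0"
  shows "pd p k (x / of_nat n)"
proof -
  obtain u where u: "n = p ^ multiplicity p n * u" "\<not> p dvd u"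
    using multiplicity_decompose'[of n p] assms(2) prime_p by (metis not_prime_unit not_gr_zero)
  have un: "zp_unit p (of_nat u)" using zp_unit_of_int[of "int u"] u(2) by simp
  obtain y where y: "y \<in> zp p" "x = of_nat p ^ (multiplicity p n + k) * y" using assms(1) by (auto simp: pd_def)
  have "x / of_nat n = of_nat p ^ k * (y / of_nat u)"
    using p_pos un by (subst u(1)) (auto simp: y(2) power_add zp_unit_iff field_simps)
  moreover have "y / of_nat u \<in> zp p" using un y(1) by (auto simp: zp_unit_iff divide_inverse)
  ultimately show ?thesis unfolding pd_def by blast
qed

lemma vp_fraction:
  assumes "a \<noteq> 0" "b \<noteq> 0"
  shows "vp p (of_int a / of_int b) = ereal (real (multiplicity (int p) a) - real (multiplicity (int p) b))"
proof -
  define x :: rat where "x = of_int a / of_int b"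
  obtain n d where nd: "quotient_of x = (n, d)" by (cases "quotient_of x")
  have x: "x = of_int n / of_int d" and d: "d > 0"
    using quotient_of_div[OF nd] quotient_of_denom_pos[OF nd] by auto
  have x0: "x \<noteq> 0" using assms by (simp add: x_def)
  then have n0: "n \<noteq> 0" using x by auto
  have "of_int (a * d) = (of_int (n * b) :: rat)"
    using x d assms unfolding x_def by (simp add: field_simps)
  then have "a * d = n * b" using of_int_eq_iff by blast
  moreover have pe: "prime_elem (int p)" using prime_int_p by simp
  ultimately have "multiplicity (int p) a + multiplicity (int p) d = multiplicity (int p) n + multiplicity (int p) b"
    using prime_elem_multiplicity_mult_distrib[OF pe] assms d n0 by (metis less_irrefl)
  then have "real (multiplicity (int p) a) + real (multiplicity (int p) d) = real (multiplicity (int p) n) + real (multiplicity (int p) b)"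
    by (simp flip: of_nat_add)
  then show ?thesis using x0 unfolding x_def[symmetric] by (simp add: vp_def nd)
qed

lemma vp_power_unit:
  assumes "zp_unit p u"
  shows "vp p (of_nat p ^ k * u) = ereal (real k)"
proof -
  obtain a b where ab: "\<not> int p dvd a" "\<not> int p dvd b" "u = of_int a / of_int b"
    using assms by (auto simp: zp_unit_def)
  have "a \<noteq> 0" "b \<noteq> 0" using ab by auto
  have e: "of_nat p ^ k * u = of_int (int p ^ k * a) / of_int b" by (simp add: ab(3))
  have pe: "prime_elem (int p)" using prime_int_p by simp
  have "multiplicity (int p) (int p) = 1" using prime_int_p by (intro multiplicity_self) auto
  then have "multiplicity (int p) (int p ^ k * a) = k"
    using ab(1) \<open>a \<noteq> 0\<close> p_pos prime_elem_multiplicity_mult_distrib[OF pe, of "int p ^ k" a]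
    by (simp add: prime_elem_multiplicity_power_distrib[OF pe] not_dvd_imp_multiplicity_0 multiplicity_same_power)
  moreover have "multiplicity (int p) b = 0" using ab(2) by (rule not_dvd_imp_multiplicity_0)
  ultimately show ?thesis unfolding e using vp_fraction[of "int p ^ k * a" b] \<open>a \<noteq> 0\<close> \<open>b \<noteq> 0\<close> p_pos by simp
qed

lemma vp_ge:
  assumes "pd p k x"
  shows "vp p x \<ge> ereal (real k)"
proof (cases "x = 0")
  case False
  obtain y where y: "y \<in> zp p" "x = of_nat p ^ k * y" using assms by (auto simp: pd_def)
  then obtain a b where ab: "\<not> int p dvd b" "y = of_int a / of_int b" by (auto simp: zp_def)
  have nz: "a \<noteq> 0" "b \<noteq> 0" using ab y False by auto
  have e: "x = of_int (int p ^ k * a) / of_int b" by (simp add: y(2) ab(2))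
  have pe: "prime_elem (int p)" using prime_int_p by simp
  have "multiplicity (int p) (int p ^ k * a) \<ge> k"
    using nz p_pos prime_int_p by (intro multiplicity_geI) auto
  moreover have "multiplicity (int p) b = 0" using ab(1) by (rule not_dvd_imp_multiplicity_0)
  ultimately show ?thesis unfolding e using vp_fraction[of "int p ^ k * a" b] nz p_pos by simp
qed (simp add: vp_def)


section \<open>Binomial coefficients\<close>

lemma zp_approx:
  assumes "x \<in> zp p"
  obtains m :: int where "pd p L (x - of_int m)"
proof -
  obtain a b where ab: "\<not> int p dvd b" "x = of_int a / of_int b" using assms by (auto simp: zp_def)
  have "coprime b (int p ^ L)" using prime_imp_coprime[OF prime_int_p ab(1)] by (simp add: coprime_commute)
  then obtain c where c: "[b * c = 1] (mod int p ^ L)" using cong_solve_coprime_int by blast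
  have "int p ^ L dvd a * (1 - b * c)" using c by (metis cong_iff_dvd_diff cong_sym dvd_mult)
  then have "pd p L (of_int (a * (1 - b * c)))" by (rule pd_of_int)
  then have "pd p L (of_int (a * (1 - b * c)) / of_int b)"
    by (rule pd_divide_unit) (rule zp_unit_of_int[OF ab(1)])
  also have "of_int (a * (1 - b * c)) / of_int b = x - of_int (a * c)"
    using ab not_dvd_neq_0[OF ab(1)] by (simp add: field_simps)
  finally show thesis by (rule that)
qed

lemma pd_prod_diff:
  assumes "\<And>i. i \<in> S \<Longrightarrow> f i \<in> zp p \<and> g i \<in> zp p \<and> pd p L (f i - g i)"
  shows "pd p L (prod f S - prod g S) \<and> prod f S \<in> zp p \<and> prod g S \<in> zp p"
  using assms
proof (induction S rule: infinite_finite_induct)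
  case (insert x S)
  then have IH: "pd p L (prod f S - prod g S)" "prod f S \<in> zp p" "prod g S \<in> zp p"
    and x: "f x \<in> zp p" "g x \<in> zp p" "pd p L (f x - g x)" by auto
  have "f x * prod f S - g x * prod g S = (f x - g x) * prod f S + g x * (prod f S - prod g S)"
    by (simp add: algebra_simps)
  moreover have "pd p L \<dots>" using IH x by (intro pd_add pd_mult_zp pd_zp_mult)
  ultimately show ?case using insert.hyps IH x by auto
qed auto

text \<open>Replacing x by an integer congruent to it modulo p ^ L changes the numerator x (x - 1)
  ... (x - n + 1) by a multiple of p ^ L, and L is the multiplicity of p in n!. For an integer the
  coefficient is an integer, after negating the upper index if it is negative.\<close>

lemma zp_gbinomial:
  assumes "x \<in> zp p"
  shows "(x gchoose n) \<in> zp p"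
proof -
  define L where "L = multiplicity p (fact n :: nat)"
  obtain m where m: "pd p L (x - of_int m)" using zp_approx[OF assms] by blast
  have "pd p L ((\<Prod>i = 0..<n. x - of_nat i) - (\<Prod>i = 0..<n. of_int m - of_nat i))"
    using pd_prod_diff[of "{0..<n}" "\<lambda>i. x - of_nat i" "\<lambda>i. of_int m - of_nat i" L] m assms by auto
  then have "pd p 0 (((\<Prod>i = 0..<n. x - of_nat i) - (\<Prod>i = 0..<n. of_int m - of_nat i)) / of_nat (fact n))"
    by (intro pd_divide_nat) (simp_all add: L_def)
  then have "(x gchoose n) - (of_int m gchoose n) \<in> zp p"
    by (simp add: pd_zp gbinomial_prod_rev diff_divide_distrib)
  moreover have "(of_int m gchoose n :: rat) \<in> zp p"
  proof -
    have nonneg: "(of_int k gchoose n :: rat) \<in> zp p" if "k \<ge> 0" for k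
    proof -
      have "(of_int k gchoose n :: rat) = of_nat (nat k choose n)"
        using that by (simp add: binomial_gbinomial)
      then show ?thesis by simp
    qed
    show ?thesis
    proof (cases "m \<ge> 0")
      case False
      have "(of_int m gchoose n :: rat) = (- 1) ^ n * ((of_nat n - of_int m - 1) gchoose n)"
        by (rule gbinomial_negated_upper)
      also have "(of_nat n - of_int m - 1 :: rat) = of_int (int n - m - 1)" by simp
      finally have "(of_int m gchoose n :: rat) = (of_int (- 1)) ^ n * (of_int (int n - m - 1) gchoose n)" by simp
      moreover have "(of_int (int n - m - 1) gchoose n :: rat) \<in> zp p" by (rule nonneg) (use False in simp)
      ultimately show ?thesis by (auto intro!: zp_mult zp_power)
    qed (rule nonneg)
  qed
  ultimately have "(x gchoose n) - (of_int m gchoose n) + (of_int m gchoose n) \<in> zp p" by blast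
  then show ?thesis by simp
qed


section \<open>Integral power series and Frobenius\<close>

definition zp_fps :: "rat fps \<Rightarrow> bool" where
  "zp_fps A \<longleftrightarrow> (\<forall>n. fps_nth A n \<in> zp p)"

definition fcong :: "nat \<Rightarrow> rat fps \<Rightarrow> rat fps \<Rightarrow> bool" where
  "fcong s A B \<longleftrightarrow> (\<forall>n. pd p s (fps_nth A n - fps_nth B n))"

lemma zp_fps_add: "zp_fps A \<Longrightarrow> zp_fps B \<Longrightarrow> zp_fps (A + B)"
  and zp_fps_diff: "zp_fps A \<Longrightarrow> zp_fps B \<Longrightarrow> zp_fps (A - B)"
  and zp_fps_1: "zp_fps 1" and zp_fps_const: "c \<in> zp p \<Longrightarrow> zp_fps (fps_const c)"
  and zp_fps_X: "zp_fps fps_X"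
  by (auto simp: zp_fps_def fps_X_def)

lemma zp_fps_mult: "zp_fps A \<Longrightarrow> zp_fps B \<Longrightarrow> zp_fps (A * B)"
  unfolding zp_fps_def fps_mult_nth by (intro allI zp_sum) auto

lemma zp_fps_power: "zp_fps A \<Longrightarrow> zp_fps (A ^ n)"
  by (induction n) (auto intro: zp_fps_1 zp_fps_mult)

lemma zp_fps_sum: "(\<And>i. i \<in> S \<Longrightarrow> zp_fps (f i)) \<Longrightarrow> zp_fps (sum f S)"
  by (induction S rule: infinite_finite_induct) (auto intro: zp_fps_add simp: zp_fps_def[of 0])

lemma zp_fps_prod: "(\<And>i. i \<in> S \<Longrightarrow> zp_fps (f i)) \<Longrightarrow> zp_fps (prod f S)"
  by (induction S rule: infinite_finite_induct) (auto intro: zp_fps_mult zp_fps_1)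

lemma zp_fps_sub: "k > 0 \<Longrightarrow> zp_fps A \<Longrightarrow> zp_fps (sub k A)"
  by (auto simp: zp_fps_def sub_nth)

lemma zp_fps_compose: "zp_fps A \<Longrightarrow> zp_fps B \<Longrightarrow> zp_fps (fps_compose A B)"
  unfolding zp_fps_def fps_compose_nth
  by (intro allI zp_sum zp_mult) (use zp_fps_power[of B] in \<open>auto simp: zp_fps_def\<close>)

lemma zp_fps_inverse:
  assumes "zp_fps A" "zp_unit p (fps_nth A 0)"
  shows "zp_fps (inverse A)"
  unfolding zp_fps_def
proof
  fix n
  show "fps_nth (inverse A) n \<in> zp p"
  proof (induction n rule: less_induct)
    case (less n)
    have u: "inverse (fps_nth A 0) \<in> zp p" "fps_nth A 0 \<noteq> 0" using assms(2) by (auto simp: zp_unit_iff)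
    show ?case
    proof (cases "n = 0")
      case True
      then show ?thesis using u by simp
    next
      case False
      have "inverse A * A = 1" using u by (intro inverse_mult_eq_1)
      then have "(\<Sum>i=0..n. fps_nth (inverse A) i * fps_nth A (n - i)) = 0"
        using False by (metis fps_mult_nth fps_one_nth)
      moreover have "{0..n} = insert n {0..<n}" by auto
      ultimately have "fps_nth (inverse A) n * fps_nth A 0 = - (\<Sum>i=0..<n. fps_nth (inverse A) i * fps_nth A (n - i))"
        by (simp add: eq_neg_iff_add_eq_0)
      then have "fps_nth (inverse A) n = - (\<Sum>i=0..<n. fps_nth (inverse A) i * fps_nth A (n - i)) * inverse (fps_nth A 0)"
        using u by (simp add: field_simps)
      also have "\<dots> \<in> zp p"
        using less assms(1) u by (intro zp_mult zp_uminus zp_sum) (auto simp: zp_fps_def)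
      finally show ?thesis .
    qed
  qed
qed

lemma fcong_refl: "fcong s A A"
  by (simp add: fcong_def)

lemma fcong_trans: "fcong s A B \<Longrightarrow> fcong s B D \<Longrightarrow> fcong s A D"
proof -
  assume *: "fcong s A B" "fcong s B D"
  have "fps_nth A n - fps_nth D n = (fps_nth A n - fps_nth B n) + (fps_nth B n - fps_nth D n)" for n by simp
  then show ?thesis using * unfolding fcong_def by (metis pd_add)
qed

lemma fcong_add: "fcong s A B \<Longrightarrow> fcong s A' B' \<Longrightarrow> fcong s (A + A') (B + B')"
  unfolding fcong_def by (simp add: add_diff_add pd_add)

lemma fcong_mult_diff:
  assumes "fcong s A B" "fcong t D 0"
  shows "fcong (s + t) ((A - B) * D) 0"
  using assms unfolding fcong_def by (auto simp: fps_mult_nth intro!: pd_sum pd_mult)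

lemma fcong_zp: "fcong 0 A 0 \<longleftrightarrow> zp_fps A"
  by (simp add: fcong_def zp_fps_def pd_zp)

lemma fcong_diff_iff: "fcong s A B \<longleftrightarrow> fcong s (A - B) 0"
  by (simp add: fcong_def)

lemma fcong_mult:
  assumes "fcong s A B" "fcong s A' B'" "zp_fps A'" "zp_fps B"
  shows "fcong s (A * A') (B * B')"
proof -
  have 1: "fcong s ((A - B) * A') 0" using fcong_mult_diff[of s A B 0 A'] assms by (simp add: fcong_zp)
  have 2: "fcong s ((A' - B') * B) 0" using fcong_mult_diff[of s A' B' 0 B] assms by (simp add: fcong_zp)
  have "A * A' - B * B' = (A - B) * A' + (A' - B') * B" by (simp add: algebra_simps)
  then show ?thesis using fcong_add[OF 1 2] by (subst fcong_diff_iff) simp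
qed

lemma fcong_power:
  assumes "fcong s A B" "zp_fps A" "zp_fps B"
  shows "fcong s (A ^ n) (B ^ n)"
  by (induction n) (use assms in \<open>auto intro!: fcong_refl fcong_mult zp_fps_power\<close>)

lemma fcong_sum: "(\<And>i. i \<in> S \<Longrightarrow> fcong s (f i) (g i)) \<Longrightarrow> fcong s (sum f S) (sum g S)"
  by (induction S rule: infinite_finite_induct) (auto intro: fcong_add fcong_refl)

text \<open>A^p - B^p is A - B times a sum of p terms, each congruent to B^(p - 1) modulo p; so this
  sum contributes another factor p.\<close>

lemma fcong_pth_power:
  assumes "fcong s A B" "s > 0" "zp_fps A" "zp_fps B"
  shows "fcong (Suc s) (A ^ p) (B ^ p)"
proof -
  have "fcong 1 A B" using assms by (auto simp: fcong_def intro: pd_mono)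
  then have "fcong 1 (\<Sum>i<p. B ^ (p - Suc i) * A ^ i) (\<Sum>i<p. B ^ (p - Suc i) * B ^ i)"
    by (intro fcong_sum fcong_mult fcong_power fcong_refl zp_fps_power assms)
  also have "(\<Sum>i<p. B ^ (p - Suc i) * B ^ i) = of_nat p * B ^ (p - 1)"
  proof -
    have "(\<Sum>i<p. B ^ (p - Suc i) * B ^ i) = (\<Sum>i<p. B ^ (p - 1))"
      by (rule sum.cong) (auto simp flip: power_add)
    then show ?thesis by simp
  qed
  finally have "fcong 1 (\<Sum>i<p. B ^ (p - Suc i) * A ^ i) (of_nat p * B ^ (p - 1))" .
  moreover have "fcong 1 (of_nat p * B ^ (p - 1)) 0"
    using zp_fps_power[OF assms(4), of "p - 1"] pd_p_power[of 1]
    by (auto simp: fcong_def zp_fps_def fps_of_nat[symmetric] intro: pd_mult_zp)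
  ultimately have "fcong 1 (\<Sum>i<p. B ^ (p - Suc i) * A ^ i) 0" by (rule fcong_trans)
  from fcong_mult_diff[OF assms(1) this]
  have "fcong (s + 1) (A ^ p - B ^ p) 0" by (simp add: power_diff_sumr2)
  then show ?thesis by (simp add: fcong_diff_iff[of _ "A ^ p"])
qed

lemma fcong_freshman:
  assumes "zp_fps A" "zp_fps B"
  shows "fcong 1 ((A + B) ^ p) (A ^ p + B ^ p)"
proof -
  let ?t = "\<lambda>k. of_nat (p choose k) * A ^ k * B ^ (p - k)"
  have "fcong 1 (?t k) 0" if "k \<in> {1..<p}" for k
  proof -
    have "p dvd (p choose k)" using that prime_p by (intro dvd_choose_prime) auto
    then have "pd p 1 (of_nat (p choose k))" by (intro pd_of_nat) simp
    moreover have "zp_fps (A ^ k * B ^ (p - k))" by (intro zp_fps_mult zp_fps_power assms)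
    ultimately show ?thesis
      by (auto simp: fcong_def zp_fps_def fps_of_nat[symmetric] mult.assoc intro: pd_mult_zp)
  qed
  then have "fcong 1 (\<Sum>k\<in>{1..<p}. ?t k) (\<Sum>k\<in>{1..<p}. 0)" by (rule fcong_sum)
  then have "fcong 1 ((A ^ p + B ^ p) + (\<Sum>k\<in>{1..<p}. ?t k)) ((A ^ p + B ^ p) + 0)"
    by (intro fcong_add fcong_refl) simp
  moreover have "(A + B) ^ p = (A ^ p + B ^ p) + (\<Sum>k\<in>{1..<p}. ?t k)"
  proof -
    have "{..p} = insert 0 (insert p {1..<p})" using p_pos by auto
    then show ?thesis unfolding binomial_ring using p_pos by (simp add: add_ac)
  qed
  ultimately show ?thesis by simp
qed

lemma zp_fermat:
  assumes "x \<in> zp p"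
  shows "pd p 1 (x ^ p - x)"
proof -
  obtain a b where ab: "\<not> int p dvd b" "x = of_int a / of_int b" using assms by (auto simp: zp_def)
  have f: "int p dvd c ^ p - c" for c
  proof (cases "int p dvd c")
    case True
    have "int p dvd c ^ p" by (rule dvd_trans[OF True dvd_power]) (use p_pos in simp)
    then show ?thesis using True by (rule dvd_diff)
  next
    case False
    have "[c ^ (p - 1) * c = 1 * c] (mod int p)"
      by (rule cong_scalar_right[OF fermat_int[OF prime_p False]])
    moreover have "c ^ (p - 1) * c = c ^ p" using p_pos by (metis Suc_diff_1 power_Suc2)
    ultimately show ?thesis by (simp add: cong_iff_dvd_diff)
  qed
  have "a ^ p * b - a * b ^ p = (a ^ p - a) * b - a * (b ^ p - b)" by (simp add: algebra_simps)
  moreover have "int p dvd (a ^ p - a) * b - a * (b ^ p - b)" by (intro dvd_diff dvd_mult dvd_mult2 f)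
  ultimately have "pd p 1 (of_int (a ^ p * b - a * b ^ p))" by (intro pd_of_int) simp
  moreover have "zp_unit p (of_int (b ^ p * b))"
    using zp_unit_of_int[OF ab(1)] by (auto intro!: zp_unit_mult zp_unit_power)
  ultimately have "pd p 1 (of_int (a ^ p * b - a * b ^ p) / of_int (b ^ p * b))" by (rule pd_divide_unit)
  also have "of_int (a ^ p * b - a * b ^ p) / of_int (b ^ p * b) = x ^ p - x"
    using not_dvd_neq_0[OF ab(1)] by (simp add: ab(2) field_simps)
  finally show ?thesis .
qed

text \<open>For polynomials this follows by induction on the number of monomials, from the binomial
  theorem modulo p and Fermat's theorem for the coefficients. The coefficient of q ^ n depends on a
  truncation only.\<close>

lemma frobenius:
  assumes "zp_fps A"
  shows "fcong 1 (A ^ p) (sub p A)"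
  unfolding fcong_def
proof
  fix n
  define P where "P = (\<lambda>K. \<Sum>k<K. fps_const (fps_nth A k) * fps_X ^ k)"
  have zP: "zp_fps (P K)" for K
    unfolding P_def using assms
    by (intro zp_fps_sum zp_fps_mult zp_fps_const zp_fps_power zp_fps_X) (simp add: zp_fps_def)
  have "fcong 1 (P K ^ p) (sub p (P K))" for K
  proof (induction K)
    case 0
    have P0: "P 0 = 0" by (simp add: P_def)
    have z: "(0 :: rat fps) ^ p = 0" using p_pos by simp
    show ?case unfolding P0 z by (simp add: sub_def fcong_refl)
  next
    case (Suc K)
    let ?M = "fps_const (fps_nth A K) * fps_X ^ K"
    have zM: "zp_fps ?M"
      using assms by (intro zp_fps_mult zp_fps_const zp_fps_power zp_fps_X) (simp add: zp_fps_def)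
    have "fcong 1 (?M ^ p) (sub p ?M)"
    proof -
      have 1: "?M ^ p = fps_const (fps_nth A K ^ p) * fps_X ^ (p * K)"
        by (simp add: power_mult_distrib fps_const_power power_mult[symmetric] mult.commute)
      have 2: "sub p ?M = fps_const (fps_nth A K) * fps_X ^ (p * K)"
        using p_pos by (simp add: sub_simps power_mult)
      have 3: "pd p 1 (fps_nth A K ^ p - fps_nth A K)"
        using assms by (intro zp_fermat) (simp add: zp_fps_def)
      show ?thesis unfolding fcong_def 1 2 using 3 by (simp add: fps_X_power_mult_right_nth)
    qed
    then have "fcong 1 (P K ^ p + ?M ^ p) (sub p (P K) + sub p ?M)" using Suc by (intro fcong_add)
    moreover have "fcong 1 ((P K + ?M) ^ p) (P K ^ p + ?M ^ p)" by (rule fcong_freshman[OF zP zM])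
    ultimately have "fcong 1 ((P K + ?M) ^ p) (sub p (P K) + sub p ?M)" using fcong_trans by blast
    then show ?case using p_pos by (simp add: P_def sub_add)
  qed
  then have "pd p 1 (fps_nth (P (Suc n) ^ p) n - fps_nth (sub p (P (Suc n))) n)" by (simp add: fcong_def)
  moreover have e: "eqm (Suc n) A (P (Suc n))"
    unfolding eqm_def
  proof (intro allI impI)
    fix i assume i: "i < Suc n"
    have "fps_nth (P (Suc n)) i = (\<Sum>k<Suc n. if k = i then fps_nth A k else 0)"
      unfolding P_def fps_sum_nth by (rule sum.cong) (auto simp: fps_X_power_nth)
    then show "fps_nth A i = fps_nth (P (Suc n)) i" using i by simp
  qed
  have "fps_nth (A ^ p) n = fps_nth (P (Suc n) ^ p) n" using eqm_power[OF e] by (simp add: eqm_def)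
  moreover have "fps_nth (sub p A) n = fps_nth (sub p (P (Suc n))) n"
    using eqm_compose_X_power[OF e p_pos] by (simp add: eqm_def sub_def)
  ultimately show "pd p 1 (fps_nth (A ^ p) n - fps_nth (sub p A) n)" by simp
qed

text \<open>Every p-th power gains one power of p in the modulus. The modulus exceeds the
  multiplicity of p in i by one, so that a factor p survives the division by i in
  \<open>change_of_parameter\<close>.\<close>

lemma fcong_power_multiplicity:
  assumes "fcong 1 A B" "zp_fps A" "zp_fps B" "i > 0"
  shows "fcong (Suc (multiplicity p i)) (A ^ i) (B ^ i)"
proof -
  have pw: "fcong (Suc k) (A ^ p ^ k) (B ^ p ^ k)" for k
  proof (induction k)
    case (Suc k)
    have "fcong (Suc (Suc k)) ((A ^ p ^ k) ^ p) ((B ^ p ^ k) ^ p)"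
      by (rule fcong_pth_power[OF Suc]) (intro zp_fps_power assms | simp)+
    then show ?case by (simp add: power_mult[symmetric] mult.commute)
  qed (use assms in simp)
  obtain u where u: "i = p ^ multiplicity p i * u"
    using multiplicity_dvd[of p i] by blast
  have c: "fcong (Suc (multiplicity p i)) ((A ^ p ^ multiplicity p i) ^ u) ((B ^ p ^ multiplicity p i) ^ u)"
    by (rule fcong_power[OF pw]) (intro zp_fps_power assms)+
  have "(F ^ p ^ multiplicity p i) ^ u = F ^ i" for F :: "rat fps"
    unfolding power_mult[symmetric] u[symmetric] ..
  then show ?thesis using c by (simp only:)
qed

text \<open>
  If \<open>\<Sum>n. \<beta> n / n * t ^ n - \<gamma> / p * (\<Sum>n. \<alpha> n / n * t ^ (p * n))\<close> is \<open>p\<close>-integral in the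
  parameter \<open>t\<close>, the same holds after substituting \<open>T\<close>, with \<open>q \<mapsto> q ^ p\<close> in place of
  \<open>t \<mapsto> t ^ p\<close>: the difference between two lifts of Frobenius is absorbed by the denominators.
\<close>

lemma change_of_parameter:
  assumes T: "zp_fps T" "fps_nth T 0 = 0"
    and zp: "\<And>n. \<alpha> n \<in> zp p" "\<And>n. \<beta> n \<in> zp p" "\<gamma> \<in> zp p"
    and D: "\<And>i. 0 < i \<Longrightarrow> i \<le> N \<Longrightarrow> p dvd i \<Longrightarrow> pd p (multiplicity p i) (\<beta> i - \<gamma> * \<alpha> (i div p))"
  defines "f \<equiv> \<lambda>\<alpha>. Abs_fps (\<lambda>n. \<alpha> n / of_nat n)"
  shows "pd p 1 (of_nat p * fps_nth (fps_compose (f \<beta>) T) N - \<gamma> * fps_nth (sub p (fps_compose (f \<alpha>) T)) N)"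
proof -
  let ?S = "\<Sum>i=0..N. fps_nth (f \<alpha>) i * fps_nth (T ^ (p * i)) N"
  have "sub p (fps_compose (f \<alpha>) T) = fps_compose (f \<alpha>) (sub p T)"
    unfolding sub_def using T(2) p_pos by (intro fps_compose_assoc[symmetric]) auto
  \<comment> \<open>\<open>?S\<close> is the coefficient of the first integral at T(q)^p, the
    Frobenius t -> t^p of the parameter; the series in the claim has T(q^p) instead.\<close>
  then have "fps_nth (sub p (fps_compose (f \<alpha>) T)) N - ?S =
     (\<Sum>i=0..N. fps_nth (f \<alpha>) i * (fps_nth (sub p T ^ i) N - fps_nth (T ^ (p * i)) N))"
    by (simp add: fps_compose_nth sum_subtractf right_diff_distrib)
  also have "pd p 1 \<dots>"
  proof (rule pd_sum)
    fix i
    show "pd p 1 (fps_nth (f \<alpha>) i * (fps_nth (sub p T ^ i) N - fps_nth (T ^ (p * i)) N))"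
    proof (cases "i = 0")
      case True
      then show ?thesis by (simp add: f_def)
    next
      case False
      have "fcong (Suc (multiplicity p i)) ((T ^ p) ^ i) (sub p T ^ i)"
        by (rule fcong_power_multiplicity[OF frobenius[OF T(1)]])
           (use False p_pos in \<open>auto intro: zp_fps_power zp_fps_sub T\<close>)
      then have "pd p (multiplicity p i + 1) (fps_nth (T ^ (p * i)) N - fps_nth (sub p T ^ i) N)"
        by (simp add: fcong_def power_mult)
      then have "pd p 1 ((fps_nth (T ^ (p * i)) N - fps_nth (sub p T ^ i) N) / of_nat i)"
        using False by (intro pd_divide_nat) auto
      then have "pd p 1 (- \<alpha> i * ((fps_nth (T ^ (p * i)) N - fps_nth (sub p T ^ i) N) / of_nat i))"
        using zp(1) by (intro pd_zp_mult zp_uminus)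
      then show ?thesis using False by (simp add: f_def field_simps)
    qed
  qed
  finally have 1: "pd p 1 (fps_nth (sub p (fps_compose (f \<alpha>) T)) N - ?S)" .
  \<comment> \<open>\<open>g\<close> holds the coefficients of the first integral as a series in t
    after t -> t^p, so that both integrals become series in the same T and are subtracted term by
    term.\<close>
  define g where "g = (\<lambda>j. if p dvd j then fps_nth (f \<alpha>) (j div p) else 0)"
  have "?S = (\<Sum>j=0..N. g j * fps_nth (T ^ j) N)"
  proof -
    have z: "fps_nth (T ^ j) N = 0" if "j > N" for j
      using startsby_zero_power_prefix[of T j] T(2) that by simp
    have "(\<Sum>j=0..N. g j * fps_nth (T ^ j) N) = (\<Sum>j\<in>{j\<in>{0..N}. p dvd j}. fps_nth (f \<alpha>) (j div p) * fps_nth (T ^ j) N)"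
      by (rule sum.mono_neutral_cong_right) (auto simp: g_def)
    also have "\<dots> = (\<Sum>i\<in>{i\<in>{0..N}. p * i \<le> N}. fps_nth (f \<alpha>) i * fps_nth (T ^ (p * i)) N)"
      by (rule sum.reindex_bij_witness[where i = "\<lambda>i. p * i" and j = "\<lambda>j. j div p"])
         (use p_pos in \<open>auto intro: order_trans[OF div_le_dividend]\<close>)
    also have "\<dots> = ?S"
      by (rule sum.mono_neutral_left) (auto, metis z not_le)
    finally show ?thesis by simp
  qed
  then have "of_nat p * fps_nth (fps_compose (f \<beta>) T) N - \<gamma> * ?S =
     (\<Sum>j=0..N. (of_nat p * fps_nth (f \<beta>) j - \<gamma> * g j) * fps_nth (T ^ j) N)"
    by (simp add: fps_compose_nth sum_subtractf sum_distrib_left left_diff_distrib mult.assoc)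
  also have "pd p 1 \<dots>"
  proof (intro pd_sum pd_mult_zp)
    fix j assume j: "j \<in> {0..N}"
    show "fps_nth (T ^ j) N \<in> zp p" using zp_fps_power[OF T(1)] by (simp add: zp_fps_def)
    show "pd p 1 (of_nat p * fps_nth (f \<beta>) j - \<gamma> * g j)"
    proof (cases "j = 0 \<or> \<not> p dvd j")
      case True
      have "pd p 1 (of_nat p * \<beta> j / of_nat j)" if "j \<noteq> 0" "\<not> p dvd j"
        using that pd_mult_zp[OF pd_p_power[of 1] zp(2)]
        by (intro pd_divide_nat) (simp_all add: not_dvd_imp_multiplicity_0)
      with True show ?thesis by (auto simp: f_def g_def)
    next
      case False
      then obtain i where i: "j = p * i" "i > 0" by auto
      have "pd p (multiplicity p j + 1) ((\<beta> j - \<gamma> * \<alpha> (j div p)) * of_nat p)"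
        using D[of j] False j pd_p_power[of 1] by (intro pd_mult) auto
      then have "pd p 1 ((\<beta> j - \<gamma> * \<alpha> (j div p)) * of_nat p / of_nat j)"
        using False by (intro pd_divide_nat) auto
      also have "(\<beta> j - \<gamma> * \<alpha> (j div p)) * of_nat p / of_nat j = of_nat p * fps_nth (f \<beta>) j - \<gamma> * g j"
        using i p_pos by (simp add: f_def g_def field_simps)
      finally show ?thesis .
    qed
  qed
  finally have 2: "pd p 1 (of_nat p * fps_nth (fps_compose (f \<beta>) T) N - \<gamma> * ?S)" .
  have "of_nat p * fps_nth (fps_compose (f \<beta>) T) N - \<gamma> * fps_nth (sub p (fps_compose (f \<alpha>) T)) N =
     (of_nat p * fps_nth (fps_compose (f \<beta>) T) N - \<gamma> * ?S) - \<gamma> * (fps_nth (sub p (fps_compose (f \<alpha>) T)) N - ?S)"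
    by (simp add: algebra_simps)
  then show ?thesis using pd_diff[OF 2 pd_zp_mult[OF 1 zp(3)]] by (simp only:)
qed

lemma zp_unit_add_pd:
  assumes "zp_unit p u" "pd p 1 x"
  shows "zp_unit p (u + x)"
proof -
  obtain a b where ab: "\<not> int p dvd a" "\<not> int p dvd b" "u = of_int a / of_int b"
    using assms(1) by (auto simp: zp_unit_def)
  obtain y where y: "y \<in> zp p" "x = of_nat p * y" using assms(2) unfolding pd_def by auto
  then obtain c d where cd: "\<not> int p dvd d" "x = of_nat p * (of_int c / of_int d)"
    unfolding zp_def by blast
  have "u + x = of_int (a * d + int p * (c * b)) / of_int (b * d)"
    using not_dvd_neq_0[OF ab(2)] not_dvd_neq_0[OF cd(1)] by (simp add: ab(3) cd(2) field_simps)
  moreover have "\<not> int p dvd a * d + int p * (c * b)"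
    using not_dvd_mult[OF ab(1) cd(1)] by (simp add: dvd_add_left_iff)
  ultimately show ?thesis unfolding zp_unit_def using not_dvd_mult[OF ab(2) cd(1)] by blast
qed

text \<open>\<open>cf\<close> will be the coefficients of G and \<open>a\<close> those of the
  newform. The p-integral \<open>W\<close> comes from an exact part of G and contributes n * W n to
  the n-th coefficient; \<open>l\<close> is the leading coefficient of T. The hypothesis on \<gamma>
  is made for each bound N separately, \<gamma> being a rational approximation of a p-adic
  unit.\<close>

theorem inert_congruences:
  fixes a cf W :: "nat \<Rightarrow> rat"
  assumes T: "zp_fps T" "fps_nth T 0 = 0"
    and zp: "\<And>n. \<alpha> n \<in> zp p" "\<And>n. \<beta> n \<in> zp p" "\<And>n. W n \<in> zp p" "\<And>n. a n \<in> zp p"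
    and l: "zp_unit p l"
    and a: "\<And>n. of_nat n * fps_nth (fps_compose (Abs_fps (\<lambda>n. \<alpha> n / of_nat n)) T) n = l * a n"
    and cf: "\<And>n. n > 0 \<Longrightarrow> cf n = of_nat n * (fps_nth (fps_compose (Abs_fps (\<lambda>n. \<beta> n / of_nat n)) T) n + W n)"
    and D: "\<And>N. \<exists>\<gamma>. zp_unit p \<gamma> \<and> (\<forall>i. 0 < i \<longrightarrow> i \<le> N \<longrightarrow> p dvd i \<longrightarrow>
              pd p (multiplicity p i) (\<beta> i - \<gamma> * \<alpha> (i div p)))"
    and hecke: "\<And>k. a (p ^ 2 * k) = - of_nat p * a k" and a1: "a 1 = 1"
  shows "\<exists>u. zp_unit p u \<and> cf (p ^ (2 * m + 1)) = of_nat p ^ m * u"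
    and "n > 0 \<Longrightarrow> pd p (2 * m + 1) (cf (p ^ (2 * m + 1) * n) - cf (p ^ (2 * m + 1)) * a n)"
proof -
  have hm: "a (p ^ (2 * m) * n) = (- of_nat p) ^ m * a n" for m n
  proof (induction m)
    case (Suc m)
    have "p ^ (2 * Suc m) * n = p ^ 2 * (p ^ (2 * m) * n)" by (simp add: power2_eq_square)
    then have "a (p ^ (2 * Suc m) * n) = - of_nat p * a (p ^ (2 * m) * n)" using hecke[of "p ^ (2 * m) * n"] by (simp only:)
    then show ?case unfolding Suc.IH by simp
  qed simp
  \<comment> \<open>The same \<gamma> has to serve for n and for 1, so that it can be eliminated
    between the two; the bound p ^ (2 * m + 1) * n covers both.\<close>
  have key: "\<exists>\<gamma>. zp_unit p \<gamma> \<and> pd p (2 * m + 1) (cf (p ^ (2 * m + 1) * n) - \<gamma> * l * (- of_nat p) ^ m * a n)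
       \<and> pd p (2 * m + 1) (cf (p ^ (2 * m + 1)) - \<gamma> * l * (- of_nat p) ^ m)" if n: "n > 0" for n
  proof -
    obtain \<gamma> where g: "zp_unit p \<gamma>"
      and D: "\<And>i. 0 < i \<Longrightarrow> i \<le> p ^ (2 * m + 1) * n \<Longrightarrow> p dvd i \<Longrightarrow> pd p (multiplicity p i) (\<beta> i - \<gamma> * \<alpha> (i div p))"
      using D[of "p ^ (2 * m + 1) * n"] by blast
    have *: "pd p (2 * m + 1) (cf (p ^ (2 * m + 1) * n') - \<gamma> * l * (- of_nat p) ^ m * a n')"
      if n': "0 < n'" "n' \<le> n" for n'
    proof -
      \<comment> \<open>The integrals are congruent modulo p, and multiplication by k adds 2 m
        powers of p. The Hecke relation turns a k into (- p) ^ m * a n', which costs only m of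
        them.\<close>
      define k where "k = p ^ (2 * m) * n'"
      have k: "p * k = p ^ (2 * m + 1) * n'" "k > 0" using n' p_pos by (simp_all add: k_def)
      have pk: "pd p (2 * m) (of_nat k)" by (rule pd_of_nat) (simp add: k_def)
      define w u where "w = fps_nth (fps_compose (Abs_fps (\<lambda>n. \<beta> n / of_nat n)) T) (p * k)"
        and "u = fps_nth (fps_compose (Abs_fps (\<lambda>n. \<alpha> n / of_nat n)) T) k"
      have "p * k \<le> p ^ (2 * m + 1) * n" unfolding k(1) using n' by simp
      then have "pd p 1 (of_nat p * w - \<gamma> * fps_nth (sub p (fps_compose (Abs_fps (\<lambda>n. \<alpha> n / of_nat n)) T)) (p * k))"
        unfolding w_def using g by (intro change_of_parameter T zp D) (auto simp: zp_unit_iff)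
      then have "pd p 1 (of_nat p * w - \<gamma> * u)" using p_pos by (simp add: u_def)
      then have "pd p (2 * m + 1) (of_nat k * (of_nat p * w - \<gamma> * u))" by (rule pd_mult[OF pk])
      moreover have "pd p (2 * m + 1) (of_nat k * of_nat p * W (p * k))"
        using pd_mult_zp[OF pd_mult[OF pk pd_p_power[of 1]] zp(3)] by simp
      ultimately have "pd p (2 * m + 1) (of_nat k * (of_nat p * w - \<gamma> * u) + of_nat k * of_nat p * W (p * k))"
        by (rule pd_add)
      moreover have ku: "\<gamma> * (of_nat k * u) = \<gamma> * (l * a k)" unfolding u_def by (subst a) (rule refl)
      have "of_nat k * (of_nat p * w - \<gamma> * u) + of_nat k * of_nat p * W (p * k) = cf (p * k) - \<gamma> * l * a k"
      proof -
        have "cf (p * k) = of_nat (p * k) * (w + W (p * k))"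
          unfolding w_def using p_pos k(2) by (intro cf) simp
        moreover have "of_nat k * (of_nat p * w - \<gamma> * u) + of_nat k * of_nat p * W (p * k)
            = of_nat (p * k) * (w + W (p * k)) - \<gamma> * (of_nat k * u)"
          by (simp add: algebra_simps)
        ultimately show ?thesis unfolding ku by simp
      qed
      moreover have "a k = (- of_nat p) ^ m * a n'" unfolding k_def by (rule hm)
      ultimately show ?thesis unfolding k(1) by (simp add: mult.assoc)
    qed
    have "pd p (2 * m + 1) (cf (p ^ (2 * m + 1)) - \<gamma> * l * (- of_nat p) ^ m)"
      using *[of 1] n a1 by simp
    with *[of n] n g show ?thesis by blast
  qed
  show "\<exists>u. zp_unit p u \<and> cf (p ^ (2 * m + 1)) = of_nat p ^ m * u"
  proof -
    obtain \<gamma> where g: "zp_unit p \<gamma>" and d: "pd p (2 * m + 1) (cf (p ^ (2 * m + 1)) - \<gamma> * l * (- of_nat p) ^ m)"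
      using key[of 1] by auto
    obtain y where y: "y \<in> zp p" "cf (p ^ (2 * m + 1)) - \<gamma> * l * (- of_nat p) ^ m = of_nat p ^ (2 * m + 1) * y"
      using d by (auto simp: pd_def)
    have sgn: "zp_unit p ((- 1) ^ m)"
    proof -
      have "\<not> int p dvd - 1" using prime_int_p by (metis dvd_minus_iff not_prime_unit)
      from zp_unit_power[OF zp_unit_of_int[OF this], of m] show ?thesis by simp
    qed
    have mp: "(- of_nat p :: rat) ^ m = of_nat p ^ m * (- 1) ^ m" by (metis mult.commute mult_minus1 power_mult_distrib)
    have "cf (p ^ (2 * m + 1)) = of_nat p ^ m * (\<gamma> * l * (- 1) ^ m + of_nat p * (of_nat p ^ m * y))"
    proof -
      have "cf (p ^ (2 * m + 1)) = \<gamma> * l * (- of_nat p) ^ m + of_nat p ^ (2 * m + 1) * y" using y(2) by simp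
      also have "of_nat p ^ (2 * m + 1) = of_nat p ^ m * (of_nat p * of_nat p ^ m :: rat)"
        by (simp add: mult_2 power_add)
      finally show ?thesis unfolding mp by (simp add: algebra_simps)
    qed
    moreover have "zp_unit p (\<gamma> * l * (- 1) ^ m + of_nat p * (of_nat p ^ m * y))"
      using g l sgn y(1) pd_p_power[of 1]
      by (intro zp_unit_add_pd zp_unit_mult pd_mult_zp) auto
    ultimately show ?thesis by blast
  qed
  show "pd p (2 * m + 1) (cf (p ^ (2 * m + 1) * n) - cf (p ^ (2 * m + 1)) * a n)" if n: "n > 0"
  proof -
    obtain \<gamma> where d1: "pd p (2 * m + 1) (cf (p ^ (2 * m + 1) * n) - \<gamma> * l * (- of_nat p) ^ m * a n)"
      and d2: "pd p (2 * m + 1) (cf (p ^ (2 * m + 1)) - \<gamma> * l * (- of_nat p) ^ m)"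
      using key[OF n] by blast
    have "pd p (2 * m + 1) ((cf (p ^ (2 * m + 1) * n) - \<gamma> * l * (- of_nat p) ^ m * a n) -
       (cf (p ^ (2 * m + 1)) - \<gamma> * l * (- of_nat p) ^ m) * a n)"
      by (intro pd_diff d1 pd_mult_zp[OF d2] zp)
    then show ?thesis by (simp add: algebra_simps)
  qed
qed

end

section \<open>The unit root ratio of hypergeometric coefficients\<close>

text \<open>The factors in Morita's p-adic Gamma function: multiples of p are replaced by 1, so that
  every product is a unit at p.\<close>

definition nu :: "nat \<Rightarrow> int \<Rightarrow> int" where
  "nu p x = (if int p dvd x then 1 else x)"

lemma mult_add_pred_mod_div:
  assumes "0 < (e :: nat)"
  shows "(e * q + (e - 1)) mod e = e - 1" "(e * q + (e - 1)) div e = q"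
proof -
  have "e - 1 < e" using assms by simp
  then show "(e * q + (e - 1)) mod e = e - 1" "(e * q + (e - 1)) div e = q"
    by (simp_all del: add_diff_assoc add_diff_assoc2)
qed

context prime_local
begin

lemma nu_not_dvd: "\<not> int p dvd nu p x"
  using prime_int_p by (auto simp: nu_def)

lemma cong_nu:
  assumes "[x = y] (mod int p ^ Suc r)"
  shows "[nu p x = nu p y] (mod int p ^ Suc r)"
proof -
  have "[x = y] (mod int p)" using assms by (rule cong_dvd_modulus) simp
  then have "int p dvd x \<longleftrightarrow> int p dvd y" by (rule cong_dvd_iff)
  then show ?thesis using assms by (simp add: nu_def)
qed

text \<open>As d is prime to p, d * i - c runs through all residues modulo p ^ (r + 1) when i runs
  through that many consecutive integers. The value is independent of c, so numerators and
  denominators below change by the same factor.\<close>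

lemma prod_nu_block:
  fixes d :: int
  assumes "coprime d (int p)"
  shows "[(\<Prod>i\<in>{k<..k + p ^ Suc r}. nu p (d * int i - c)) = (\<Prod>u\<in>{0..<int p ^ Suc r}. nu p u)] (mod int p ^ Suc r)"
proof -
  define M where "M = int p ^ Suc r"
  have M: "M > 0" using p_pos by (simp add: M_def)
  have co: "coprime d M" using assms by (simp add: M_def)
  define h where "h = (\<lambda>i. (d * int i - c) mod M)"
  let ?I = "{k<..k + p ^ Suc r}"
  have inj: "inj_on h ?I"
  proof (rule inj_onI)
    fix i j assume ij: "i \<in> ?I" "j \<in> ?I" "h i = h j"
    then have "[d * int i - c = d * int j - c] (mod M)" by (simp add: h_def cong_def)
    then have "[d * int i = d * int j] (mod M)" by (simp add: cong_iff_dvd_diff)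
    then have "[int i = int j] (mod M)" using co by (simp add: cong_mult_lcancel)
    then have "M dvd int i - int j" by (simp add: cong_iff_dvd_diff)
    moreover have "\<bar>int i - int j\<bar> < M" using ij(1,2) unfolding M_def greaterThanAtMost_iff of_nat_power[symmetric] by linarith
    ultimately show "i = j" using dvd_imp_le_int[of "int i - int j" M] M by fastforce
  qed
  have "h ` ?I = {0..<M}"
  proof (rule card_subset_eq)
    show "h ` ?I \<subseteq> {0..<M}" using M by (auto simp: h_def)
    show "card (h ` ?I) = card {0..<M}" using card_image[OF inj] by (simp add: M_def nat_mult_distrib nat_power_eq)
  qed simp
  then have "(\<Prod>u\<in>{0..<M}. nu p u) = (\<Prod>i\<in>?I. nu p (h i))"
    using prod.reindex[OF inj, of "nu p"] by simp
  moreover have "[(\<Prod>i\<in>?I. nu p (d * int i - c)) = (\<Prod>i\<in>?I. nu p (h i))] (mod M)"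
    unfolding M_def by (intro cong_prod cong_nu) (simp add: h_def M_def cong_def)
  ultimately show ?thesis by (simp add: M_def)
qed

lemma cong_pth_power:
  fixes x y :: int
  assumes "[x = y] (mod int p ^ Suc r)"
  shows "[x ^ p = y ^ p] (mod int p ^ Suc (Suc r))"
proof -
  have "[x = y] (mod int p)" using assms by (rule cong_dvd_modulus) simp
  then have "[(\<Sum>i<p. y ^ (p - Suc i) * x ^ i) = (\<Sum>i<p. y ^ (p - Suc i) * y ^ i)] (mod int p)"
    by (intro cong_sum cong_mult cong_pow cong_refl)
  also have "(\<Sum>i<p. y ^ (p - Suc i) * y ^ i) = (\<Sum>i<p. y ^ (p - 1))"
    by (rule sum.cong) (simp_all flip: power_add)
  also have "[\<dots> = 0] (mod int p)" by (simp add: cong_0_iff)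
  finally have "int p dvd (\<Sum>i<p. y ^ (p - Suc i) * x ^ i)" by (simp add: cong_0_iff)
  then have "int p ^ Suc r * int p dvd (x - y) * (\<Sum>i<p. y ^ (p - Suc i) * x ^ i)"
    using assms by (intro mult_dvd_mono) (simp_all add: cong_iff_dvd_diff)
  then show ?thesis
    by (simp only: power_diff_sumr2 cong_iff_dvd_diff power_Suc2[of "int p" "Suc r"])
qed

text \<open>Up to sign the binomial coefficient is the rising factorial of a / d divided by j!, here
  with all factors multiplied by d. The numerator factors a + d (i - 1) are written d i - (d - a),
  the shape in which they reappear among the multiples of p in \<open>unit_ratio\<close>.\<close>

lemma gbinomial_prod_form:
  "(- (of_nat a / of_nat d) gchoose j :: rat) * (- 1) ^ j * (\<Prod>i\<in>{1..j}. of_int (int d * int i)) =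
     (\<Prod>i\<in>{1..j}. of_int (int d * int i - (int d - int a)))" if "d > 0"
proof (induction j)
  case (Suc j)
  have "(- (of_nat a / of_nat d) gchoose Suc j :: rat) * of_nat (Suc j) = (- (of_nat a / of_nat d) gchoose j) * (- (of_nat a / of_nat d) - of_nat j)"
    using gbinomial_mult_1[of "- (of_nat a / of_nat d) :: rat" j] by (simp add: algebra_simps)
  then have "(- (of_nat a / of_nat d) gchoose Suc j :: rat) * (- 1) * of_int (int d * int (Suc j)) =
     (- (of_nat a / of_nat d) gchoose j) * of_int (int d * int (Suc j) - (int d - int a))"
    using that by (simp add: field_simps)
  note step = this
  have ins: "{1..Suc j} = insert (Suc j) {1..j}" "Suc j \<notin> {1..j}" by auto
  define g g' s P P' c c' :: rat where "g = (- (of_nat a / of_nat d) gchoose j)" and "g' = (- (of_nat a / of_nat d) gchoose Suc j)"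
    and "s = (- 1) ^ j" and "P = (\<Prod>i\<in>{1..j}. of_int (int d * int i))"
    and "P' = (\<Prod>i\<in>{1..j}. of_int (int d * int i - (int d - int a)))"
    and "c = of_int (int d * int (Suc j))" and "c' = of_int (int d * int (Suc j) - (int d - int a))"
  have "g' * ((- 1) * s) * (c * P) = (g' * (- 1) * c) * (s * P)" by (simp only: mult_ac)
  also have "\<dots> = c' * (g * s * P)" using step by (simp only: g_def g'_def c_def c'_def mult_ac)
  also have "\<dots> = c' * P'" using Suc by (simp only: g_def s_def P_def P'_def)
  finally show ?case
    unfolding ins(1) prod.insert[OF finite_atLeastAtMost ins(2)] power_Suc
    by (simp only: g'_def s_def c_def c'_def P_def P'_def)
qed simp

text \<open>For n = e j + 1 the coefficients \<open>\<alpha> n\<close> and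
  \<open>\<beta> (p * n)\<close> are quotients of products. In those for
  \<open>\<beta> (p * n)\<close> the factors divisible by p reproduce p ^ j times the factors for
  \<open>\<alpha> n\<close>, in the numerator as in the denominator, so the ratio of the two
  coefficients is a quotient of units. This quotient is p-adically continuous in j, and \<gamma>
  approximates its limit as n = e j + 1 tends to 0.\<close>

theorem unit_ratio:
  fixes \<kappa> :: int
  assumes cop: "coprime d p" "coprime e p" and d: "0 < a" "a < d"
    and e: "p + 1 = e * k0" "1 < e" and s: "(p + 1) * a = d * s" "k0 < s" and \<kappa>: "\<not> int p dvd \<kappa>"
  defines "\<alpha> \<equiv> \<lambda>n. if n mod e = 1 then (- (of_nat a / of_nat d) gchoose (n div e)) * of_int \<kappa> ^ (n div e) else (0 :: rat)"
    and "\<beta> \<equiv> \<lambda>n. if n mod e = e - 1 then (- (of_nat (d - a) / of_nat d) gchoose (n div e + 1)) * of_int \<kappa> ^ (n div e + 1) else (0 :: rat)"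
  shows "\<exists>\<gamma>. zp_unit p \<gamma> \<and> (\<forall>i. 0 < i \<longrightarrow> i \<le> N \<longrightarrow> p dvd i \<longrightarrow>
              pd p (multiplicity p i) (\<beta> i - \<gamma> * \<alpha> (i div p)))"
proof -
  define A B where "A = (\<lambda>j. (- (of_nat a / of_nat d) gchoose j) :: rat)" and "B = (\<lambda>k. (- (of_nat (d - a) / of_nat d) gchoose k) :: rat)"
  define K where "K = (\<lambda>j. p * j + k0)"
  define Nn Dd :: "nat \<Rightarrow> int" where "Nn = (\<lambda>j. \<Prod>i\<in>{1..K j}. nu p (int d * int i - int a))"
    and "Dd = (\<lambda>j. \<Prod>i\<in>{1..K j}. nu p (int d * int i))"
  define Q where "Q = (\<lambda>j. \<kappa> ^ ((p - 1) * j + k0) * (- 1) ^ (K j + j) * Nn j)"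
  have p2: "p \<ge> 2" using prime_p prime_ge_2_nat by blast
  have ndp: "\<not> int p dvd (\<Prod>i\<in>S. nu p (f i))" for S :: "nat set" and f
  proof (cases "finite S")
    case True
    then show ?thesis using prime_int_p nu_not_dvd by (simp add: prime_dvd_prod_iff)
  next
    case False
    then show ?thesis using nu_not_dvd[of 1] by (simp add: nu_def split: if_splits)
  qed
  have ndD: "\<not> int p dvd Dd j" and ndN: "\<not> int p dvd Nn j" for j
    unfolding Dd_def Nn_def by (rule ndp)+
  have n1: "\<not> int p dvd (- 1) ^ n" for n
    using prime_int_p by (metis minus_one_power_iff dvd_minus_iff not_prime_unit)
  have ndQ: "\<not> int p dvd Q j" for j
    unfolding Q_def using \<kappa> ndN n1 prime_int_p by (intro not_dvd_mult) (blast dest: prime_dvd_power)+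
  have s_le: "s \<le> p"
  proof -
    have "(p + 1) * a < (p + 1) * d" using d by (intro mult_strict_left_mono) auto
    then have "d * s < d * (p + 1)" unfolding s(1) by (simp only: mult.commute[of d])
    then have "s < p + 1" by (metis nat_mult_less_cancel_disj)
    then show ?thesis by simp
  qed
  have k0p: "k0 < p" using s(2) s_le by simp
  have ratio: "B (K j) * of_int \<kappa> ^ K j * of_int (Dd j) = A j * of_int \<kappa> ^ j * of_int (Q j)" for j
  proof -
    have split: "(\<Prod>i\<in>{1..K j}. f i) = (\<Prod>i\<in>{1..K j}. nu p (f i)) * (\<Prod>i\<in>{i\<in>{1..K j}. int p dvd f i}. f i)" for f
    proof -
      have "(\<Prod>i\<in>{1..K j}. f i) = (\<Prod>i\<in>{1..K j}. nu p (f i) * (if int p dvd f i then f i else 1))"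
        by (rule prod.cong) (auto simp: nu_def)
      then show ?thesis by (simp add: prod.distrib prod.If_cases Int_def)
    qed
    have cdi: "int p dvd int d * int i \<longleftrightarrow> p dvd i" for i
      using cop(1) by (metis coprime_commute coprime_dvd_mult_right_iff int_dvd_int_iff of_nat_mult)
    have den: "(\<Prod>i\<in>{i\<in>{1..K j}. int p dvd int d * int i}. int d * int i) = (\<Prod>i\<in>{1..j}. int p * (int d * int i))"
      unfolding cdi
    proof (rule prod.reindex_bij_witness[where i = "\<lambda>i. p * i" and j = "\<lambda>i. i div p"])
      fix i assume i: "i \<in> {i \<in> {1..K j}. p dvd i}"
      then have "i div p \<ge> 1" using p_pos by (auto elim!: dvdE)
      moreover have "i < p * (j + 1)" using i k0p by (auto simp: K_def)
      then have "i div p < j + 1" using p_pos by (simp add: div_less_iff_less_mult mult.commute)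
      ultimately show "i div p \<in> {1..j}" by auto
    qed (use p_pos in \<open>auto simp: K_def intro: trans_le_add1\<close>)
    \<comment> \<open>From d s = (p + 1) a, the residue of i modulo p at which p divides d i - a is
      that of s.\<close>
    have mem: "int p dvd int d * int i - int a \<longleftrightarrow> int p dvd int i - int s" for i
    proof -
      have "int d * int s = (int p + 1) * int a"
        using s(1) by (metis of_nat_1 of_nat_add of_nat_mult)
      then have "int d * int i - int a = int d * (int i - int s) + int p * int a"
        by (simp add: algebra_simps)
      then have "int p dvd int d * int i - int a \<longleftrightarrow> int p dvd int d * (int i - int s)"
        by (metis dvd_add_left_iff dvd_triv_left)
      then show ?thesis using cop(1) by (metis coprime_commute coprime_dvd_mult_right_iff coprime_int_iff)
    qed
    \<comment> \<open>The indices concerned are p t + s with t < j; the index p j + s exceeds K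
      because k0 < s. At p (i - 1) + s the factor is p (d i - (d - a)), which is p times the i-th
      numerator factor of \<open>A j\<close>.\<close>
    have num: "(\<Prod>i\<in>{i\<in>{1..K j}. int p dvd int d * int i - int a}. int d * int i - int a) =
       (\<Prod>i\<in>{1..j}. int p * (int d * int i - (int d - int a)))"
      unfolding mem
    proof (rule prod.reindex_bij_witness[where i = "\<lambda>i. p * (i - 1) + s" and j = "\<lambda>i. (i + p - s) div p"])
      fix i assume i: "i \<in> {i \<in> {1..K j}. int p dvd int i - int s}"
      have "i \<ge> s"
      proof (rule ccontr)
        assume "\<not> s \<le> i"
        then have "int s - int i > 0" "int s - int i < int p" using i s_le by auto
        moreover have "int p dvd int s - int i" using i by (metis (mono_tags, lifting) dvd_diff_commute mem_Collect_eq)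
        ultimately show False using zdvd_not_zless by blast
      qed
      moreover have "int p dvd int (i - s)" using i calculation by (simp add: of_nat_diff)
      then obtain t where t: "i - s = p * t" using int_dvd_int_iff by blast
      ultimately have it: "i = p * t + s" by simp
      then have dv: "(i + p - s) div p = t + 1" using p_pos by simp
      have "p * t + s \<le> p * j + k0" using i it by (simp add: K_def)
      then have "p * t < p * j" using s(2) by linarith
      then have "t < j" by simp
      then show "(i + p - s) div p \<in> {1..j}" "p * ((i + p - s) div p - 1) + s = i" using dv it by auto
      show "int p * (int d * int ((i + p - s) div p) - (int d - int a)) = int d * int i - int a"
      proof -
        have "int d * int s = (int p + 1) * int a" using s(1) by (metis of_nat_1 of_nat_add of_nat_mult)
        then show ?thesis unfolding dv it by (simp add: algebra_simps)
      qed
    next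
      fix i assume i: "i \<in> {1..j}"
      then obtain t where t: "i = Suc t" "t < j" by (cases i) auto
      have "s > 0" using s d p_pos by (cases s) auto
      moreover have "p * t + s \<le> p * j + k0"
      proof -
        have "p * t + s \<le> p * t + p" using s_le by simp
        also have "\<dots> = p * Suc t" by simp
        also have "\<dots> \<le> p * j" using t by (intro mult_le_mono2) simp
        finally show ?thesis by simp
      qed
      ultimately show "p * (i - 1) + s \<in> {i \<in> {1..K j}. int p dvd int i - int s}" by (auto simp: K_def t)
      show "(p * (i - 1) + s + p - s) div p = i" using p_pos t by simp
    qed
    have nzd: "(\<Prod>i\<in>{1..k}. of_int (int d * int i) :: rat) \<noteq> 0" for k using d by auto
    have B1: "B k * (- 1) ^ k * (\<Prod>i\<in>{1..k}. of_int (int d * int i)) = (\<Prod>i\<in>{1..k}. of_int (int d * int i - int a))" for k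
      using gbinomial_prod_form[of d "d - a" k] d by (simp add: B_def of_nat_diff)
    have A1: "A k * (- 1) ^ k * (\<Prod>i\<in>{1..k}. of_int (int d * int i)) = (\<Prod>i\<in>{1..k}. of_int (int d * int i - (int d - int a)))" for k
      using gbinomial_prod_form[of d a k] d by (simp add: A_def)
    define P where "P = (\<Prod>i\<in>{1..j}. of_int (int d * int i) :: rat)"
    have D2: "(\<Prod>i\<in>{1..K j}. of_int (int d * int i) :: rat) = of_int (Dd j) * (of_nat p ^ j * P)"
      using arg_cong[OF split[of "\<lambda>i. int d * int i"], of "of_int :: int \<Rightarrow> rat"] unfolding den
      by (simp add: Dd_def P_def prod.distrib)
    have N2: "(\<Prod>i\<in>{1..K j}. of_int (int d * int i - int a) :: rat) = of_int (Nn j) * (of_nat p ^ j * (A j * (- 1) ^ j * P))"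
      using arg_cong[OF split[of "\<lambda>i. int d * int i - int a"], of "of_int :: int \<Rightarrow> rat"] A1[of j] unfolding num
      by (simp add: Nn_def P_def prod.distrib)
    have "B (K j) * (- 1) ^ K j * (of_int (Dd j) * (of_nat p ^ j * P)) = of_int (Nn j) * (of_nat p ^ j * (A j * (- 1) ^ j * P))"
      using B1[of "K j"] unfolding D2 N2 .
    moreover have "of_nat p ^ j * P \<noteq> 0" using p_pos nzd[of j] by (simp add: P_def)
    ultimately have "B (K j) * (- 1) ^ K j * of_int (Dd j) = of_int (Nn j) * (A j * (- 1) ^ j)"
    proof -
      assume h: "B (K j) * (- 1) ^ K j * (of_int (Dd j) * (of_nat p ^ j * P)) = of_int (Nn j) * (of_nat p ^ j * (A j * (- 1) ^ j * P))"
        and nz: "of_nat p ^ j * P \<noteq> 0"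
      have "(B (K j) * (- 1) ^ K j * of_int (Dd j)) * (of_nat p ^ j * P) = (of_int (Nn j) * (A j * (- 1) ^ j)) * (of_nat p ^ j * P)"
        using h by (simp only: mult_ac)
      then show ?thesis by (rule iffD1[OF mult_right_cancel[OF nz]])
    qed
    then have "(B (K j) * (- 1) ^ K j * of_int (Dd j)) * (- 1) ^ K j = (of_int (Nn j) * (A j * (- 1) ^ j)) * (- 1) ^ K j" by (simp only:)
    moreover have "(- 1 :: rat) ^ K j * (- 1) ^ K j = 1" by (simp flip: power_mult_distrib)
    moreover have "(B (K j) * (- 1) ^ K j * of_int (Dd j)) * (- 1) ^ K j = B (K j) * of_int (Dd j) * ((- 1) ^ K j * (- 1) ^ K j)"
      by (simp only: mult_ac)
    ultimately have BD: "B (K j) * of_int (Dd j) = A j * ((- 1) ^ (K j + j) * of_int (Nn j))"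
      by (simp only: power_add mult_1_right mult_ac)
    have "K j = j + ((p - 1) * j + k0)" using p_pos by (cases p) (auto simp: K_def)
    then have kk: "of_int \<kappa> ^ K j = (of_int \<kappa> ^ j * of_int \<kappa> ^ ((p - 1) * j + k0) :: rat)" by (metis power_add)
    have "B (K j) * of_int \<kappa> ^ K j * of_int (Dd j) = (B (K j) * of_int (Dd j)) * of_int \<kappa> ^ K j" by (simp only: mult_ac)
    also have "\<dots> = A j * of_int \<kappa> ^ j * of_int (Q j)"
      unfolding BD kk Q_def of_int_mult of_int_power of_int_minus of_int_1 by (simp only: mult_ac)
    finally show ?thesis .
  qed
  \<comment> \<open>Raising j by p ^ r raises K by p ^ (r + 1), which appends one full block of
    residues to each product.\<close>
  define U where "U = (\<lambda>r. \<Prod>u\<in>{0..<int p ^ Suc r}. nu p u)"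
  have un: "{1..K (j + p ^ r)} = {1..K j} \<union> {K j<..K j + p ^ Suc r}" "{1..K j} \<inter> {K j<..K j + p ^ Suc r} = {}" for j r
    unfolding K_def by (auto simp: algebra_simps)
  have cd: "coprime (int d) (int p)" using cop(1) by simp
  have stepD: "[Dd (j + p ^ r) = Dd j * U r] (mod int p ^ Suc r)" for j r
  proof -
    have "Dd (j + p ^ r) = Dd j * (\<Prod>i\<in>{K j<..K j + p ^ Suc r}. nu p (int d * int i - 0))"
      unfolding Dd_def un(1) using prod.union_disjoint[OF _ _ un(2)] by simp
    then show ?thesis
      unfolding U_def using cong_scalar_left[OF prod_nu_block[OF cd]] by presburger
  qed
  have stepQ: "[Q (j + p ^ r) = Q j * U r] (mod int p ^ Suc r)" for j r
  proof -
    let ?M = "int p ^ Suc r"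
    have "Nn (j + p ^ r) = Nn j * (\<Prod>i\<in>{K j<..K j + p ^ Suc r}. nu p (int d * int i - int a))"
      unfolding Nn_def un(1) using prod.union_disjoint[OF _ _ un(2)] by simp
    then have nn: "[Nn (j + p ^ r) = Nn j * U r] (mod ?M)"
      unfolding U_def using cong_scalar_left[OF prod_nu_block[OF cd]] by presburger
    have euler: "[x ^ ((p - 1) * p ^ r) = 1] (mod ?M)" if "\<not> int p dvd x" for x
    proof (induction r)
      case 0
      then show ?case using fermat_int[OF prime_p that] by simp
    next
      case (Suc r)
      then have "[x ^ ((p - 1) * p ^ r) = 1] (mod int p ^ Suc r)" .
      then have "[(x ^ ((p - 1) * p ^ r)) ^ p = 1 ^ p] (mod int p ^ Suc (Suc r))" by (rule cong_pth_power)
      then show ?case by (simp add: power_mult[symmetric] mult_ac)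
    qed
    have kk: "[\<kappa> ^ ((p - 1) * (j + p ^ r) + k0) = \<kappa> ^ ((p - 1) * j + k0)] (mod ?M)"
    proof -
      have "\<kappa> ^ ((p - 1) * (j + p ^ r) + k0) = \<kappa> ^ ((p - 1) * j + k0) * \<kappa> ^ ((p - 1) * p ^ r)"
        by (simp add: power_add algebra_simps)
      then show ?thesis using cong_scalar_left[OF euler[OF \<kappa>], of "\<kappa> ^ ((p - 1) * j + k0)"] by simp
    qed
    \<comment> \<open>A congruence and not an equality: for p = 2 and r = 0 the sign does change,
      but only the value modulo 2 matters.\<close>
    have par: "[(- 1 :: int) ^ (K (j + p ^ r) + (j + p ^ r)) = (- 1) ^ (K j + j)] (mod ?M)"
    proof -
      have "K (j + p ^ r) + (j + p ^ r) = (K j + j) + (p - 1) * p ^ r + 2 * p ^ r"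
        using p_pos by (cases p) (simp_all add: K_def algebra_simps)
      then have "(- 1 :: int) ^ (K (j + p ^ r) + (j + p ^ r)) = (- 1) ^ (K j + j) * (- 1) ^ ((p - 1) * p ^ r)"
        by (simp add: power_add power_mult)
      then show ?thesis using cong_scalar_left[OF euler[OF n1[of 1, simplified power_one_right]], of "(- 1) ^ (K j + j)"] by simp
    qed
    show ?thesis
      unfolding Q_def using cong_mult[OF cong_mult[OF kk par] nn] by (simp add: mult.assoc)
  qed
  have iter: "[Dd (j + t * p ^ r) = Dd j * U r ^ t] (mod int p ^ Suc r)"
    "[Q (j + t * p ^ r) = Q j * U r ^ t] (mod int p ^ Suc r)" for j t r
  proof (induction t)
    case (Suc t)
    have e: "j + Suc t * p ^ r = (j + t * p ^ r) + p ^ r" by simp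
    {
      case 1
      show ?case unfolding e
        using cong_trans[OF stepD[of "j + t * p ^ r" r] cong_scalar_right[OF Suc(1), of "U r"]]
        by (simp add: mult_ac)
    next
      case 2
      show ?case unfolding e
        using cong_trans[OF stepQ[of "j + t * p ^ r" r] cong_scalar_right[OF Suc(2), of "U r"]]
        by (simp add: mult_ac)
    }
  qed simp_all
  have main: "int p ^ Suc r dvd Q j * Dd (j + t * p ^ r) - Q (j + t * p ^ r) * Dd j" for j t r
  proof -
    have "[Q j * Dd (j + t * p ^ r) = Q j * (Dd j * U r ^ t)] (mod int p ^ Suc r)"
      by (rule cong_scalar_left[OF iter(1)])
    moreover have "[Q (j + t * p ^ r) * Dd j = Q j * U r ^ t * Dd j] (mod int p ^ Suc r)"
      by (rule cong_scalar_right[OF iter(2)])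
    moreover have "Q j * (Dd j * U r ^ t) = Q j * U r ^ t * Dd j" by simp
    ultimately have "[Q j * Dd (j + t * p ^ r) = Q (j + t * p ^ r) * Dd j] (mod int p ^ Suc r)"
      by (metis cong_sym cong_trans)
    then show ?thesis by (simp add: cong_iff_dvd_diff)
  qed
  \<comment> \<open>J approximates - 1 / e p-adically, the index j at which n = e j + 1 would be 0.
    The bound N \<le> J keeps J - j nonnegative for all j that occur.\<close>
  obtain J where J: "N \<le> J" "p ^ N dvd e * J + 1"
  proof -
    have "coprime e (p ^ N)" using cop(2) by simp
    then obtain x where "[e * x = Suc 0] (mod p ^ N)" using cong_solve_coprime_nat by blast
    then have x: "[e * x = 1] (mod p ^ N)" by simp
    \<comment> \<open>This is - x modulo p ^ N, raised by a multiple of p ^ N so as to be at least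
      N.\<close>
    define y where "y = x * (p ^ N - 1) + N * p ^ N"
    have "N \<le> y" using p_pos unfolding y_def by (simp add: trans_le_add2)
    moreover have "[e * y + 1 = 0] (mod p ^ N)"
    proof -
      have "e * y + 1 = (e * x) * (p ^ N - 1) + 1 + e * N * p ^ N"
        unfolding y_def by (simp add: distrib_left mult_ac)
      moreover have "[(e * x) * (p ^ N - 1) + 1 + e * N * p ^ N = 1 * (p ^ N - 1) + 1 + e * N * p ^ N] (mod p ^ N)"
        by (intro cong_add cong_mult x cong_refl)
      moreover have "1 * (p ^ N - 1) + 1 + e * N * p ^ N = (1 + e * N) * p ^ N"
        using p_pos by (simp add: add_mult_distrib)
      moreover have "[(1 + e * N) * p ^ N = 0] (mod p ^ N)" by (simp add: cong_0_iff)
      ultimately show ?thesis using cong_trans by (simp only:)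
    qed
    ultimately show thesis using that[of y] by (simp add: cong_0_iff)
  qed
  define \<gamma> :: rat where "\<gamma> = of_int (Q J) / of_int (Dd J)"
  have "zp_unit p \<gamma>" unfolding zp_unit_def \<gamma>_def using ndQ ndD by blast
  moreover have "pd p (multiplicity p i) (\<beta> i - \<gamma> * \<alpha> (i div p))" if i: "0 < i" "i \<le> N" "p dvd i" for i
  proof -
    obtain n where n: "i = p * n" using i(3) by blast
    have ip: "i div p = n" using p_pos n by simp
    have k0: "k0 > 0" using e(1) by (cases k0) auto
    have pe: "p = e * (k0 - 1) + (e - 1)"
      using e k0 by (cases k0; cases e) auto
    show ?thesis
    proof (cases "n mod e = 1")
      case False
      have "i mod e \<noteq> e - 1"
      proof
        assume "i mod e = e - 1"
        then have "i = e * (i div e) + (e - 1)" using mult_div_mod_eq[of e i] by simp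
        then obtain q where "i = e * q + (e - 1)" by blast
        then have "int p * int n = int e * int q + (int e - 1)"
          unfolding n using e(2) by (metis less_imp_le of_nat_1 of_nat_add of_nat_diff of_nat_mult)
        moreover have "int p = int e * int k0 - 1" using arg_cong[OF e(1), of int] by simp
        ultimately have c: "(int e * int k0 - 1) * int n = int e * int q + (int e - 1)" by simp
        have "int n - 1 = int e * (int k0 * int n - 1 - int q)" using c by (simp add: algebra_simps)
        then have "[int n = int 1] (mod int e)" by (simp add: cong_iff_dvd_diff)
        then have "[n = 1] (mod e)" by (simp only: cong_int_iff)
        then show False using False e(2) by (simp add: cong_def)
      qed
      then show ?thesis using False by (simp add: \<alpha>_def \<beta>_def ip)
    next
      case True
      define j where "j = n div e"
      have nj: "n = e * j + 1" using True mult_div_mod_eq[of e n] by (simp add: j_def)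
      have "i = e * (p * j + (k0 - 1)) + (e - 1)"
      proof -
        have "i = e * (p * j) + p" unfolding n nj by (simp add: algebra_simps)
        also have "\<dots> = e * (p * j) + (e * (k0 - 1) + (e - 1))" by (simp only: pe[symmetric])
        finally show ?thesis by (simp only: distrib_left add.assoc)
      qed
      then have im: "i mod e = e - 1" "i div e = p * j + (k0 - 1)" using mult_add_pred_mod_div[of e] e(2) by simp_all
      have be: "\<beta> i = B (K j) * of_int \<kappa> ^ K j" 
      proof -
        have "p * j + (k0 - 1) + 1 = K j" using k0 by (simp add: K_def)
        then show ?thesis unfolding \<beta>_def im B_def by (simp only: simp_thms if_True)
      qed
      have al: "\<alpha> n = A j * of_int \<kappa> ^ j" using True by (simp add: \<alpha>_def A_def j_def)
      define r where "r = multiplicity p n"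
      have n0: "n > 0" using nj by simp
      have mi: "multiplicity p i = Suc r"
        unfolding n r_def using n0 prime_p by (intro multiplicity_times_same) auto
      have pr: "p ^ r dvd n" unfolding r_def by (rule multiplicity_dvd)
      have nN: "n \<le> N" using i(2) n p_pos by (metis dual_order.trans dvd_imp_le dvd_triv_right i(1))
      have "r < N"
      proof -
        have "r < 2 ^ r" by simp
        also have "\<dots> \<le> p ^ r" using p2 by (intro power_mono) auto
        also have "\<dots> \<le> n" using pr n0 by (rule dvd_imp_le)
        finally show ?thesis using nN by simp
      qed
      then have "p ^ r dvd e * J + 1" using J(2) by (metis dvd_trans le_imp_power_dvd less_imp_le)
      \<comment> \<open>Both e J + 1 and n = e j + 1 are divisible by p ^ r, so J and j agree modulo
        p ^ r. Then \<open>main\<close> compares the ratios modulo p ^ (r + 1), and r + 1 is the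
        multiplicity of p in i = p n.\<close>
      then have "p ^ r dvd (e * J + 1) - (e * j + 1)" using pr unfolding nj by (rule dvd_diff_nat)
      then have "p ^ r dvd e * (J - j)" by (simp add: right_diff_distrib')
      moreover have "coprime (p ^ r) e" using cop(2) by (simp add: coprime_commute)
      ultimately have "p ^ r dvd J - j" by (simp add: coprime_dvd_mult_right_iff)
      then obtain t where "J - j = p ^ r * t" by blast
      moreover have "j \<le> J"
      proof -
        have "1 * j \<le> e * j" using e(2) by (intro mult_le_mono1) simp
        then have "j \<le> e * j" by (simp only: mult_1)
        then show ?thesis using nN nj J(1) by linarith
      qed
      ultimately have Jj: "J = j + t * p ^ r" by (metis le_add_diff_inverse mult.commute)
      have z: "of_int (Dd j) \<noteq> (0 :: rat)" "of_int (Dd J) \<noteq> (0 :: rat)" using ndD not_dvd_neq_0 by blast+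
      have "\<beta> i = \<alpha> n * of_int (Q j) / of_int (Dd j)"
        using ratio[of j] z unfolding be al by (simp add: field_simps)
      then have "\<beta> i - \<gamma> * \<alpha> n = \<alpha> n * (of_int (Q j * Dd J - Q J * Dd j) / of_int (Dd j * Dd J))"
        using z by (simp add: \<gamma>_def field_simps)
      moreover have "pd p (Suc r) (of_int (Q j * Dd J - Q J * Dd j) / of_int (Dd j * Dd J))"
        unfolding Jj by (intro pd_divide_unit pd_of_int main zp_unit_of_int not_dvd_mult ndD)
      moreover have "\<alpha> n \<in> zp p"
      proof -
        have "of_nat a / of_nat d \<in> zp p"
        proof -
          have "\<not> int p dvd int d" using cop(1) prime_p by (metis coprime_absorb_right int_dvd_int_iff not_prime_unit)
          then show ?thesis unfolding zp_def by (intro CollectI exI[of _ "int a"] exI[of _ "int d"]) simp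
        qed
        then show ?thesis unfolding al A_def by (intro zp_mult zp_gbinomial zp_uminus zp_power zp_of_int)
      qed
      ultimately show ?thesis unfolding ip mi by (simp only: pd_zp_mult)
    qed
  qed
  ultimately show ?thesis by blast
qed

end

section \<open>From a parametrization to the congruences\<close>

lemma XD_compose: "fps_nth T 0 = 0 \<Longrightarrow> fps_XD (fps_compose F T) = fps_compose (fps_deriv F) T * fps_XD T" for F T :: "rat fps"
  by (simp add: fps_XD_def fps_compose_deriv mult_ac)

lemma compose_pow: "fps_nth T 0 = 0 \<Longrightarrow> fps_compose (A ^ n) T = fps_compose A T ^ n" for A T :: "rat fps"
  by (induction n) (simp_all add: fps_compose_mult_distrib)

definition binomial_fps :: "rat \<Rightarrow> int \<Rightarrow> nat \<Rightarrow> rat fps" where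
  "binomial_fps b \<kappa> e = fps_compose (fps_binomial b) (fps_const (of_int \<kappa>) * fps_X ^ e)"

lemma binomial_fps_eq: "e > 0 \<Longrightarrow> binomial_fps b \<kappa> e = sub e (Abs_fps (\<lambda>k. (b gchoose k) * of_int \<kappa> ^ k))"
proof -
  assume e: "e > 0"
  have "binomial_fps b \<kappa> e = fps_compose (fps_binomial b) (fps_compose (fps_const (of_int \<kappa>) * fps_X) (fps_X ^ e))"
    using e by (simp add: binomial_fps_def fps_compose_mult_distrib)
  also have "\<dots> = sub e (fps_compose (fps_binomial b) (fps_const (of_int \<kappa>) * fps_X))"
    using e by (simp add: sub_def fps_compose_assoc)
  also have "fps_compose (fps_binomial b) (fps_const (of_int \<kappa>) * fps_X) = Abs_fps (\<lambda>k. (b gchoose k) * of_int \<kappa> ^ k)"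
    unfolding fps_compose_linear by (rule fps_ext) simp
  finally show ?thesis .
qed

lemma binomial_fps_power:
  assumes "e > 0" and that: "d > 0"
  shows "binomial_fps (- (1 / of_nat d)) \<kappa> e ^ d * (1 + fps_const (of_int \<kappa>) * fps_X ^ e) = 1"
proof -
  let ?L = "fps_const (of_int \<kappa>) * fps_X ^ e :: rat fps"
  have L: "fps_nth ?L 0 = 0" using assms by simp
  have "fps_binomial (- (1 / of_nat d)) ^ d = (fps_binomial (- 1) :: rat fps)"
    using that by (simp add: fps_binomial_power)
  then have "fps_binomial (- (1 / of_nat d)) ^ d * fps_binomial 1 = (1 :: rat fps)"
    by (simp flip: fps_binomial_add_mult)
  then have "fps_compose (fps_binomial (- (1 / of_nat d)) ^ d * fps_binomial 1) ?L = 1" by simp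
  then show ?thesis
    using L by (simp add: binomial_fps_def fps_compose_mult_distrib compose_pow fps_binomial_1 fps_compose_add_distrib)
qed

lemma binomial_fps_nth_0 [simp]: "fps_nth (binomial_fps b \<kappa> e) 0 = 1"
  by (simp add: binomial_fps_def)

context prime_local
begin

lemma zp_unit_1: "zp_unit p 1"
  by (simp add: zp_unit_iff)

lemma zp_fps_ep: "zp_fps (ep k)"
proof -
  have "zp_fps (\<Prod>i\<le>n. 1 - fps_const 1 * fps_X ^ (k * i + k))" for n
    by (intro zp_fps_prod zp_fps_diff zp_fps_1 zp_fps_mult zp_fps_const zp_1 zp_fps_power zp_fps_X)
  then show ?thesis unfolding ep_def qpoch_def zp_fps_def[of "Abs_fps _"] by (simp add: zp_fps_def)
qed

lemma zp_neg_fraction: "coprime d p \<Longrightarrow> - (of_nat a / of_nat d) \<in> zp p"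
proof -
  assume "coprime d p"
  then have "\<not> int p dvd int d" using prime_p by (metis coprime_absorb_right int_dvd_int_iff not_prime_unit)
  then have "of_nat a / of_nat d \<in> zp p" unfolding zp_def by (intro CollectI exI[of _ "int a"] exI[of _ "int d"]) simp
  then show ?thesis by (rule zp_uminus)
qed

text \<open>In the applications (1 + \<kappa> T^e)^(- a / d) dT is the differential of the first
  kind and ((1 + \<kappa> T^e)^(- (d - a) / d) - 1) dT / T^2 one of the second kind, regular at T =
  0. Since G is \<open>sub e (u * g)\<close> divided by q, its n-th coefficient has index n + 1 in
  \<open>cf\<close>. The term (XD R - R) / q is q d/dq (R / q), the exact part that has to be added
  to G to obtain the second differential.\<close>

theorem inert_case:
  fixes T R g u :: "rat fps"
  assumes cop: "coprime d p" "coprime e p" and d: "0 < a" "a < d"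
    and e: "p + 1 = e * k0" "2 < e" and s: "(p + 1) * a = d * s" "k0 < s" and \<kappa>: "\<not> int p dvd \<kappa>"
    and T: "zp_fps T" "fps_nth T 0 = 0" and T0: "T \<noteq> 0" and R: "zp_fps R" and g: "zp_fps g" "fps_nth g 0 = 1"
    and l: "zp_unit p l"
    and \<alpha>: "fps_compose (binomial_fps (- (of_nat a / of_nat d)) \<kappa> e) T * fps_XD T = fps_const l * (fps_X * sub e g)"
    and \<beta>: "T ^ 2 * (sub e (u * g) + fps_XD R - R) = fps_X * ((fps_compose (binomial_fps (- (of_nat (d - a) / of_nat d)) \<kappa> e) T - 1) * fps_XD T)"
    and hecke: "hecke_inert p (fps_X * sub e g)"
  defines "cf \<equiv> \<lambda>n. fps_nth (sub e (u * g)) (n + 1)"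
  shows "\<exists>v. zp_unit p v \<and> cf (p ^ (2 * m + 1)) = of_nat p ^ m * v"
    and "n > 0 \<Longrightarrow> pd p (2 * m + 1) (cf (p ^ (2 * m + 1) * n) - cf (p ^ (2 * m + 1)) * fps_nth (fps_X * sub e g) n)"
proof -
  define A B where "A = (\<lambda>n. if n mod e = 1 then (- (of_nat a / of_nat d) gchoose (n div e)) * of_int \<kappa> ^ (n div e) else (0 :: rat))"
    and "B = (\<lambda>n. if n mod e = e - 1 then (- (of_nat (d - a) / of_nat d) gchoose (n div e + 1)) * of_int \<kappa> ^ (n div e + 1) else (0 :: rat))"
  define f where "f = (\<lambda>w :: nat \<Rightarrow> rat. Abs_fps (\<lambda>n. w n / of_nat n))"
  have e1: "1 < e" "e > 0" using e(2) by simp_all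
  have dA: "fps_deriv (f A) = binomial_fps (- (of_nat a / of_nat d)) \<kappa> e"
  proof (rule fps_ext)
    fix n
    have "(n + 1) mod e = 1 \<longleftrightarrow> e dvd n"
      using e1 by (metis add.left_neutral mod_less cong_def cong_add_rcancel_nat cong_0_iff)
    moreover have "(n + 1) div e = n div e" if dv: "e dvd n"
    proof -
      obtain k where k: "n = e * k" using dv by blast
      have "(1 + e * k) div e = k + 1 div e" using e1 by (intro div_mult_self2) simp
      then show ?thesis using e1 unfolding k by (simp add: add.commute)
    qed
    ultimately show "fps_nth (fps_deriv (f A)) n = fps_nth (binomial_fps (- (of_nat a / of_nat d)) \<kappa> e) n"
      using e1 by (simp add: binomial_fps_eq sub_nth f_def A_def)
  qed
  \<comment> \<open>Subtracting 1 removes the pole left by division by X ^ 2. The exponents e k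
    become e k - 2, and e k - 1 after integration; this explains the residue e - 1 and the index
    \<open>n div e + 1\<close> in B.\<close>
  have dB: "fps_X ^ 2 * fps_deriv (f B) = binomial_fps (- (of_nat (d - a) / of_nat d)) \<kappa> e - 1"
  proof (rule fps_ext)
    fix n
    show "fps_nth (fps_X ^ 2 * fps_deriv (f B)) n = fps_nth (binomial_fps (- (of_nat (d - a) / of_nat d)) \<kappa> e - 1) n"
    proof (cases "n \<ge> 2")
      case False
      then have "n = 0 \<or> n = 1" by auto
      moreover have "\<not> e dvd 1" using e1 by simp
      ultimately show ?thesis using e1 by (auto simp: binomial_fps_eq sub_nth fps_X_power_mult_nth)
    next
      case True
      then obtain k where k: "n = k + 2" by (metis add.commute le_Suc_ex)
      have iff: "(k + 1) mod e = e - 1 \<longleftrightarrow> e dvd n"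
      proof
        assume "(k + 1) mod e = e - 1"
        then have "k + 1 = e * ((k + 1) div e) + (e - 1)" using mult_div_mod_eq[of e "k + 1"] by simp
        then have "n = e * ((k + 1) div e + 1)" using k e1 by (simp add: algebra_simps)
        then show "e dvd n" by simp
      next
        assume "e dvd n"
        then obtain j where j: "n = e * Suc j" using k by (metis add_2_eq_Suc' dvdE mult_0_right nat.distinct(1) not0_implies_Suc)
        then have "k + 1 = e * j + (e - 1)" using k e1 by simp
        then show "(k + 1) mod e = e - 1" by (simp only: mult_add_pred_mod_div[OF e1(2)])
      qed
      moreover have "(k + 1) div e + 1 = n div e" if dv: "e dvd n"
      proof -
        obtain j where j: "n = e * Suc j" using k dv by (metis add_2_eq_Suc' dvdE mult_0_right nat.distinct(1) not0_implies_Suc)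
        then have "k + 1 = e * j + (e - 1)" using k e1 by simp
        then have "(k + 1) div e = j" by (simp only: mult_add_pred_mod_div[OF e1(2)])
        then show ?thesis using j e1 by simp
      qed
      ultimately show ?thesis
        using e1 k by (simp add: binomial_fps_eq sub_nth f_def B_def fps_X_power_mult_nth del: fps_binomial_nth)
    qed
  qed
  have XA: "fps_XD (fps_compose (f A) T) = fps_const l * (fps_X * sub e g)"
    unfolding XD_compose[OF T(2)] dA by (rule \<alpha>)
  have "T ^ 2 * (fps_X * fps_XD (fps_compose (f B) T)) = fps_X * (fps_compose (fps_X ^ 2 * fps_deriv (f B)) T * fps_XD T)"
    unfolding XD_compose[OF T(2)] using T(2) by (simp add: fps_compose_mult_distrib compose_pow mult_ac)
  also have "\<dots> = T ^ 2 * (sub e (u * g) + fps_XD R - R)"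
    unfolding dB \<beta> using T(2) by (simp add: fps_compose_sub_distrib)
  finally have XB: "fps_X * fps_XD (fps_compose (f B) T) = sub e (u * g) + fps_XD R - R"
    using T0 by simp
  have cf: "cf n = of_nat n * (fps_nth (fps_compose (f B) T) n + (- fps_nth R (n + 1)))" for n
    using arg_cong[OF XB, of "\<lambda>F. fps_nth F (n + 1)"] by (simp add: cf_def algebra_simps)
  note zneg = zp_neg_fraction[OF cop(1)]
  have zA: "A n \<in> zp p" and zB: "B n \<in> zp p" for n
    unfolding A_def B_def by (auto intro!: zp_mult zp_gbinomial zneg zp_power)
  have zR: "- fps_nth R (n + 1) \<in> zp p" for n using R by (intro zp_uminus) (simp add: zp_fps_def)
  have "zp_fps (fps_X * sub e g)" using e1 g by (intro zp_fps_mult zp_fps_X zp_fps_sub)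
  then have zg: "fps_nth (fps_X * sub e g) n \<in> zp p" for n by (simp add: zp_fps_def)
  have a: "of_nat n * fps_nth (fps_compose (Abs_fps (\<lambda>n. A n / of_nat n)) T) n = l * fps_nth (fps_X * sub e g) n" for n
    using arg_cong[OF XA, of "\<lambda>F. fps_nth F n"] by (simp add: f_def)
  have h: "fps_nth (fps_X * sub e g) (p ^ 2 * k) = - of_nat p * fps_nth (fps_X * sub e g) k" for k
    using hecke by (simp add: hecke_inert_def)
  have a1: "fps_nth (fps_X * sub e g) 1 = 1" using g by simp
  have D: "\<exists>\<gamma>. zp_unit p \<gamma> \<and> (\<forall>i. 0 < i \<longrightarrow> i \<le> N \<longrightarrow> p dvd i \<longrightarrow>
      pd p (multiplicity p i) (B i - \<gamma> * A (i div p)))" for N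
    unfolding A_def B_def by (rule unit_ratio[OF cop d e(1) e1(1) s \<kappa>])
  note main = inert_congruences[OF T zA zB zR zg l a cf[unfolded f_def] D h a1]
  show "\<exists>v. zp_unit p v \<and> cf (p ^ (2 * m + 1)) = of_nat p ^ m * v" by (rule main(1))
  show "n > 0 \<Longrightarrow> pd p (2 * m + 1) (cf (p ^ (2 * m + 1) * n) - cf (p ^ (2 * m + 1)) * fps_nth (fps_X * sub e g) n)"
    by (rule main(2))
qed

text \<open>
  The curve is \<open>y\<^sup>2 = u\<^sup>3 + \<kappa> X w\<close>, where \<open>X = q ^ e\<close>; the local
  parameter at infinity is \<open>T = q / sqrt u\<close>.
\<close>

theorem inert_case_sqrt:
  fixes u y w g :: "rat fps"
  assumes op: "odd p" and e: "p + 1 = e * k0" "2 < e" and cop: "coprime e p" and \<kappa>: "\<not> int p dvd \<kappa>"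
    and u: "zp_fps u" "fps_nth u 0 = 1" and y: "fps_nth y 0 = 1" and g: "zp_fps g" "fps_nth g 0 = 1"
    and curve: "y ^ 2 = u ^ 3 + fps_const (of_int \<kappa>) * fps_X * w"
    and w: "\<And>S. S ^ 2 * u = 1 \<Longrightarrow> w * S ^ 6 = S ^ e"
    and diff: "2 * u - of_nat e * fps_XD u = 2 * y * g"
    and hecke: "hecke_inert p (fps_X * sub e g)"
  defines "cf \<equiv> \<lambda>n. fps_nth (sub e (u * g)) (n + 1)"
  shows "\<exists>v. zp_unit p v \<and> cf (p ^ (2 * m + 1)) = of_nat p ^ m * v"
    and "n > 0 \<Longrightarrow> pd p (2 * m + 1) (cf (p ^ (2 * m + 1) * n) - cf (p ^ (2 * m + 1)) * fps_nth (fps_X * sub e g) n)"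
proof -
  have e0: "e > 0" using e by simp
  have c2: "coprime 2 p" using op by simp
  \<comment> \<open>S = u^(- 1/2), which is p-integral as p is odd. The hypothesis on w reads w =
    S^(e - 6): it is 1 for e = 6 and u for e = 4.\<close>
  define S where "S = fps_compose (fps_binomial (- (1 / 2))) (u - 1)"
  have S: "S ^ 2 * u = 1"
  proof -
    have "fps_binomial (- (1 / 2)) ^ 2 * fps_binomial 1 = (1 :: rat fps)"
      by (simp add: fps_binomial_power flip: fps_binomial_add_mult)
    then have "fps_compose (fps_binomial (- (1 / 2)) ^ 2 * fps_binomial 1) (u - 1) = 1" by simp
    then show ?thesis using u(2)
      by (simp add: S_def fps_compose_mult_distrib compose_pow fps_binomial_1 fps_compose_add_distrib)
  qed
  have S0: "fps_nth S 0 = 1" by (simp add: S_def)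
  have zS: "zp_fps S"
    unfolding S_def using zp_neg_fraction[of 2 1] c2 u(1)
    by (intro zp_fps_compose zp_fps_diff zp_fps_1) (auto simp: zp_fps_def zp_gbinomial)
  have Sn: "S \<noteq> 0" using S0 by auto
  \<comment> \<open>Z = y / u^(3/2), which becomes the square root of 1 + \<kappa> T^e after q ->
    q^e.\<close>
  define Z where "Z = y * S ^ 3"
  have Z0: "fps_nth Z 0 = 1" using y S0 by (simp add: Z_def fps_power_zeroth)
  have Z: "Z ^ 2 = 1 + fps_const (of_int \<kappa>) * fps_X * S ^ e"
  proof -
    have "Z ^ 2 = y ^ 2 * S ^ 6" by (simp add: Z_def power_mult_distrib flip: power_mult)
    also have "\<dots> = (S ^ 2 * u) ^ 3 + fps_const (of_int \<kappa>) * fps_X * (w * S ^ 6)"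
      unfolding curve by (simp add: power_mult_distrib algebra_simps flip: power_mult)
    finally show ?thesis unfolding w[OF S] S by simp
  qed
  have dS: "S + of_nat e * fps_XD S = Z * g"
  proof -
    have 0: "2 * S * fps_XD S * u + S ^ 2 * fps_XD u = 0"
      using arg_cong[OF S, of fps_XD] by (simp add: XD_simps)
    have "2 * S ^ 2 * u * (S + of_nat e * fps_XD S)
        = S ^ 3 * (2 * u - of_nat e * fps_XD u) + of_nat e * S * (2 * S * fps_XD S * u + S ^ 2 * fps_XD u)"
      by (simp add: pow_expand algebra_simps)
    then have "2 * (S ^ 2 * u) * (S + of_nat e * fps_XD S) = 2 * (Z * g)"
      unfolding 0 diff by (simp add: Z_def mult_ac)
    then have "2 * (S + of_nat e * fps_XD S) = 2 * (Z * g)" unfolding S by (simp only: mult_1_right)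
    moreover have "(2 :: rat fps) \<noteq> 0" by (metis fps_numeral_nth_0 fps_zero_nth zero_neq_numeral)
    ultimately show ?thesis by (metis mult_left_cancel)
  qed
  define s z where "s = sub e S" and "z = sub e Z"
  define T where "T = fps_X * s"
  define H where "H = fps_compose (binomial_fps (- (1 / 2)) \<kappa> e) T"
  have XT: "fps_XD T = fps_X * (s + fps_XD s)" by (simp add: T_def XD_simps algebra_simps)
  have XT': "fps_XD T = fps_X * (z * sub e g)"
    unfolding XT using sub_eq[OF dS, of e] e0
    by (simp add: s_def z_def XD_sub sub_simps) (metis sub_const fps_of_nat)
  have T0: "fps_nth T 0 = 0" by (simp add: T_def)
  have z2: "z ^ 2 = 1 + fps_const (of_int \<kappa>) * T ^ e"
    using sub_eq[OF Z, of e] e0 by (simp add: z_def s_def T_def sub_simps power_mult_distrib mult.assoc)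
  have H2: "H ^ 2 * z ^ 2 = 1"
  proof -
    have "fps_compose (binomial_fps (- (1 / of_nat 2)) \<kappa> e ^ 2 * (1 + fps_const (of_int \<kappa>) * fps_X ^ e)) T = 1"
      using binomial_fps_power[of e 2 \<kappa>] e0 by simp
    then show ?thesis
      unfolding z2 H_def using T0
      by (simp add: fps_compose_mult_distrib compose_pow fps_compose_add_distrib)
  qed
  have Hz: "H * z = 1"
  proof (rule fps_square_unique)
    show "(H * z) ^ 2 = 1 ^ 2" using H2 by (simp add: power_mult_distrib)
  qed (simp_all add: H_def z_def Z0)
  define R where "R = sub e (inverse S)"
  have sR: "s * R = 1"
  proof -
    have "S * inverse S = 1" using S0 by (intro inverse_mult_eq_1') simp
    from sub_eq[OF this, of e] show ?thesis using e0 by (simp add: s_def R_def sub_simps)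
  qed
  have uR: "sub e u = R ^ 2"
  proof -
    have "s ^ 2 * sub e u = 1" using sub_eq[OF S, of e] e0 by (simp add: sub_simps s_def)
    moreover have "s ^ 2 * R ^ 2 = 1" using sR by (simp flip: power_mult_distrib)
    moreover have "s ^ 2 \<noteq> 0" using nth_0_neq_0[of s] S0 by (simp add: s_def)
    ultimately show ?thesis by (metis mult_left_cancel)
  qed
  have dR: "s * fps_XD R + fps_XD s * R = 0"
    using arg_cong[OF sR, of fps_XD] by (simp add: XD_simps add.commute)
  have \<alpha>: "H * fps_XD T = fps_const 1 * (fps_X * sub e g)"
    using Hz unfolding XT' by (simp add: mult.assoc[symmetric] mult.commute[of H])
  \<comment> \<open>Since \<open>sub e u\<close> is R^2 and R / q = 1 / T, the form G is the newform
    divided by T^2, that is, H * XD T / T^2. Adding q d/dq (1 / T) = - XD T / T^2 supplies the -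
    1.\<close>
  have \<beta>: "T ^ 2 * (sub e (u * g) + fps_XD R - R) = fps_X * ((H - 1) * fps_XD T)"
  proof -
    have "T ^ 2 * (sub e (u * g) + fps_XD R - R)
      = fps_X ^ 2 * (s * R) ^ 2 * sub e g + fps_X ^ 2 * (s * (s * fps_XD R + fps_XD s * R) - (s * R) * fps_XD s - (s * R) * s)"
      using e0 uR by (simp add: T_def sub_mult pow_expand algebra_simps)
    also have "\<dots> = fps_X * (fps_X * sub e g - fps_X * (s + fps_XD s))"
      unfolding sR dR by (simp add: pow_expand algebra_simps)
    also have "\<dots> = fps_X * (H * fps_XD T - fps_XD T)" unfolding XT[symmetric] \<alpha> by simp
    finally show ?thesis by (simp add: algebra_simps)
  qed
  \<comment> \<open>For a / d = 1 / 2 the residue s is (p + 1) / 2, and it exceeds k0 = (p + 1) / e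
    because e > 2.\<close>
  have ps: "(p + 1) * 1 = 2 * ((p + 1) div 2)" using op by simp
  have ks: "k0 < (p + 1) div 2"
  proof -
    have "k0 > 0" using e by (cases k0) auto
    then have "2 * k0 < e * k0" using e(2) by simp
    then have "2 * k0 < p + 1" unfolding e(1) .
    then show ?thesis using op by presburger
  qed
  have zR: "zp_fps R"
    unfolding R_def using zS S0 e0 zp_unit_1
    by (intro zp_fps_sub zp_fps_inverse) (auto)
  have zT: "zp_fps T" unfolding T_def s_def using e0 by (intro zp_fps_mult zp_fps_X zp_fps_sub zS)
  have Tn: "T \<noteq> 0" using nth_0_neq_0[of s] S0 by (simp add: T_def s_def)
  note u1 = zp_unit_1
  note main = inert_case[of 2 e 1 k0 "(p + 1) div 2" \<kappa> T R g 1 u, OF c2 cop _ _ e ps ks \<kappa> zT T0 Tn zR g u1 _ _ hecke]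
  show "\<exists>v. zp_unit p v \<and> cf (p ^ (2 * m + 1)) = of_nat p ^ m * v"
    unfolding cf_def by (rule main(1)) (use \<alpha> \<beta> in \<open>simp_all add: H_def\<close>)
  show "n > 0 \<Longrightarrow> pd p (2 * m + 1) (cf (p ^ (2 * m + 1) * n) - cf (p ^ (2 * m + 1)) * fps_nth (fps_X * sub e g) n)"
    unfolding cf_def by (rule main(2)) (use \<alpha> \<beta> in \<open>simp_all add: H_def\<close>)
qed

end

section \<open>The congruences for the curves of conductor 27, 32 and 36\<close>

context prime_local
begin

lemma zp_fps_cancel:
  assumes "zp_fps (A * B)" "zp_fps B" "fps_nth B 0 = 1"
  shows "zp_fps A"
proof -
  have "zp_fps (inverse B)" using assms zp_unit_1 by (intro zp_fps_inverse) auto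
  then have "zp_fps (A * B * inverse B)" by (intro zp_fps_mult assms(1))
  moreover have "A * B * inverse B = A"
    using assms(3) by (simp add: mult.assoc inverse_mult_eq_1')
  ultimately show ?thesis by simp
qed

lemma zp_fps_psi: "zp_fps psi"
  by (rule zp_fps_cancel[of _ "ep 1"], unfold psi_ep) (intro zp_fps_power zp_fps_ep | simp)+

lemma zp_fps_phi: "zp_fps phi"
proof (rule zp_fps_cancel[of _ "ep 1 ^ 2 * ep 4 ^ 2"])
  show "zp_fps (phi * (ep 1 ^ 2 * ep 4 ^ 2))"
    unfolding mult.assoc[symmetric] phi_ep by (intro zp_fps_power zp_fps_ep)
qed (auto simp: fps_power_zeroth intro!: zp_fps_power zp_fps_ep zp_fps_mult)

lemma zp_fps_f12: "zp_fps f12"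
proof (rule zp_fps_cancel[of _ "ep 1 * ep 6"])
  show "zp_fps (f12 * (ep 1 * ep 6))"
    unfolding mult.assoc[symmetric] f12_ep by (intro zp_fps_power zp_fps_ep zp_fps_mult)
qed (auto intro!: zp_fps_ep zp_fps_mult)

lemma zp_fps_cc: "zp_fps cc"
  by (rule zp_fps_cancel[of _ "ep 1"], unfold cc_ep) (intro zp_fps_power zp_fps_ep | simp)+

lemma zp_fps_cb: "zp_fps cb"
  by (rule zp_fps_cancel[of _ "ep 3"], unfold cb_ep) (intro zp_fps_power zp_fps_ep | simp)+

lemma zp_fps_ca: "zp_fps ca"
proof -
  have "sub 3 ca = cb + fps_const (of_int 3) * fps_X * sub 3 cc"
    unfolding cb_dissect by (simp add: numeral_fps_const)
  also have "zp_fps \<dots>"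
    by (intro zp_fps_add zp_fps_cb zp_fps_mult zp_fps_const zp_of_int zp_fps_X zp_fps_sub zp_fps_cc) simp
  finally have z: "zp_fps (sub 3 ca)" .
  show ?thesis
    unfolding zp_fps_def
  proof
    fix n
    have "fps_nth (sub 3 ca) (3 * n) \<in> zp p" using z unfolding zp_fps_def by blast
    then show "fps_nth ca n \<in> zp p" by simp
  qed
qed

lemma divide_fps:
  assumes "fps_nth B 0 = (1 :: rat)"
  shows "A * inverse B * B = A" "fps_nth (A * inverse B) 0 = fps_nth A 0"
  using assms by (simp_all add: mult.assoc inverse_mult_eq_1)

text \<open>The eta quotient of G is u times that of the newform, in other words G = x * g. So on
  the curve G corresponds, up to sign, to x dx / (2 y), a differential of the second kind.\<close>

theorem inert_36:
  assumes p5: "p mod 6 = 5" and W: "W * ep 6 ^ 3 = ep 1 ^ 3 * ep 2 * ep 3 ^ 3"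
  shows "\<exists>v. zp_unit p v \<and> fps_nth (sub 6 W) (p ^ (2 * m + 1) + 1) = of_nat p ^ m * v"
    and "n > 0 \<Longrightarrow> pd p (2 * m + 1) (fps_nth (sub 6 W) (p ^ (2 * m + 1) * n + 1) -
            fps_nth (sub 6 W) (p ^ (2 * m + 1) + 1) * fps_nth (fps_X * sub 6 (ep 1 ^ 4)) n)"
proof -
  define Q where "Q = sub 3 psi"
  have Q: "fps_nth Q 0 = 1" by (simp add: Q_def)
  define u y where "u = f12 * inverse Q" and "y = psi ^ 2 * inverse (Q ^ 2)"
  have u: "u * sub 3 psi = f12" and y: "y * sub 3 psi ^ 2 = psi ^ 2"
    using divide_fps(1)[OF Q] divide_fps(1)[of "Q ^ 2"] Q by (simp_all add: u_def y_def Q_def fps_power_zeroth)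
  have u0: "fps_nth u 0 = 1" and y0: "fps_nth y 0 = 1" using Q by (simp_all add: u_def y_def fps_power_zeroth)
  have zu: "zp_fps u"
    by (rule zp_fps_cancel[of _ Q]) (use u Q in \<open>auto simp: Q_def intro!: zp_fps_f12 zp_fps_sub zp_fps_psi\<close>)
  note par = parametrization_6[OF u y]
  have op: "odd p" using p5 by presburger
  have k0: "p + 1 = 6 * ((p + 1) div 6)" using p5 by presburger
  have "\<not> 3 dvd p" using p5 by presburger
  then have "coprime 3 p" by (intro prime_imp_coprime) auto
  moreover have "coprime 2 p" using op by simp
  ultimately have "coprime (2 * 3) p" by (simp only: coprime_mult_left_iff)
  then have cop: "coprime 6 p" by simp
  have nd: "\<not> int p dvd 1" using prime_int_p by auto
  have zg: "zp_fps (ep 1 ^ 4)" by (intro zp_fps_power zp_fps_ep)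
  have diff: "2 * u - of_nat 6 * fps_XD u = 2 * y * ep 1 ^ 4"
  proof -
    have "2 * u - of_nat 6 * fps_XD u = 2 * (u - 3 * fps_XD u)" by (simp add: algebra_simps)
    then show ?thesis unfolding par(2) by simp
  qed
  have W': "W = u * ep 1 ^ 4"
  proof (rule ep_cancel[of _ "ep 6 ^ 3 * Q"])
    have Q3: "Q * ep 3 = ep 6 ^ 2" using psi_ep_sub[of 3] by (simp add: Q_def)
    have "W * (ep 6 ^ 3 * Q) * ep 3 = ep 1 ^ 3 * ep 2 * ep 3 ^ 3 * (Q * ep 3)" unfolding W[symmetric] by (simp only: mult_ac)
    also have "\<dots> = (f12 * ep 1 * ep 6) * ep 1 ^ 3 * ep 6 ^ 2 * ep 3"
      unfolding Q3 f12_ep by (simp add: pow_expand algebra_simps)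
    also have "\<dots> = u * ep 1 ^ 4 * (ep 6 ^ 3 * Q) * ep 3"
      unfolding u[symmetric] Q_def by (simp add: pow_expand algebra_simps)
    finally have "W * (ep 6 ^ 3 * Q) * ep 3 = u * ep 1 ^ 4 * (ep 6 ^ 3 * Q) * ep 3" .
    then show "W * (ep 6 ^ 3 * Q) = u * ep 1 ^ 4 * (ep 6 ^ 3 * Q)" by simp
  qed (use nth_0_neq_0[OF Q] in simp)
  note main = inert_case_sqrt[of 6 _ 1 u y "ep 1 ^ 4" 1, OF op k0 _ cop nd zu u0 y0 zg]
  show "\<exists>v. zp_unit p v \<and> fps_nth (sub 6 W) (p ^ (2 * m + 1) + 1) = of_nat p ^ m * v"
    unfolding W'
    by (rule main(1)) (use par(1) diff hecke_36[OF prime_p p5] in \<open>simp_all add: fps_power_zeroth\<close>)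
  show "n > 0 \<Longrightarrow> pd p (2 * m + 1) (fps_nth (sub 6 W) (p ^ (2 * m + 1) * n + 1) -
            fps_nth (sub 6 W) (p ^ (2 * m + 1) + 1) * fps_nth (fps_X * sub 6 (ep 1 ^ 4)) n)"
    unfolding W'
    by (rule main(2)) (use par(1) diff hecke_36[OF prime_p p5] in \<open>simp_all add: fps_power_zeroth\<close>)
qed

theorem inert_32:
  assumes p3: "p mod 4 = 3" and W: "W * ep 8 ^ 4 = ep 1 ^ 2 * ep 4 ^ 6"
  shows "\<exists>v. zp_unit p v \<and> fps_nth (sub 4 W) (p ^ (2 * m + 1) + 1) = of_nat p ^ m * v"
    and "n > 0 \<Longrightarrow> pd p (2 * m + 1) (fps_nth (sub 4 W) (p ^ (2 * m + 1) * n + 1) -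
            fps_nth (sub 4 W) (p ^ (2 * m + 1) + 1) * fps_nth (fps_X * sub 4 (ep 1 ^ 2 * ep 2 ^ 2)) n)"
proof -
  define Q where "Q = sub 4 psi"
  have Q: "fps_nth Q 0 = 1" by (simp add: Q_def)
  define u y where "u = sub 2 phi * inverse Q" and "y = sub 2 psi * phi * inverse (Q ^ 2)"
  have u: "u * sub 4 psi = sub 2 phi" and y: "y * sub 4 psi ^ 2 = sub 2 psi * phi"
    using divide_fps(1)[OF Q] divide_fps(1)[of "Q ^ 2"] Q by (simp_all add: u_def y_def Q_def fps_power_zeroth)
  have u0: "fps_nth u 0 = 1" and y0: "fps_nth y 0 = 1" using Q by (simp_all add: u_def y_def fps_power_zeroth)
  have zu: "zp_fps u"
    by (rule zp_fps_cancel[of _ Q]) (use u Q in \<open>auto simp: Q_def intro!: zp_fps_phi zp_fps_sub zp_fps_psi\<close>)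
  note par = parametrization_4[OF u y]
  have op: "odd p" using p3 by presburger
  have k0: "p + 1 = 4 * ((p + 1) div 4)" using p3 by presburger
  have cop: "coprime 4 p" using op by (metis coprime_left_2_iff_odd coprime_power_left_iff numeral_Bit0_eq_double power2_eq_square mult_2)
  have nd: "\<not> int p dvd 4"
  proof
    assume "int p dvd 4"
    then have "p dvd 4" using int_dvd_int_iff[of p 4] by simp
    then show False using cop prime_p by (metis coprime_absorb_right not_prime_unit)
  qed
  define g where "g = ep 1 ^ 2 * ep 2 ^ 2"
  have zg: "zp_fps g" unfolding g_def by (intro zp_fps_power zp_fps_ep zp_fps_mult)
  have diff: "2 * u - of_nat 4 * fps_XD u = 2 * y * g"
  proof -
    have "2 * u - of_nat 4 * fps_XD u = 2 * (u - 2 * fps_XD u)" by (simp add: algebra_simps)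
    then show ?thesis unfolding par(2) g_def by simp
  qed
  have W': "W = u * g"
  proof (rule ep_cancel[of _ "ep 8 ^ 4 * Q"])
    have Q3: "Q * ep 4 = ep 8 ^ 2" using psi_ep_sub[of 4] by (simp add: Q_def)
    have p2: "sub 2 phi * ep 2 ^ 2 * ep 8 ^ 2 = ep 4 ^ 5" using phi_ep_sub[of 2] by simp
    have "W * (ep 8 ^ 4 * Q) * ep 4 = ep 1 ^ 2 * ep 4 ^ 6 * (Q * ep 4)" unfolding W[symmetric] by (simp only: mult_ac)
    also have "\<dots> = (sub 2 phi * ep 2 ^ 2 * ep 8 ^ 2) * ep 1 ^ 2 * ep 8 ^ 2 * ep 4"
      unfolding Q3 p2 by (simp add: pow_expand algebra_simps)
    also have "\<dots> = u * g * (ep 8 ^ 4 * Q) * ep 4"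
      unfolding u[symmetric] Q_def g_def by (simp add: pow_expand algebra_simps)
    finally have "W * (ep 8 ^ 4 * Q) * ep 4 = u * g * (ep 8 ^ 4 * Q) * ep 4" .
    then show "W * (ep 8 ^ 4 * Q) = u * g * (ep 8 ^ 4 * Q)" by simp
  qed (use nth_0_neq_0[OF Q] in simp)
  have w: "u * S ^ 6 = S ^ 4" if S: "S ^ 2 * u = 1" for S
  proof -
    have "u * S ^ 6 = (S ^ 2 * u) * S ^ 4" by (simp add: pow_expand algebra_simps)
    then show ?thesis unfolding S by simp
  qed
  have curve: "y ^ 2 = u ^ 3 + fps_const (of_int 4) * fps_X * u" using par(1) by (simp add: numeral_fps_const)
  have g0: "fps_nth g 0 = 1" by (simp add: g_def fps_power_zeroth)
  have hecke: "hecke_inert p (fps_X * sub 4 g)" unfolding g_def by (rule hecke_32[OF prime_p p3])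
  note main = inert_case_sqrt[of 4 _ 4 u y g u, OF op k0 _ cop nd zu u0 y0 zg g0 curve w diff hecke]
  show "\<exists>v. zp_unit p v \<and> fps_nth (sub 4 W) (p ^ (2 * m + 1) + 1) = of_nat p ^ m * v"
    unfolding W' by (rule main(1)) simp_all
  show "n > 0 \<Longrightarrow> pd p (2 * m + 1) (fps_nth (sub 4 W) (p ^ (2 * m + 1) * n + 1) -
            fps_nth (sub 4 W) (p ^ (2 * m + 1) + 1) * fps_nth (fps_X * sub 4 (ep 1 ^ 2 * ep 2 ^ 2)) n)"
    unfolding W' g_def[symmetric] by (rule main(2)) simp_all
qed

text \<open>
  Here the curve is the Fermat cubic \<open>Y\<^sup>3 = 1 - T\<^sup>3\<close>, parametrized by the Borwein theta functions,
  and \<open>G\<close> is the derivative of \<open>- (2 + Y) / T\<close> plus that of an integral of \<open>(1 / Y - 1) / T\<^sup>2\<close>.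
\<close>

theorem inert_27:
  assumes p2: "p mod 3 = 2" and W: "W * ep 9 ^ 3 = ep 1 * ep 3 ^ 6"
  shows "\<exists>v. zp_unit p v \<and> fps_nth (sub 3 W) (p ^ (2 * m + 1) + 1) = of_nat p ^ m * v"
    and "n > 0 \<Longrightarrow> pd p (2 * m + 1) (fps_nth (sub 3 W) (p ^ (2 * m + 1) * n + 1) -
            fps_nth (sub 3 W) (p ^ (2 * m + 1) + 1) * fps_nth (fps_X * sub 3 (ep 1 ^ 2 * ep 3 ^ 2)) n)"
proof -
  define g u v b where "g = ep 1 ^ 2 * ep 3 ^ 2" and "u = cc * inverse (sub 3 cc)"
    and "v = cc * inverse ca" and "b = cb * inverse ca"
  have u: "u * sub 3 cc = cc" and v: "v * ca = cc" and b: "b * ca = cb"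
    by (simp_all add: u_def v_def b_def divide_fps)
  have b0: "fps_nth b 0 = 1" and v0: "fps_nth v 0 = 1" and g0: "fps_nth g 0 = 1"
    by (simp_all add: b_def v_def g_def fps_power_zeroth)
  have ca0: "ca \<noteq> 0" by (rule nth_0_neq_0) simp
  have g: "cb * cc = g"
  proof (rule ep_cancel[of _ "ep 1 * ep 3"])
    have "cb * cc * (ep 1 * ep 3) = (cb * ep 3) * (cc * ep 1)" by (simp only: mult_ac)
    also have "\<dots> = g * (ep 1 * ep 3)" unfolding cb_ep cc_ep g_def by (simp add: pow_expand algebra_simps)
    finally show "cb * cc * (ep 1 * ep 3) = g * (ep 1 * ep 3)" .
  qed simp
  have cubic: "b ^ 3 = 1 - 27 * fps_X * v ^ 3"
  proof (rule ep_cancel[of _ "ca ^ 3"])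
    have "b ^ 3 * ca ^ 3 = (b * ca) ^ 3" by (simp add: power_mult_distrib)
    also have "\<dots> = ca ^ 3 - 27 * fps_X * (v * ca) ^ 3" unfolding b v cubic_sum by simp
    also have "\<dots> = (1 - 27 * fps_X * v ^ 3) * ca ^ 3" by (simp add: power_mult_distrib algebra_simps)
    finally show "b ^ 3 * ca ^ 3 = (1 - 27 * fps_X * v ^ 3) * ca ^ 3" .
  qed (use ca0 in simp)
  have diff: "v + 3 * fps_XD v = b ^ 2 * g"
  proof (rule ep_cancel[of _ "ca ^ 2"])
    have d: "fps_XD v * ca + v * fps_XD ca = fps_XD cc" using arg_cong[OF v, of fps_XD] by (simp add: XD_mult)
    have "(v + 3 * fps_XD v) * ca ^ 2 = 3 * (ca * (fps_XD v * ca + v * fps_XD ca) - (v * ca) * fps_XD ca) + ca * (v * ca)"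
      by (simp add: pow_expand algebra_simps)
    also have "\<dots> = cb ^ 3 * cc" unfolding d v by (rule borwein_wronskian)
    also have "\<dots> = (b * ca) ^ 2 * (cb * cc)" unfolding b by (simp add: pow_expand algebra_simps)
    also have "\<dots> = b ^ 2 * g * ca ^ 2" unfolding g by (simp add: pow_expand algebra_simps)
    finally show "(v + 3 * fps_XD v) * ca ^ 2 = b ^ 2 * g * ca ^ 2" .
  qed (use ca0 in simp)
  \<comment> \<open>T = c / a and Y = b / a in Borwein's functions at q^3, so that
    \<open>cubic_sum\<close> becomes T^3 + Y^3 = 1. The factor 3 in T is a unit, as p is not
    3.\<close>
  define s Y where "s = sub 3 v" and "Y = sub 3 b"
  define T where "T = 3 * fps_X * s"
  have s0: "fps_nth s 0 = 1" and Y0: "fps_nth Y 0 = 1" by (simp_all add: s_def Y_def v0 b0)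
  have T0: "fps_nth T 0 = 0" by (simp add: T_def fps_mult_nth_0)
  have Tn: "T \<noteq> 0" using nth_0_neq_0[OF s0] by (simp add: T_def)
  have Y3: "Y ^ 3 = 1 - T ^ 3"
    using sub_eq[OF cubic, of 3] by (simp add: Y_def T_def s_def sub_simps power_mult_distrib)
  have XT: "fps_XD T = 3 * fps_X * (s + fps_XD s)" by (simp add: T_def XD_simps algebra_simps)
  have XT': "fps_XD T = Y ^ 2 * (3 * (fps_X * sub 3 g))"
  proof -
    have "s + fps_XD s = Y ^ 2 * sub 3 g"
      using sub_eq[OF diff, of 3] by (simp add: s_def Y_def XD_sub sub_simps)
    then show ?thesis unfolding XT by (simp only: mult_ac)
  qed
  have YX: "Y ^ 2 * fps_XD Y = - (T ^ 2 * fps_XD T)"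
  proof -
    have "3 * (Y ^ 2 * fps_XD Y) = - (3 * (T ^ 2 * fps_XD T))"
      using arg_cong[OF Y3, of fps_XD] by (simp add: XD_simps mult.assoc)
    then have "3 * (Y ^ 2 * fps_XD Y + T ^ 2 * fps_XD T) = 0" by (simp only: distrib_left neg_eq_iff_add_eq_0) simp
    moreover have "(3 :: rat fps) \<noteq> 0" by (metis fps_numeral_nth_0 fps_zero_nth zero_neq_numeral)
    ultimately have "Y ^ 2 * fps_XD Y + T ^ 2 * fps_XD T = 0" by (metis mult_eq_0_iff)
    then show ?thesis by (simp add: eq_neg_iff_add_eq_0)
  qed
  \<comment> \<open>Here R / q = (2 + Y) / T. The combination 2 + Y is the one for which G + q d/dq
    (R / q) becomes exactly (1 / Y - 1) / T^2 times q dT/dq.\<close>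
  define R where "R = (2 + Y) * inverse (3 * s)"
  have n3: "\<not> int p dvd 3"
  proof
    assume "int p dvd 3"
    then have "p dvd 3" using int_dvd_int_iff[of p 3] by simp
    then have "p \<le> 3" by (rule dvd_imp_le) simp
    then have "p = 2" using p2 prime_ge_2_nat[OF prime_p] by (cases "p = 3") auto
    then show False using \<open>p dvd 3\<close> by simp
  qed
  have u3: "zp_unit p 3" using zp_unit_of_int[OF n3] by simp
  have RT: "R * T = (2 + Y) * fps_X"
  proof -
    have "inverse (3 * s) * (3 * s) = 1" using s0 by (intro inverse_mult_eq_1) (simp add: fps_mult_nth_0)
    moreover have "R * T = (2 + Y) * fps_X * (inverse (3 * s) * (3 * s))" by (simp add: R_def T_def mult_ac)
    ultimately show ?thesis by simp
  qed
  have zY: "zp_fps Y" unfolding Y_def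
    by (rule zp_fps_sub, simp, rule zp_fps_cancel[of _ ca]) (use b in \<open>auto intro!: zp_fps_cb zp_fps_ca\<close>)
  have zs: "zp_fps s" unfolding s_def
    by (rule zp_fps_sub, simp, rule zp_fps_cancel[of _ ca]) (use v in \<open>auto intro!: zp_fps_cc zp_fps_ca\<close>)
  have znum: "zp_fps (numeral k)" for k
    using zp_fps_const[OF zp_of_int[of "numeral k"]] by (simp add: numeral_fps_const)
  have z3s: "zp_fps (inverse (3 * s))"
    by (intro zp_fps_inverse zp_fps_mult znum zs) (use u3 s0 in \<open>simp add: fps_mult_nth_0\<close>)
  have zR: "zp_fps R" unfolding R_def by (intro zp_fps_mult zp_fps_add znum zY z3s)
  have zT: "zp_fps T" unfolding T_def by (intro zp_fps_mult znum zs zp_fps_X)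
  have zg: "zp_fps g" unfolding g_def by (intro zp_fps_power zp_fps_ep zp_fps_mult)
  have Yn: "Y \<noteq> 0" by (rule nth_0_neq_0[OF Y0])
  define h1 where "h1 = fps_compose (binomial_fps (- (1 / 3)) (- 1) 3) T"
  have h1: "h1 * Y = 1"
  proof (rule fps_cube_unique)
    have "fps_compose (binomial_fps (- (1 / of_nat 3)) (- 1) 3 ^ 3 * (1 + fps_const (of_int (- 1)) * fps_X ^ 3)) T = 1"
      using binomial_fps_power[of 3 3 "- 1"] by simp
    then have "h1 ^ 3 * (1 + fps_const (- 1) * T ^ 3) = 1"
      using T0 by (simp add: h1_def fps_compose_mult_distrib compose_pow fps_compose_add_distrib)
    moreover have "1 + fps_const (- 1) * T ^ 3 = Y ^ 3" unfolding Y3 by (simp flip: fps_const_neg)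
    ultimately show "(h1 * Y) ^ 3 = 1 ^ 3" by (simp add: power_mult_distrib)
  qed (simp_all add: h1_def Y0)
  define h2 where "h2 = fps_compose (binomial_fps (- (2 / 3)) (- 1) 3) T"
  have h2: "h2 = h1 ^ 2"
    unfolding h1_def h2_def using T0 by (simp add: binomial_fps_def fps_binomial_power flip: compose_pow)
  have \<alpha>: "h2 * fps_XD T = fps_const 3 * (fps_X * sub 3 g)"
  proof -
    have "h2 * fps_XD T = (h1 * Y) ^ 2 * (3 * (fps_X * sub 3 g))" unfolding h2 XT' by (simp add: pow_expand algebra_simps)
    then show ?thesis unfolding h1 by (simp add: numeral_fps_const)
  qed
  \<comment> \<open>That is, x = \<open>sub 3 u\<close> / q^2 equals 3 T / (1 - Y). Together with y
    = 9 / (1 - Y) - 5 this maps the Fermat cubic to y^2 + y = x^3 - 7.\<close>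
  have uY: "sub 3 u * (1 - Y) = 3 * T * fps_X ^ 2"
  proof (rule ep_cancel[of _ "sub 9 cc * sub 3 ca"])
    have s1: "s * sub 3 ca = sub 3 cc" using sub_eq[OF v, of 3] by (simp add: s_def sub_simps)
    have s2: "Y * sub 3 ca = sub 3 cb" using sub_eq[OF b, of 3] by (simp add: Y_def sub_simps)
    have s3: "sub 3 u * sub 9 cc = sub 3 cc" using sub_eq[OF u, of 3] by (simp add: sub_simps)
    have s4: "sub 3 ca - sub 3 cb = 9 * fps_X ^ 3 * sub 9 cc"
    proof -
      have "ca - cb = 9 * fps_X * sub 3 cc" unfolding cb_dissect by (subst (1) ca_dissect) (simp add: algebra_simps)
      from sub_eq[OF this, of 3] show ?thesis by (simp add: sub_simps)
    qed
    have "sub 3 u * (1 - Y) * (sub 9 cc * sub 3 ca) = (sub 3 u * sub 9 cc) * (sub 3 ca - Y * sub 3 ca)"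
      by (simp add: algebra_simps)
    also have "\<dots> = 3 * (3 * fps_X * (s * sub 3 ca)) * fps_X ^ 2 * sub 9 cc"
      unfolding s2 s3 s4 s1 by (simp add: pow_expand algebra_simps)
    also have "\<dots> = 3 * T * fps_X ^ 2 * (sub 9 cc * sub 3 ca)" by (simp add: T_def algebra_simps)
    finally show "sub 3 u * (1 - Y) * (sub 9 cc * sub 3 ca) = 3 * T * fps_X ^ 2 * (sub 9 cc * sub 3 ca)" .
  qed (use nth_0_neq_0[of "sub 9 cc"] nth_0_neq_0[of "sub 3 ca"] in simp)
  have \<beta>: "T ^ 2 * (sub 3 (u * g) + fps_XD R - R) = fps_X * ((h1 - 1) * fps_XD T)"
  proof (rule ep_cancel[of _ "Y ^ 2 * (1 - Y)"])
    define D E F U' g' where "D = fps_XD T" and "E = fps_XD R" and "F = fps_XD Y" and "U' = sub 3 u" and "g' = sub 3 g"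
    have dR: "E * T + R * D = F * fps_X + (2 + Y) * fps_X"
      using arg_cong[OF RT, of fps_XD] by (simp add: XD_simps D_def E_def F_def algebra_simps)
    have a1: "D = Y ^ 2 * (3 * (fps_X * g'))" using XT' by (simp add: D_def g'_def)
    have a2: "Y ^ 2 * F = - (T ^ 2 * D)" using YX by (simp add: F_def D_def)
    have a3: "U' * (1 - Y) = 3 * T * fps_X ^ 2" using uY by (simp add: U'_def)
    have TY: "T ^ 3 = 1 - Y ^ 3" unfolding Y3 by simp
    have t1: "T ^ 2 * (U' * g') * (Y ^ 2 * (1 - Y)) = T ^ 3 * fps_X * D"
    proof -
      have "T ^ 2 * (U' * g') * (Y ^ 2 * (1 - Y)) = T ^ 2 * g' * Y ^ 2 * (U' * (1 - Y))" by (simp only: mult_ac)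
      also have "\<dots> = T ^ 3 * fps_X * (Y ^ 2 * (3 * (fps_X * g')))" unfolding a3 by (simp add: pow_expand algebra_simps)
      finally show ?thesis unfolding a1[symmetric] .
    qed
    have t2: "T ^ 2 * (E - R) * Y ^ 2 = fps_X * D * (- (T ^ 3) - (2 + Y) * Y ^ 2)"
    proof -
      have "T ^ 2 * (E - R) = T * (E * T + R * D) - (R * T) * D - (R * T) * T" by (simp add: pow_expand algebra_simps)
      also have "\<dots> = T * fps_X * F - (2 + Y) * fps_X * D" unfolding dR RT by (simp add: algebra_simps)
      finally have "T ^ 2 * (E - R) * Y ^ 2 = (T * fps_X * F - (2 + Y) * fps_X * D) * Y ^ 2" by (simp only:)
      also have "\<dots> = T * fps_X * (Y ^ 2 * F) - (2 + Y) * fps_X * D * Y ^ 2" by (simp add: algebra_simps)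
      finally show ?thesis unfolding a2 by (simp add: pow_expand algebra_simps)
    qed
    have "T ^ 2 * (U' * g' + E - R) * (Y ^ 2 * (1 - Y)) = T ^ 2 * (U' * g') * (Y ^ 2 * (1 - Y)) + T ^ 2 * (E - R) * Y ^ 2 * (1 - Y)"
      by (simp add: algebra_simps)
    also have "\<dots> = fps_X * D * ((1 - Y) * (Y - Y ^ 2))"
      unfolding t1 t2 TY by (simp add: pow_expand algebra_simps)
    also have "\<dots> = fps_X * D * ((1 - Y) * ((h1 * Y) * Y - Y ^ 2))" unfolding h1 by simp
    also have "\<dots> = fps_X * ((h1 - 1) * D) * (Y ^ 2 * (1 - Y))" by (simp add: pow_expand algebra_simps)
    finally show "T ^ 2 * (sub 3 (u * g) + fps_XD R - R) * (Y ^ 2 * (1 - Y)) = fps_X * ((h1 - 1) * fps_XD T) * (Y ^ 2 * (1 - Y))"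
      by (simp add: D_def E_def F_def U'_def g'_def sub_mult)
    have "1 - Y \<noteq> 0" using uY Tn by auto
    then show "Y ^ 2 * (1 - Y) \<noteq> 0" using Yn by simp
  qed
  have W': "W = u * g"
  proof (rule ep_cancel[of _ "ep 9 ^ 3"])
    have "u * g * ep 9 ^ 3 = u * g * (sub 3 cc * ep 3)" using cc_ep_sub[of 3] by simp
    also have "\<dots> = ep 1 * ep 3 ^ 3 * ((u * sub 3 cc) * ep 1)" unfolding g_def by (simp add: pow_expand algebra_simps)
    also have "\<dots> = W * ep 9 ^ 3" unfolding u cc_ep W by (simp add: pow_expand algebra_simps)
    finally show "W * ep 9 ^ 3 = u * g * ep 9 ^ 3" by simp
  qed simp
  have cop: "coprime 3 p" using n3 prime_imp_coprime[OF prime_int_p n3] by (metis coprime_commute coprime_int_iff of_nat_numeral)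
  have k0: "p + 1 = 3 * ((p + 1) div 3)" using p2 by presburger
  \<comment> \<open>Here a / d = 2 / 3, so s = 2 (p + 1) / 3, which exceeds k0 = (p + 1) /
    3.\<close>
  have s: "(p + 1) * 2 = 3 * (2 * ((p + 1) div 3))" using k0 by simp
  have ks: "(p + 1) div 3 < 2 * ((p + 1) div 3)" using k0 by simp
  have nd: "\<not> int p dvd - 1" using prime_int_p by auto
  have hecke: "hecke_inert p (fps_X * sub 3 g)" unfolding g_def by (rule hecke_27[OF prime_p p2])
  note main = inert_case[of 3 3 2 "(p + 1) div 3" "2 * ((p + 1) div 3)" "- 1" T R g 3 u,
      OF cop cop _ _ k0 _ s ks nd zT T0 Tn zR zg g0 u3 _ _ hecke]
  show "\<exists>v. zp_unit p v \<and> fps_nth (sub 3 W) (p ^ (2 * m + 1) + 1) = of_nat p ^ m * v"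
    unfolding W' by (rule main(1)) (use \<alpha> \<beta> in \<open>simp_all add: h1_def h2_def\<close>)
  show "n > 0 \<Longrightarrow> pd p (2 * m + 1) (fps_nth (sub 3 W) (p ^ (2 * m + 1) * n + 1) -
            fps_nth (sub 3 W) (p ^ (2 * m + 1) + 1) * fps_nth (fps_X * sub 3 (ep 1 ^ 2 * ep 3 ^ 2)) n)"
    unfolding W' g_def[symmetric] by (rule main(2)) (use \<alpha> \<beta> in \<open>simp_all add: h1_def h2_def\<close>)
qed

end

section \<open>Eta quotients as power series\<close>

lemma euler_product_eq: "euler_product = ep 1"
proof -
  let ?f = "\<lambda>n. 1 - fps_X ^ Suc n :: rat fps"
  have lim: "(\<lambda>n. \<Prod>i\<le>n. ?f (i + 0)) \<longlonglongrightarrow> ep 1"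
  proof (rule tendsto_fpsI)
    fix k
    have "fps_nth (\<Prod>i\<le>n. ?f (i + 0)) k = fps_nth (ep 1) k" if "n \<ge> Suc k" for n
    proof -
      have "eqm (Suc k) (ep 1) (\<Prod>i<Suc n. 1 - fps_const 1 * fps_X ^ (1 * i + 1))"
        unfolding ep_def using that by (intro eqm_qpoch) simp_all
      then show ?thesis by (simp add: eqm_def lessThan_Suc_atMost)
    qed
    then show "\<forall>\<^sub>F n in sequentially. fps_nth (\<Prod>i\<le>n. ?f (i + 0)) k = fps_nth (ep 1) k"
      unfolding eventually_sequentially by blast
  qed
  \<comment> \<open>As no factor vanishes, the infinite product can only be the limit of the partial
    products starting at index 0, which makes its value unique.\<close>
  have ne: "?f i \<noteq> 0" for i by (rule nth_0_neq_0) simp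
  have raw: "raw_has_prod ?f 0 (ep 1)" using lim unfolding raw_has_prod_def by simp
  have "\<exists>!x. ?f has_prod x"
  proof (rule ex1I)
    show "?f has_prod ep 1" using raw by (simp add: has_prod_def)
    fix x assume "?f has_prod x"
    then have "raw_has_prod ?f 0 x" using ne unfolding has_prod_def by blast
    then show "x = ep 1" using raw unfolding raw_has_prod_def by (metis LIMSEQ_unique)
  qed
  then have "(THE x. ?f has_prod x) = ep 1"
    using raw by (intro the1_equality) (auto simp: has_prod_def)
  then show ?thesis unfolding euler_product_def prodinf_def .
qed

text \<open>With t = q^(1/24) this means f = t ^ a * A(q). The fractional power of q and the Euler
  products are tracked separately through products and powers of eta functions.\<close>

definition eta_form :: "nat \<Rightarrow> rat fps \<Rightarrow> rat fls \<Rightarrow> bool" where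
  "eta_form a A f \<longleftrightarrow> f = fls_X ^ a * fps_to_fls (sub 24 A)"

lemma eta_form_eta: "d > 0 \<Longrightarrow> eta_form d (ep d) (eta_at d)"
proof -
  assume d: "d > 0"
  have s: "sub 24 (ep d) = ep (d * 24)" using sub_ep[of 24 d] d by (simp only: mult.commute zero_less_numeral)
  have "eta_at d = fls_X_intpow (int d) * fps_to_fls (sub 24 (ep d))"
    using d by (simp add: eta_at_def eta_def euler_product_eq fls_compose_power_fps_to_fls s del: One_nat_def)
  then show ?thesis unfolding eta_form_def by (simp add: fls_X_power_times_conv_shift fls_X_intpow_times_conv_shift)
qed

lemma eta_form_mult: "eta_form a A f \<Longrightarrow> eta_form b B g \<Longrightarrow> eta_form (a + b) (A * B) (f * g)"
  unfolding eta_form_def by (simp add: sub_mult fls_times_fps_to_fls power_add mult_ac)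

lemma eta_form_power: "eta_form a A f \<Longrightarrow> eta_form (a * n) (A ^ n) (f ^ n)"
  unfolding eta_form_def by (simp add: sub_power power_mult_distrib power_mult fps_to_fls_power)

lemma eta_form_1: "eta_form 0 1 1"
  by (simp add: eta_form_def sub_1)

lemma q_expansion_quotient:
  assumes "eta_form a A f" "eta_form b B g" "W * B = A" "fps_nth B 0 = 1" "int a - int b = 24 * c"
  shows "q_expansion (f / g) $$ n = (if n \<ge> c then fps_nth W (nat (n - c)) else 0)"
proof -
  have nz: "sub 24 B \<noteq> 0" using assms(4) by (intro nth_0_neq_0) simp
  have g0: "g \<noteq> 0" using assms(2) nz unfolding eta_form_def by simp
  have AB: "sub 24 A = sub 24 W * sub 24 B" unfolding assms(3)[symmetric] by (simp add: sub_mult)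
  have "(fls_X_intpow (24 * c) * fps_to_fls (sub 24 W)) * g
      = fls_X_intpow (24 * c) * (fls_X ^ b * (fps_to_fls (sub 24 W) * fps_to_fls (sub 24 B)))"
    using assms(2) unfolding eta_form_def by (simp only: mult_ac)
  also have "\<dots> = fls_shift (- (24 * c)) (fls_shift (- int b) (fps_to_fls (sub 24 A)))"
    unfolding AB by (simp only: fls_X_intpow_times_conv_shift fls_X_power_times_conv_shift fls_times_fps_to_fls)
  also have "\<dots> = fls_shift (- int a) (fps_to_fls (sub 24 A))"
    using assms(5) by (simp add: algebra_simps)
  also have "\<dots> = f" using assms(1) unfolding eta_form_def by (simp only: fls_X_power_times_conv_shift)
  finally have fg: "(fls_X_intpow (24 * c) * fps_to_fls (sub 24 W)) * g = f" .
  then have "f / g = fls_X_intpow (24 * c) * fps_to_fls (sub 24 W)" using g0 by auto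
  then have "q_expansion (f / g) $$ n = fps_to_fls (sub 24 W) $$ (24 * (n - c))"
    by (simp add: q_expansion_def U_nth fls_X_intpow_times_conv_shift algebra_simps)
  also have "\<dots> = (if n \<ge> c then fps_nth W (nat (n - c)) else 0)"
  proof (cases "n \<ge> c")
    case True
    then have "nat (24 * (n - c)) = 24 * nat (n - c)" by (simp only: nat_mult_distrib) simp
    then show ?thesis using True by (simp del: right_diff_distrib_numeral)
  qed simp
  finally show ?thesis .
qed

section \<open>The substitution q -> - q, for the conductors 64 and 144\<close>

definition neg :: "rat fps \<Rightarrow> rat fps" where
  "neg A = fps_compose A (fps_const (- 1) * fps_X)"

lemma neg_nth: "fps_nth (neg A) n = (- 1) ^ n * fps_nth A n"
  unfolding neg_def fps_compose_linear by simp

lemma neg_mult: "neg (A * B) = neg A * neg B"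
  by (simp add: neg_def fps_compose_mult_distrib)

lemma neg_power: "neg (A ^ n) = neg A ^ n"
  by (simp add: neg_def compose_pow)

lemma neg_1: "neg 1 = 1" by (simp add: neg_def)

lemma neg_prod: "neg (prod F S) = (\<Prod>i\<in>S. neg (F i))"
  by (induction S rule: infinite_finite_induct) (simp_all add: neg_mult neg_1)

lemma neg_sub_2: "neg (sub 2 A) = sub 2 A"
  by (rule fps_ext) (auto simp: neg_nth sub_nth)

lemma neg_ep_2: "neg (ep 2) = ep 2"
  using neg_sub_2[of "ep 1"] by (simp add: sub_simps)

lemma neg_qpoch: "neg (qpoch 1 1 2) = qpoch (- 1) 1 2"
proof (rule fps_ext)
  fix n
  have f: "neg (1 - fps_const 1 * fps_X ^ (2 * i + 1)) = 1 - fps_const (- 1) * fps_X ^ (2 * i + 1)" for i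
  proof (rule fps_ext)
    fix n
    show "fps_nth (neg (1 - fps_const 1 * fps_X ^ (2 * i + 1))) n = fps_nth (1 - fps_const (- 1) * fps_X ^ (2 * i + 1)) n"
    proof (cases "n = 2 * i + 1")
      case False
      then have "\<not> (n - Suc 0 = 2 * i \<and> 0 < n)" by auto
      then show ?thesis by (auto simp: neg_nth)
    qed (simp add: neg_nth)
  qed
  have "fps_nth (neg (qpoch 1 1 2)) n = (- 1) ^ n * fps_nth (\<Prod>i\<le>n. 1 - fps_const 1 * fps_X ^ (2 * i + 1)) n"
    by (simp add: neg_nth qpoch_def)
  also have "\<dots> = fps_nth (\<Prod>i\<le>n. 1 - fps_const (- 1) * fps_X ^ (2 * i + 1)) n"
    unfolding neg_nth[symmetric] neg_prod f ..
  finally show "fps_nth (neg (qpoch 1 1 2)) n = fps_nth (qpoch (- 1) 1 2) n" by (simp add: qpoch_def)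
qed

text \<open>Only the factors with odd exponent change under q -> - q. The relation turns the eta
  quotients of the newforms of conductor 32 and 36 into those of conductor 64 and 144: in q *
  A(q^e), replacing A(q) by A(- q) is the twist, by \<open>twisted_coeff\<close>.\<close>

lemma neg_ep_1: "neg (ep 1) * (ep 1 * ep 4) = ep 2 ^ 3"
proof -
  have h: "ep 1 = qpoch 1 1 2 * ep 2" by (rule ep_odd)
  have h2: "ep 2 = qpoch 1 2 4 * ep 4"
    using sub_eq[OF h, of 2] by (simp add: sub_simps sub_mult) (simp add: sub_def qpoch_compose)
  have m: "qpoch 1 1 2 * qpoch (- 1) 1 2 = (qpoch 1 2 4 :: rat fps)"
    using qpoch_mult_minus[where s = "1 :: rat" and j = 1 and m = 2] by simp
  have "neg (ep 1) = qpoch (- 1) 1 2 * ep 2"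
    by (subst h) (simp add: neg_mult neg_ep_2 neg_qpoch del: One_nat_def)
  then have "neg (ep 1) * (ep 1 * ep 4) = (qpoch 1 1 2 * qpoch (- 1) 1 2) * ep 4 * ep 2 ^ 2"
    by (subst (2) h) (simp add: power2_eq_square mult_ac)
  also have "\<dots> = ep 2 ^ 3" unfolding m h2[symmetric] by (simp add: power2_eq_square power3_eq_cube)
  finally show ?thesis .
qed

section \<open>The forms G and the newforms as power series\<close>

definition W27 :: "rat fps" where "W27 = ep 1 * ep 3 ^ 6 * inverse (ep 9 ^ 3)"
definition W32 :: "rat fps" where "W32 = ep 1 ^ 2 * ep 4 ^ 6 * inverse (ep 8 ^ 4)"
definition W36 :: "rat fps" where "W36 = ep 1 ^ 3 * ep 2 * ep 3 ^ 3 * inverse (ep 6 ^ 3)"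

lemma W_ep: "W27 * ep 9 ^ 3 = ep 1 * ep 3 ^ 6" "W32 * ep 8 ^ 4 = ep 1 ^ 2 * ep 4 ^ 6"
  "W36 * ep 6 ^ 3 = ep 1 ^ 3 * ep 2 * ep 3 ^ 3"
  unfolding W27_def W32_def W36_def mult.assoc[of _ "inverse _"]
  by (subst inverse_mult_eq_1; simp add: fps_power_zeroth)+

lemma G27_nth: "G E27 $$ n = (if n \<ge> - 1 then fps_nth (sub 3 W27) (nat (n + 1)) else 0)"
proof -
  have w: "sub 3 W27 * ep 27 ^ 3 = ep 3 * ep 9 ^ 6" using sub_eq[OF W_ep(1), of 3] by (simp add: sub_simps)
  show ?thesis unfolding G.simps
    by (subst q_expansion_quotient[OF eta_form_mult[OF eta_form_eta eta_form_power[OF eta_form_eta]] eta_form_power[OF eta_form_eta] w, where c = "- 1"])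
       (simp_all add: fps_power_zeroth)
qed

lemma G32_nth: "G32 $$ n = (if n \<ge> - 1 then fps_nth (sub 4 W32) (nat (n + 1)) else 0)"
proof -
  have w: "sub 4 W32 * ep 32 ^ 4 = ep 4 ^ 2 * ep 16 ^ 6" using sub_eq[OF W_ep(2), of 4] by (simp add: sub_simps)
  show ?thesis unfolding G32_def
    by (subst q_expansion_quotient[OF eta_form_mult[OF eta_form_power[OF eta_form_eta] eta_form_power[OF eta_form_eta]] eta_form_power[OF eta_form_eta] w, where c = "- 1"])
       (simp_all add: fps_power_zeroth)
qed

lemma G36_nth: "G36 $$ n = (if n \<ge> - 1 then fps_nth (sub 6 W36) (nat (n + 1)) else 0)"
proof -
  have w: "sub 6 W36 * ep 36 ^ 3 = ep 6 ^ 3 * ep 12 * ep 18 ^ 3" using sub_eq[OF W_ep(3), of 6] by (simp add: sub_simps)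
  show ?thesis unfolding G36_def
    by (subst q_expansion_quotient[OF eta_form_mult[OF eta_form_mult[OF eta_form_power[OF eta_form_eta] eta_form_eta] eta_form_power[OF eta_form_eta]] eta_form_power[OF eta_form_eta] w, where c = "- 1"])
       (simp_all add: fps_power_zeroth)
qed

lemma shifted_nth: "(if n \<ge> 1 then fps_nth F (nat (n - 1)) else 0) = (if n \<ge> 0 then fps_nth (fps_X * F) (nat n) else (0 :: rat))" for n :: int
  by (auto simp: nat_diff_distrib)

lemma newform_nth_27: "newform E27 $$ n = (if n \<ge> 0 then fps_nth (fps_X * sub 3 (ep 1 ^ 2 * ep 3 ^ 2)) (nat n) else 0)"
proof -
  have w: "sub 3 (ep 1 ^ 2 * ep 3 ^ 2) * 1 = ep 3 ^ 2 * ep 9 ^ 2" by (simp add: sub_simps)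
  have q: "newform E27 = q_expansion (eta_at 3 ^ 2 * eta_at 9 ^ 2 / 1)" by simp
  show ?thesis unfolding q
    by (subst q_expansion_quotient[OF eta_form_mult[OF eta_form_power[OF eta_form_eta] eta_form_power[OF eta_form_eta]] eta_form_1 w, where c = 1])
       (simp_all only: shifted_nth, simp_all)
qed

lemma newform_nth_32: "newform E32 $$ n = (if n \<ge> 0 then fps_nth (fps_X * sub 4 (ep 1 ^ 2 * ep 2 ^ 2)) (nat n) else 0)"
proof -
  have w: "sub 4 (ep 1 ^ 2 * ep 2 ^ 2) * 1 = ep 4 ^ 2 * ep 8 ^ 2" by (simp add: sub_simps)
  have q: "newform E32 = q_expansion (eta_at 4 ^ 2 * eta_at 8 ^ 2 / 1)" by simp
  show ?thesis unfolding q
    by (subst q_expansion_quotient[OF eta_form_mult[OF eta_form_power[OF eta_form_eta] eta_form_power[OF eta_form_eta]] eta_form_1 w, where c = 1])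
       (simp_all only: shifted_nth, simp_all)
qed

lemma newform_nth_36: "newform E36 $$ n = (if n \<ge> 0 then fps_nth (fps_X * sub 6 (ep 1 ^ 4)) (nat n) else 0)"
proof -
  have w: "sub 6 (ep 1 ^ 4) * 1 = ep 6 ^ 4" by (simp add: sub_simps)
  have q: "newform E36 = q_expansion (eta_at 6 ^ 4 / 1)" by simp
  show ?thesis unfolding q
    by (subst q_expansion_quotient[OF eta_form_power[OF eta_form_eta] eta_form_1 w, where c = 1])
       (simp_all only: shifted_nth, simp_all)
qed

lemma newform_nth_64: "newform E64 $$ n = (if n \<ge> 0 then fps_nth (fps_X * sub 4 (neg (ep 1 ^ 2 * ep 2 ^ 2))) (nat n) else 0)"
proof -
  have "neg (ep 1 ^ 2 * ep 2 ^ 2) * (ep 1 ^ 2 * ep 4 ^ 2) = (neg (ep 1) * (ep 1 * ep 4)) ^ 2 * ep 2 ^ 2"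
    by (simp add: neg_mult neg_power neg_ep_2 power_mult_distrib mult_ac del: One_nat_def)
  also have "\<dots> = ep 2 ^ 8" unfolding neg_ep_1 by (simp flip: power_mult power_add)
  finally have "neg (ep 1 ^ 2 * ep 2 ^ 2) * (ep 1 ^ 2 * ep 4 ^ 2) = ep 2 ^ 8" .
  from sub_eq[OF this, of 4]
  have w: "sub 4 (neg (ep 1 ^ 2 * ep 2 ^ 2)) * (ep 4 ^ 2 * ep 16 ^ 2) = ep 8 ^ 8"
    by (simp only: sub_mult[of 4] sub_power[of 4] sub_ep[of 4] zero_less_numeral zero_less_one) simp
  show ?thesis unfolding newform.simps
    by (subst q_expansion_quotient[OF eta_form_power[OF eta_form_eta] eta_form_mult[OF eta_form_power[OF eta_form_eta] eta_form_power[OF eta_form_eta]] w, where c = 1])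
       (simp_all only: shifted_nth, simp_all add: fps_power_zeroth)
qed

lemma newform_nth_144: "newform E144 $$ n = (if n \<ge> 0 then fps_nth (fps_X * sub 6 (neg (ep 1 ^ 4))) (nat n) else 0)"
proof -
  have "neg (ep 1 ^ 4) * (ep 1 ^ 4 * ep 4 ^ 4) = (neg (ep 1) * (ep 1 * ep 4)) ^ 4"
    by (simp add: neg_power power_mult_distrib mult_ac del: One_nat_def)
  also have "\<dots> = ep 2 ^ 12" unfolding neg_ep_1 by (simp flip: power_mult)
  finally have "neg (ep 1 ^ 4) * (ep 1 ^ 4 * ep 4 ^ 4) = ep 2 ^ 12" .
  from sub_eq[OF this, of 6]
  have w: "sub 6 (neg (ep 1 ^ 4)) * (ep 6 ^ 4 * ep 24 ^ 4) = ep 12 ^ 12"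
    by (simp only: sub_mult[of 6] sub_power[of 6] sub_ep[of 6] zero_less_numeral zero_less_one) simp
  show ?thesis unfolding newform.simps
    by (subst q_expansion_quotient[OF eta_form_power[OF eta_form_eta] eta_form_mult[OF eta_form_power[OF eta_form_eta] eta_form_power[OF eta_form_eta]] w, where c = 1])
       (simp_all only: shifted_nth, simp_all add: fps_power_zeroth)
qed

section \<open>Kronecker symbols\<close>

lemma kronecker_mult:
  assumes "m > 0" "n > 0"
  shows "kronecker a (m * n) = kronecker a m * kronecker a n"
proof -
  have pf: "prime_factors (m * n) = prime_factors m \<union> prime_factors n"
    using assms by (simp add: prime_factors_product)
  let ?k = "\<lambda>q. kronecker_prime a q"
  have ext: "(\<Prod>q\<in>prime_factors m \<union> prime_factors n. ?k q ^ multiplicity q k) = (\<Prod>q\<in>prime_factors k. ?k q ^ multiplicity q k)"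
    if "k = m \<or> k = n" for k
  proof (rule prod.mono_neutral_right)
    show "\<forall>q\<in>prime_factors m \<union> prime_factors n - prime_factors k. ?k q ^ multiplicity q k = 1"
    proof
      fix q assume q: "q \<in> prime_factors m \<union> prime_factors n - prime_factors k"
      then have "prime q" "q \<notin> prime_factors k" by auto
      then have "\<not> q dvd k" using that assms by (auto simp: in_prime_factors_iff)
      then show "?k q ^ multiplicity q k = 1" by (simp add: not_dvd_imp_multiplicity_0)
    qed
  qed (use that in auto)
  have "(\<Prod>q\<in>prime_factors (m * n). ?k q ^ multiplicity q (m * n))
      = (\<Prod>q\<in>prime_factors m \<union> prime_factors n. ?k q ^ multiplicity q m * ?k q ^ multiplicity q n)"
    unfolding pf
  proof (rule prod.cong[OF refl])
    fix q assume "q \<in> prime_factors m \<union> prime_factors n"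
    then have "prime q" using in_prime_factors_imp_prime by blast
    then have "prime_elem q" by (rule prime_imp_prime_elem)
    then have "multiplicity q (m * n) = multiplicity q m + multiplicity q n"
      using assms by (intro prime_elem_multiplicity_mult_distrib) auto
    then show "?k q ^ multiplicity q (m * n) = ?k q ^ multiplicity q m * ?k q ^ multiplicity q n"
      by (simp add: power_add)
  qed
  then have 1: "(\<Prod>q\<in>prime_factors (m * n). ?k q ^ multiplicity q (m * n))
      = (\<Prod>q\<in>prime_factors m. ?k q ^ multiplicity q m) * (\<Prod>q\<in>prime_factors n. ?k q ^ multiplicity q n)"
    using ext[of m] ext[of n] by (simp only: prod.distrib simp_thms)
  have 2: "kronecker a k = (\<Prod>q\<in>prime_factors k. ?k q ^ multiplicity q k)" if "k > 0" for k
    using that by (simp add: kronecker_def)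
  have "m * n > 0" using assms by simp
  then show ?thesis using 1 by (simp only: 2 assms)
qed

lemma kronecker_1: "kronecker a 1 = 1"
  by (simp add: kronecker_def)

lemma kronecker_of_prime: "prime p \<Longrightarrow> kronecker a p = kronecker_prime a p" for p :: int
  using prime_gt_0_int[of p] by (auto simp: kronecker_def prime_factorization_prime multiplicity_self)

text \<open>The values 0, 1 and - 1 are distinct modulo a prime p > 2, so a congruence such as
  Euler's criterion determines the symbol.\<close>

lemma legendre_cong:
  assumes p: "prime p" "2 < p" and c: "[Legendre a (int p) = s] (mod int p)" and s: "s = 1 \<or> s = - 1"
  shows "Legendre a (int p) = s"
proof -
  have "\<not> int p dvd 1" using p by auto
  moreover have "Legendre a (int p) = 0 \<Longrightarrow> int p dvd 1"
    using c s by (auto simp: cong_iff_dvd_diff)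
  ultimately have L: "Legendre a (int p) = 1 \<or> Legendre a (int p) = - 1"
    by (auto simp: Legendre_def)
  have "int p dvd Legendre a (int p) - s" using c by (simp add: cong_iff_dvd_diff)
  moreover have "\<not> int p dvd 2" "\<not> int p dvd - 2"
    using p zdvd_imp_le[of "int p" 2] by auto
  ultimately show ?thesis using L s by auto
qed

lemma legendre_mult_square:
  assumes p: "prime p" "2 < p" and c: "\<not> int p dvd c" and a: "\<not> int p dvd a"
  shows "Legendre (a * c ^ 2) (int p) = Legendre a (int p)"
proof (rule legendre_cong[OF p])
  let ?h = "(p - 1) div 2"
  have "2 * ?h = p - 1" using p prime_odd_nat[of p] by auto
  then have "(c ^ 2) ^ ?h = c ^ (p - 1)" by (metis power_mult)
  then have "[(c ^ 2) ^ ?h = 1] (mod int p)" using fermat_int[OF p(1) c] by simp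
  then have "[a ^ ?h * (c ^ 2) ^ ?h = a ^ ?h * 1] (mod int p)" by (rule cong_scalar_left)
  then have "[(a * c ^ 2) ^ ?h = a ^ ?h] (mod int p)" by (simp add: power_mult_distrib)
  then show "[Legendre (a * c ^ 2) (int p) = Legendre a (int p)] (mod int p)"
    using euler_criterion[OF p] by (meson cong_sym cong_trans)
  have "\<not> [a = 0] (mod int p)" using a by (simp add: cong_0_iff)
  then show "Legendre a (int p) = 1 \<or> Legendre a (int p) = - 1" by (simp add: Legendre_def)
qed

text \<open>Gauss's lemma: for 1 \<le> x \<le> h = (p - 1) / 2 the doubles 2 x are already reduced
  modulo p, and those with x > h / 2 exceed h. It remains to find the parity of their
  number.\<close>

lemma legendre_2:
  assumes p: "prime p" "2 < p"
  shows "Legendre 2 (int p) = (if p mod 8 = 1 \<or> p mod 8 = 7 then 1 else - 1)"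
proof -
  have "\<not> int p dvd 2" using p zdvd_imp_le[of "int p" 2] by auto
  then interpret GAUSS p 2 using p by unfold_locales (auto simp: cong_0_iff)
  define h where "h = (int p - 1) div 2"
  have op: "odd p" using p prime_odd_nat by blast
  then have h: "int p = 2 * h + 1" unfolding h_def by presburger
  have "E = (\<lambda>x. 2 * x) ` {h div 2<..h}"
  proof
    show "E \<subseteq> (\<lambda>x. 2 * x) ` {h div 2<..h}"
    proof
      fix y assume "y \<in> E"
      then obtain x where x: "0 < x" "x \<le> h" "y = (x * 2) mod int p" "h < y"
        by (auto simp: E_def C_def B_def A_def h_def)
      then have "y = 2 * x" using h by (simp add: mod_pos_pos_trivial mult.commute)
      moreover have "h div 2 < x" using \<open>y = 2 * x\<close> x(4) by presburger
      ultimately show "y \<in> (\<lambda>x. 2 * x) ` {h div 2<..h}" using x by auto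
    qed
    show "(\<lambda>x. 2 * x) ` {h div 2<..h} \<subseteq> E"
    proof
      fix y assume "y \<in> (\<lambda>x. 2 * x) ` {h div 2<..h}"
      then obtain x where x: "h div 2 < x" "x \<le> h" "y = 2 * x" by auto
      have "0 \<le> h div 2" using h p by presburger
      then have x0: "0 < x" using x by linarith
      have "y = (x * 2) mod int p" using x x0 h by (simp add: mod_pos_pos_trivial)
      moreover have "h < y" using x by presburger
      moreover have "x \<in> A" using x x0 by (simp add: A_def h_def)
      then have "(x * 2) mod int p \<in> C" unfolding C_def B_def by blast
      ultimately show "y \<in> E" by (simp add: E_def h_def)
    qed
  qed
  then have cE: "card E = nat (h - h div 2)" by (simp add: card_image inj_on_def)
  have "even (card E) \<longleftrightarrow> p mod 8 = 1 \<or> p mod 8 = 7"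
  proof -
    have "0 \<le> h - h div 2" using h p by presburger
    then have "even (card E) \<longleftrightarrow> even (h - h div 2)" unfolding cE by (simp add: even_nat_iff)
    also have "\<dots> \<longleftrightarrow> int p mod 8 = 1 \<or> int p mod 8 = 7"
    proof -
      define t where "t = h div 4"
      have "h = 4 * t \<or> h = 4 * t + 1 \<or> h = 4 * t + 2 \<or> h = 4 * t + 3" unfolding t_def by linarith
      then show ?thesis
      proof (elim disjE)
        assume h4: "h = 4 * t"
        then have "int p = 8 * t + 1" "h div 2 = 2 * t" using h by simp_all
        then show ?thesis using h4 by simp
      next
        assume h4: "h = 4 * t + 1"
        then have "int p = 8 * t + 3" "h div 2 = 2 * t" using h by simp_all
        then show ?thesis using h4 by simp
      next
        assume h4: "h = 4 * t + 2"
        then have "int p = 8 * t + 5" "h div 2 = 2 * t + 1" using h by simp_all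
        then show ?thesis using h4 by simp
      next
        assume h4: "h = 4 * t + 3"
        then have "int p = 8 * t + 7" "h div 2 = 2 * t + 1" using h by simp_all
        then show ?thesis using h4 by simp
      qed
    qed
    also have "int p mod 8 = int (p mod 8)" by (simp add: zmod_int)
    finally have "even (card E) \<longleftrightarrow> int (p mod 8) = 1 \<or> int (p mod 8) = 7" .
    moreover have "int x = 1 \<longleftrightarrow> x = 1" "int x = 7 \<longleftrightarrow> x = 7" for x by linarith+
    ultimately show ?thesis by (simp only:)
  qed
  then show ?thesis using gauss_lemma by simp
qed

text \<open>By quadratic reciprocity the symbol is (- 1)^((p - 1) / 2) times the symbol of p modulo
  3; the conditions modulo 4 and modulo 3 combine to one modulo 12.\<close>

lemma legendre_3:
  assumes p: "prime p" "3 < p"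
  shows "Legendre 3 (int p) = (if p mod 12 = 1 \<or> p mod 12 = 11 then 1 else - 1)"
proof -
  have op: "odd p" using p prime_odd_nat[of p] by auto
  have n3: "\<not> 3 dvd p" using p by (metis less_irrefl prime_nat_iff numeral_eq_one_iff semiring_norm(86))
  have "Legendre (int 3) (int p) * Legendre (int p) (int 3) = (- 1) ^ ((3 - 1) div 2 * ((p - 1) div 2))"
    using p by (intro Quadratic_Reciprocity) auto
  then have qr: "Legendre 3 (int p) * Legendre (int p) 3 = (- 1) ^ ((p - 1) div 2)" by simp
  have L: "Legendre (int p) 3 = (if p mod 3 = 1 then 1 else - 1)"
  proof (cases "p mod 3 = 1")
    case True
    then have "[1 ^ 2 = int p] (mod 3)" by (simp add: cong_def) presburger
    then have "QuadRes 3 (int p)" unfolding QuadRes_def by blast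
    moreover have "\<not> [int p = 0] (mod 3)" using True by (simp add: cong_def) presburger
    ultimately show ?thesis using True by (simp add: Legendre_def)
  next
    case False
    then have p2: "int p mod 3 = 2" using n3 by presburger
    have "\<not> QuadRes 3 (int p)"
    proof
      assume "QuadRes 3 (int p)"
      then obtain y where "[y ^ 2 = int p] (mod 3)" unfolding QuadRes_def by blast
      then have y: "(y mod 3) ^ 2 mod 3 = 2" using p2 by (simp add: cong_def power_mod)
      have "y mod 3 = 0 \<or> y mod 3 = 1 \<or> y mod 3 = 2" by presburger
      then show False using y by auto
    qed
    moreover have "\<not> [int p = 0] (mod 3)" using p2 by (simp add: cong_def)
    ultimately show ?thesis using False by (simp add: Legendre_def)
  qed
  have ev: "even ((p - 1) div 2) \<longleftrightarrow> p mod 4 = 1" using op by presburger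
  have "p mod 12 = 1 \<or> p mod 12 = 11 \<longleftrightarrow> (p mod 3 = 1 \<longleftrightarrow> p mod 4 = 1)"
  proof -
    define r where "r = p mod 12"
    have r: "r < 12" "r mod 2 = p mod 2" "r mod 3 = p mod 3" "r mod 4 = p mod 4"
      by (simp_all add: r_def mod_mod_cancel)
    have "p mod 2 = 1" "p mod 3 \<noteq> 0" using op n3 by presburger+
    then have h: "r mod 2 = 1" "r mod 3 \<noteq> 0" using r by simp_all
    have "\<forall>r<12::nat. r mod 2 = 1 \<longrightarrow> r mod 3 \<noteq> 0 \<longrightarrow> (r = 1 \<or> r = 11 \<longleftrightarrow> (r mod 3 = 1 \<longleftrightarrow> r mod 4 = 1))"
      by code_simp
    then have "r = 1 \<or> r = 11 \<longleftrightarrow> (r mod 3 = 1 \<longleftrightarrow> r mod 4 = 1)" using r(1) h by blast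
    then show ?thesis unfolding r_def[symmetric] r(3-4)[symmetric] .
  qed
  then show ?thesis using qr ev unfolding L by (cases "p mod 3 = 1"; cases "p mod 4 = 1") auto
qed

lemma int_mod_numeral: "int p mod numeral N = int (p mod numeral N)"
  by (simp add: zmod_int)

lemma int_eq_small: "int x = 1 \<longleftrightarrow> x = 1" "int x = numeral N \<longleftrightarrow> x = numeral N"
  by (metis of_nat_1 of_nat_eq_iff, metis of_nat_numeral of_nat_eq_iff)

text \<open>The Kronecker symbols of 8 and 12 on arguments prime to the modulus. There is no value
  0, so at other arguments it does not agree with the symbol.\<close>

definition residue_sign :: "int \<Rightarrow> int set \<Rightarrow> int \<Rightarrow> int" where
  "residue_sign N S n = (if n mod N \<in> S then 1 else - 1)"

lemma residue_sign_mult: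
  assumes "m mod N \<in> A" "n mod N \<in> A"
    and "\<forall>a\<in>A. \<forall>b\<in>A. residue_sign N S (a * b) = residue_sign N S a * residue_sign N S b"
  shows "residue_sign N S (m * n) = residue_sign N S m * residue_sign N S n"
proof -
  have "residue_sign N S (m * n) = residue_sign N S ((m mod N) * (n mod N))"
    by (simp only: residue_sign_def mod_mult_eq)
  also have "\<dots> = residue_sign N S (m mod N) * residue_sign N S (n mod N)" using assms by blast
  finally show ?thesis by (simp only: residue_sign_def mod_mod_trivial)
qed

text \<open>Both sides are multiplicative on positive numbers prime to c, so agreement at primes
  suffices: a prime factor is split off in each step.\<close>

lemma kronecker_eq_residue_sign:
  assumes prime: "\<And>p. prime p \<Longrightarrow> coprime (int p) c \<Longrightarrow> kronecker_prime a (int p) = residue_sign N S (int p)"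
    and one: "residue_sign N S 1 = 1"
    and mult: "\<And>m n. coprime m c \<Longrightarrow> coprime n c \<Longrightarrow> residue_sign N S (m * n) = residue_sign N S m * residue_sign N S n"
    and n: "n > 0" "coprime (int n) c"
  shows "kronecker a (int n) = residue_sign N S (int n)"
  using n
proof (induction n rule: less_induct)
  case (less n)
  show ?case
  proof (cases "n = 1")
    case True
    then show ?thesis using one kronecker_1 by simp
  next
    case False
    then obtain p where p: "prime p" "p dvd n" using prime_factor_nat by blast
    then obtain k where k: "n = p * k" by blast
    have p1: "p > 1" using p prime_gt_1_nat by blast
    have k0: "k > 0" "k < n"
    proof -
      show "k > 0" using less.prems(1) k by (cases "k = 0") auto
      then have "1 * k < p * k" using p1 by (intro mult_strict_right_mono)
      then show "k < n" by (simp only: k mult_1)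
    qed
    have c: "coprime (int p) c" "coprime (int k) c" using less.prems(2) unfolding k by simp_all
    have "kronecker a (int n) = kronecker a (int p) * kronecker a (int k)"
      unfolding k of_nat_mult using k0 p1 by (intro kronecker_mult) simp_all
    also have "\<dots> = residue_sign N S (int p) * residue_sign N S (int k)"
      using less.IH[OF k0(2,1) c(2)] prime[OF p(1) c(1)] kronecker_of_prime[of "int p" a] p(1) by simp
    also have "\<dots> = residue_sign N S (int n)" unfolding k of_nat_mult using mult[OF c] by simp
    finally show ?thesis .
  qed
qed

lemma kronecker_8:
  assumes "n > 0" "odd n"
  shows "kronecker 8 (int n) = residue_sign 8 {1, 7} (int n)"
proof (rule kronecker_eq_residue_sign[where c = 2])
  fix p :: nat assume p: "prime p" "coprime (int p) 2"
  then have op: "odd (int p)" by simp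
  then have p2: "2 < p" using prime_ge_2_nat[OF p(1)] by (cases "p = 2") auto
  have nd: "\<not> int p dvd 2" using p2 zdvd_imp_le[of "int p" 2] by auto
  have "Legendre (2 * 2 ^ 2) (int p) = Legendre 2 (int p)"
    by (rule legendre_mult_square[OF p(1) p2 nd nd])
  then have "kronecker_prime 8 (int p) = Legendre 2 (int p)" using op by (auto simp: kronecker_prime_def)
  moreover have "int p mod 8 \<in> {1, 7} \<longleftrightarrow> p mod 8 = 1 \<or> p mod 8 = 7"
    by (simp only: int_mod_numeral insert_iff empty_iff int_eq_small simp_thms)
  ultimately show "kronecker_prime 8 (int p) = residue_sign 8 {1, 7} (int p)"
    using legendre_2[OF p(1) p2] by (simp add: residue_sign_def)
next
  fix m n :: int assume "coprime m 2" "coprime n 2"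
  then have o: "odd m" "odd n" by simp_all
  have "m mod 8 = 1 \<or> m mod 8 = 3 \<or> m mod 8 = 5 \<or> m mod 8 = 7" "n mod 8 = 1 \<or> n mod 8 = 3 \<or> n mod 8 = 5 \<or> n mod 8 = 7"
    using o by presburger+
  then show "residue_sign 8 {1, 7} (m * n) = residue_sign 8 {1, 7} m * residue_sign 8 {1, 7} n"
    by (intro residue_sign_mult[where A = "{1, 3, 5, 7}"]) (simp_all add: residue_sign_def)
qed (use assms in \<open>simp_all add: residue_sign_def\<close>)

lemma kronecker_12:
  assumes "n > 0" "coprime (int n) 6"
  shows "kronecker 12 (int n) = residue_sign 12 {1, 11} (int n)"
proof (rule kronecker_eq_residue_sign[where c = 6])
  fix p :: nat assume p: "prime p" "coprime (int p) 6"
  have "coprime (int p) (2 * 3)" using p(2) by simp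
  then have c: "coprime (int p) 2" "coprime (int p) 3" unfolding coprime_mult_right_iff by blast+
  have op: "odd (int p)" using c(1) by simp
  have "p \<noteq> 3" using c(2) by auto
  moreover have "p \<noteq> 2" using op by auto
  ultimately have p3: "3 < p" using prime_ge_2_nat[OF p(1)] by auto
  have nd: "\<not> int p dvd 2" "\<not> int p dvd 3" using p3 zdvd_imp_le[of "int p" 2] zdvd_imp_le[of "int p" 3] by auto
  have "Legendre (3 * 2 ^ 2) (int p) = Legendre 3 (int p)"
    using p3 by (intro legendre_mult_square[OF p(1)] nd) simp
  then have "kronecker_prime 12 (int p) = Legendre 3 (int p)" using op by (auto simp: kronecker_prime_def)
  moreover have "int p mod 12 \<in> {1, 11} \<longleftrightarrow> p mod 12 = 1 \<or> p mod 12 = 11"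
    by (simp only: int_mod_numeral insert_iff empty_iff int_eq_small simp_thms)
  ultimately show "kronecker_prime 12 (int p) = residue_sign 12 {1, 11} (int p)"
    using legendre_3[OF p(1) p3] by (simp add: residue_sign_def)
next
  fix m n :: int assume mn: "coprime m 6" "coprime n 6"
  have r: "k mod 12 = 1 \<or> k mod 12 = 5 \<or> k mod 12 = 7 \<or> k mod 12 = 11" if "coprime k 6" for k :: int
  proof -
    have "coprime k (2 * 3)" using that by simp
    then have "coprime k 2" "coprime k 3" unfolding coprime_mult_right_iff by blast+
    then have "odd k" "\<not> 3 dvd k" using coprime_common_divisor[of k 3 3] by auto
    then show ?thesis by presburger
  qed
  have "m mod 12 \<in> {1, 5, 7, 11}" "n mod 12 \<in> {1, 5, 7, 11}" using r[OF mn(1)] r[OF mn(2)] by simp_all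
  then show "residue_sign 12 {1, 11} (m * n) = residue_sign 12 {1, 11} m * residue_sign 12 {1, 11} n"
    by (rule residue_sign_mult) (simp add: residue_sign_def)
qed (use assms in \<open>simp_all add: residue_sign_def\<close>)

section \<open>Inert primes\<close>

text \<open>Let w = n + r and L = Z + Z r. As w^2 = 2 n w - (n^2 + d), every w^(i + 1) is (2 n)^i w
  modulo p L. A monic equation with integral coefficients for w / p puts some w^(j + 1) into p L,
  and comparison of imaginary parts shows that p divides (2 n)^j.\<close>

lemma quadratic_integer_trace:
  fixes r :: complex and n d :: int
  assumes p: "prime p" and r: "r ^ 2 = - of_int d" "Im r \<noteq> 0" "Re r = 0" and dv: "int p dvd n ^ 2 + d"
    and x: "algebraic_int ((of_int n + r) / of_nat p)"
  shows "int p dvd 2 * n"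
proof -
  define L where "L = {of_int a + of_int b * r | a b. True}"
  define w where "w = of_int n + r"
  have p0: "(of_nat p :: complex) \<noteq> 0" using p by auto
  have L_add: "y + z \<in> L" if "y \<in> L" "z \<in> L" for y z
  proof -
    obtain a b a' b' where "y = of_int a + of_int b * r" "z = of_int a' + of_int b' * r" using \<open>y \<in> L\<close> \<open>z \<in> L\<close> by (auto simp: L_def)
    then have "y + z = of_int (a + a') + of_int (b + b') * r" by (simp add: algebra_simps)
    then show ?thesis unfolding L_def by blast
  qed
  have L_mult: "y * z \<in> L" if "y \<in> L" "z \<in> L" for y z
  proof -
    obtain a b a' b' where yz: "y = of_int a + of_int b * r" "z = of_int a' + of_int b' * r" using \<open>y \<in> L\<close> \<open>z \<in> L\<close> by (auto simp: L_def)
    have "y * z = of_int a * of_int a' + of_int b * of_int b' * r ^ 2 + (of_int a * of_int b' + of_int b * of_int a') * r"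
      unfolding yz by (simp add: algebra_simps power2_eq_square)
    then have "y * z = of_int (a * a' - b * b' * d) + of_int (a * b' + b * a') * r"
      unfolding r(1) by (simp add: algebra_simps)
    then show ?thesis unfolding L_def by blast
  qed
  have L_int: "of_int a \<in> L" for a unfolding L_def by (intro CollectI exI[of _ a] exI[of _ 0]) simp
  have L_w: "w \<in> L" unfolding L_def w_def by (intro CollectI exI[of _ n] exI[of _ 1]) simp
  have L_pow: "y ^ k \<in> L" if "y \<in> L" for y k
    by (induction k) (use that L_int[of 1] in \<open>auto intro: L_mult\<close>)
  have L_sum: "sum f S \<in> L" if "\<And>i. i \<in> S \<Longrightarrow> f i \<in> L" for f :: "nat \<Rightarrow> complex" and S
    using that by (induction S rule: infinite_finite_induct) (use L_int[of 0] in \<open>auto intro: L_add\<close>)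
  have L_nat: "of_nat k \<in> L" for k using L_int[of "int k"] by simp
  have powers: "\<exists>l\<in>L. w ^ Suc i = of_int ((2 * n) ^ i) * w + of_nat p * l" for i
  proof (induction i)
    case 0
    show ?case using L_int[of 0] by (intro bexI[of _ 0]) auto
  next
    case (Suc i)
    then obtain l where l: "l \<in> L" "w ^ Suc i = of_int ((2 * n) ^ i) * w + of_nat p * l" by blast
    obtain q where q: "n ^ 2 + d = int p * q" using dv by blast
    have "w * w = of_int (2 * n) * w - of_int (n ^ 2 + d)"
    proof -
      have "w * w = of_int (2 * n) * w - of_int n ^ 2 + r ^ 2" unfolding w_def by (simp add: power2_eq_square algebra_simps)
      then show ?thesis unfolding r(1) by simp
    qed
    then have ww: "w * w = of_int (2 * n) * w - of_nat p * of_int q" unfolding q by simp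
    have "w ^ Suc (Suc i) = of_int ((2 * n) ^ i) * (w * w) + of_nat p * (l * w)"
      unfolding power_Suc2[of w "Suc i"] l(2) by (simp add: algebra_simps)
    then have "w ^ Suc (Suc i) = of_int ((2 * n) ^ Suc i) * w + of_nat p * (l * w + of_int (- ((2 * n) ^ i * q)))"
      unfolding ww by (simp add: algebra_simps)
    moreover have "l * w + of_int (- ((2 * n) ^ i * q)) \<in> L" by (intro L_add L_mult l L_w L_int)
    ultimately show ?case by blast
  qed
  obtain P where P: "lead_coeff P = 1" "\<And>i. Polynomial.coeff P i \<in> \<int>" "poly P (w / of_nat p) = 0"
    using x unfolding w_def[symmetric] by (elim algebraic_int.cases) auto
  define k where "k = degree P"
  have "k \<noteq> 0"
  proof
    assume "k = 0"
    then obtain c where "P = [:c:]" unfolding k_def using degree_eq_zeroE by blast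
    then show False using P by simp
  qed
  then obtain j where j: "k = Suc j" by (cases k) auto
  have lc: "Polynomial.coeff P k = 1" using P(1) by (simp add: k_def)
  have sp: "(\<Sum>i\<le>k. f i) = f k + (\<Sum>i\<le>j. f i)" for f :: "nat \<Rightarrow> complex"
    unfolding j by (simp add: add.commute)
  have "0 = of_nat p ^ k * poly P (w / of_nat p)" using P(3) by simp
  also have "\<dots> = (\<Sum>i\<le>k. Polynomial.coeff P i * of_nat p ^ (k - i) * w ^ i)"
    unfolding poly_altdef k_def[symmetric] sum_distrib_left
  proof (rule sum.cong[OF refl])
    fix i assume "i \<in> {..k}"
    then have "(of_nat p :: complex) ^ k = of_nat p ^ (k - i) * of_nat p ^ i" by (simp flip: power_add)
    then show "of_nat p ^ k * (Polynomial.coeff P i * (w / of_nat p) ^ i) = Polynomial.coeff P i * of_nat p ^ (k - i) * w ^ i"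
      using p0 by (simp add: power_divide)
  qed
  also have "\<dots> = w ^ k + (\<Sum>i\<le>j. Polynomial.coeff P i * of_nat p ^ (k - i) * w ^ i)"
    by (subst sp) (simp add: lc)
  also have "(\<Sum>i\<le>j. Polynomial.coeff P i * of_nat p ^ (k - i) * w ^ i) = of_nat p * (\<Sum>i\<le>j. Polynomial.coeff P i * of_nat p ^ (j - i) * w ^ i)"
    unfolding sum_distrib_left by (rule sum.cong) (simp_all add: j Suc_diff_le mult_ac)
  finally have wS: "w ^ Suc j = of_nat p * - (\<Sum>i\<le>j. Polynomial.coeff P i * of_nat p ^ (j - i) * w ^ i)"
    by (simp add: j eq_neg_iff_add_eq_0 del: power_Suc)
  obtain l where l: "l \<in> L" "w ^ Suc j = of_int ((2 * n) ^ j) * w + of_nat p * l" using powers by blast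
  define S where "S = (\<Sum>i\<le>j. Polynomial.coeff P i * of_nat p ^ (j - i) * w ^ i)"
  have e: "of_int ((2 * n) ^ j) * w = of_nat p * (of_int (- 1) * (S + l))"
  proof -
    have "of_int ((2 * n) ^ j) * w = w ^ Suc j - of_nat p * l" unfolding l(2) by (rule add_diff_cancel_right'[symmetric])
    also have "\<dots> = of_nat p * - S - of_nat p * l" unfolding wS S_def ..
    also have "\<dots> = of_nat p * (of_int (- 1) * (S + l))" by (simp add: right_diff_distrib distrib_left)
    finally show ?thesis .
  qed
  have "Polynomial.coeff P i \<in> L" for i using P(2)[of i] L_int by (auto elim: Ints_cases)
  then have "of_int (- 1) * (S + l) \<in> L"
    unfolding S_def by (intro L_mult L_add L_sum L_pow L_nat L_int L_w l)
  then obtain a b where ab: "of_int (- 1) * (S + l) = of_int a + of_int b * r" unfolding L_def by blast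
  have im: "Im (of_int A * z) = of_int A * Im z" for A z by simp
  have Iw: "Im w = Im r" by (simp add: w_def)
  have "of_int ((2 * n) ^ j) * Im r = Im (of_int ((2 * n) ^ j) * w)" by (simp only: im Iw)
  also have "\<dots> = Im (of_nat p * (of_int a + of_int b * r))" by (simp only: e ab)
  also have "\<dots> = of_int (int p * b) * Im r" by simp
  finally have "of_int ((2 * n) ^ j) * Im r = of_int (int p * b) * Im r" .
  then have "(2 * n) ^ j = int p * b" using r(2) of_int_eq_iff by (metis mult_right_cancel)
  then have "int p dvd (2 * n) ^ j" by simp
  then show ?thesis using p prime_dvd_power[of "int p"] by simp
qed

text \<open>The product (n + r) (n - r) = n^2 + d lies in the ideal generated by p. If one of the
  factors did, \<open>quadratic_integer_trace\<close> would make p a divisor of 2 n and hence of 4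
  d.\<close>

lemma not_inert:
  fixes d n :: int
  assumes prime: "prime p" and d: "d > 0" and dv: "int p dvd n ^ 2 + d" and np: "\<not> int p dvd 4 * d"
  shows "\<not> inert (quadratic_field (- d)) p"
proof
  define K where "K = quadratic_field (- d)"
  define R where "R = ring_of_integers K"
  define r where "r = csqrt (of_int (- d))"
  assume "inert (quadratic_field (- d)) p"
  then have pr: "primeideal (PIdl\<^bsub>R\<^esub> (of_nat p)) R" by (simp add: inert_def R_def K_def)
  have r2: "r ^ 2 = - of_int d" by (simp add: r_def)
  have Re: "Re r = 0" and Im: "Im r \<noteq> 0"
    using d by (simp_all add: r_def csqrt.simps cmod_def)
  have carr: "carrier R = {x \<in> K. algebraic_int x}" by (simp add: R_def ring_of_integers_def)
  have ideal_eq: "PIdl\<^bsub>R\<^esub> (of_nat p) = {x * of_nat p | x. x \<in> carrier R}"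
    by (simp add: cgenideal_def R_def ring_of_integers_def)
  have "algebraic_int r" unfolding r_def by (intro algebraic_int_csqrt int_imp_algebraic_int) simp
  have mem: "of_int n + of_int s * r \<in> carrier R" if "s = 1 \<or> s = - 1" for s :: int
  proof -
    have "of_int n + of_int s * r = of_rat (of_int n) + of_rat (of_int s) * csqrt (of_int (- d))"
      by (simp add: r_def)
    then have "of_int n + of_int s * r \<in> K" unfolding K_def quadratic_field_def by blast
    moreover have "algebraic_int (of_int n + of_int s * r)"
    proof (rule algebraic_int.intros)
      let ?P = "[:of_int (n ^ 2 + d), of_int (- 2 * n), 1:] :: complex poly"
      show "lead_coeff ?P = 1" by simp
      show "\<forall>i. Polynomial.coeff ?P i \<in> \<int>" by (auto simp: coeff_pCons split: nat.splits)
      have "of_int s * of_int s = (1 :: complex)" using that by auto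
      then have ss: "of_int s * (of_int s * r ^ 2) = r ^ 2" by (metis mult.assoc mult_1)
      have "poly ?P (of_int n + of_int s * r) = of_int d + of_int s * (of_int s * r ^ 2)"
        by (simp add: power2_eq_square algebra_simps)
      also have "\<dots> = 0" unfolding ss using r2 by simp
      finally show "poly ?P (of_int n + of_int s * r) = 0" .
    qed
    ultimately show ?thesis unfolding carr by simp
  qed
  have m1: "of_int n + r \<in> carrier R" and m2: "of_int n - r \<in> carrier R" using mem[of 1] mem[of "- 1"] by simp_all
  obtain q where q: "n ^ 2 + d = int p * q" using dv by blast
  have "of_int q \<in> carrier R"
  proof -
    have "of_int q = of_rat (of_int q) + of_rat 0 * csqrt (of_int (- d))" by simp
    then have "of_int q \<in> K" unfolding K_def quadratic_field_def by blast
    then show ?thesis unfolding carr by (simp add: int_imp_algebraic_int)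
  qed
  moreover have "(of_int n + r) * (of_int n - r) = of_int q * of_nat p"
  proof -
    have "(of_int n + r) * (of_int n - r) = of_int n ^ 2 - r ^ 2" by (simp add: power2_eq_square algebra_simps)
    also have "\<dots> = of_int (n ^ 2 + d)" unfolding r2 by simp
    finally show ?thesis unfolding q by simp
  qed
  ultimately have "(of_int n + r) \<otimes>\<^bsub>R\<^esub> (of_int n - r) \<in> PIdl\<^bsub>R\<^esub> (of_nat p)"
    unfolding ideal_eq by (auto simp: R_def ring_of_integers_def)
  then have "of_int n + r \<in> PIdl\<^bsub>R\<^esub> (of_nat p) \<or> of_int n - r \<in> PIdl\<^bsub>R\<^esub> (of_nat p)"
    by (rule primeideal.I_prime[OF pr m1 m2])
  then obtain r' x where r': "r' = r \<or> r' = - r" and x: "algebraic_int x" "of_int n + r' = x * of_nat p"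
    unfolding ideal_eq carr by fastforce
  have "(of_int n + r') / of_nat p = x" using x(2) prime by auto
  then have "int p dvd 2 * n"
    using x(1) r' r2 Re Im by (intro quadratic_integer_trace[OF prime _ _ _ dv, of r']) auto
  then have "int p dvd (2 * n) * (2 * n)" by (rule dvd_mult)
  with dvd_mult[OF dv, of 4] have "int p dvd 4 * (n ^ 2 + d) - (2 * n) * (2 * n)" by (rule dvd_diff)
  moreover have "4 * (n ^ 2 + d) - (2 * n) * (2 * n) = 4 * d" by (simp add: power2_eq_square)
  ultimately show False using np by simp
qed

lemma prime_not_dvd_small:
  assumes "p > 3"
  shows "\<not> int p dvd 2" "\<not> int p dvd 3" "\<not> int p dvd 1"
  using assms zdvd_imp_le[of "int p" 2] zdvd_imp_le[of "int p" 3] zdvd_imp_le[of "int p" 1] by auto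

lemma legendre_1_dvd:
  assumes "Legendre (- d) (int p) = 1"
  obtains n where "int p dvd n ^ 2 + d"
proof -
  have "QuadRes (int p) (- d)" using assms by (auto simp: Legendre_def split: if_splits)
  then obtain n where "[n ^ 2 = - d] (mod int p)" unfolding QuadRes_def by blast
  then show thesis using that[of n] by (simp add: cong_iff_dvd_diff)
qed

text \<open>If p is 1 modulo 4, then - 1 is a square modulo p by Euler's criterion, and
  \<open>not_inert\<close> applies.\<close>

lemma inert_gauss:
  assumes p: "prime p" "odd p" and i: "inert (quadratic_field (- 1)) p"
  shows "p mod 4 = 3"
proof (rule ccontr)
  assume "p mod 4 \<noteq> 3"
  then have p4: "p mod 4 = 1" using p(2) by presburger
  then have p3: "p > 3" using prime_ge_2_nat[OF p(1)] by (cases "p = 2 \<or> p = 3") auto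
  have "even ((p - 1) div 2)" using p4 by presburger
  then have "[Legendre (- 1) (int p) = 1] (mod int p)"
    using euler_criterion[of p "- 1"] p(1) p3 by simp
  then have "Legendre (- 1) (int p) = 1" using p3 by (intro legendre_cong p(1)) auto
  then obtain n where n: "int p dvd n ^ 2 + 1" by (rule legendre_1_dvd)
  have "\<not> int p dvd 4 * 1"
    using prime_not_dvd_small[OF p3] p(1) prime_dvd_mult_iff[of "int p" 2 2] by auto
  then show False using not_inert[OF p(1) _ n] i by simp
qed

text \<open>If p is 1 modulo 3, the symbols of - 1 and of 3 at p are equal, which is the content of
  \<open>hp\<close>. Hence - 3 is a square modulo p and \<open>not_inert\<close> applies.\<close>

lemma inert_eisenstein:
  assumes p: "prime p" "p \<noteq> 3" and i: "inert (quadratic_field (- 3)) p"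
  shows "p mod 3 = 2"
proof (rule ccontr)
  assume h: "p mod 3 \<noteq> 2"
  have "\<not> 3 dvd p" using p by (metis prime_nat_iff numeral_eq_one_iff semiring_norm(86))
  then have p1: "p mod 3 = 1" using h by presburger
  then have "p \<noteq> 2" by auto
  then have p3: "p > 3" using p prime_ge_2_nat[OF p(1)] by linarith
  have op: "odd p" using prime_odd_nat[OF p(1)] p3 by simp
  let ?h = "(p - 1) div 2"
  have hp: "even ?h \<longleftrightarrow> p mod 12 = 1 \<or> p mod 12 = 11"
  proof -
    obtain k where k: "p = 2 * k + 1" using op by (rule oddE)
    then have "k mod 3 = 0" using p1 by presburger
    then obtain j where "k = 3 * j" by auto
    then have pj: "p = 6 * j + 1" "?h = 3 * j" using k by simp_all
    show ?thesis
    proof (cases "even j")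
      case True
      then obtain i where "j = 2 * i" by blast
      then have "p = 12 * i + 1" using pj by simp
      then have "p mod 12 = 1" by simp
      then show ?thesis using True pj(2) by simp
    next
      case False
      then obtain i where "j = 2 * i + 1" by (rule oddE)
      then have "p = 12 * i + 7" using pj by simp
      then have "p mod 12 = 7" by simp
      then show ?thesis using False pj(2) by simp
    qed
  qed
  have "[(- 1) ^ ?h * 3 ^ ?h = (- 1) ^ ?h * Legendre 3 (int p)] (mod int p)"
    using euler_criterion[of p 3] p(1) p3 by (intro cong_scalar_left) (simp add: cong_sym)
  moreover have "(- 1) ^ ?h * Legendre 3 (int p) = 1"
    unfolding legendre_3[OF p(1) p3] using hp by (cases "even ?h") auto
  moreover have "(- 1) ^ ?h * 3 ^ ?h = (- 3 :: int) ^ ?h" by (simp flip: power_mult_distrib)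
  ultimately have "[(- 3) ^ ?h = 1] (mod int p)" by simp
  then have "[Legendre (- 3) (int p) = 1] (mod int p)"
    using euler_criterion[of p "- 3"] p(1) p3 cong_trans by simp blast
  then have "Legendre (- 3) (int p) = 1" using p3 by (intro legendre_cong p(1)) auto
  then obtain n where n: "int p dvd n ^ 2 + 3" by (rule legendre_1_dvd)
  have "\<not> int p dvd 4 * 3"
    using prime_not_dvd_small[OF p3] p(1) prime_dvd_mult_iff[of "int p" 2 "2 * 3"] prime_dvd_mult_iff[of "int p" 2 3] by auto
  then show False using not_inert[OF p(1) _ n] i by simp
qed

section \<open>Valuations of the coefficients\<close>

context prime_local
begin

text \<open>s is the twisting character, constantly 1 for the curves that are not twists. Being
  multiplicative, it multiplies both terms of the congruence at P * n by s P * s n, and s P is a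
  unit. Division by the coefficient at P, of valuation m, turns the modulus p ^ (2 * m + 1) into p ^
  (m + 1).\<close>

lemma valuations_of_congruences:
  fixes F f :: "rat fls" and W g :: "rat fps" and s :: "nat \<Rightarrow> rat"
  assumes F: "\<And>n. n > 0 \<Longrightarrow> F $$ int n = s n * fps_nth (sub e W) (n + 1)"
    and F0: "\<And>n. n \<le> 0 \<Longrightarrow> n \<noteq> - 1 \<Longrightarrow> F $$ n = 0"
    and f: "\<And>n. n > 0 \<Longrightarrow> f $$ int n = s n * fps_nth (fps_X * sub e g) n"
    and f0: "\<And>n. n \<le> 0 \<Longrightarrow> f $$ n = 0"
    and s: "\<And>m n. m > 0 \<Longrightarrow> n > 0 \<Longrightarrow> s (m * n) = s m * s n" "\<And>n. s n \<in> zp p" "s 1 = 1" "s p = 1 \<or> s p = - 1"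
    and unit: "\<exists>v. zp_unit p v \<and> fps_nth (sub e W) (p ^ (2 * m + 1) + 1) = of_nat p ^ m * v"
    and cong: "\<And>n. n > 0 \<Longrightarrow> pd p (2 * m + 1) (fps_nth (sub e W) (p ^ (2 * m + 1) * n + 1) -
            fps_nth (sub e W) (p ^ (2 * m + 1) + 1) * fps_nth (fps_X * sub e g) n)"
  shows "vp p (F $$ int (p ^ (2 * m + 1))) = ereal (real m) \<and>
    vp_fls p (U (p ^ (2 * m + 1)) F / fls_const (F $$ int (p ^ (2 * m + 1))) - f) \<ge> ereal (real (m + 1))"
proof -
  define P where "P = p ^ (2 * m + 1)"
  have P: "P > 1" using prime_gt_1_nat[OF prime_p] unfolding P_def by (intro one_less_power) auto
  define c where "c = F $$ int P"
  have sp: "s (p ^ k) = s p ^ k" for k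
    by (induction k) (use p_pos s in simp_all)
  have "zp_unit p (s p)"
    using s(4) zp_unit_1 zp_uminus[OF zp_1] by (auto simp: zp_unit_iff)
  then have sP: "zp_unit p (s P)" unfolding P_def sp by (rule zp_unit_power)
  obtain v where v: "zp_unit p v" "fps_nth (sub e W) (P + 1) = of_nat p ^ m * v"
    using unit unfolding P_def by blast
  have c: "c = of_nat p ^ m * (s P * v)" using F[of P] P v(2) by (simp add: c_def)
  have sv: "zp_unit p (s P * v)" using sP v(1) by (rule zp_unit_mult)
  then have svn: "s P * v \<noteq> 0" by (simp add: zp_unit_iff)
  have c0: "c \<noteq> 0" unfolding c using svn p_pos by simp
  have q: "(U P F / fls_const c - f) $$ n = F $$ (int P * n) / c - f $$ n" for n
    using P U_nth[of P F n] by (simp add: divide_inverse fls_inverse_const)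
  have "pd p (m + 1) (F $$ (int P * n) / c - f $$ n)" for n
  proof (cases "n > 0")
    case True
    define k where "k = nat n"
    have k: "n = int k" "k > 0" using True by (simp_all add: k_def)
    have "F $$ (int P * n) = s (P * k) * fps_nth (sub e W) (P * k + 1)"
      using F[of "P * k"] P k by simp
    then have "F $$ (int P * n) - c * f $$ n
        = s P * s k * (fps_nth (sub e W) (P * k + 1) - fps_nth (sub e W) (P + 1) * fps_nth (fps_X * sub e g) k)"
      unfolding c v(2) using s(1)[of P k] f[of k] P k by (simp add: algebra_simps)
    moreover have "pd p (2 * m + 1) \<dots>"
      using cong[OF k(2)] s(2) by (intro pd_zp_mult zp_mult) (auto simp: P_def)
    ultimately obtain y where y: "y \<in> zp p" "F $$ (int P * n) - c * f $$ n = of_nat p ^ (2 * m + 1) * y"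
      unfolding pd_def by auto
    have pp: "of_nat p ^ (2 * m + 1) = of_nat p ^ m * (of_nat p ^ (m + 1) :: rat)"
      by (simp add: mult_2 power_add)
    have "F $$ (int P * n) / c - f $$ n = (F $$ (int P * n) - c * f $$ n) / c"
      using c0 by (simp add: diff_divide_distrib)
    also have "\<dots> = of_nat p ^ (2 * m + 1) * y / c" by (simp only: y(2))
    also have "\<dots> = of_nat p ^ m * (of_nat p ^ (m + 1) * y) / (of_nat p ^ m * (s P * v))"
      unfolding c pp by (simp only: mult.assoc)
    also have "\<dots> = of_nat p ^ (m + 1) * (y / (s P * v))" using p_pos by simp
    finally have "F $$ (int P * n) / c - f $$ n = of_nat p ^ (m + 1) * (y / (s P * v))" .
    moreover have "y / (s P * v) \<in> zp p"
      using y(1) sv unfolding zp_unit_iff divide_inverse by blast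
    ultimately show ?thesis unfolding pd_def by blast
  next
    case False
    \<comment> \<open>For n \<le> 0 both coefficients vanish: the only nonpositive exponent in F is
      that of the pole, - 1, which is not a multiple of P > 1.\<close>
    have "int P * n \<noteq> - 1"
    proof
      assume "int P * n = - 1"
      then have "int P dvd 1" by (metis dvd_minus_iff dvd_triv_left)
      then show False using P by simp
    qed
    moreover have "int P * n \<le> 0" using False P by (simp add: mult_nonneg_nonpos)
    ultimately show ?thesis using F0 f0 False by simp
  qed
  then have "ereal (real (m + 1)) \<le> vp p ((U P F / fls_const c - f) $$ n)" for n
    unfolding q by (rule vp_ge)
  then have "vp_fls p (U P F / fls_const c - f) \<ge> ereal (real (m + 1))"
    unfolding vp_fls_def by (intro INF_greatest)
  moreover have "vp p c = ereal (real m)" unfolding c by (rule vp_power_unit[OF sv])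
  ultimately show ?thesis unfolding c_def P_def by blast
qed

lemma kronecker_unit:
  assumes "kronecker a (int p) = residue_sign N S (int p)"
  shows "of_int (kronecker a (int p)) = (1 :: rat) \<or> of_int (kronecker a (int p)) = (- 1 :: rat)"
  unfolding assms residue_sign_def by simp

end

text \<open>The constant term of G has index 1 after the shift by q, and 1 is not a multiple of
  e.\<close>

lemma coeff_at_0:
  assumes "e > 1"
  shows "fps_nth (sub e W) (Suc 0) = 0"
proof -
  have "\<not> e dvd Suc 0" using assms by simp
  then show ?thesis using assms by (simp add: sub_nth)
qed

lemma residue_sign_8: "residue_sign 8 {1, 7} (int (4 * k + 1)) = (- 1) ^ k"
proof (cases "even k")
  case True
  then obtain j where "k = 2 * j" by blast
  then have "int (4 * k + 1) mod 8 = 1" by simp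
  then show ?thesis using True by (simp add: residue_sign_def)
next
  case False
  then obtain j where "k = 2 * j + 1" by (rule oddE)
  then have "int (4 * k + 1) = 8 * int j + 5" by simp
  then have "int (4 * k + 1) mod 8 = 5" by (simp only: mod_mult_self4) simp
  then show ?thesis using False by (simp add: residue_sign_def)
qed

lemma residue_sign_12: "residue_sign 12 {1, 11} (int (6 * k + 1)) = (- 1) ^ k"
proof (cases "even k")
  case True
  then obtain j where "k = 2 * j" by blast
  then have "int (6 * k + 1) mod 12 = 1" by simp
  then show ?thesis using True by (simp add: residue_sign_def)
next
  case False
  then obtain j where "k = 2 * j + 1" by (rule oddE)
  then have "int (6 * k + 1) = 12 * int j + 7" by simp
  then have "int (6 * k + 1) mod 12 = 7" by (simp only: mod_mult_self4) simp
  then show ?thesis using False by (simp add: residue_sign_def)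
qed

text \<open>All exponents that occur are of the form e k + 1, where the character takes the value (-
  1)^k. This is the sign that \<open>neg\<close> attaches to the k-th coefficient.\<close>

lemma twisted_coeff:
  assumes e: "e > 0" and \<chi>: "\<And>k. kronecker a (int (e * k + 1)) = (- 1) ^ k" and n: "n > 0"
  shows "fps_nth (fps_X * sub e (neg g)) n = of_int (kronecker a (int n)) * fps_nth (fps_X * sub e g) n"
proof (cases "e dvd n - 1")
  case True
  then obtain k where "n - 1 = e * k" by blast
  then have k: "n = e * k + 1" using n by simp
  have "fps_nth (fps_X * sub e A) n = fps_nth A k" for A unfolding k using e by simp
  then show ?thesis using \<chi>[of k] unfolding k by (simp add: neg_nth)
next
  case False
  then show ?thesis using n e by (simp add: sub_nth)
qed

text \<open>The condition on the conductor concerns p = 2 with the conductors 36 and 144: there 2 is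
  inert in the field of sqrt(- 3), but all exponents of G are - 1 modulo 6, so that C vanishes at
  every p ^ (2 * m + 1) and its valuation is infinite.\<close>

theorem theorem1p1:
  fixes E :: cm_curve and p m :: nat
  assumes "prime p"
    and "inert (cm_field E) p"
    and "\<not> p dvd conductor E"
  shows "vp p (C E (p ^ (2 * m + 1))) = ereal (real m) \<and>
         vp_fls p (U (p ^ (2 * m + 1)) (G E) / fls_const (C E (p ^ (2 * m + 1))) - newform E)
           \<ge> ereal (real (m + 1))"
proof -
  interpret prime_local p by unfold_locales (rule assms(1))
  note one = valuations_of_congruences[where s = "\<lambda>_. 1"]
  have n2: "p \<noteq> 2" if "even (conductor E)" using that assms(3) by auto
  have n3: "p \<noteq> 3" if "3 dvd conductor E" using that assms(3) by auto
  have odd: "odd p" if "p \<noteq> 2" using that prime_odd_nat[OF assms(1)] prime_ge_2_nat[OF assms(1)] by auto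
  have mod4: "p mod 4 = 3" if "cm_field E = quadratic_field (- 1)" "even (conductor E)"
    using inert_gauss[OF assms(1) odd[OF n2]] that assms(2) by simp
  have mod3: "p mod 3 = 2" if "cm_field E = quadratic_field (- 3)" "3 dvd conductor E"
    using inert_eisenstein[OF assms(1) n3] that assms(2) by simp
  have mod6: "p mod 6 = 5" if "p mod 3 = 2" "odd p" using that by presburger
  show ?thesis
  proof (cases E)
    case E27
    have p: "p mod 3 = 2" using mod3 E27 by simp
    show ?thesis unfolding C_def E27
      by (rule one[OF _ _ _ _ _ _ _ _ inert_27[OF p W_ep(1)]])
         (auto simp: G27_nth newform_nth_27 nat_add_distrib coeff_at_0 simp del: G.simps newform.simps)
  next
    case E32
    have p: "p mod 4 = 3" using mod4 E32 by simp
    show ?thesis unfolding C_def E32 G.simps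
      by (rule one[OF _ _ _ _ _ _ _ _ inert_32[OF p W_ep(2)]])
         (auto simp: G32_nth newform_nth_32 nat_add_distrib coeff_at_0 simp del: G.simps newform.simps)
  next
    case E36
    have p: "p mod 6 = 5" using mod6[OF mod3 odd[OF n2]] E36 by simp
    show ?thesis unfolding C_def E36 G.simps
      by (rule one[OF _ _ _ _ _ _ _ _ inert_36[OF p W_ep(3)]])
         (auto simp: G36_nth newform_nth_36 nat_add_distrib coeff_at_0 simp del: G.simps newform.simps)
  next
    case E64
    have p: "p mod 4 = 3" using mod4 E64 by simp
    have \<chi>: "kronecker 8 (int (4 * k + 1)) = (- 1) ^ k" for k
      using kronecker_8[of "4 * k + 1"] residue_sign_8[of k] by simp
    have op: "odd p" using odd n2 E64 by simp
    show ?thesis unfolding C_def E64 G.simps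
    proof (rule valuations_of_congruences[where s = "\<lambda>n. of_int (kronecker 8 (int n))", OF _ _ _ _ _ _ _ _ inert_32[OF p W_ep(2)]])
      show "of_int (kronecker 8 (int p)) = (1 :: rat) \<or> of_int (kronecker 8 (int p)) = (- 1 :: rat)"
        by (rule kronecker_unit[OF kronecker_8[OF p_pos op]])
      show "newform E64 $$ int n = of_int (kronecker 8 (int n)) * fps_nth (fps_X * sub 4 (ep 1 ^ 2 * ep 2 ^ 2)) n" if "n > 0" for n
        unfolding newform_nth_64 using twisted_coeff[OF _ \<chi> that] by simp
      show "newform E64 $$ n = 0" if "n \<le> 0" for n using that by (auto simp: newform_nth_64 simp del: newform.simps)
    qed (auto simp: twist_nth G32_nth nat_add_distrib coeff_at_0 kronecker_mult kronecker_1)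
  next
    case E144
    have p: "p mod 6 = 5" using mod6[OF mod3 odd[OF n2]] E144 by simp
    have cop: "coprime (int (6 * k + 1)) 6" for k
    proof -
      have "gcd 6 (int k * 6 + 1) = gcd 6 1" by (rule gcd_add_mult)
      then have "coprime 6 (int k * 6 + 1)" by (simp add: coprime_iff_gcd_eq_1)
      moreover have "int k * 6 + 1 = int (6 * k + 1)" by simp
      ultimately show ?thesis by (metis coprime_commute)
    qed
    have \<chi>: "kronecker 12 (int (6 * k + 1)) = (- 1) ^ k" for k
      using kronecker_12[OF _ cop, of k] residue_sign_12[of k] by simp
    have "coprime (int p) 6"
    proof -
      have "\<not> 3 dvd p" "odd p" using p by presburger+
      then have "coprime 3 p" "coprime 2 p" by (auto intro!: prime_imp_coprime)
      then have "coprime (2 * 3) p" by (simp only: coprime_mult_left_iff)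
      then show ?thesis by (metis coprime_commute coprime_int_iff of_nat_numeral num_double mult_numeral_1 numeral_times_numeral semiring_norm(12,13,14))
    qed
    note k12 = kronecker_12[OF p_pos this]
    show ?thesis unfolding C_def E144 G.simps
    proof (rule valuations_of_congruences[where s = "\<lambda>n. of_int (kronecker 12 (int n))", OF _ _ _ _ _ _ _ _ inert_36[OF p W_ep(3)]])
      show "of_int (kronecker 12 (int p)) = (1 :: rat) \<or> of_int (kronecker 12 (int p)) = (- 1 :: rat)"
        by (rule kronecker_unit[OF k12])
      show "newform E144 $$ int n = of_int (kronecker 12 (int n)) * fps_nth (fps_X * sub 6 (ep 1 ^ 4)) n" if "n > 0" for n
        unfolding newform_nth_144 using twisted_coeff[OF _ \<chi> that] by simp
      show "newform E144 $$ n = 0" if "n \<le> 0" for n using that by (auto simp: newform_nth_144 simp del: newform.simps)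
    qed (auto simp: twist_nth G36_nth nat_add_distrib coeff_at_0 kronecker_mult kronecker_1)
  qed
qed

end
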